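(* Let $(A,\alpha_A)$ and $(G,\alpha)$ be locally compact contraction groups such that $A$ is abelian, and let $\gamma\colon G\to\mathrm{Aut}(A)$ be a continuous homomorphism such that $\gamma(\alpha(g))=\alpha_A\circ\gamma(g)\circ\alpha_A^{-1}$ for all $g\in G$. Then the assignment $[\omega]\mapsto[A\times_\omega G]$ is a bijection from $H^2_{\mathrm{eq}}(G,A)$ onto the set of all equivalence classes of extensions $$\{e\}\to A\to\widehat{G}\to G\to\{e\}$$ of contraction groups which induce $\gamma$.
   Context: A locally compact contraction group is a pair $(G,\alpha)$ where $G$ is a (Hausdorff) locally compact group and $\alpha$ a bicontinuous automorphism of $G$ with $\alpha^n(x)\to e$ as $n\to\infty$ for each $x\in G$. A morphism $(G,\alpha_G)\to(H,\alpha_H)$ of contraction groups is a continuous homomorphism $\phi$ with $\alpha_H\circ\phi=\phi\circ\alpha_G$; an isomorphism is an invertible morphism whose inverse is a morphism. $\mathrm{Aut}(A)$ is the group of bicontinuous automorphisms of $A$ with the Braconnier topology (subbasis: sets $\{\beta:\beta(K_1)\subseteq U_1,\ \beta^{-1}(K_2)\subseteq U_2\}$ with $K_1,K_2\subseteq A$ compact and $U_1,U_2\subseteq A$ open); $\gamma$ is continuous iff the action $G\times A\to A$, $g.a:=\gamma(g)(a)$ is continuous. $A$ is written additively, $G$ multiplicatively. $Z^2_{\mathrm{eq}}(G,A)$ is the group (pointwise addition) of continuous maps $\omega\colon G\times G\to A$ with $g_1.\omega(g_2,g_3)-\omega(g_1g_2,g_3)+\omega(g_1,g_2g_3)-\omega(g_1,g_2)=0$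 and $\omega(\alpha(g_1),\alpha(g_2))=\alpha_A(\omega(g_1,g_2))$ for all $g_1,g_2,g_3\in G$. $B^2_{\mathrm{eq}}(G,A)$ is its subgroup of all maps $\omega_f(g_1,g_2)=g_1.f(g_2)-f(g_1g_2)+f(g_1)$ with $f\colon G\to A$ continuous and $f\circ\alpha=\alpha_A\circ f$. $H^2_{\mathrm{eq}}(G,A):=Z^2_{\mathrm{eq}}(G,A)/B^2_{\mathrm{eq}}(G,A)$ and $[\omega]$ is the class of $\omega$. An extension of contraction groups is a short exact sequence $\{e\}\to A\xrightarrow{\iota}\widehat{G}\xrightarrow{q}G\to\{e\}$ where $(\widehat{G},\widehat{\alpha})$ is a locally compact contraction group and $\iota,q$ are morphisms of contraction groups. It induces $\gamma$ if $\iota(\gamma(q(x))(a))=x\iota(a)x^{-1}$ for all $a\in A$, $x\in\widehat{G}$. Two extensions $(\widehat{G}_1,\iota_1,q_1)$, $(\widehat{G}_2,\iota_2,q_2)$ inducing $\gamma$ are equivalent if there is an isomorphism of contraction groups $\psi\colon\widehat{G}_1\to\widehat{G}_2$ with $\psi\circ\iota_1=\iota_2$ and $q_2\circ\psi=q_1$; $[\widehat{G}]$ denotes the equivalence class. $A\times_\omega G$ is $A\times G$ with the product topology, multiplication $(a_1,g_1)(a_2,g_2)=(a_1+g_1.a_2+\omega(g_1,g_2),g_1g_2)$, and contractive automorphism $\alpha_A\times\alpha$, regarded as an extension via $\iota(a)=(a,e)$ and $q(a,g)=g$. *)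

theory Defs
  imports "HOL-Analysis.Analysis" "HOL-Algebra.Coset" "HOL-Algebra.Bij"
begin

(* All groups are written multiplicatively, including the abelian group A: a product in A
   stands for a sum, and an inverse for a negative. *)

record 'a dynamical_group = "'a monoid" +
  topol :: "'a topology"
  contr :: "'a \<Rightarrow> 'a"

definition topological_group :: "('a, 'm) dynamical_group_scheme \<Rightarrow> bool" where
  "topological_group G \<longleftrightarrow>
     group G \<and> topspace (topol G) = carrier G \<and>
     continuous_map (prod_topology (topol G) (topol G)) (topol G) (\<lambda>(x, y). x \<otimes>\<^bsub>G\<^esub> y) \<and>
     continuous_map (topol G) (topol G) (\<lambda>x. inv\<^bsub>G\<^esub> x)"

definition lc_contraction_group :: "('a, 'm) dynamical_group_scheme \<Rightarrow> bool" where
  "lc_contraction_group G \<longleftrightarrow>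
     topological_group G \<and> Hausdorff_space (topol G) \<and> locally_compact_space (topol G) \<and>
     contr G \<in> iso G G \<and> homeomorphic_map (topol G) (topol G) (contr G) \<and>
     (\<forall>x\<in>carrier G. limitin (topol G) (\<lambda>n. (contr G ^^ n) x) \<one>\<^bsub>G\<^esub> sequentially)"

definition contraction_morphism ::
    "('a, 'm) dynamical_group_scheme \<Rightarrow> ('b, 'n) dynamical_group_scheme \<Rightarrow> ('a \<Rightarrow> 'b) \<Rightarrow> bool" where
  "contraction_morphism G H \<phi> \<longleftrightarrow>
     \<phi> \<in> hom G H \<and> continuous_map (topol G) (topol H) \<phi> \<and>
     (\<forall>x\<in>carrier G. contr H (\<phi> x) = \<phi> (contr G x))"

definition contraction_isomorphism ::
    "('a, 'm) dynamical_group_scheme \<Rightarrow> ('b, 'n) dynamical_group_scheme \<Rightarrow> ('a \<Rightarrow> 'b) \<Rightarrow> bool" where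
  "contraction_isomorphism G H \<phi> \<longleftrightarrow>
     contraction_morphism G H \<phi> \<and>
     (\<exists>\<psi>. contraction_morphism H G \<psi> \<and> group_isomorphisms G H \<phi> \<psi>)"

(* As in the library's group of automorphisms, automorphisms are extensional functions. *)

definition top_auto :: "('a, 'm) dynamical_group_scheme \<Rightarrow> ('a \<Rightarrow> 'a) set" where
  "top_auto A = {\<beta> \<in> auto A. homeomorphic_map (topol A) (topol A) \<beta>}"

definition TopAutoGroup :: "('a, 'm) dynamical_group_scheme \<Rightarrow> ('a \<Rightarrow> 'a) monoid" where
  "TopAutoGroup A = BijGroup (carrier A) \<lparr>carrier := top_auto A\<rparr>"

definition braconnier_topology :: "('a, 'm) dynamical_group_scheme \<Rightarrow> ('a \<Rightarrow> 'a) topology" where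
  "braconnier_topology A = topology_generated_by
     {{\<beta> \<in> top_auto A. \<beta> ` K1 \<subseteq> U1 \<and> inv_into (carrier A) \<beta> ` K2 \<subseteq> U2} | K1 K2 U1 U2.
        compactin (topol A) K1 \<and> compactin (topol A) K2 \<and>
        openin (topol A) U1 \<and> openin (topol A) U2}"

(* Cocycles are extensional on carrier G \<times> carrier G, so that they are determined by their
   values on the carrier. *)

definition Z2_eq ::
    "('g, 'n) dynamical_group_scheme \<Rightarrow> ('a, 'm) dynamical_group_scheme \<Rightarrow> ('g \<Rightarrow> 'a \<Rightarrow> 'a)
      \<Rightarrow> ('g \<times> 'g \<Rightarrow> 'a) monoid" where
  "Z2_eq G A \<gamma> =
    \<lparr>carrier = {\<omega> \<in> extensional (carrier G \<times> carrier G).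
        continuous_map (prod_topology (topol G) (topol G)) (topol A) \<omega> \<and>
        (\<forall>g1\<in>carrier G. \<forall>g2\<in>carrier G. \<forall>g3\<in>carrier G.
           \<gamma> g1 (\<omega> (g2, g3)) \<otimes>\<^bsub>A\<^esub> inv\<^bsub>A\<^esub> \<omega> (g1 \<otimes>\<^bsub>G\<^esub> g2, g3) \<otimes>\<^bsub>A\<^esub> \<omega> (g1, g2 \<otimes>\<^bsub>G\<^esub> g3)
             \<otimes>\<^bsub>A\<^esub> inv\<^bsub>A\<^esub> \<omega> (g1, g2) = \<one>\<^bsub>A\<^esub>) \<and>
        (\<forall>g1\<in>carrier G. \<forall>g2\<in>carrier G. \<omega> (contr G g1, contr G g2) = contr A (\<omega> (g1, g2)))},
     mult = (\<lambda>\<omega> \<omega>'. \<lambda>p\<in>carrier G \<times> carrier G. \<omega> p \<otimes>\<^bsub>A\<^esub> \<omega>' p),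
     one = (\<lambda>p\<in>carrier G \<times> carrier G. \<one>\<^bsub>A\<^esub>)\<rparr>"

definition coboundary ::
    "('g, 'n) dynamical_group_scheme \<Rightarrow> ('a, 'm) dynamical_group_scheme \<Rightarrow> ('g \<Rightarrow> 'a \<Rightarrow> 'a)
      \<Rightarrow> ('g \<Rightarrow> 'a) \<Rightarrow> 'g \<times> 'g \<Rightarrow> 'a" where
  "coboundary G A \<gamma> f =
     (\<lambda>(g1, g2)\<in>carrier G \<times> carrier G. \<gamma> g1 (f g2) \<otimes>\<^bsub>A\<^esub> inv\<^bsub>A\<^esub> f (g1 \<otimes>\<^bsub>G\<^esub> g2) \<otimes>\<^bsub>A\<^esub> f g1)"

definition B2_eq ::
    "('g, 'n) dynamical_group_scheme \<Rightarrow> ('a, 'm) dynamical_group_scheme \<Rightarrow> ('g \<Rightarrow> 'a \<Rightarrow> 'a)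
      \<Rightarrow> ('g \<times> 'g \<Rightarrow> 'a) set" where
  "B2_eq G A \<gamma> =
     {coboundary G A \<gamma> f | f. continuous_map (topol G) (topol A) f \<and>
        (\<forall>g\<in>carrier G. f (contr G g) = contr A (f g))}"

definition H2_eq ::
    "('g, 'n) dynamical_group_scheme \<Rightarrow> ('a, 'm) dynamical_group_scheme \<Rightarrow> ('g \<Rightarrow> 'a \<Rightarrow> 'a)
      \<Rightarrow> ('g \<times> 'g \<Rightarrow> 'a) set monoid" where
  "H2_eq G A \<gamma> = Z2_eq G A \<gamma> Mod B2_eq G A \<gamma>"

definition H2_class ::
    "('g, 'n) dynamical_group_scheme \<Rightarrow> ('a, 'm) dynamical_group_scheme \<Rightarrow> ('g \<Rightarrow> 'a \<Rightarrow> 'a)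
      \<Rightarrow> ('g \<times> 'g \<Rightarrow> 'a) \<Rightarrow> ('g \<times> 'g \<Rightarrow> 'a) set" where
  "H2_class G A \<gamma> \<omega> = B2_eq G A \<gamma> #>\<^bsub>Z2_eq G A \<gamma>\<^esub> \<omega>"

record ('a, 'e, 'g) extension =
  total_group :: "'e dynamical_group"
  incl :: "'a \<Rightarrow> 'e"
  proj :: "'e \<Rightarrow> 'g"

definition contraction_extension ::
    "('a, 'm) dynamical_group_scheme \<Rightarrow> ('g, 'n) dynamical_group_scheme
      \<Rightarrow> ('a, 'e, 'g) extension \<Rightarrow> bool" where
  "contraction_extension A G E \<longleftrightarrow>
     lc_contraction_group (total_group E) \<and>
     contraction_morphism A (total_group E) (incl E) \<and>
     contraction_morphism (total_group E) G (proj E) \<and>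
     inj_on (incl E) (carrier A) \<and>
     incl E ` carrier A = kernel (total_group E) G (proj E) \<and>
     proj E ` carrier (total_group E) = carrier G"

definition induces ::
    "('a, 'm) dynamical_group_scheme \<Rightarrow> ('a, 'e, 'g) extension \<Rightarrow> ('g \<Rightarrow> 'a \<Rightarrow> 'a) \<Rightarrow> bool" where
  "induces A E \<gamma> \<longleftrightarrow>
     (\<forall>a\<in>carrier A. \<forall>x\<in>carrier (total_group E).
        incl E (\<gamma> (proj E x) a) = x \<otimes>\<^bsub>total_group E\<^esub> incl E a \<otimes>\<^bsub>total_group E\<^esub> inv\<^bsub>total_group E\<^esub> x)"

definition extensions_inducing ::
    "('a, 'm) dynamical_group_scheme \<Rightarrow> ('g, 'n) dynamical_group_scheme \<Rightarrow> ('g \<Rightarrow> 'a \<Rightarrow> 'a)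
      \<Rightarrow> ('a, 'e, 'g) extension set" where
  "extensions_inducing A G \<gamma> = {E. contraction_extension A G E \<and> induces A E \<gamma>}"

(* Heterogeneous: the two total groups may live on different types. *)

definition extension_equivalent ::
    "('a, 'm) dynamical_group_scheme \<Rightarrow> ('a, 'e, 'g) extension \<Rightarrow> ('a, 'f, 'g) extension \<Rightarrow> bool" where
  "extension_equivalent A E1 E2 \<longleftrightarrow>
     (\<exists>\<psi>. contraction_isomorphism (total_group E1) (total_group E2) \<psi> \<and>
        (\<forall>a\<in>carrier A. \<psi> (incl E1 a) = incl E2 a) \<and>
        (\<forall>x\<in>carrier (total_group E1). proj E2 (\<psi> x) = proj E1 x))"

definition extension_rel ::
    "('a, 'm) dynamical_group_scheme \<Rightarrow> ('g, 'n) dynamical_group_scheme \<Rightarrow> ('g \<Rightarrow> 'a \<Rightarrow> 'a)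
      \<Rightarrow> (('a, 'e, 'g) extension \<times> ('a, 'e, 'g) extension) set" where
  "extension_rel A G \<gamma> =
     {(E1, E2). E1 \<in> extensions_inducing A G \<gamma> \<and> E2 \<in> extensions_inducing A G \<gamma> \<and>
        extension_equivalent A E1 E2}"

(* The pair of neutral elements is the neutral element because every equivariant cocycle
   satisfies \<omega> (\<one>, \<one>) = \<one>: this value is a fixed point of the contraction of A. *)

definition twisted_product ::
    "('a, 'm) dynamical_group_scheme \<Rightarrow> ('g, 'n) dynamical_group_scheme \<Rightarrow> ('g \<Rightarrow> 'a \<Rightarrow> 'a)
      \<Rightarrow> ('g \<times> 'g \<Rightarrow> 'a) \<Rightarrow> ('a \<times> 'g) dynamical_group" where
  "twisted_product A G \<gamma> \<omega> =
    \<lparr>carrier = carrier A \<times> carrier G,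
     mult = (\<lambda>(a1, g1) (a2, g2). (a1 \<otimes>\<^bsub>A\<^esub> \<gamma> g1 a2 \<otimes>\<^bsub>A\<^esub> \<omega> (g1, g2), g1 \<otimes>\<^bsub>G\<^esub> g2)),
     one = (\<one>\<^bsub>A\<^esub>, \<one>\<^bsub>G\<^esub>),
     topol = prod_topology (topol A) (topol G),
     contr = map_prod (contr A) (contr G)\<rparr>"

definition twisted_extension ::
    "('a, 'm) dynamical_group_scheme \<Rightarrow> ('g, 'n) dynamical_group_scheme \<Rightarrow> ('g \<Rightarrow> 'a \<Rightarrow> 'a)
      \<Rightarrow> ('g \<times> 'g \<Rightarrow> 'a) \<Rightarrow> ('a, 'a \<times> 'g, 'g) extension" where
  "twisted_extension A G \<gamma> \<omega> =
    \<lparr>total_group = twisted_product A G \<gamma> \<omega>, incl = (\<lambda>a. (a, \<one>\<^bsub>G\<^esub>)), proj = snd\<rparr>"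

end

(* The only hard point is that every extension E -> G of contraction groups with abelian kernel N has
a continuous section commuting with the contractions; equivalently, there is a continuous map F: E -> N
commuting with the contraction a with F(x n) = F(x) n.  Every connected nontrivial contraction group has
a nonzero homomorphism to the reals (a limit of averages of word-length functions), and from this
one gets that it has no nontrivial compact subgroups.  Hence N is the product of a vector group, its identity
component, and a totally disconnected part D that meets the identity component of E trivially.  For D,
the map F is given by a digit expansion along the cosets of an open invariant subgroup.  For the vector
group, coordinates on N are extended to E outside N by weighted averages of the local extensions
x -> - int phi(x b) h(b) db / int phi(x b) db over the orbit of x under a. *)
theory Submission
  imports Defs
begin

subsection \<open>Locally compact groups\<close>

text \<open>Connected contraction groups are known to be simply connected nilpotent Lie groups, but
  this rests on the solution of Hilbert's fifth problem. Only two consequences are needed, and both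
  are drawn from real homomorphisms: compact subgroups are trivial, and in the abelian case the
  group is a vector group. The first is an induction over common kernels of real homomorphisms, so
  these kernels must stay connected and the descent must stop. Connectedness comes from a retraction
  that is a homomorphism up to a compact error, termination from counting separated words in compact
  sets.

  Equivariance is what makes the section hard: a local choice is moved by the contraction. So
  choices are spread along orbits from a fundamental domain, or made as an intersection over all
  iterates. Points close to N reach the fundamental domain only after many backward steps, and
  continuity at N needs its own argument. Given the section, the rest is algebra together with an
  open mapping theorem: another section of a twisted product changes its cocycle by a
  coboundary.\<close>

lemma mem_set_mult: "x : A <#>\<^bsub>G\<^esub> B \<longleftrightarrow> (EX a:A. EX b:B. x = a \<otimes>\<^bsub>G\<^esub> b)"
 by (auto simp: set_mult_def)

lemma set_multI: "a : A ==> b : B ==> a \<otimes>\<^bsub>G\<^esub> b : A <#>\<^bsub>G\<^esub> B"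
 by (auto simp: set_mult_def)

lemma set_mult_mono: "A <= A' ==> B <= B' ==> A <#>\<^bsub>G\<^esub> B <= A' <#>\<^bsub>G\<^esub> B'"
 by (auto simp: set_mult_def)

lemma compactin_cover:
 assumes "compactin X K" "!!U. U : \<U> ==> openin X U" "K <= \<Union>\<U>"
 shows "EX \<F>. finite \<F> & \<F> <= \<U> & K <= \<Union>\<F>"
 using assms unfolding compactin_def by simp

locale lcgroup =
 fixes G :: "'a dynamical_group" (structure)
 assumes tgrp: "topological_group G" and haus: "Hausdorff_space (topol G)"
  and loccomp: "locally_compact_space (topol G)"
begin

sublocale group G
 using tgrp by (simp add: topological_group_def)

abbreviation "T \<equiv> topol G"
abbreviation "CG \<equiv> carrier G"
abbreviation "rcont \<equiv> continuous_map T euclideanreal"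

lemma topspace_T [simp]: "topspace T = CG"
 using tgrp by (simp add: topological_group_def)

lemma openin_carrier: "openin T U ==> x : U ==> x : CG"
 using openin_subset by fastforce

lemma compactin_carrier: "compactin T U ==> x : U ==> x : CG"
 using compactin_subset_topspace by fastforce

lemma closedin_carrier: "closedin T U ==> x : U ==> x : CG"
 using closedin_subset by fastforce

lemma openin_subset_carrier: "openin T U ==> U <= CG"
 and compactin_subset_carrier: "compactin T K ==> K <= CG"
 and closedin_subset_carrier: "closedin T C ==> C <= CG"
 using openin_subset compactin_subset_topspace closedin_subset by fastforce+

lemma compact_closed: "compactin T K ==> closedin T K"
 using compactin_imp_closedin haus by blast

lemma continuous_mult [continuous_intros]:
 assumes "continuous_map Z T f" "continuous_map Z T g"
 shows "continuous_map Z T (%z. f z \<otimes> g z)"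
proof -
 have "continuous_map Z T ((%(x, y). x \<otimes> y) \<circ> (%z. (f z, g z)))"
  using assms tgrp by (intro continuous_map_compose) (auto simp: topological_group_def continuous_map_paired)
 then show ?thesis by (simp add: o_def)
qed

lemma continuous_inv [continuous_intros]:
 assumes "continuous_map Z T f" shows "continuous_map Z T (%z. inv f z)"
proof -
 have "continuous_map Z T ((%x. inv x) \<circ> f)"
  using assms tgrp by (intro continuous_map_compose) (auto simp: topological_group_def)
 then show ?thesis by (simp add: o_def)
qed

lemma continuous_const [continuous_intros]: "c : CG ==> continuous_map Z T (%z. c)"
 by simp

lemma continuous_id [continuous_intros]: "continuous_map T T (%z. z)"
 by simp

lemma continuous_mult_pair: "continuous_map (prod_topology T T) T (%z. fst z \<otimes> snd z)"
 by (intro continuous_intros)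

lemma open_preimage: "continuous_map Z T f ==> openin T U ==> openin Z {z : topspace Z. f z : U}"
 by (rule openin_continuous_map_preimage)

lemma closed_preimage: "continuous_map Z T f ==> closedin T U ==> closedin Z {z : topspace Z. f z : U}"
 by (rule closedin_continuous_map_preimage)

lemma open_ltrans: "openin T U ==> x : CG ==> openin T {y : CG. x \<otimes> y : U}"
 using open_preimage[of T "%y. x \<otimes> y" U] by (simp add: continuous_intros)

lemma open_rtrans: "openin T U ==> x : CG ==> openin T {y : CG. y \<otimes> x : U}"
 using open_preimage[of T "%y. y \<otimes> x" U] by (simp add: continuous_intros)

lemma set_mult_carrier: "A <= CG ==> B <= CG ==> A <#> B <= CG"
 by (fastforce simp: mem_set_mult)

lemma open_mult_right:
 assumes "openin T U" "B <= CG" shows "openin T (U <#> B)"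
proof -
 have "U <#> B = (\<Union>b\<in>B. {y : CG. y \<otimes> inv b : U})"
 proof (intro equalityI subsetI)
  fix x assume "x : U <#> B"
  then obtain u b where ub: "u : U" "b : B" "x = u \<otimes> b" by (auto simp: mem_set_mult)
  then have "u : CG" "b : CG" using assms openin_carrier by auto
  then have "x \<otimes> inv b = u" using ub by (simp add: m_assoc)
  then show "x : (\<Union>b\<in>B. {y : CG. y \<otimes> inv b : U})" using ub \<open>u : CG\<close> \<open>b : CG\<close> by (intro UN_I[of b]) auto
 next
  fix x assume "x : (\<Union>b\<in>B. {y : CG. y \<otimes> inv b : U})"
  then obtain b where b: "b : B" "x : CG" "x \<otimes> inv b : U" by auto
  then have "x = (x \<otimes> inv b) \<otimes> b" using assms by (simp add: m_assoc subsetD)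
  then show "x : U <#> B" using b by (auto simp: mem_set_mult)
 qed
 then show ?thesis using assms open_rtrans by (auto intro!: openin_Union)
qed

lemma open_mult_left:
 assumes "openin T U" "B <= CG" shows "openin T (B <#> U)"
proof -
 have "B <#> U = (\<Union>b\<in>B. {y : CG. inv b \<otimes> y : U})"
 proof (intro equalityI subsetI)
  fix x assume "x : B <#> U"
  then obtain u b where ub: "u : U" "b : B" "x = b \<otimes> u" by (auto simp: mem_set_mult)
  then have "u : CG" "b : CG" using assms openin_carrier by auto
  then have "inv b \<otimes> x = u" using ub by (simp add: m_assoc[symmetric])
  then show "x : (\<Union>b\<in>B. {y : CG. inv b \<otimes> y : U})" using ub \<open>u : CG\<close> \<open>b : CG\<close> by (intro UN_I[of b]) auto
 next
  fix x assume "x : (\<Union>b\<in>B. {y : CG. inv b \<otimes> y : U})"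
  then obtain b where b: "b : B" "x : CG" "inv b \<otimes> x : U" by auto
  then have "x = b \<otimes> (inv b \<otimes> x)" using assms by (simp add: m_assoc[symmetric] subsetD)
  then show "x : B <#> U" using b by (auto simp: mem_set_mult)
 qed
 then show ?thesis using assms open_ltrans by (auto intro!: openin_Union)
qed

lemma open_inverses: "openin T U ==> openin T {y : CG. inv y : U}"
 using open_preimage[of T "%y. inv y" U] by (simp add: continuous_intros)

lemma compact_mult:
 assumes "compactin T K" "compactin T L" shows "compactin T (K <#> L)"
proof -
 have "compactin (prod_topology T T) (K \<times> L)" using assms by (simp add: compactin_Times)
 then have "compactin T ((%z. fst z \<otimes> snd z) ` (K \<times> L))"
  using continuous_mult_pair image_compactin by blast
 moreover have "(%z. fst z \<otimes> snd z) ` (K \<times> L) = K <#> L" by (force simp: mem_set_mult)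
 ultimately show ?thesis by simp
qed

lemma compact_inverses: "compactin T K ==> compactin T ((%x. inv x) ` K)"
 by (rule image_compactin) (auto intro!: continuous_intros)

text \<open>The tube lemma for an arbitrary continuous expression \<open>f x y\<close>, so that one
  statement serves products, quotients and conjugates around compact sets.\<close>

lemma Wallace:
 assumes "compactin T K" "compactin T L" "openin T U" "continuous_map (prod_topology T T) T (%z. f (fst z) (snd z))"
  "!!x y. x : K ==> y : L ==> f x y : U"
 obtains V W where "openin T V" "openin T W" "K <= V" "L <= W" "!!x y. x : V ==> y : W ==> f x y : U"
proof -
 let ?P = "{z : topspace (prod_topology T T). f (fst z) (snd z) : U}"
 have "openin (prod_topology T T) ?P" using open_preimage[OF assms(4,3)] .
 moreover have "K \<times> L <= ?P" using assms compactin_carrier by auto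
 ultimately obtain V W where "openin T V" "openin T W" "K <= V" "L <= W" "V \<times> W <= ?P"
  by (rule Wallace_theorem_prod_topology[OF assms(1,2)])
 then show thesis by (intro that[of V W]) auto
qed

lemma nbhd_sym:
 assumes "openin T U" "\<one> : U"
 obtains V where "openin T V" "\<one> : V" "V <= U" "!!x. x : V ==> inv x : V"
proof -
 let ?V = "U \<inter> {y : CG. inv y : U}"
 have "openin T ?V" using assms open_inverses by blast
 moreover have "!!x. x : ?V ==> inv x : ?V" using assms openin_carrier by auto
 ultimately show thesis using that[of ?V] assms by auto
qed

lemma nbhd_mult:
 assumes "openin T U" "\<one> : U"
 obtains V where "openin T V" "\<one> : V" "V <= U" "!!x. x : V ==> inv x : V" "!!x y. x : V ==> y : V ==> x \<otimes> y : U"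
proof -
 obtain V W where VW: "openin T V" "openin T W" "{\<one>} <= V" "{\<one>} <= W" "!!x y. x : V ==> y : W ==> x \<otimes> y : U"
  by (rule Wallace[of "{\<one>}" "{\<one>}" U "%x y. x \<otimes> y"]) (use assms continuous_mult_pair in auto)
 have "openin T (V \<inter> W \<inter> U)" using VW assms by auto
 then obtain N where "openin T N" "\<one> : N" "N <= V \<inter> W \<inter> U" "!!x. x : N ==> inv x : N"
  using nbhd_sym[of "V \<inter> W \<inter> U"] VW assms by blast
 then show thesis using that[of N] VW by blast
qed

lemma tube_right:
 assumes "compactin T K" "openin T U" "K <= U"
 obtains V where "openin T V" "\<one> : V" "!!x y. x : K ==> y : V ==> x \<otimes> y : U"
proof -
 obtain V W where VW: "openin T V" "openin T W" "K <= V" "{\<one>} <= W" "!!x y. x : V ==> y : W ==> x \<otimes> y : U"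
  by (rule Wallace[of K "{\<one>}" U "%x y. x \<otimes> y"])
   (use assms continuous_mult_pair compactin_carrier in auto)
 then show thesis using that[of W] by blast
qed

lemma tube_left:
 assumes "compactin T K" "openin T U" "K <= U"
 obtains V where "openin T V" "\<one> : V" "!!x y. x : K ==> y : V ==> y \<otimes> x : U"
proof -
 obtain V W where VW: "openin T V" "openin T W" "{\<one>} <= V" "K <= W" "!!x y. x : V ==> y : W ==> x \<otimes> y : U"
  by (rule Wallace[of "{\<one>}" K U "%x y. x \<otimes> y"])
   (use assms continuous_mult_pair compactin_carrier in auto)
 then show thesis using that[of V] by blast
qed

text \<open>If \<open>x\<close> is not in \<open>C K\<close>, then \<open>x k^-1\<close> avoids
  \<open>C\<close> for every \<open>k\<close> in \<open>K\<close>, and by compactness of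
  \<open>K\<close> this persists for all points near \<open>x\<close>.\<close>

lemma closed_compact_mult:
 assumes "closedin T C" "compactin T K" shows "closedin T (C <#> K)"
proof -
 have "openin T (CG - (C <#> K))"
 proof (subst openin_subopen, intro ballI)
  fix x assume x: "x : CG - (C <#> K)"
  have "x \<otimes> inv k : CG - C" if "k : K" for k
  proof -
   have k: "k : CG" using that assms compactin_carrier by auto
   have "x = (x \<otimes> inv k) \<otimes> k" using x k by (simp add: m_assoc)
   then show ?thesis using x that k by (auto simp: mem_set_mult)
  qed
  note neg = this
  obtain V W where VW: "openin T V" "openin T W" "{x} <= V" "K <= W"
    "!!x y. x : V ==> y : W ==> x \<otimes> inv y : CG - C"
   by (rule Wallace[of "{x}" K "CG - C" "%x y. x \<otimes> inv y"])
    (use x assms neg openin_diff[OF openin_topspace, of T C] in \<open>auto intro!: continuous_intros\<close>)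
  have "V \<inter> (C <#> K) = {}"
  proof -
   have False if "v : V" "c : C" "k : K" "v = c \<otimes> k" for v c k
   proof -
    have "v \<otimes> inv k = c" using that assms compactin_carrier closedin_carrier by (simp add: m_assoc)
    then show False using VW that by blast
   qed
   then show ?thesis unfolding mem_set_mult disjoint_iff by blast
  qed
  then show "EX U. openin T U & x : U & U <= CG - (C <#> K)"
   using VW openin_subset[of T V] by (intro exI[of _ V]) auto
 qed
 moreover have "C <#> K <= CG"
  using assms compactin_subset_carrier closedin_subset_carrier by (intro set_mult_carrier) auto
 ultimately show ?thesis by (simp add: closedin_def)
qed

lemma compact_nbhd:
 assumes "openin T U" "\<one> : U"
 obtains V K where "openin T V" "compactin T K" "\<one> : V" "V <= K" "K <= U"
  "!!x. x : V ==> inv x : V" "!!x. x : K ==> inv x : K"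
proof -
 have "neighbourhood_base_of (compactin T) T"
  using locally_compact_space_neighbourhood_base haus loccomp by blast
 then obtain V K where VK: "openin T V" "compactin T K" "\<one> : V" "V <= K" "K <= U"
  using assms unfolding neighbourhood_base_of by meson
 let ?V = "V \<inter> {y : CG. inv y : V}" let ?K = "K \<inter> {y : CG. inv y : K}"
 have "{y : CG. inv y : K} = (%x. inv x) ` K"
 proof (intro equalityI subsetI)
  fix y assume "y : {y : CG. inv y : K}"
  then have "y = inv (inv y)" "inv y : K" by auto
  then show "y : (%x. inv x) ` K" by blast
 qed (use VK compactin_carrier in auto)
 then have "compactin T ?K"
  using VK by (simp add: closed_Int_compactin compact_closed compact_inverses)
 moreover have "openin T ?V" using VK open_inverses by blast
 moreover have "!!x. x : ?V ==> inv x : ?V" "!!x. x : ?K ==> inv x : ?K"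
  using VK openin_carrier compactin_carrier by auto
 moreover have "\<one> : ?V" "?V <= ?K" "?K <= U" using VK by auto
 ultimately show thesis using that[of ?V ?K] by blast
qed

lemma separate_one:
 assumes "x : CG" "x ~= \<one>" obtains U where "openin T U" "\<one> : U" "x ~: U"
 using haus assms unfolding Hausdorff_space_def disjnt_iff by (metis topspace_T one_closed)

lemma open_subgroup_closed:
 assumes "subgroup H G" "openin T H" shows "closedin T H"
proof -
 interpret H: subgroup H G by fact
 have "CG - H = (CG - H) <#> H"
 proof (intro equalityI subsetI)
  fix x assume x: "x : CG - H"
  then have "x \<otimes> \<one> : (CG - H) <#> H" using H.one_closed by (intro set_multI)
  then show "x : (CG - H) <#> H" using x by simp
 next
  fix x assume "x : (CG - H) <#> H"
  then obtain a b where ab: "a : CG" "a ~: H" "b : H" "x = a \<otimes> b" by (auto simp: mem_set_mult)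
  have "a = x \<otimes> inv b" using ab by (simp add: m_assoc)
  then show "x : CG - H" using ab by (metis DiffI H.m_closed H.m_inv_closed H.mem_carrier m_closed)
 qed
 moreover have "openin T ((CG - H) <#> H)" using open_mult_left[OF assms(2)] by blast
 ultimately have "openin T (CG - H)" by simp
 then show ?thesis using H.subset by (simp add: closedin_def)
qed

lemma connected_open_subgroup:
 assumes "connected_space T" "subgroup H G" "openin T H" shows "H = CG"
proof -
 have "closedin T H" using open_subgroup_closed assms by blast
 then have "H = {} \<or> H = CG" using assms unfolding connected_space_clopen_in by auto
 then show ?thesis using subgroup.one_closed[OF assms(2)] by auto
qed

lemma open_subgroupI:
 assumes "subgroup H G" "openin T U" "\<one> : U" "U <= H" shows "openin T H"
proof -
 interpret H: subgroup H G by fact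
 have "H = U <#> H"
 proof (intro equalityI subsetI)
  fix x assume x: "x : H" then have "\<one> \<otimes> x : U <#> H" using assms by (intro set_multI)
  then show "x : U <#> H" using x by simp
 qed (use assms in \<open>auto simp: mem_set_mult\<close>)
 then show ?thesis using open_mult_right[OF assms(2) H.subset] by simp
qed

section \<open>Product sets of a neighbourhood and the subgroups they generate\<close>

primrec spow :: "'a set => nat => 'a set" where
 "spow W 0 = {\<one>}" | "spow W (Suc n) = spow W n <#> W"

lemma spow_carrier: "W <= CG ==> spow W n <= CG"
 by (induction n) (simp_all add: set_mult_carrier)

lemma set_mult_one: "A <= CG ==> A <#> {\<one>} = A" "A <= CG ==> {\<one>} <#> A = A"
 unfolding set_mult_def subset_iff by simp_all

lemma spow_add: "W <= CG ==> spow W (m + n) = spow W m <#> spow W n"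
proof (induction n)
 case 0
 then show ?case using spow_carrier[of W m] by (simp add: set_mult_one)
qed (simp add: set_mult_assoc spow_carrier)

lemma spow_1: "W <= CG ==> spow W 1 = W"
 by (simp add: set_mult_one)

lemma spow_compact: "compactin T W ==> compactin T (spow W n)"
 by (induction n) (auto intro: compact_mult)

lemma spow_mono: "W <= V ==> spow W n <= spow V n"
 by (induction n) (auto intro: subsetD[OF set_mult_mono])

lemma spow_le: "W <= CG ==> \<one> : W ==> m <= n ==> spow W m <= spow W n"
proof (induction n)
 case (Suc n)
 have "spow W n <= spow W (Suc n)"
 proof
  fix x assume "x : spow W n"
  then have "x \<otimes> \<one> : spow W (Suc n)" "x : CG" using Suc.prems spow_carrier[of W n] by (auto intro: set_multI)
  then show "x : spow W (Suc n)" by (simp del: spow.simps)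
 qed
 then show ?case using Suc by (cases "m = Suc n") auto
qed simp

lemma spow_mult: "W <= CG ==> spow (spow W m) n = spow W (m * n)"
proof (induction n)
 case (Suc n)
 then have "spow (spow W m) (Suc n) = spow W (m * n) <#> spow W m" by simp
 also have "... = spow W (m * n + m)" using Suc by (simp add: spow_add)
 finally show ?case by (simp add: algebra_simps)
qed simp

lemma spow_inv:
 assumes "W <= CG" "!!x. x : W ==> inv x : W" "x : spow W n" shows "inv x : spow W n"
 using assms(3)
proof (induction n arbitrary: x)
 case (Suc n)
 then obtain a w where aw: "a : spow W n" "w : W" "x = a \<otimes> w" by (auto simp: mem_set_mult)
 have "inv x = inv w \<otimes> inv a" using aw assms(1) spow_carrier[OF assms(1), of n] by (simp add: inv_mult_group subset_iff)
 moreover have "inv w : spow W 1" using aw assms spow_1 by auto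
 ultimately have "inv x : spow W (1 + n)" using Suc.IH[OF aw(1)] assms(1) unfolding spow_add[OF assms(1)] by (auto intro: set_multI simp del: spow.simps)
 then show ?case by simp
qed simp

lemma spow_pow: "W <= CG ==> x : W ==> x [^] (n::nat) : spow W n"
 by (induction n) (auto simp: mem_set_mult)

lemma spow_subgroup:
 assumes "W <= CG" "!!x. x : W ==> inv x : W"
 shows "subgroup (\<Union>n. spow W n) G"
proof
 show "(\<Union>n. spow W n) <= CG" using spow_carrier[OF assms(1)] by auto
 show "\<one> : (\<Union>n. spow W n)" by (auto intro: exI[of _ 0])
 show "inv x : (\<Union>n. spow W n)" if "x : (\<Union>n. spow W n)" for x using that spow_inv[OF assms] by auto
 show "x \<otimes> y : (\<Union>n. spow W n)" if "x : (\<Union>n. spow W n)" "y : (\<Union>n. spow W n)" for x y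
 proof -
  from that obtain m n where "x : spow W m" "y : spow W n" by blast
  then have "x \<otimes> y : spow W (m + n)" by (auto simp: spow_add[OF assms(1)] intro: set_multI)
  then show ?thesis by blast
 qed
qed

text \<open>The generated subgroup contains a neighbourhood of the identity, so it is open, and a
  connected group has no proper open subgroup.\<close>

lemma connected_generated:
 assumes "connected_space T" "W <= CG" "!!x. x : W ==> inv x : W" "openin T V" "\<one> : V" "V <= W"
 shows "(\<Union>n. spow W n) = CG"
proof (rule connected_open_subgroup[OF assms(1)])
 show s: "subgroup (\<Union>n. spow W n) G" using spow_subgroup assms by blast
 show "openin T (\<Union>n. spow W n)"
  by (rule open_subgroupI[OF s assms(4,5)]) (use assms spow_1[of W] in blast)
qed

lemma compact_increasing:
 assumes "compactin T K" "!!n::nat. openin T (U n)" "!!m n. m <= n ==> U m <= U n" "K <= (\<Union>n. U n)"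
 obtains n where "K <= U n"
proof -
 have "!!X. X : range U ==> openin T X" "K <= \<Union>(range U)" using assms by auto
 then obtain \<F> where F: "finite \<F>" "\<F> <= range U" "K <= \<Union>\<F>"
  using compactin_cover[OF assms(1), of "range U"] by meson
 then obtain I where I: "finite I" "\<F> = U ` I" by (meson finite_subset_image)
 have "K <= U (if I = {} then 0 else Max I)"
 proof
  fix x assume "x : K" then obtain i where "i : I" "x : U i" using F I by auto
  moreover then have "i <= Max I" using I by auto
  ultimately show "x : U (if I = {} then 0 else Max I)" using assms(3) by auto
 qed
 then show thesis using that by blast
qed

lemma finite_translates:
 assumes "compactin T K" "openin T V" "\<one> : V"
 obtains F where "finite F" "F <= K" "!!x. x : K ==> EX f:F. EX v:V. x = f \<otimes> v"
proof -
 let ?U = "%f. {y : CG. inv f \<otimes> y : V}"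
 have "!!X. X : ?U ` K ==> openin T X" using assms compactin_carrier open_ltrans by auto
 moreover have "K <= \<Union>(?U ` K)" using assms compactin_carrier by auto
 note cov = compactin_cover[OF assms(1), of "?U ` K", OF calculation this]
 then obtain \<F> where F: "finite \<F>" "\<F> <= ?U ` K" "K <= \<Union>\<F>"
  by blast
 then obtain I where I: "finite I" "I <= K" "\<F> = ?U ` I" by (meson finite_subset_image)
 show thesis
 proof (rule that[OF I(1,2)])
  fix x assume "x : K"
  then obtain f where f: "f : I" "x : CG" "inv f \<otimes> x : V" using F I by auto
  then have "f : CG" using I assms compactin_carrier by auto
  then have "x = f \<otimes> (inv f \<otimes> x)" using f by (simp add: m_assoc[symmetric])
  then show "EX f:I. EX v:V. x = f \<otimes> v" using f by blast
 qed
qed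

lemma Baire_cover:
 assumes "!!n::nat. closedin T (F n)" "CG <= (\<Union>n. F n)"
 obtains n x V where "openin T V" "x : V" "V <= F n"
proof -
 have "EX n. T interior_of (F n) ~= {}"
 proof (rule ccontr)
  assume "~ ?thesis"
  then have "T interior_of \<Union>(range F) = {}"
   using assms haus loccomp by (intro Baire_category_alt) (auto intro: locally_compact_Hausdorff_imp_regular_space)
  moreover have "\<Union>(range F) = CG" using assms closedin_subset_carrier by blast
  ultimately show False using interior_of_topspace[of T] one_closed by auto
 qed
 then show thesis using that by (metis ex_in_conv interior_of_subset openin_interior_of)
qed

end

subsection \<open>Contractions\<close>

text \<open>The action of the integers by powers of the contraction; negative powers iterate its
  inverse on the carrier.\<close>

definition actr :: "'a dynamical_group => int => 'a => 'a" where
 "actr G k x = (if 0 <= k then (contr G ^^ nat k) x else (inv_into (carrier G) (contr G) ^^ nat (- k)) x)"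

text \<open>The field \<open>contr\<close> is kept as it is; the subgroup becomes a contraction
  group when it is closed and mapped onto itself.\<close>

definition sub :: "'a dynamical_group => 'a set => 'a dynamical_group" where
 "sub G H = G\<lparr>carrier := H, topol := subtopology (topol G) H\<rparr>"

lemma sub_simps [simp]: "carrier (sub G H) = H" "topol (sub G H) = subtopology (topol G) H"
 "mult (sub G H) = mult G" "one (sub G H) = one G" "contr (sub G H) = contr G"
 by (simp_all add: sub_def)

lemma set_mult_sub [simp]: "A <#>\<^bsub>sub G H\<^esub> B = A <#>\<^bsub>G\<^esub> B"
 by (simp add: set_mult_def)

lemma group_sub:
 assumes "group G" "subgroup H G" shows "group (sub G H)"
proof -
 interpret G: group G by fact
 interpret H: subgroup H G by fact
 show ?thesis proof (rule groupI)
  show "EX y:carrier (sub G H). y \<otimes>\<^bsub>sub G H\<^esub> x = \<one>\<^bsub>sub G H\<^esub>" if "x : carrier (sub G H)" for x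
   using that by (intro bexI[of _ "inv\<^bsub>G\<^esub> x"]) auto
 qed (auto simp: G.m_assoc)
qed

lemma inv_sub:
 assumes "group G" "subgroup H G" "x : H" shows "inv\<^bsub>sub G H\<^esub> x = inv\<^bsub>G\<^esub> x"
proof -
 interpret G: group G by fact
 interpret H: subgroup H G by fact
 interpret S: group "sub G H" using group_sub assms by blast
 show ?thesis using assms by (intro S.inv_equality) auto
qed

locale contraction = lcgroup G for G :: "'a dynamical_group" (structure) +
 assumes contr_iso: "contr G : iso G G" and contr_homeo: "homeomorphic_map (topol G) (topol G) (contr G)"
  and contr_lim: "!!x. x : carrier G ==> limitin (topol G) (%n. (contr G ^^ n) x) \<one> sequentially"

lemma contraction_iff: "contraction G \<longleftrightarrow> lc_contraction_group G"
 by (auto simp: contraction_def contraction_axioms_def lcgroup_def lc_contraction_group_def)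

context contraction begin

abbreviation "act \<equiv> actr G"

lemma contr_bij: "bij_betw (contr G) (CG) (CG)"
 using contr_iso by (simp add: iso_def)

lemma contr_closed [simp, intro]: "x : CG ==> contr G x : CG"
 using contr_bij by (auto simp: bij_betw_def)

lemma contr_mult: "x : CG ==> y : CG ==> contr G (x \<otimes> y) = contr G x \<otimes> contr G y"
 using contr_iso by (simp add: iso_def hom_def)

lemma contr_inj: "x : CG ==> y : CG ==> contr G x = contr G y \<longleftrightarrow> x = y"
 using contr_bij by (auto simp: bij_betw_def inj_on_def)

abbreviation "cinv \<equiv> inv_into (CG) (contr G)"

lemma cinv_closed [simp, intro]: "x : CG ==> cinv x : CG"
 using contr_bij by (metis bij_betw_def inv_into_into)

lemma contr_cinv [simp]: "x : CG ==> contr G (cinv x) = x"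
 using contr_bij by (metis bij_betw_def f_inv_into_f)

lemma cinv_contr [simp]: "x : CG ==> cinv (contr G x) = x"
 using contr_bij by (metis bij_betw_def inv_into_f_f)

lemma funpow_closed: "x : CG ==> (contr G ^^ n) x : CG" "x : CG ==> (cinv ^^ n) x : CG"
 by (induction n) auto

lemma act_closed [simp, intro]: "x : CG ==> act k x : CG"
 by (simp add: actr_def funpow_closed)

lemma act_0 [simp]: "act 0 x = x" by (simp add: actr_def)

lemma act_1: "act 1 x = contr G x" by (simp add: actr_def)

lemma act_Suc: "x : CG ==> act (k + 1) x = contr G (act k x)"
proof (cases "0 <= k")
 case True
 then have "nat (k + 1) = Suc (nat k)" by simp
 then show ?thesis using True by (simp add: actr_def)
next
 case False
 assume x: "x : CG"
 have "nat (- k) = Suc (nat (- (k + 1)))" using False by simp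
 then have "act k x = cinv ((cinv ^^ nat (- (k + 1))) x)" using False by (simp add: actr_def)
 then have "contr G (act k x) = (cinv ^^ nat (- (k + 1))) x" using x funpow_closed by simp
 also have "... = act (k + 1) x" using False by (cases "k = -1") (auto simp: actr_def)
 finally show ?thesis by simp
qed

lemma act_add: "x : CG ==> act (k + l) x = act k (act l x)"
proof (induction k rule: int_induct[where k = 0])
 case (step1 i)
 have "act (i + 1 + l) x = act ((i + l) + 1) x" by (simp add: algebra_simps)
 also have "... = contr G (act (i + l) x)" using step1 act_Suc by simp
 also have "... = act (i + 1) (act l x)" using step1 act_Suc by simp
 finally show ?case .
next
 case (step2 i)
 have "contr G (act (i - 1 + l) x) = act (i + l) x"
  using act_Suc[of x "i - 1 + l"] step2 by (simp add: algebra_simps)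
 also have "... = contr G (act (i - 1) (act l x))"
  using act_Suc[of "act l x" "i - 1"] step2 by simp
 finally show ?case using contr_inj step2 by simp
qed simp

lemma act_minus [simp]: "x : CG ==> act (- k) (act k x) = x" "x : CG ==> act k (act (- k) x) = x"
 using act_add[of x "- k" k] act_add[of x k "- k"] by auto

lemma act_contr: "x : CG ==> act k (contr G x) = contr G (act k x)"
 using act_add[of x k 1] act_Suc[of x k] by (simp add: act_1)

lemma act_inj: "x : CG ==> y : CG ==> act k x = act k y \<longleftrightarrow> x = y"
 using act_minus(1) by metis

lemma act_mult: "x : CG ==> y : CG ==> act k (x \<otimes> y) = act k x \<otimes> act k y"
proof (induction k rule: int_induct[where k = 0])
 case (step1 i) then show ?case by (simp add: act_Suc contr_mult)
next
 case (step2 i)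
 have "contr G (act (i - 1) (x \<otimes> y)) = contr G (act (i - 1) x \<otimes> act (i - 1) y)"
  using act_Suc[of _ "i - 1"] step2 by (simp add: contr_mult)
 then show ?case using contr_inj step2 by simp
qed simp

lemma act_hom: "group_hom G G (act k)"
 by unfold_locales (auto simp: hom_def act_mult)

lemma act_one [simp]: "act k \<one> = \<one>" using group_hom.hom_one[OF act_hom] .

lemma act_inv: "x : CG ==> act k (inv x) = inv (act k x)"
 using group_hom.hom_inv[OF act_hom] .

lemma contr_one [simp]: "contr G \<one> = \<one>" using act_one[of 1] by (simp only: act_1)

lemma act_eq_one: "x : CG ==> act k x = \<one> \<longleftrightarrow> x = \<one>"
 using act_inj[of x "\<one>" k] by simp

lemma act_image_add: "S <= CG ==> act (k + l) ` S = act k ` act l ` S"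
 unfolding image_image by (intro image_cong) (auto simp: act_add)

lemma act_image_minus: "S <= CG ==> act (- k) ` act k ` S = S" "S <= CG ==> act k ` act (- k) ` S = S"
 using act_image_add[of S "-k" k] act_image_add[of S k "-k"] by simp_all

lemma act_image_iff: "S <= CG ==> x : CG ==> x : act k ` S \<longleftrightarrow> act (- k) x : S"
proof
 assume "S <= CG" "x : CG" "act (- k) x : S"
 then show "x : act k ` S" using act_minus(2)[of x k] by (metis imageI)
qed (auto simp: subset_iff)

lemma act_image_carrier [simp]: "act k ` CG = CG"
 using act_image_iff[of "CG" _ k] by blast

lemma act_set_mult: "A <= CG ==> B <= CG ==> act k ` (A <#> B) = act k ` A <#> act k ` B"
proof -
 assume "A <= CG" "B <= CG"
 then have "act k ` (A <#> B) = (\<Union>a\<in>A. \<Union>b\<in>B. {act k a \<otimes> act k b})"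
  unfolding set_mult_def image_UN image_insert image_empty by (intro SUP_cong refl) (simp add: act_mult subset_iff)
 then show ?thesis by (simp add: set_mult_def)
qed

lemma act_spow: "W <= CG ==> act k ` spow W n = spow (act k ` W) n"
 by (induction n) (simp_all add: act_set_mult spow_carrier)

lemma continuous_act0: "continuous_map T T (act k)"
proof -
 obtain g where g: "homeomorphic_maps T T (contr G) g"
  using contr_homeo homeomorphic_map_maps by metis
 have "g x = cinv x" if "x : CG" for x
  using g that unfolding homeomorphic_maps_def
  by (metis cinv_contr contr_cinv cinv_closed topspace_T)
 then have c: "continuous_map T T cinv" using g continuous_map_eq[of T T g cinv] unfolding homeomorphic_maps_def by simp
 have c': "continuous_map T T (contr G)" using contr_homeo homeomorphic_imp_continuous_map by blast
 have "continuous_map T T (f ^^ n)" if "continuous_map T T f" for f n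
 proof (induction n)
  case (Suc n) show ?case using continuous_map_compose[OF Suc that] by (simp add: o_def)
 qed (simp add: id_def)
 note this[OF c, of "nat (-k)"] this[OF c', of "nat k"]
 then show ?thesis unfolding actr_def by (cases "0 <= k") simp_all
qed

lemma continuous_act [continuous_intros]: "continuous_map Z T f ==> continuous_map Z T (%z. act k (f z))"
 using continuous_map_compose[OF _ continuous_act0, of Z f k] by (simp add: o_def)

lemma continuous_contr [continuous_intros]: "continuous_map Z T f ==> continuous_map Z T (%z. contr G (f z))"
 using continuous_act[of Z f 1] by (simp add: act_1)

lemma act_preimage: "S <= CG ==> act k ` S = {x : CG. act (- k) x : S}"
 using act_image_iff by blast

lemma open_act: "openin T U ==> openin T (act k ` U)"
 using open_preimage[OF continuous_act0, of U "- k"] openin_subset_carrier[of U] by (simp add: act_preimage)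

lemma closed_act: "closedin T U ==> closedin T (act k ` U)"
 using closed_preimage[OF continuous_act0, of U "- k"] closedin_subset_carrier[of U] by (simp add: act_preimage)

lemma compact_act: "compactin T K ==> compactin T (act k ` K)"
 using image_compactin continuous_act0 by blast

lemma subgroup_act: "subgroup H G ==> subgroup (act k ` H) G"
 by (rule group_hom.subgroup_img_is_subgroup[OF act_hom])

lemma act_eventually:
 assumes "x : CG" "openin T U" "\<one> : U"
 obtains N where "!!n. int N <= n ==> act n x : U"
proof -
 obtain N where N: "!!n. N <= n ==> (contr G ^^ n) x : U"
  using contr_lim[OF assms(1)] assms(2,3) unfolding limitin_def eventually_sequentially by blast
 show thesis by (rule that[of N]) (use N in \<open>auto simp: actr_def nat_le_iff le_nat_iff\<close>)
qed

text \<open>Pointwise contraction is uniform on compact sets: by the Baire category theorem the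
 iterates are equicontinuous at the neutral element.\<close>

lemma act_equicontinuous:
 assumes "openin T U" "\<one> : U"
 obtains V N where "openin T V" "\<one> : V" "!!n x. int N <= n ==> x : V ==> act n x : U"
proof -
 obtain U1 where U1: "openin T U1" "\<one> : U1" "!!x. x : U1 ==> inv x : U1" "!!x y. x : U1 ==> y : U1 ==> x \<otimes> y : U"
  using nbhd_mult[OF assms] by metis
 obtain O1 K where K: "openin T O1" "compactin T K" "\<one> : O1" "O1 <= K" "K <= U1" "!!x. x : K ==> inv x : K"
  using compact_nbhd[OF U1(1,2)] by metis
 \<comment> \<open>\<open>F N\<close> collects the points whose orbit stays in \<open>K\<close> from
   time \<open>N\<close> on; pointwise convergence makes these closed sets cover the group.\<close>
 define F where "F N = CG \<inter> (\<Inter>n\<in>{int N..}. {x : CG. act n x : K})" for N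
 have "closedin T (F N)" for N
 proof -
  have "closedin T {x : CG. act n x : K}" for n
   using closed_preimage[OF continuous_act0 compact_closed[OF K(2)], of n] by simp
  then show ?thesis unfolding F_def using closedin_topspace[of T] by (intro closedin_Int closedin_INT) auto
 qed
 moreover have "CG <= (\<Union>N. F N)"
 proof
  fix x assume x: "x : CG"
  obtain N where "!!n. int N <= n ==> act n x : O1" using act_eventually[OF x K(1,3)] by metis
  then have "x : F N" using x K by (auto simp: F_def)
  then show "x : (\<Union>N. F N)" by blast
 qed
 ultimately obtain N x V where V: "openin T V" "x : V" "V <= F N" by (rule Baire_cover)
 have x: "x : CG" using V openin_carrier by blast
 \<comment> \<open>Translating the open set to the identity costs a quotient of two elements of
   \<open>K\<close>, which still lies in \<open>U\<close>.\<close>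
 let ?V = "{y : CG. x \<otimes> y : V}"
 have "act n y : U" if "int N <= n" "y : ?V" for n y
 proof -
  have "act n (x \<otimes> y) : K" "act n x : K" using that V by (auto simp: F_def)
  then have "inv (act n x) \<otimes> act n (x \<otimes> y) : U" using K U1 by blast
  moreover have "inv (act n x) \<otimes> act n (x \<otimes> y) = act n y"
   using that x by (simp add: act_mult m_assoc[symmetric])
  ultimately show ?thesis by simp
 qed
 then show thesis using that[of ?V N] open_ltrans[OF V(1) x] V(2) x by simp
qed

text \<open>Every point of \<open>K\<close> enters the equicontinuity neighbourhood \<open>V\<close>
  at some time. By compactness these times may be taken at most \<open>m\<close>, and
  \<open>N\<close> further steps lead into \<open>U\<close>.\<close>

lemma act_compact_eventually:
 assumes "compactin T K" "openin T U" "\<one> : U"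
 obtains N where "!!n x. int N <= n ==> x : K ==> act n x : U"
proof -
 obtain V N where V: "openin T V" "\<one> : V" "!!n x. int N <= n ==> x : V ==> act n x : U"
  using act_equicontinuous[OF assms(2,3)] by metis
 define P where "P m = (\<Union>k\<in>{0..int m}. act (- k) ` V)" for m
 have "K <= (\<Union>m. P m)"
 proof
  fix x assume "x : K"
  then have x: "x : CG" using assms compactin_carrier by blast
  obtain m where "!!n. int m <= n ==> act n x : V" using act_eventually[OF x V(1,2)] by metis
  then have "act (- (- int m)) x : V" by simp
  then have "x : act (- int m) ` V" using act_image_iff[OF openin_subset_carrier[OF V(1)] x] by blast
  then have "x : P m" unfolding P_def by (intro UN_I[of "int m"]) auto
  then show "x : (\<Union>m. P m)" by blast
 qed
 moreover have "openin T (P m)" for m unfolding P_def using open_act V by blast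
 moreover have "P m <= P n" if "m <= n" for m n unfolding P_def using that by (intro UN_mono) auto
 ultimately obtain m where m: "K <= P m" using compact_increasing[OF assms(1), of P] by blast
 have "act n x : U" if n: "int (N + m) <= n" and "x : K" for n x
 proof -
  obtain k v where k: "0 <= k" "k <= int m" "v : V" "x = act (- k) v" using m \<open>x : K\<close> unfolding P_def by fastforce
  then have "act n x = act (n - k) v" using openin_carrier[OF V(1)] by (simp add: act_add[symmetric])
  then show ?thesis using V(3)[of "n - k" v] k n by simp
 qed
 then show thesis using that by blast
qed

text \<open>From time \<open>N\<close> on the iterates map \<open>K\<close> into itself, so
  intersecting the images of \<open>K\<close> under the powers 0 to \<open>N\<close> gives a stable
  set. The one condition that is not inherited from the preceding power, the one at power 0, is met
  because power \<open>N + 1\<close> maps \<open>K\<close> into \<open>K\<close>.\<close>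

lemma base_nbhd:
 assumes "openin T U" "\<one> : U"
 obtains V W where "openin T V" "compactin T W" "\<one> : V" "V <= W" "W <= U" "!!x. x : W ==> inv x : W"
  "!!x. x : W ==> contr G x : W"
proof -
 obtain V K where K: "openin T V" "compactin T K" "\<one> : V" "V <= K" "K <= U" "!!x. x : K ==> inv x : K"
  using compact_nbhd[OF assms] by metis
 obtain N where N: "!!n x. int N <= n ==> x : K ==> act n x : V"
  using act_compact_eventually[OF K(2,1,3)] by metis
 let ?I = "{0..int N}"
 let ?W = "\<Inter>n\<in>?I. act n ` K" let ?V = "\<Inter>n\<in>?I. act n ` V"
 have Kc: "K <= CG" using K compactin_subset_carrier by blast
 show thesis
 proof (rule that[of ?V ?W])
  show "openin T ?V" using K open_act by (intro openin_INT2) auto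
  show "compactin T ?W"
  proof (rule closed_compactin[of T "act 0 ` K"])
   show "closedin T ?W" using K compact_closed compact_act by (intro closedin_INT) auto
   show "compactin T (act 0 ` K)" using K by simp
   show "?W <= act 0 ` K" by (rule INF_lower) simp
  qed
  show "\<one> : ?V" using K by (auto intro: image_eqI[of _ _ "\<one>"])
  show "?V <= ?W" using K(4) by blast
  have "act 0 ` K <= U" using K by simp
  then show "?W <= U" by (meson INF_lower2 atLeastAtMost_iff of_nat_0_le_iff order_refl)
  show "inv x : ?W" if "x : ?W" for x
  proof
   fix n assume "n : ?I"
   with that have "x : act n ` K" by blast
   then obtain k where "k : K" "x = act n k" by blast
   then show "inv x : act n ` K" using act_inv[of k n] K Kc by (metis imageI subsetD)
  qed
  show "contr G x : ?W" if x: "x : ?W" for x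
  proof
   fix n assume n: "n : ?I"
   have xN: "x : act (int N) ` K" "x : act 0 ` K" using x by (auto simp del: act_0)
   then have xc: "x : CG" using Kc by auto
   show "contr G x : act n ` K"
   proof (cases "n = 0")
    case True
    obtain k where k: "k : K" "x = act (int N) k" using xN by auto
    then have "contr G x = act (int N + 1) k" using act_Suc Kc by auto
    then show ?thesis using N[of "int N + 1" k] k K True by auto
   next
    case False
    then have "x : act (n - 1) ` K" using x n by auto
    then obtain k where k: "k : K" "x = act (n - 1) k" by auto
    then have "contr G x = act n k" using act_Suc[of k "n - 1"] Kc by auto
    then show ?thesis using k by blast
   qed
  qed
 qed
qed

lemma act_invariant:
 assumes "!!x. x : W ==> contr G x : W" "W <= CG" "0 <= n" "x : W" shows "act n x : W"
 using assms(3)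
proof (induction n rule: int_ge_induct)
 case (step i) then show ?case using act_Suc[of x i] assms by auto
qed (use assms in simp)

lemma act_image_antimono:
 assumes "!!x. x : W ==> contr G x : W" "W <= CG" "m <= n" shows "act n ` W <= act m ` W"
proof -
 have "act (n - m) ` W <= W" using act_invariant[OF assms(1,2), of "n - m"] assms by auto
 then have "act m ` act (n - m) ` W <= act m ` W" by blast
 then show ?thesis using act_image_add[OF assms(2), of m "n - m"] by simp
qed

lemma absorbing:
 assumes "compactin T K" "openin T U" "\<one> : U"
 obtains N where "K <= act (- int N) ` U"
proof -
 obtain N where N: "!!n x. int N <= n ==> x : K ==> act n x : U" using act_compact_eventually[OF assms] by metis
 have "K <= act (- int N) ` U"
 proof
  fix x assume x: "x : K"
  then have "act (- (- int N)) x : U" using N by simp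
  then show "x : act (- int N) ` U"
   using act_image_iff[OF openin_subset_carrier[OF assms(2)], of x "- int N"] x assms(1) compactin_carrier by blast
 qed
 then show thesis using that by blast
qed

text \<open>A point \<open>x\<close> of \<open>K\<close> is \<alpha>^n applied to the point
  \<alpha>^(-n)(x) of \<open>K\<close>, so by uniform contraction it lies in every neighbourhood of
  the identity.\<close>

lemma invariant_compact_trivial:
 assumes "compactin T K" "!!x. x : K ==> cinv x : K" shows "K <= {\<one>}"
proof (rule ccontr)
 assume "~ K <= {\<one>}"
 then obtain x where x: "x : K" "x ~= \<one>" by auto
 then have xc: "x : CG" using assms compactin_carrier by blast
 obtain U where U: "openin T U" "\<one> : U" "x ~: U" using separate_one[OF xc x(2)] by metis
 obtain N where N: "!!n x. int N <= n ==> x : K ==> act n x : U" using act_compact_eventually[OF assms(1) U(1,2)] by metis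
 have "(cinv ^^ n) x : K" for n by (induction n) (use x assms in auto)
 then have "act (- int N) x : K" by (simp add: actr_def) (metis act_0 x(1))
 then have "act (int N) (act (- int N) x) : U" using N by blast
 then show False using U xc by simp
qed

lemma sub_contraction:
 assumes "subgroup H G" "closedin T H" "contr G ` H = H" shows "contraction (sub G H)"
proof -
 interpret H: subgroup H G by fact
 have inv: "inv\<^bsub>sub G H\<^esub> x = inv x" if "x : H" for x using inv_sub[OF is_group assms(1) that] .
 interpret S: group "sub G H" using group_sub[OF is_group assms(1)] .
 let ?S = "subtopology T H"
 have ts: "topspace ?S = H" using H.subset by auto
 have m: "continuous_map (prod_topology ?S ?S) ?S (%(x, y). x \<otimes> y)"
 proof -
  have "continuous_map (prod_topology ?S ?S) T (%z. fst z \<otimes> snd z)"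
   by (intro continuous_intros) (auto intro: continuous_map_into_fulltopology continuous_map_fst continuous_map_snd)
  then show ?thesis unfolding continuous_map_in_subtopology by (auto simp: case_prod_unfold ts)
 qed
 have i: "continuous_map ?S ?S (%x. inv x)"
  unfolding continuous_map_in_subtopology using ts by (auto intro!: continuous_intros continuous_map_from_subtopology)
 have i': "continuous_map ?S ?S (%x. inv\<^bsub>sub G H\<^esub> x)"
  using i by (rule continuous_map_eq) (use inv ts in auto)
 have "topological_group (sub G H)"
  unfolding topological_group_def using S.group_axioms ts m i' by simp
 moreover have "Hausdorff_space ?S" using haus Hausdorff_space_subtopology by blast
 moreover have "locally_compact_space ?S" using loccomp assms(2) locally_compact_space_closed_subset by blast
 moreover have "contr G : iso (sub G H) (sub G H)"
 proof -
  have "inj_on (contr G) H" using contr_bij H.subset by (meson bij_betw_def inj_on_subset)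
  moreover have "contr G : H \<rightarrow> H" using assms(3) by auto
  ultimately show ?thesis using assms(3) contr_mult H.mem_carrier by (simp add: iso_def hom_def bij_betw_def)
 qed
 moreover have "homeomorphic_map ?S ?S (contr G)"
 proof (rule homeomorphic_map_subtopologies_alt[OF contr_homeo])
  show "contr G x : H \<longleftrightarrow> x : H" if "x : topspace T" for x
   using that assms(3) contr_inj[of x] H.mem_carrier by (metis imageE imageI topspace_T)
 qed
 moreover have "limitin ?S (%n. (contr G ^^ n) x) \<one> sequentially" if "x : H" for x
 proof -
  have "(contr G ^^ n) x : H" for n by (induction n) (use that assms(3) in auto)
  then show ?thesis unfolding limitin_subtopology using contr_lim that by auto
 qed
 ultimately show ?thesis unfolding contraction_iff lc_contraction_group_def
  by (intro conjI) simp_all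
qed

lemma act_sub:
 assumes "subgroup H G" "contr G ` H = H" "x : H" shows "actr (sub G H) k x = act k x"
proof -
 have Hc: "H <= CG" using assms subgroup.subset by blast
 have c: "inv_into H (contr G) y = cinv y & cinv y : H" if y: "y : H" for y
 proof -
  obtain z where z: "z : H" "y = contr G z" using assms(2) y by (metis imageE)
  then have "cinv y = z" using Hc by auto
  moreover have "inj_on (contr G) H" using contr_bij Hc by (meson bij_betw_def inj_on_subset)
  then have "inv_into H (contr G) y = z" using z inv_into_f_f by metis
  ultimately show ?thesis using z by simp
 qed
 have "(inv_into H (contr G) ^^ n) x = (cinv ^^ n) x & (cinv ^^ n) x : H" for n
 proof (induction n)
  case (Suc n) then show ?case using c[of "(cinv ^^ n) x"] by simp
 qed (use assms in simp)
 then show ?thesis by (simp add: actr_def)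
qed

lemma act_stable:
 assumes "contr G ` H = H" "H <= CG" shows "act k ` H = H"
proof (induction k rule: int_induct[where k = 0])
 case (step1 i)
 have "act (1 + i) ` H = act 1 ` act i ` H" using act_image_add assms by blast
 then show ?case using step1 assms by (simp add: act_1 add.commute cong: image_cong_simp)
next
 case (step2 i)
 have "act ((i - 1) + 1) ` H = act (i - 1) ` act 1 ` H" using act_image_add assms by blast
 then show ?case using step2 assms by (simp add: act_1 cong: image_cong_simp)
qed simp

end

text \<open>An open mapping theorem in which the contraction supplies countability: the sets
  \<alpha>^(-n)(W), for a compact neighbourhood \<open>W\<close>, exhaust \<open>P\<close>, so their
  compact images cover \<open>Q\<close> and one of them has interior by Baire's theorem. It gives
  the continuity of inverses and of sections below.\<close>

lemma contraction_morphism_open: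
 fixes P :: "'a dynamical_group" and Q :: "'b dynamical_group"
 assumes P: "lc_contraction_group P" and Q: "lc_contraction_group Q" and phi: "contraction_morphism P Q \<phi>"
  and surj: "\<phi> ` carrier P = carrier Q"
 shows "open_map (topol P) (topol Q) \<phi>"
proof -
 interpret P: contraction P using P contraction_iff by blast
 interpret Q: contraction Q using Q contraction_iff by blast
 have hom: "\<phi> : hom P Q" and cont: "continuous_map (topol P) (topol Q) \<phi>"
  and eq: "!!x. x : carrier P ==> contr Q (\<phi> x) = \<phi> (contr P x)"
  using phi by (auto simp: contraction_morphism_def)
 interpret h: group_hom P Q \<phi> using hom by unfold_locales
 have eqn: "\<phi> (actr P (- int n) x) = actr Q (- int n) (\<phi> x)" if "x : carrier P" for x n
 proof -
  have "actr Q (int n) (\<phi> y) = \<phi> (actr P (int n) y)" if "y : carrier P" for y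
   using that
  proof (induction n)
   case (Suc n)
   then show ?case using Q.act_Suc[of "\<phi> y" "int n"] P.act_Suc[of y "int n"] eq[of "actr P (int n) y"] by (simp add: add.commute)
  qed simp
  from this[of "actr P (- int n) x"] have "actr Q (int n) (\<phi> (actr P (- int n) x)) = \<phi> x" using that by simp
  then show ?thesis using Q.act_minus(1)[of "\<phi> (actr P (- int n) x)" "int n"] that by simp
 qed
 have nb: "EX V. openin (topol Q) V & \<one>\<^bsub>Q\<^esub> : V & V <= \<phi> ` U" if U: "openin (topol P) U" "\<one>\<^bsub>P\<^esub> : U" for U
 proof -
  obtain U1 where U1: "openin (topol P) U1" "\<one>\<^bsub>P\<^esub> : U1" "!!x. x : U1 ==> inv\<^bsub>P\<^esub> x : U1"
   "!!x y. x : U1 ==> y : U1 ==> x \<otimes>\<^bsub>P\<^esub> y : U" using P.nbhd_mult[OF U] by metis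
  obtain V W where W: "openin (topol P) V" "compactin (topol P) W" "\<one>\<^bsub>P\<^esub> : V" "V <= W" "W <= U1" 
   "!!x. x : W ==> inv\<^bsub>P\<^esub> x : W" using P.base_nbhd[OF U1(1,2)] by metis
  have Wc: "W <= carrier P" using W P.compactin_subset_carrier by blast
  define F where "F n = actr Q (- int n) ` \<phi> ` W" for n
  have "closedin (topol Q) (F n)" for n
   unfolding F_def using image_compactin[OF W(2) cont] Q.compact_act Q.compact_closed by blast
  moreover have "carrier Q <= (\<Union>n. F n)"
  proof
   fix y assume "y : carrier Q"
   then obtain x where x: "x : carrier P" "y = \<phi> x" using surj by blast
   obtain n where "{x} <= actr P (- int n) ` V" using P.absorbing[of "{x}" V] W x by (metis P.topspace_T compactin_sing)
   then obtain v where v: "v : W" "x = actr P (- int n) v" using W by blast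
   then have "y : F n" using x eqn[of v n] Wc by (auto simp: F_def)
   then show "y : (\<Union>n. F n)" by blast
  qed
  ultimately obtain n y O1 where O1: "openin (topol Q) O1" "y : O1" "O1 <= F n" by (rule Q.Baire_cover)
  let ?O = "actr Q (int n) ` O1"
  have o: "openin (topol Q) ?O" "actr Q (int n) y : ?O" using O1 Q.open_act by auto
  have sub: "?O <= \<phi> ` W"
  proof
   fix z assume "z : ?O"
   then obtain w where "w : W" "z = actr Q (int n) (actr Q (- int n) (\<phi> w))" using O1 by (auto simp: F_def)
   then show "z : \<phi> ` W" using Wc by (metis Q.act_minus(2) h.hom_closed imageI subsetD)
  qed
  define z where "z = actr Q (int n) y"
  have z: "z : ?O" "z : carrier Q" using o Q.openin_carrier by (auto simp: z_def)
  \<comment> \<open>Moving the point \<open>z\<close> of the open set to the identity replaces the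
    image of \<open>W\<close> by the image of \<open>W^-1 W\<close>, which lies in the image of
    \<open>U\<close>.\<close>
  let ?V = "{v : carrier Q. z \<otimes>\<^bsub>Q\<^esub> v : ?O}"
  have "?V <= \<phi> ` U"
  proof
   fix v assume v: "v : ?V"
   then obtain w w' where w: "w : W" "z \<otimes>\<^bsub>Q\<^esub> v = \<phi> w" "w' : W" "z = \<phi> w'" using sub z by blast
   have "v = inv\<^bsub>Q\<^esub> z \<otimes>\<^bsub>Q\<^esub> (z \<otimes>\<^bsub>Q\<^esub> v)" using v z by (simp add: Q.m_assoc[symmetric])
   also have "... = \<phi> (inv\<^bsub>P\<^esub> w' \<otimes>\<^bsub>P\<^esub> w)" unfolding w(2) unfolding w(4) using w Wc by (simp add: subset_iff)
   moreover have "inv\<^bsub>P\<^esub> w' \<otimes>\<^bsub>P\<^esub> w : U" using U1(4) W(5) W(6)[OF w(3)] w(1) by (simp add: subset_iff)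
   ultimately show "v : \<phi> ` U" using \<open>v = _\<close> by (metis imageI)
  qed
  then show ?thesis using Q.open_ltrans[OF o(1) z(2)] z Q.one_closed by (intro exI[of _ ?V]) auto
 qed
 show ?thesis
  unfolding open_map_def
 proof (intro allI impI)
  fix U assume U: "openin (topol P) U"
  show "openin (topol Q) (\<phi> ` U)"
  proof (subst openin_subopen, intro ballI)
   fix y assume "y : \<phi> ` U"
   then obtain x where x: "x : U" "y = \<phi> x" by blast
   then have xc: "x : carrier P" using U P.openin_carrier by blast
   obtain V where V: "openin (topol Q) V" "\<one>\<^bsub>Q\<^esub> : V" "V <= \<phi> ` {v : carrier P. x \<otimes>\<^bsub>P\<^esub> v : U}"
    using nb[OF P.open_ltrans[OF U xc]] x xc by auto
   let ?V = "{z : carrier Q. inv\<^bsub>Q\<^esub> y \<otimes>\<^bsub>Q\<^esub> z : V}"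
   have "?V <= \<phi> ` U"
   proof
    fix z assume z: "z : ?V"
    then obtain v where v: "v : carrier P" "x \<otimes>\<^bsub>P\<^esub> v : U" "inv\<^bsub>Q\<^esub> y \<otimes>\<^bsub>Q\<^esub> z = \<phi> v" using V by blast
    have "z = y \<otimes>\<^bsub>Q\<^esub> (inv\<^bsub>Q\<^esub> y \<otimes>\<^bsub>Q\<^esub> z)" using z x xc by (simp add: Q.m_assoc[symmetric])
    also have "... = \<phi> (x \<otimes>\<^bsub>P\<^esub> v)" unfolding v(3) using v xc x(2) by simp
    finally show "z : \<phi> ` U" using v by blast
   qed
   then show "EX T. openin (topol Q) T & y : T & T <= \<phi> ` U"
    using Q.open_ltrans[OF V(1), of "inv\<^bsub>Q\<^esub> y"] V(2) x xc by (intro exI[of _ ?V]) auto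
  qed
 qed
qed

subsection \<open>Haar functionals\<close>

lemma cluster_point:
 fixes u :: "nat => 'i => real"
 assumes "!!n i. a i <= u n i" "!!n i. u n i <= b i"
 obtains L where "!!i. a i <= L i" "!!i. L i <= b i"
  "!!J e N. finite J ==> 0 < e ==> EX n>=N. ALL i:J. \<bar>u n i - L i\<bar> < e"
proof -
 let ?X = "product_topology (%i. euclideanreal) (UNIV :: 'i set)"
 let ?B = "\<Pi>\<^sub>E i\<in>UNIV. {a i..b i}"
 let ?Y = "subtopology ?X ?B"
 have cB: "compactin ?X ?B" by (subst compactin_PiE) auto
 then have cs: "compact_space ?Y" by (rule compact_space_subtopology)
 have ts: "topspace ?Y = ?B" by auto
 let ?C = "%N. ?Y closure_of (u ` {N..})"
 have uB: "u n : ?B" for n using assms by auto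
 have "(\<Inter>N. ?C N) ~= {}"
 proof (rule compact_space_imp_nest[OF cs])
  show "?C n ~= {}" for n
  proof -
   have "topspace ?Y \<inter> u ` {n..} <= ?C n" by (rule closure_of_subset_Int)
   moreover have "u n : topspace ?Y \<inter> u ` {n..}" using uB ts by simp
   ultimately show ?thesis by blast
  qed
  show "decseq ?C" unfolding decseq_def by (intro allI impI closure_of_mono) auto
 qed (rule closedin_closure_of)
 then obtain L where L: "!!N. L : ?C N" by auto
 then have LB: "L : ?B" using in_closure_of[of L ?Y] ts by blast
 have "EX n>=N. ALL i:J. \<bar>u n i - L i\<bar> < e" if "finite J" "0 < e" for J e N
 proof -
  let ?U = "\<Pi>\<^sub>E i\<in>UNIV. (if i : J then {L i - e<..<L i + e} else UNIV)"
  have "openin ?X ?U"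
  proof (subst openin_PiE_gen, intro disjI2 conjI ballI)
   show "finite {i : UNIV. (if i : J then {L i - e<..<L i + e} else UNIV) ~= topspace euclideanreal}"
    by (rule finite_subset[OF _ that(1)]) auto
  qed auto
  then have "openin ?Y (?U \<inter> ?B)" by (rule openin_subtopology_Int)
  moreover have "L : ?U \<inter> ?B" using that LB by auto
  ultimately have "EX y. y : u ` {N..} & y : ?U \<inter> ?B"
   using L[of N, unfolded in_closure_of, THEN conjunct2, rule_format, of "?U \<inter> ?B"] by simp
  then obtain y where "y : u ` {N..}" "y : ?U \<inter> ?B" by blast
  then obtain n where n: "N <= n" "u n : ?U" by auto
  have "\<bar>u n i - L i\<bar> < e" if "i : J" for i using PiE_mem[OF n(2), of i] that by (auto simp: abs_less_iff)
  then show ?thesis using n by blast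
 qed
 moreover have "!!i. a i <= L i" "!!i. L i <= b i" using LB by auto
 ultimately show thesis using that by blast
qed

section \<open>Functions of compact support and covering numbers\<close>

context lcgroup begin

definition Cc :: "('a => real) set" where
 "Cc = {f. rcont f & (EX K. compactin T K & (ALL x:CG - K. f x = 0))}"

definition Cp :: "('a => real) set" where
 "Cp = {f : Cc. ALL x:CG. 0 <= f x}"

lemma CcI: "rcont f ==> compactin T K ==> (!!x. x : CG ==> x ~: K ==> f x = 0) ==> f : Cc"
 by (auto simp: Cc_def)

lemma Cc_cont: "f : Cc ==> rcont f"
 by (simp add: Cc_def)

lemma Cc_combine:
 assumes "f : Cc" "g : Cc" "rcont h"
  "!!x. x : CG ==> f x = 0 ==> g x = 0 ==> h x = 0"
 shows "h : Cc"
proof -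
 obtain K where K: "compactin T K" "ALL x:CG - K. f x = 0" using assms by (auto simp: Cc_def)
 obtain L where L: "compactin T L" "ALL x:CG - L. g x = 0" using assms by (auto simp: Cc_def)
 show ?thesis
 proof (rule CcI[OF assms(3)])
  show "compactin T (K \<union> L)" using K L by (simp add: compactin_Un)
 qed (use K L assms(4) in auto)
qed

lemma Cc_add: "f : Cc ==> g : Cc ==> (%x. f x + g x) : Cc"
 by (rule Cc_combine[of f g]) (auto intro: continuous_intros Cc_cont)

lemma Cc_diff: "f : Cc ==> g : Cc ==> (%x. f x - g x) : Cc"
 by (rule Cc_combine[of f g]) (auto intro: continuous_intros Cc_cont)

lemma Cc_mult: "f : Cc ==> rcont g ==> (%x. f x * g x) : Cc"
 by (rule Cc_combine[of f f]) (auto intro: continuous_intros Cc_cont)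

lemma Cc_abs: "f : Cc ==> (%x. \<bar>f x\<bar>) : Cc"
 by (rule Cc_combine[of f f]) (auto intro: continuous_intros Cc_cont)

lemma Cc_cmult: "f : Cc ==> (%x. c * f x) : Cc"
 by (rule Cc_combine[of f f]) (auto intro: continuous_intros Cc_cont)

lemma Cc_pos:
 assumes "f : Cc" shows "(%x. max (f x) 0) : Cp" "(%x. max (- f x) 0) : Cp"
proof -
 have "rcont (%x. max (f x) 0)" "rcont (%x. max (- f x) 0)"
  using Cc_cont[OF assms] by (intro continuous_intros; simp)+
 from this[THEN Cc_combine[OF assms assms]] show "(%x. max (f x) 0) : Cp" "(%x. max (- f x) 0) : Cp"
  by (simp_all add: Cp_def)
qed

lemma Cc_zero: "(%x. 0) : Cc"
 by (rule CcI[of _ "{}"]) auto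

lemma Cc_transl:
 assumes "f : Cc" "s : CG" shows "(%x. f (x \<otimes> s)) : Cc"
proof -
 obtain K where K: "compactin T K" "ALL x:CG - K. f x = 0" using assms by (auto simp: Cc_def)
 show ?thesis
 proof (rule CcI)
  have "continuous_map T T (%x. x \<otimes> s)" using assms by (intro continuous_intros)
  from continuous_map_compose[OF this Cc_cont[OF assms(1)]]
  show "rcont (%x. f (x \<otimes> s))" by (simp add: o_def)
  show "compactin T (K <#> {inv s})" using K assms by (intro compact_mult) auto
  fix x assume x: "x : CG" "x ~: K <#> {inv s}"
  have "x = (x \<otimes> s) \<otimes> inv s" using x assms by (simp add: m_assoc)
  then have "x \<otimes> s ~: K" using x set_multI[of "x \<otimes> s" K "inv s" "{inv s}" G] by auto
  then show "f (x \<otimes> s) = 0" using K x assms by simp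
 qed
qed

lemma Cc_bounded: assumes "f : Cc" obtains M where "0 < M" "!!x. x : CG ==> \<bar>f x\<bar> <= M"
proof -
 obtain K where K: "compactin T K" "ALL x:CG - K. f x = 0" using assms by (auto simp: Cc_def)
 have "compact (f ` K)" using image_compactin[OF K(1) Cc_cont[OF assms]] by simp
 then obtain M where "ALL y:f ` K. norm y <= M" using compact_imp_bounded bounded_iff by metis
 then have "\<bar>f x\<bar> <= max M 1" if "x : CG" for x using K that by (cases "x : K") force+
 then show thesis using that[of "max M 1"] by simp
qed

text \<open>The tube lemma gives the estimates for \<open>x\<close> in \<open>K\<close>. If only the
  translate of \<open>x\<close> lies in \<open>K\<close>, they are applied there with
  \<open>inv v\<close>, which is why \<open>V\<close> is symmetric.\<close>

lemma uniform_cont: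
 assumes "f : Cc" "0 < e"
 obtains V where "openin T V" "\<one> : V" "!!x. x : V ==> inv x : V"
  "!!x v. x : CG ==> v : V ==> \<bar>f (x \<otimes> v) - f x\<bar> < e"
  "!!x v. x : CG ==> v : V ==> \<bar>f (v \<otimes> x) - f x\<bar> < e"
proof -
 obtain K where K: "compactin T K" "ALL x:CG - K. f x = 0" using assms by (auto simp: Cc_def)
 let ?P = "prod_topology T T"
 have cf: "continuous_map ?P euclideanreal (%z. f (g z))" if "continuous_map ?P T g" for g
  using continuous_map_compose[OF that Cc_cont[OF assms(1)]] by (simp add: o_def)
 let ?A = "{z : topspace ?P. \<bar>f (fst z \<otimes> snd z) - f (fst z)\<bar> : {..<e}}"
 let ?B = "{z : topspace ?P. \<bar>f (snd z \<otimes> fst z) - f (fst z)\<bar> : {..<e}}"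
 have "openin ?P ?A"
  by (rule openin_continuous_map_preimage[of _ euclideanreal]) (auto intro!: continuous_intros cf)
 moreover have "openin ?P ?B"
  by (rule openin_continuous_map_preimage[of _ euclideanreal]) (auto intro!: continuous_intros cf)
 ultimately have oAB: "openin ?P (?A \<inter> ?B)" by blast
 have sAB: "K \<times> {\<one>} <= ?A \<inter> ?B" using compactin_carrier[OF K(1)] assms by auto
 have c1: "compactin T {\<one>}" by simp
 obtain U V where UV: "openin T U" "openin T V" "K <= U" "{\<one>} <= V" "U \<times> V <= ?A \<inter> ?B"
  by (rule Wallace_theorem_prod_topology[OF K(1) c1 oAB sAB])
 obtain W where W: "openin T W" "\<one> : W" "W <= V" "!!x. x : W ==> inv x : W" using nbhd_sym[OF UV(2)] UV(4) by auto
 have A: "\<bar>f (x \<otimes> v) - f x\<bar> < e" if "x : K" "v : W" for x v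
 proof -
  have "(x, v) : ?A" using UV W that by blast
  then show ?thesis by simp
 qed
 have B: "\<bar>f (v \<otimes> x) - f x\<bar> < e" if "x : K" "v : W" for x v
 proof -
  have "(x, v) : ?B" using UV W that by blast
  then show ?thesis by simp
 qed
 show thesis
 proof (rule that[OF W(1,2,4)])
  fix x v assume x: "x : CG" "v : W"
  have v: "v : CG" using W x openin_carrier by blast
  show "\<bar>f (x \<otimes> v) - f x\<bar> < e"
  proof (cases "x : K \<or> x \<otimes> v : K")
   case True
   then show ?thesis using A[of x v] A[of "x \<otimes> v" "inv v"] W x v by (auto simp: m_assoc abs_minus_commute)
  qed (use K x v assms in auto)
  show "\<bar>f (v \<otimes> x) - f x\<bar> < e"
  proof (cases "x : K \<or> v \<otimes> x : K")
   case True
   then show ?thesis using B[of x v] B[of "v \<otimes> x" "inv v"] W x v by (auto simp: m_assoc[symmetric] abs_minus_commute)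
  qed (use K x v assms in auto)
 qed
qed

lemma completely_regular: "completely_regular_space T"
 using loccomp haus locally_compact_regular_imp_completely_regular_space by blast

lemma compact_nbhd_of:
 assumes "compactin T K" "openin T U" "K <= U"
 obtains V L where "openin T V" "compactin T L" "K <= V" "V <= L" "L <= U"
proof -
 obtain V0 where V0: "openin T V0" "\<one> : V0" "!!x y. x : K ==> y : V0 ==> x \<otimes> y : U" using tube_right[OF assms] by metis
 obtain V L where V: "openin T V" "compactin T L" "\<one> : V" "V <= L" "L <= V0" using compact_nbhd[OF V0(1,2)] by metis
 have Kc: "K <= CG" using assms compactin_subset_carrier by blast
 show thesis
 proof (rule that)
  show "openin T (K <#> V)" using V Kc open_mult_left by blast
  show "compactin T (K <#> L)" using V assms compact_mult by blast
  show "K <= K <#> V"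
  proof
   fix x assume "x : K"
   then have "x \<otimes> \<one> : K <#> V" "x : CG" using V Kc by (auto intro: set_multI)
   then show "x : K <#> V" by simp
  qed
  show "K <#> V <= K <#> L" using V by (intro set_mult_mono) auto
  show "K <#> L <= U" using V0(3) V(5) unfolding set_mult_def by blast
 qed
qed

lemma bump:
 assumes "compactin T K" "openin T U" "K <= U"
 obtains f where "f : Cp" "!!x. x : K ==> f x = 1" "!!x. x : CG ==> f x <= 1"
  "!!x. x : CG ==> x ~: U ==> f x = 0"
proof -
 obtain V L where VL: "openin T V" "compactin T L" "K <= V" "V <= L" "L <= U" using compact_nbhd_of[OF assms] by metis
 have cl: "closedin T (CG - V)" using VL(1) openin_closedin_eq[of T V] by simp
 have "disjnt K (CG - V)" using VL by (auto simp: disjnt_def)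
 then obtain f where f: "continuous_map T (top_of_set {0..1::real}) f" "f ` (CG - V) <= {0}" "f ` K <= {1}"
  using Urysohn_completely_regular_compact_closed[OF _ completely_regular assms(1) cl, of 0 1] by auto
 have c: "rcont f" using f continuous_map_into_fulltopology by blast
 have "!!x. x : CG ==> f x : {0..1}" using f(1) unfolding continuous_map_in_subtopology by auto
 moreover have "f : Cc" by (rule CcI[OF c VL(2)]) (use f VL in blast)
 moreover have "f x = 0" if "x : CG" "x ~: U" for x using f(2) VL that by blast
 ultimately show thesis using f VL by (intro that[of f]) (auto simp: Cp_def)
qed

text \<open>The covering number \<open>(f : \<phi>)\<close> of Weil's construction of Haar measure, with right translates.\<close>

definition covset :: "('a => real) => ('a => real) => real set" where
 "covset f \<phi> = {sum_list (map fst l) | l. (ALL (c, s):set l. 0 <= c & s : CG) &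
   (ALL x:CG. f x <= (\<Sum>(c, s)\<leftarrow>l. c * \<phi> (x \<otimes> s)))}"

definition cov :: "('a => real) => ('a => real) => real" where
 "cov f \<phi> = Inf (covset f \<phi>)"

lemma covsetE:
 assumes "r : covset f \<phi>"
 obtains l where "r = sum_list (map fst l)" "ALL (c, s):set l. 0 <= c & s : CG"
  "ALL x:CG. f x <= (\<Sum>(c, s)\<leftarrow>l. c * \<phi> (x \<otimes> s))"
 using assms unfolding covset_def by blast

lemma covsetI:
 assumes "r = sum_list (map fst l)" "ALL (c, s):set l. 0 <= c & s : CG"
  "ALL x:CG. f x <= (\<Sum>(c, s)\<leftarrow>l. c * \<phi> (x \<otimes> s))"
 shows "r : covset f \<phi>"
 using assms unfolding covset_def by blast

lemma covset_nonneg: "r : covset f \<phi> ==> 0 <= r"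
 by (erule covsetE) (force intro!: sum_list_nonneg)

lemma covset_bdd: "bdd_below (covset f \<phi>)"
 using covset_nonneg by (intro bdd_belowI)

text \<open>Finitely many translates of the open set where \<open>\<phi>\<close> exceeds half of
  \<open>\<phi> u\<close> cover \<open>K\<close>, so finitely many translates of
  \<open>\<phi>\<close>, each with weight \<open>M / e\<close>, dominate \<open>f\<close>.\<close>

lemma covset_nonempty:
 assumes "f : Cc" "\<phi> : Cp" "u : CG" "0 < \<phi> u"
 shows "covset f \<phi> ~= {}"
proof -
 obtain K where K: "compactin T K" "ALL x:CG - K. f x = 0" using assms by (auto simp: Cc_def)
 obtain M where M: "0 < M" "!!x. x : CG ==> \<bar>f x\<bar> <= M" using Cc_bounded[OF assms(1)] by metis
 define e where "e = \<phi> u / 2"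
 have e: "0 < e" "e < \<phi> u" using assms by (auto simp: e_def)
 have cphi: "\<phi> : Cc" "!!x. x : CG ==> 0 <= \<phi> x" using assms by (auto simp: Cp_def)
 define V where "V = {v : CG. v \<otimes> u : {x : topspace T. \<phi> x : {e<..}}}"
 have "openin T {x : topspace T. \<phi> x : {e<..}}"
  by (rule openin_continuous_map_preimage[OF Cc_cont[OF cphi(1)]]) auto
 then have oV: "openin T V" unfolding V_def using open_rtrans assms by blast
 have V1: "\<one> : V" unfolding V_def using e assms by auto
 obtain W where W: "openin T W" "\<one> : W" "W <= V" "!!x. x : W ==> inv x : W" using nbhd_sym[OF oV V1] by metis
 have "compactin T ((%x. inv x) ` K)" using K compact_inverses by blast
 then obtain F where F: "finite F" "F <= (%x. inv x) ` K" "!!x. x : (%x. inv x) ` K ==> EX f:F. EX v:W. x = f \<otimes> v"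
  using finite_translates[OF _ W(1,2)] by metis
 have Fc: "F <= CG" using F compactin_carrier[OF K(1)] by auto
 obtain xs where xs: "set xs = F" using F finite_list by blast
 let ?l = "map (%s. (M / e, s \<otimes> u)) xs"
 have le: "f x <= (\<Sum>(c, s)\<leftarrow>?l. c * \<phi> (x \<otimes> s))" if x: "x : CG" for x
 proof -
  have nn: "0 <= y" if "y : set (map (%(c, s). c * \<phi> (x \<otimes> s)) ?l)" for y
   using that x xs Fc e M cphi assms by (auto intro!: mult_nonneg_nonneg)
  show ?thesis
  proof (cases "x : K")
   case False
   have "0 <= (\<Sum>(c, s)\<leftarrow>?l. c * \<phi> (x \<otimes> s))" by (rule sum_list_nonneg) (rule nn)
   then show ?thesis using False K x by simp
  next
   case True
   then obtain s v where s: "s : F" "v : W" "inv x = s \<otimes> v" using F(3) by blast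
   have sv: "s : CG" "v : CG" using s Fc W openin_carrier by auto
   have "x = inv (s \<otimes> v)" using s(3) x by (metis inv_inv)
   then have "x \<otimes> s = inv v" using sv by (simp add: inv_mult_group m_assoc)
   then have "x \<otimes> (s \<otimes> u) = inv v \<otimes> u" using sv x assms by (simp add: m_assoc[symmetric])
   moreover have "inv v : V" using W s by blast
   ultimately have "e < \<phi> (x \<otimes> (s \<otimes> u))" by (simp add: V_def)
   then have "M <= M / e * \<phi> (x \<otimes> (s \<otimes> u))" using e M by (simp add: field_simps)
   moreover have "M / e * \<phi> (x \<otimes> (s \<otimes> u)) : set (map (%(c, s). c * \<phi> (x \<otimes> s)) ?l)" using s xs by auto
   then have "M / e * \<phi> (x \<otimes> (s \<otimes> u)) <= (\<Sum>(c, s)\<leftarrow>?l. c * \<phi> (x \<otimes> s))"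
    using nn by (rule member_le_sum_list)
   ultimately show ?thesis using M(2)[OF x] by linarith
  qed
 qed
 have "sum_list (map fst ?l) : covset f \<phi>"
  unfolding covset_def using le e M Fc xs assms by (intro CollectI exI[of _ ?l]) auto
 then show ?thesis by blast
qed

lemma cov_le: "r : covset f \<phi> ==> cov f \<phi> <= r"
 unfolding cov_def by (intro cInf_lower covset_bdd)

lemma cov_nonneg: "covset f \<phi> ~= {} ==> 0 <= cov f \<phi>"
 unfolding cov_def by (intro cInf_greatest covset_nonneg)

lemma cov_ge: "covset f \<phi> ~= {} ==> (!!r. r : covset f \<phi> ==> b <= r) ==> b <= cov f \<phi>"
 unfolding cov_def by (intro cInf_greatest)

lemma cov_lower:
 assumes "covset f \<phi> ~= {}" "x : CG" "0 < M" "!!y. y : CG ==> \<phi> y <= M"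
 shows "f x / M <= cov f \<phi>"
proof (rule cov_ge[OF assms(1)])
 fix r assume "r : covset f \<phi>"
 then obtain l where l: "r = sum_list (map fst l)" "ALL (c, s):set l. 0 <= c & s : CG"
  "f x <= (\<Sum>(c, s)\<leftarrow>l. c * \<phi> (x \<otimes> s))" using assms(2) by (elim covsetE) blast
 have "(\<Sum>(c, s)\<leftarrow>l. c * \<phi> (x \<otimes> s)) <= (\<Sum>(c, s)\<leftarrow>l. c * M)"
  using l(2) assms by (intro sum_list_mono) (auto intro!: mult_left_mono)
 also have "... = r * M" unfolding l(1) by (simp add: sum_list_mult_const[symmetric] case_prod_unfold)
 finally show "f x / M <= r" using l assms by (simp add: field_simps)
qed

lemma cov_mono:
 assumes "covset g \<phi> ~= {}" "!!x. x : CG ==> f x <= g x" shows "cov f \<phi> <= cov g \<phi>"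
proof (rule cov_ge[OF assms(1)])
 fix r assume "r : covset g \<phi>"
 then obtain l where l: "r = sum_list (map fst l)" "ALL (c, s):set l. 0 <= c & s : CG"
  "ALL x:CG. g x <= (\<Sum>(c, s)\<leftarrow>l. c * \<phi> (x \<otimes> s))" by (rule covsetE)
 have "r : covset f \<phi>" using assms(2) l(3) by (intro covsetI[OF l(1,2)]) force
 then show "cov f \<phi> <= r" by (rule cov_le)
qed

lemma cov_subadd:
 assumes "covset f \<phi> ~= {}" "covset g \<phi> ~= {}" shows "cov (%x. f x + g x) \<phi> <= cov f \<phi> + cov g \<phi>"
proof -
 have "cov (%x. f x + g x) \<phi> <= r + t" if rt: "r : covset f \<phi>" "t : covset g \<phi>" for r t
 proof (rule cov_le)
  obtain l m where l: "r = sum_list (map fst l)" "ALL (c, s):set l. 0 <= c & s : CG"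
   "ALL x:CG. f x <= (\<Sum>(c, s)\<leftarrow>l. c * \<phi> (x \<otimes> s))"
   "t = sum_list (map fst m)" "ALL (c, s):set m. 0 <= c & s : CG"
   "ALL x:CG. g x <= (\<Sum>(c, s)\<leftarrow>m. c * \<phi> (x \<otimes> s))" using rt by (elim covsetE) blast
  then show "r + t : covset (%x. f x + g x) \<phi>"
   by (intro covsetI[of _ "l @ m"]) (auto intro!: add_mono)
 qed
 then have "cov (%x. f x + g x) \<phi> - t <= cov f \<phi>" if "t : covset g \<phi>" for t
  using that by (intro cov_ge[OF assms(1)]) (simp add: algebra_simps)
 then have "cov (%x. f x + g x) \<phi> - cov f \<phi> <= cov g \<phi>"
  by (intro cov_ge[OF assms(2)]) (simp add: algebra_simps)
 then show ?thesis by simp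
qed

lemma cov_scale_le:
 assumes "covset f \<phi> ~= {}" "0 < c" shows "cov (%x. c * f x) \<phi> <= c * cov f \<phi>"
proof -
 have "cov (%x. c * f x) \<phi> / c <= cov f \<phi>"
 proof (rule cov_ge[OF assms(1)])
  fix r assume "r : covset f \<phi>"
  then obtain l where l: "r = sum_list (map fst l)" "ALL (c, s):set l. 0 <= c & s : CG"
   "ALL x:CG. f x <= (\<Sum>(c, s)\<leftarrow>l. c * \<phi> (x \<otimes> s))" by (elim covsetE) blast
  let ?l = "map (%(d, s). (c * d, s)) l"
  have "c * r : covset (%x. c * f x) \<phi>"
  proof -
   have "c * r = sum_list (map fst ?l)" using l(1) by (simp add: sum_list_const_mult o_def case_prod_unfold)
   moreover have "(\<Sum>(d, s)\<leftarrow>?l. d * \<phi> (x \<otimes> s)) = c * (\<Sum>(d, s)\<leftarrow>l. d * \<phi> (x \<otimes> s))" for x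
    by (simp add: sum_list_const_mult[symmetric] o_def case_prod_unfold mult.assoc)
   ultimately show ?thesis unfolding covset_def using l assms
    by (intro CollectI exI[of _ ?l]) (auto intro!: mult_left_mono)
  qed
  from cov_le[OF this] show "cov (%x. c * f x) \<phi> / c <= r" using assms by (simp add: field_simps)
 qed
 then show ?thesis using assms by (simp add: field_simps)
qed

lemma cov_transl_le:
 assumes "covset f \<phi> ~= {}" "s : CG" shows "cov (%x. f (x \<otimes> s)) \<phi> <= cov f \<phi>"
proof (rule cov_ge[OF assms(1)])
 fix r assume "r : covset f \<phi>"
 then obtain l where l: "r = sum_list (map fst l)" "ALL (c, s):set l. 0 <= c & s : CG"
  "ALL x:CG. f x <= (\<Sum>(c, s)\<leftarrow>l. c * \<phi> (x \<otimes> s))" by (elim covsetE) blast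
 let ?l = "map (%(d, t). (d, s \<otimes> t)) l"
 have "f (x \<otimes> s) <= (\<Sum>(d, t)\<leftarrow>?l. d * \<phi> (x \<otimes> t))" if "x : CG" for x
 proof -
  have "(\<Sum>(d, t)\<leftarrow>?l. d * \<phi> (x \<otimes> t)) = (\<Sum>(d, t)\<leftarrow>l. d * \<phi> (x \<otimes> s \<otimes> t))"
   using l(2) that assms by (intro arg_cong[of _ _ sum_list]) (auto simp: m_assoc)
  then show ?thesis using l(3) that assms by simp
 qed
 then have "r : covset (%x. f (x \<otimes> s)) \<phi>"
  unfolding covset_def using l(1,2) assms
  by (intro CollectI exI[of _ ?l]) (auto simp: o_def case_prod_unfold)
 then show "cov (%x. f (x \<otimes> s)) \<phi> <= r" by (rule cov_le)
qed

text \<open>Substituting a cover of \<open>g\<close> by translates of \<open>\<phi>\<close> into a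
  cover of \<open>f\<close> by translates of \<open>g\<close> multiplies the total weights.\<close>

lemma cov_trans:
 assumes "covset f g ~= {}" "covset g \<phi> ~= {}" "!!x. x : CG ==> 0 <= g x"
 shows "cov f \<phi> <= cov f g * cov g \<phi>"
proof -
 have *: "cov f \<phi> <= r * t" if rt: "r : covset f g" "t : covset g \<phi>" for r t
 proof (rule cov_le)
  obtain l m where l: "r = sum_list (map fst l)" "ALL (c, s):set l. 0 <= c & s : CG"
   "ALL x:CG. f x <= (\<Sum>(c, s)\<leftarrow>l. c * g (x \<otimes> s))"
   "t = sum_list (map fst m)" "ALL (c, s):set m. 0 <= c & s : CG"
   "ALL x:CG. g x <= (\<Sum>(c, s)\<leftarrow>m. c * \<phi> (x \<otimes> s))" using rt by (elim covsetE) blast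
  let ?k = "concat (map (%(c, s). map (%(d, t). (c * d, s \<otimes> t)) m) l)"
  have a: "sum_list (map fst ?k) = r * t"
  proof -
   have "sum_list (map fst ?k) = (\<Sum>p\<leftarrow>l. fst p * t)"
    unfolding l(4) by (induction l) (auto simp: case_prod_unfold o_def sum_list_const_mult)
   then show ?thesis unfolding l(1) by (simp add: sum_list_mult_const)
  qed
  have b: "f x <= (\<Sum>(c, s)\<leftarrow>?k. c * \<phi> (x \<otimes> s))" if x: "x : CG" for x
  proof -
   have "f x <= (\<Sum>(c, s)\<leftarrow>l. c * g (x \<otimes> s))" using l x by blast
   also have "... <= (\<Sum>(c, s)\<leftarrow>l. c * (\<Sum>(d, t)\<leftarrow>m. d * \<phi> (x \<otimes> s \<otimes> t)))"
   proof (rule sum_list_mono, clarify)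
    fix c s assume "(c, s) : set l"
    then have "0 <= c" "s : CG" using l(2) by auto
    then show "c * g (x \<otimes> s) <= c * (\<Sum>(d, t)\<leftarrow>m. d * \<phi> (x \<otimes> s \<otimes> t))" using l(6) x by (intro mult_left_mono) auto
   qed
   also have "... = (\<Sum>(c, s)\<leftarrow>?k. c * \<phi> (x \<otimes> s))"
    using l(2)
   proof (induction l)
    case (Cons p l)
    obtain c s where p: "p = (c, s)" by force
    then have s: "s : CG" using Cons by auto
    have "c * (\<Sum>(d, t)\<leftarrow>m. d * \<phi> (x \<otimes> s \<otimes> t)) = (\<Sum>(d, t)\<leftarrow>map (%(d, t). (c * d, s \<otimes> t)) m. d * \<phi> (x \<otimes> t))"
     using l(5) x s unfolding sum_list_const_mult[symmetric] map_map
     by (intro arg_cong[of _ _ sum_list]) (auto simp: m_assoc)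
    then show ?case using Cons p by simp
   qed simp
   finally show ?thesis .
  qed
  have "ALL (c, s):set ?k. 0 <= c & s : CG" using l(2,5) by fastforce
  then show "r * t : covset f \<phi>" unfolding covset_def using a b by (intro CollectI exI[of _ ?k]) auto
 qed
 \<comment> \<open>The infimum over \<open>t\<close> is taken first and the one over
   \<open>r\<close> afterwards, each by a division; a zero divisor is treated apart.\<close>
 have "cov f \<phi> <= r * cov g \<phi>" if r: "r : covset f g" for r
 proof (cases "r = 0")
  case True
  obtain t where "t : covset g \<phi>" using assms by blast
  then show ?thesis using *[OF r] True by fastforce
 next
  case False
  then have "0 < r" using covset_nonneg[OF r] by simp
  have "cov f \<phi> / r <= cov g \<phi>" by (rule cov_ge[OF assms(2)]) (use *[OF r] \<open>0 < r\<close> in \<open>simp add: field_simps\<close>)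
  then show ?thesis using \<open>0 < r\<close> by (simp add: field_simps)
 qed
 note ** = this
 show ?thesis
 proof (cases "cov g \<phi> = 0")
  case True
  obtain r where "r : covset f g" using assms by blast
  then show ?thesis using **[of r] True by simp
 next
  case False
  then have p: "0 < cov g \<phi>" using cov_nonneg[OF assms(2)] by simp
  have "cov f \<phi> / cov g \<phi> <= cov f g" by (rule cov_ge[OF assms(1)]) (use ** p in \<open>simp add: field_simps\<close>)
  then show ?thesis using p by (simp add: field_simps)
 qed
qed

text \<open>Covering numbers are only subadditive; this is the approximate reverse inequality for
  \<open>\<phi>\<close> of small support. Where \<open>\<phi> (x s)\<close> is nonzero,
  \<open>x\<close> is close to \<open>inv s\<close>, so \<open>h1\<close> and \<open>h2\<close> may
  be replaced by their values at \<open>inv s\<close> up to \<open>e\<close>. A cover of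
  \<open>F\<close> with weights \<open>c\<close> thus splits into covers of \<open>f1\<close> and
  \<open>f2\<close> with weights \<open>c * (h1 (inv s) + e)\<close> and
  \<open>c * (h2 (inv s) + e)\<close>, whose sum is at most \<open>c * (1 + 2 * e)\<close>.\<close>

lemma cov_near_additive:
 assumes f: "f1 : Cp" "f2 : Cp" and h: "h1 : Cc" "h2 : Cc" "0 < e"
  and F: "!!x. x : CG ==> f1 x = h1 x * F x" "!!x. x : CG ==> f2 x = h2 x * F x"
  and h0: "!!x. x : CG ==> 0 <= h1 x & 0 <= h2 x & h1 x + h2 x <= 1"
 shows "EX V. openin T V & \<one> : V &
  (ALL \<phi>:Cp. covset F \<phi> ~= {} --> (ALL x:CG. x ~: V --> \<phi> x = 0) -->
   cov f1 \<phi> + cov f2 \<phi> <= (1 + 2 * e) * cov F \<phi>)"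
proof -
 obtain V1 where V1: "openin T V1" "\<one> : V1" "!!x v. x : CG ==> v : V1 ==> \<bar>h1 (v \<otimes> x) - h1 x\<bar> < e"
  using uniform_cont[OF h(1,3)] by metis
 obtain V2 where V2: "openin T V2" "\<one> : V2" "!!x v. x : CG ==> v : V2 ==> \<bar>h2 (v \<otimes> x) - h2 x\<bar> < e"
  using uniform_cont[OF h(2,3)] by metis
 show ?thesis
 proof (intro exI[of _ "V1 \<inter> V2"] conjI ballI impI)
  show "openin T (V1 \<inter> V2)" "\<one> : V1 \<inter> V2" using V1 V2 by auto
  fix \<phi> assume phi0: "\<phi> : Cp" "covset F \<phi> ~= {}" "ALL x:CG. x ~: V1 \<inter> V2 --> \<phi> x = 0"
  then have phi: "\<phi> : Cp" "covset F \<phi> ~= {}" "!!x. x : CG ==> x ~: V1 \<inter> V2 ==> \<phi> x = 0" by auto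
  have pp: "!!x. x : CG ==> 0 <= \<phi> x" using phi by (auto simp: Cp_def)
  have part: "(\<Sum>(c, s)\<leftarrow>l. c * (h (inv s) + e)) : covset f \<phi>"
   if l: "ALL (c, s):set l. 0 <= c & s : CG" "ALL x:CG. F x <= (\<Sum>(c, s)\<leftarrow>l. c * \<phi> (x \<otimes> s))"
    and fh: "!!x. x : CG ==> f x = h x * F x" "!!x. x : CG ==> 0 <= h x"
     "!!x v. x : CG ==> v : V1 \<inter> V2 ==> \<bar>h (v \<otimes> x) - h x\<bar> < e" for f h l
  proof -
   let ?l = "map (%(c, s). (c * (h (inv s) + e), s)) l"
   have "f x <= (\<Sum>(c, s)\<leftarrow>?l. c * \<phi> (x \<otimes> s))" if x: "x : CG" for x
   proof -
    have "f x <= h x * (\<Sum>(c, s)\<leftarrow>l. c * \<phi> (x \<otimes> s))" using fh l x by (auto intro!: mult_left_mono)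
    also have "... = (\<Sum>(c, s)\<leftarrow>l. h x * (c * \<phi> (x \<otimes> s)))" by (simp add: sum_list_const_mult[symmetric] case_prod_unfold)
    also have "... <= (\<Sum>(c, s)\<leftarrow>l. c * (h (inv s) + e) * \<phi> (x \<otimes> s))"
    proof (rule sum_list_mono, clarify)
     fix c s assume "(c, s) : set l"
     then have cs: "0 <= c" "s : CG" using l by auto
     show "h x * (c * \<phi> (x \<otimes> s)) <= c * (h (inv s) + e) * \<phi> (x \<otimes> s)"
     proof (cases "x \<otimes> s : V1 \<inter> V2")
      case True
      have "\<bar>h ((x \<otimes> s) \<otimes> inv s) - h (inv s)\<bar> < e" using fh(3)[OF _ True, of "inv s"] cs by simp
      then have "h x <= h (inv s) + e" using x cs by (simp add: m_assoc)
      then have "h x * (c * \<phi> (x \<otimes> s)) <= (h (inv s) + e) * (c * \<phi> (x \<otimes> s))"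
       using cs pp x by (intro mult_right_mono) auto
      then show ?thesis by (simp add: algebra_simps)
     next
      case False then show ?thesis using phi(3)[of "x \<otimes> s"] x cs by simp
     qed
    qed
    also have "... = (\<Sum>(c, s)\<leftarrow>?l. c * \<phi> (x \<otimes> s))" by (simp add: o_def case_prod_unfold)
    finally show ?thesis .
   qed
   moreover have "ALL (c, s):set ?l. 0 <= c & s : CG" using l(1) fh(2) h(3) by (fastforce intro!: mult_nonneg_nonneg add_nonneg_nonneg)
   moreover have "(\<Sum>(c, s)\<leftarrow>l. c * (h (inv s) + e)) = sum_list (map fst ?l)" by (simp add: o_def case_prod_unfold)
   ultimately show ?thesis unfolding covset_def by (intro CollectI exI[of _ ?l]) auto
  qed
  have "(cov f1 \<phi> + cov f2 \<phi>) / (1 + 2 * e) <= cov F \<phi>"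
  proof (rule cov_ge[OF phi(2)])
   fix r assume "r : covset F \<phi>"
   then obtain l where l: "r = sum_list (map fst l)" "ALL (c, s):set l. 0 <= c & s : CG"
    "ALL x:CG. F x <= (\<Sum>(c, s)\<leftarrow>l. c * \<phi> (x \<otimes> s))" by (elim covsetE) blast
   have "cov f1 \<phi> <= (\<Sum>(c, s)\<leftarrow>l. c * (h1 (inv s) + e))"
    by (intro cov_le part[OF l(2,3)]) (use F h0 V1 in auto)
   moreover have "cov f2 \<phi> <= (\<Sum>(c, s)\<leftarrow>l. c * (h2 (inv s) + e))"
    by (intro cov_le part[OF l(2,3)]) (use F h0 V2 in auto)
   moreover have "(\<Sum>(c, s)\<leftarrow>l. c * (h1 (inv s) + e)) + (\<Sum>(c, s)\<leftarrow>l. c * (h2 (inv s) + e)) <= r * (1 + 2 * e)"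
    unfolding l(1) sum_list_addf[symmetric] sum_list_mult_const[symmetric]
   proof (rule sum_list_mono, clarify)
    fix c s assume "(c, s) : set l"
    then have cs: "0 <= c" "s : CG" using l by auto
    have "c * (h1 (inv s) + h2 (inv s) + 2 * e) <= c * (1 + 2 * e)" using cs h0[of "inv s"] by (intro mult_left_mono) auto
    then show "c * (h1 (inv s) + e) + c * (h2 (inv s) + e) <= fst (c, s) * (1 + 2 * e)" by (simp add: algebra_simps)
   qed
   ultimately show "(cov f1 \<phi> + cov f2 \<phi>) / (1 + 2 * e) <= r" using h(3) by (simp add: field_simps)
  qed
  then show "cov f1 \<phi> + cov f2 \<phi> <= (1 + 2 * e) * cov F \<phi>" using h(3) by (simp add: field_simps)
 qed
qed

end

section \<open>Existence of a Haar functional\<close>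

context contraction begin

text \<open>A right-invariant integral on \<open>Cc\<close> that is faithful on nonnegative
  functions. Functions are total, so independence of the values off the carrier is a separate
  clause.\<close>

definition haar :: "(('a => real) => real) => bool" where
 "haar L \<longleftrightarrow> (ALL f:Cc. ALL g:Cc. L (%x. f x + g x) = L f + L g) & (ALL f:Cc. ALL c. L (%x. c * f x) = c * L f)
  & (ALL f:Cp. 0 <= L f) & (ALL f:Cc. ALL s:CG. L (%x. f (x \<otimes> s)) = L f)
  & (ALL f g. (ALL x:CG. f x = g x) --> L f = L g) & (ALL f:Cp. ALL x:CG. 0 < f x --> 0 < L f)"

lemma Cp_Cc: "f : Cp ==> f : Cc" and Cp_nonneg: "f : Cp ==> x : CG ==> 0 <= f x"
 by (auto simp: Cp_def)

lemma Cp_add: "f : Cp ==> g : Cp ==> (%x. f x + g x) : Cp"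
 by (auto simp: Cp_def intro!: Cc_add)

text \<open>Weil's construction. The covering ratios of \<open>f\<close> and \<open>f0\<close> by
  \<open>p n\<close> are bounded independently of \<open>n\<close>, and a cluster point is additive
  because the supports of the \<open>p n\<close> shrink to the identity. The contraction provides
  the shrinking sets \<alpha>^n(V), so a sequence of bumps is enough.\<close>

lemma cone_functional_exists:
 obtains L where "!!f g. f : Cp ==> g : Cp ==> L (%x. f x + g x) = L f + L g"
  "!!f c. f : Cp ==> 0 < c ==> L (%x. c * f x) = c * L f"
  "!!f. f : Cp ==> 0 <= L f"
  "!!f s. f : Cp ==> s : CG ==> L (%x. f (x \<otimes> s)) = L f"
  "!!f g. f : Cp ==> (!!x. x : CG ==> f x = g x) ==> L f = L g"
  "!!f x. f : Cp ==> x : CG ==> 0 < f x ==> 0 < L f"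
proof -
 obtain V W where VW: "openin T V" "compactin T W" "\<one> : V" "V <= W" "W <= CG" "!!x. x : W ==> inv x : W"
  "!!x. x : W ==> contr G x : W" using base_nbhd[of "CG"] by (metis one_closed openin_topspace topspace_T)
 have one_in: "\<one> : act n ` V" for n using VW(3) by (intro image_eqI[of _ _ "\<one>"]) auto
 have "EX p. p : Cp & p \<one> = 1 & (ALL x:CG. p x <= 1) & (ALL x:CG. x ~: act (int n) ` V --> p x = 0)" for n :: nat
 proof -
  have "compactin T {\<one>}" by simp
  from bump[OF this open_act[OF VW(1), of "int n"]] one_in[of "int n"] show ?thesis by (metis empty_subsetI insert_subset insertI1)
 qed
 then obtain p where p: "!!n::nat. p n : Cp" "!!n. p n \<one> = 1" "!!n x. x : CG ==> p n x <= 1"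
  "!!n x. x : CG ==> x ~: act (int n) ` V ==> p n x = 0" by metis
 define f0 where "f0 = p 0"
 have f0: "f0 : Cp" "f0 \<one> = 1" using p by (auto simp: f0_def)
 have ne: "covset f (p n) ~= {}" if "f : Cp" for f n using covset_nonempty[OF Cp_Cc[OF that] p(1)[of n], of "\<one>"] p(2) by simp
 have nf: "covset f f0 ~= {}" if "f : Cp" for f using ne that f0_def by simp
 have c0: "1 <= cov f0 (p n)" for n using cov_lower[OF ne[OF f0(1)], of "\<one>" 1 n] p(3) f0 by simp
 define I where "I n f = (if f : Cp then cov f (p n) / cov f0 (p n) else 0)" for n f
 have I: "I n f = cov f (p n) / cov f0 (p n)" if "f : Cp" for n f using that by (simp add: I_def)
 have Ib: "0 <= I n f & I n f <= (if f : Cp then cov f f0 else 0)" for n f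
 proof (cases "f : Cp")
  case True
  have "cov f (p n) <= cov f f0 * cov f0 (p n)" using cov_trans[OF nf[OF True] ne[OF f0(1)]] Cp_nonneg[OF f0(1)] by blast
  then show ?thesis using True c0[of n] cov_nonneg[OF ne[OF True, of n]] by (simp add: I_def field_simps)
 qed (simp add: I_def)
 obtain L where L: "!!f. 0 <= L f" "!!f. L f <= (if f : Cp then cov f f0 else 0)"
  "!!J e N. finite J ==> 0 < e ==> EX n>=N. ALL f:J. \<bar>I n f - L f\<bar> < e"
  using cluster_point[of "%_. 0" I "%f. if f : Cp then cov f f0 else 0"] Ib by metis
 \<comment> \<open>A finite linear inequality satisfied by all \<open>I n\<close> from some
   \<open>N\<close> on passes to the cluster point \<open>L\<close>.\<close>
 have lin: "0 <= (\<Sum>f\<in>J. a f * L f)" if J: "finite J" "!!n. N <= n ==> 0 <= (\<Sum>f\<in>J. a f * I n f) + d" "!!d. 0 < d ==> True" "d = 0" for J a N d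
 proof (rule ccontr)
  assume neg: "~ 0 <= (\<Sum>f\<in>J. a f * L f)"
  define S where "S = - (\<Sum>f\<in>J. a f * L f)"
  define A where "A = (\<Sum>f\<in>J. \<bar>a f\<bar>) + 1"
  have pos: "0 < S" "0 < A" using neg by (auto simp: S_def A_def intro!: add_nonneg_pos sum_nonneg)
  then obtain n where n: "N <= n" "!!f. f : J ==> \<bar>I n f - L f\<bar> < S / A" using L(3)[OF J(1), of "S / A" N] by auto
  have "(\<Sum>f\<in>J. a f * I n f) + S = (\<Sum>f\<in>J. a f * (I n f - L f))" by (simp add: S_def algebra_simps sum_subtractf)
  also have "... <= (\<Sum>f\<in>J. \<bar>a f\<bar> * (S / A))"
  proof (rule sum_mono)
   fix f assume "f : J"
   have "a f * (I n f - L f) <= \<bar>a f\<bar> * \<bar>I n f - L f\<bar>" by (metis abs_ge_self abs_mult)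
   also have "... <= \<bar>a f\<bar> * (S / A)" using n(2)[OF \<open>f : J\<close>] by (intro mult_left_mono) auto
   finally show "a f * (I n f - L f) <= \<bar>a f\<bar> * (S / A)" .
  qed
  also have "... = (\<Sum>f\<in>J. \<bar>a f\<bar>) * (S / A)" by (rule sum_distrib_right[symmetric])
  also have "... = (A - 1) * (S / A)" by (simp add: A_def)
  also have "... < S" using pos by (simp add: field_simps)
  finally show False using J(2)[OF n(1)] J(4) by simp
 qed
 have ineq2: "L f <= c * L g" if "!!n. I n f <= c * I n g" for f g c
 proof (cases "f = g")
  case True
  then show ?thesis using lin[of "{f}" 0 "%_. c - 1" 0] that by (simp add: algebra_simps)
 next
  case False
  then show ?thesis using lin[of "{f, g}" 0 "%h. if h = f then - 1 else c" 0] that by simp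
 qed
 have mono: "L f <= L g" if "f : Cp" "g : Cp" "!!x. x : CG ==> f x <= g x" for f g
  using ineq2[of f 1 g] cov_mono[OF ne[OF that(2)] that(3)] I[OF that(1)] I[OF that(2)] c0
  by (simp add: divide_right_mono order_trans[OF zero_le_one])
 have sub: "L (%x. f x + g x) <= L f + L g" if fg: "f : Cp" "g : Cp" for f g
 proof -
  let ?h = "%x. f x + g x"
  have h: "?h : Cp" using Cp_add fg .
  have *: "I n ?h <= I n f + I n g" for n
   using cov_subadd[OF ne[OF fg(1)] ne[OF fg(2)], of n] c0[of n] unfolding I[OF h] I[OF fg(1)] I[OF fg(2)]
   by (simp add: add_divide_distrib[symmetric] divide_right_mono)
  have **: "0 <= L f + L g - L ?h" 
  proof (rule ccontr)
   assume neg: "~ ?thesis"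
   define S where "S = (L ?h - L f - L g) / 3"
   have "0 < S" using neg by (simp add: S_def)
   then obtain n where n: "!!k. k : {f, g, ?h} ==> \<bar>I n k - L k\<bar> < S" using L(3)[of "{f, g, ?h}" S 0] by auto
   have b: "\<bar>I n f - L f\<bar> < S" "\<bar>I n g - L g\<bar> < S" "\<bar>I n ?h - L ?h\<bar> < S" by (rule n, simp)+
   have "3 * S = L ?h - L f - L g" by (simp add: S_def)
   then show False using b *[of n] by linarith
  qed
  then show ?thesis by simp
 qed
 have super: "L f + L g <= L (%x. f x + g x)" if fg: "f : Cp" "g : Cp" for f g
 proof (rule field_le_epsilon)
  fix eps :: real assume eps: "0 < eps"
  let ?h = "%x. f x + g x"
  have h: "?h : Cp" using Cp_add fg .
  obtain K where K: "compactin T K" "ALL x:CG - K. ?h x = 0" using Cp_Cc[OF h] by (auto simp: Cc_def)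
  obtain b where b: "b : Cp" "!!x. x : K ==> b x = 1"
   using bump[OF K(1) openin_topspace] compactin_subset_topspace[OF K(1)] by metis
  \<comment> \<open>\<open>B\<close> bounds \<open>I n\<close> at \<open>f + g\<close> and at
    \<open>b\<close> for all \<open>n\<close>. With the choice of \<open>d\<close> below, the total
    error \<open>5 * d * B\<close> stays under \<open>eps / 2\<close>; the remaining half is spent
    on three approximations by \<open>eps / 6\<close>.\<close>
  define B where "B = cov ?h f0 + cov b f0 + 1"
  have B: "1 <= B" "cov ?h f0 <= B" "cov b f0 <= B" using cov_nonneg[OF nf[OF h]] cov_nonneg[OF nf[OF b(1)]] by (auto simp: B_def)
  define d where "d = min 1 (eps / (12 * B))"
  have d: "0 < d" "d <= 1" "d * B <= eps / 12" using eps B by (auto simp: d_def min_def field_simps)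
  \<comment> \<open>The summand \<open>d * b\<close> keeps \<open>F\<close> at least
    \<open>d\<close> on \<open>K\<close>, off which \<open>f\<close> and \<open>g\<close> vanish. So
    \<open>f\<close> and \<open>g\<close> can be divided by \<open>F\<close>, and the cutoff by
    \<open>max\<close> keeps the quotients continuous everywhere.\<close>
  define F where "F x = ?h x + d * b x" for x
  have db: "(%x. d * b x) : Cp" using b d by (auto simp: Cp_def intro!: Cc_cmult)
  have F: "F : Cp" unfolding F_def using Cp_add[OF h db] .
  have cm: "rcont (%x. inverse (max (F x) d))"
   using d Cc_cont[OF Cp_Cc[OF F]] by (intro continuous_intros) (auto simp: max_def)
  define h1 where "h1 x = f x * inverse (max (F x) d)" for x
  define h2 where "h2 x = g x * inverse (max (F x) d)" for x
  have hc: "h1 : Cc" "h2 : Cc" unfolding h1_def h2_def using Cc_mult[OF Cp_Cc cm] fg by auto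
  have z: "f x = 0 & g x = 0" if "x : CG" "x ~: K" for x
   using K(2) that Cp_nonneg[OF fg(1), of x] Cp_nonneg[OF fg(2), of x] by force
  have FK: "d <= F x" if "x : K" for x
   using b(2)[OF that] compactin_carrier[OF K(1) that] Cp_nonneg[OF h, of x] by (simp add: F_def)
  have e1: "f x = h1 x * F x" "g x = h2 x * F x" if x: "x : CG" for x
  proof -
   have "max (F x) d = F x & F x ~= 0" if "x : K" using FK[OF that] d(1) by simp
   then show "f x = h1 x * F x" "g x = h2 x * F x" using z[OF x] by (cases "x : K"; simp add: h1_def h2_def)+
  qed
  have e2: "0 <= h1 x & 0 <= h2 x & h1 x + h2 x <= 1" if x: "x : CG" for x
  proof -
   have "?h x <= max (F x) d" using Cp_nonneg[OF db x] by (simp add: F_def)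
   moreover have "0 < max (F x) d" using d by simp
   ultimately have "?h x * inverse (max (F x) d) <= 1" by (simp add: field_simps)
   then show ?thesis using Cp_nonneg[OF fg(1) x] Cp_nonneg[OF fg(2) x] d by (simp add: h1_def h2_def distrib_right)
  qed
  obtain U where U: "openin T U" "\<one> : U" "ALL \<phi>:Cp. covset F \<phi> ~= {} --> (ALL x:CG. x ~: U --> \<phi> x = 0) -->
   cov f \<phi> + cov g \<phi> <= (1 + 2 * d) * cov F \<phi>"
   using cov_near_additive[OF fg hc d(1) e1 e2] by blast
  obtain N where N: "!!n x. int N <= n ==> x : W ==> act n x : U" using act_compact_eventually[OF VW(2) U(1,2)] by metis
  have key: "I n f + I n g <= I n ?h + eps / 2" if "N <= n" for n
  proof -
   have "act (int n) ` V <= U" using N[of "int n"] that VW(4) by auto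
   then have "cov f (p n) + cov g (p n) <= (1 + 2 * d) * cov F (p n)" using U(3)[rule_format, OF p(1) ne[OF F]] p(4) by blast
   also have "... <= (1 + 2 * d) * (cov ?h (p n) + d * cov b (p n))"
    using cov_subadd[OF ne[OF h] ne[OF db], of n] cov_scale_le[OF ne[OF b(1)] d(1), of n] d
    by (intro mult_left_mono) (auto simp: F_def[abs_def])
   finally have "(cov f (p n) + cov g (p n)) / cov f0 (p n) <= (1 + 2 * d) * (cov ?h (p n) + d * cov b (p n)) / cov f0 (p n)"
    using c0[of n] by (intro divide_right_mono) auto
   then have "I n f + I n g <= (1 + 2 * d) * (I n ?h + d * I n b)"
    unfolding I[OF h] I[OF fg(1)] I[OF fg(2)] I[OF b(1)] by (simp add: add_divide_distrib algebra_simps)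
   also have "... = I n ?h + d * (2 * I n ?h + (1 + 2 * d) * I n b)" by (simp add: algebra_simps)
   also have "... <= I n ?h + d * (2 * B + 3 * B)"
    using Ib[of n ?h] Ib[of n b] h b B d by (intro add_left_mono mult_left_mono add_mono mult_mono) auto
   also have "... <= I n ?h + eps / 2" using d eps by simp
   finally show ?thesis .
  qed
  obtain n where n: "N <= n" "!!k. k : {f, g, ?h} ==> \<bar>I n k - L k\<bar> < eps / 6" using L(3)[of "{f, g, ?h}" "eps / 6" N] eps by auto
  have "\<bar>I n f - L f\<bar> < eps / 6" "\<bar>I n g - L g\<bar> < eps / 6" "\<bar>I n ?h - L ?h\<bar> < eps / 6" by (rule n(2), simp)+
  then show "L f + L g <= L ?h + eps" using key[OF n(1)] by linarith
 qed
 show thesis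
 proof (rule that[of L])
  show "L (%x. f x + g x) = L f + L g" if "f : Cp" "g : Cp" for f g using sub[OF that] super[OF that] by simp
  show "L (%x. c * f x) = c * L f" if f: "f : Cp" and c: "0 < c" for f c
  proof (rule antisym)
   have le: "L (%x. c * f x) <= c * L f" if f: "f : Cp" and c: "0 < c" for f c
   proof (rule ineq2)
    have cf: "(%x. c * f x) : Cp" using f c by (auto simp: Cp_def intro!: Cc_cmult)
    show "I n (%x. c * f x) <= c * I n f" for n
     unfolding I[OF f] I[OF cf] using cov_scale_le[OF ne[OF f] c, of n] c0[of n] by (simp add: divide_right_mono)
   qed
   show "L (%x. c * f x) <= c * L f" using le f c .
   have "(%x. c * f x) : Cp" using f c by (auto simp: Cp_def intro!: Cc_cmult)
   from le[OF this, of "inverse c"] c show "c * L f <= L (%x. c * f x)" by (simp add: field_simps)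
  qed
  show "0 <= L f" for f using L(1) .
  have tr: "L (%x. f (x \<otimes> s)) <= L f" if f: "f : Cp" and s: "s : CG" for f s
  proof -
   have fs: "(%x. f (x \<otimes> s)) : Cp" using f s by (auto simp: Cp_def intro!: Cc_transl)
   have "I n (%x. f (x \<otimes> s)) <= 1 * I n f" for n
    unfolding I[OF f] I[OF fs] using cov_transl_le[OF ne[OF f] s, of n] c0[of n] by (simp add: divide_right_mono)
   then show ?thesis using ineq2[of "%x. f (x \<otimes> s)" 1 f] by simp
  qed
  show cong: "L f = L g" if "f : Cp" "!!x. x : CG ==> f x = g x" for f g
  proof -
   have "rcont g" using continuous_map_eq[OF Cc_cont[OF Cp_Cc[OF that(1)]]] that(2) by simp
   then have "g : Cc" using Cc_combine[OF Cp_Cc[OF that(1)] Cp_Cc[OF that(1)]] that(2) by simp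
   then have "g : Cp" using that by (auto simp: Cp_def)
   then show ?thesis using mono[of f g] mono[of g f] that by fastforce
  qed
  show "L (%x. f (x \<otimes> s)) = L f" if f: "f : Cp" and s: "s : CG" for f s
  proof (rule antisym[OF tr[OF f s]])
   have fs: "(%x. f (x \<otimes> s)) : Cp" using f s by (auto simp: Cp_def intro!: Cc_transl)
   have "L (%x. f (x \<otimes> inv s \<otimes> s)) <= L (%x. f (x \<otimes> s))" using tr[OF fs, of "inv s"] s by simp
   moreover have "L f = L (%x. f (x \<otimes> inv s \<otimes> s))" by (rule cong[OF f]) (use s in \<open>simp add: m_assoc\<close>)
   ultimately show "L f <= L (%x. f (x \<otimes> s))" by simp
  qed
  show "0 < L f" if f: "f : Cp" and x: "x : CG" "0 < f x" for f x
  proof -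
   have nef: "covset f0 f ~= {}" using covset_nonempty[OF Cp_Cc[OF f0(1)] f x] .
   have *: "1 <= cov f0 f * I n f" for n
   proof -
    have "cov f0 (p n) <= cov f0 f * cov f (p n)" using cov_trans[OF nef ne[OF f]] Cp_nonneg[OF f] by blast
    then show ?thesis unfolding I[OF f] using c0[of n] by (simp add: field_simps)
   qed
   show ?thesis
   proof (rule ccontr)
    assume "~ 0 < L f"
    then have "L f = 0" using L(1)[of f] by simp
    then obtain n where "\<bar>I n f\<bar> < 1 / (cov f0 f + 1)"
     using L(3)[of "{f}" "1 / (cov f0 f + 1)" 0] cov_nonneg[OF nef] by auto
    then have "I n f * (cov f0 f + 1) < 1" "0 <= I n f" using cov_nonneg[OF nef] Ib[of n f] by (auto simp: field_simps)
    then show False using *[of n] by (simp add: algebra_simps)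
   qed
  qed
 qed
qed

lemma haar_exists: obtains L where "haar L"
proof -
 obtain L where L: "!!f g. f : Cp ==> g : Cp ==> L (%x. f x + g x) = L f + L g"
  "!!f c. f : Cp ==> 0 < c ==> L (%x. c * f x) = c * L f"
  "!!f. f : Cp ==> 0 <= L f"
  "!!f s. f : Cp ==> s : CG ==> L (%x. f (x \<otimes> s)) = L f"
  "!!f g. f : Cp ==> (!!x. x : CG ==> f x = g x) ==> L f = L g"
  "!!f x. f : Cp ==> x : CG ==> 0 < f x ==> 0 < L f" using cone_functional_exists by blast
 \<comment> \<open>Truncation to zero off the carrier makes the positive part, and with it the
   extended functional, depend only on the values on the carrier.\<close>
 define P where "P f x = max (if x : CG then f x else 0) 0" for f :: "'a => real" and x
 define N where "N f = P (%x. - f x)" for f :: "'a => real"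
 define \<Lambda> where "\<Lambda> f = L (P f) - L (N f)" for f
 have zero: "L (%x. 0) = 0"
 proof -
  have "(%x. 0) : Cp" using Cc_zero by (auto simp: Cp_def)
  from L(1)[OF this this] show ?thesis by simp
 qed
 have PC: "P f : Cp" if f: "f : Cc" for f
 proof -
  have "rcont (P f)"
   using Cc_cont[OF Cp_Cc[OF Cc_pos(1)[OF f]]] by (rule continuous_map_eq) (simp add: P_def)
  then have "P f : Cc" using Cc_combine[OF f f, of "P f"] by (simp add: P_def)
  then show ?thesis by (auto simp: Cp_def P_def)
 qed
 have neg: "(%x. - f x) : Cc" if "f : Cc" for f using Cc_cmult[OF that, of "-1"] by simp
 have NC: "N f : Cp" if "f : Cc" for f unfolding N_def using PC[OF neg[OF that]] .
 have \<Lambda>P: "\<Lambda> f = L f" if "f : Cp" for f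
 proof -
  have "L (N f) = L (%x. 0)" by (rule L(5)[OF NC[OF Cp_Cc[OF that]]]) (use Cp_nonneg[OF that] in \<open>auto simp: N_def P_def\<close>)
  moreover have "L f = L (P f)" by (rule L(5)[OF that]) (use Cp_nonneg[OF that] in \<open>auto simp: P_def\<close>)
  ultimately show ?thesis by (simp add: \<Lambda>_def zero)
 qed
 \<comment> \<open>The value at a difference of two elements of the cone is independent of the
   decomposition; linearity and invariance are reduced to this.\<close>
 have diff: "\<Lambda> (%x. f x - g x) = L f - L g" if fg: "f : Cp" "g : Cp" for f g
 proof -
  let ?h = "%x. f x - g x"
  have h: "?h : Cc" using Cc_diff[OF fg[THEN Cp_Cc]] .
  have "L (%x. P ?h x + g x) = L (%x. N ?h x + f x)"
   by (rule L(5)[OF Cp_add[OF PC[OF h] fg(2)]]) (auto simp: P_def N_def)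
  then have "L (P ?h) + L g = L (N ?h) + L f" using L(1)[OF PC[OF h] fg(2)] L(1)[OF NC[OF h] fg(1)] by simp
  then show ?thesis by (simp add: \<Lambda>_def)
 qed
 have cong: "\<Lambda> f = \<Lambda> g" if "!!x. x : CG ==> f x = g x" for f g
 proof -
  have "P f = P g" "N f = N g" using that by (auto simp: P_def N_def fun_eq_iff)
  then show ?thesis by (simp add: \<Lambda>_def)
 qed
 have dec: "\<Lambda> f = \<Lambda> (%x. P f x - N f x)" for f by (rule cong) (auto simp: P_def N_def)
 have "haar \<Lambda>"
  unfolding haar_def
 proof (intro conjI ballI allI impI)
  fix f g assume fg: "f : Cc" "g : Cc"
  have "\<Lambda> (%x. f x + g x) = \<Lambda> (%x. (P f x + P g x) - (N f x + N g x))" by (rule cong) (auto simp: P_def N_def)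
  also have "... = \<Lambda> f + \<Lambda> g"
   using diff[OF Cp_add[OF PC[OF fg(1)] PC[OF fg(2)]] Cp_add[OF NC[OF fg(1)] NC[OF fg(2)]]]
    L(1)[OF PC[OF fg(1)] PC[OF fg(2)]] L(1)[OF NC[OF fg(1)] NC[OF fg(2)]] by (simp add: \<Lambda>_def)
  finally show "\<Lambda> (%x. f x + g x) = \<Lambda> f + \<Lambda> g" .
 next
  fix f and c :: real assume f: "f : Cc"
  have sc: "(%x. c * g x) : Cp & L (%x. c * g x) = c * L g" if "0 < c" "g : Cp" for c :: real and g
   using that L(2)[OF that(2,1)] by (auto simp: Cp_def intro!: Cc_cmult)
  consider "c = 0" | "0 < c" | "c < 0" by linarith
  then show "\<Lambda> (%x. c * f x) = c * \<Lambda> f"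
  proof cases
   case 1 then show ?thesis using diff[of "%x. 0" "%x. 0"] Cc_zero by (simp add: Cp_def)
  next
   case 2
   have "\<Lambda> (%x. c * f x) = \<Lambda> (%x. c * P f x - c * N f x)" by (rule cong) (auto simp: P_def N_def max_def)
   also have "... = c * L (P f) - c * L (N f)" using diff[of "%x. c * P f x" "%x. c * N f x"] sc[OF 2 PC[OF f]] sc[OF 2 NC[OF f]] by simp
   finally show ?thesis by (simp add: \<Lambda>_def algebra_simps)
  next
   case 3
   then have 3: "0 < - c" by simp
   have "\<Lambda> (%x. c * f x) = \<Lambda> (%x. - c * N f x - (- c) * P f x)" by (rule cong) (auto simp: P_def N_def max_def)
   also have "... = - c * L (N f) - (- c) * L (P f)" using diff[of "%x. - c * N f x" "%x. - c * P f x"] sc[OF 3 PC[OF f]] sc[OF 3 NC[OF f]] by simp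
   finally show ?thesis by (simp add: \<Lambda>_def algebra_simps)
  qed
 next
  fix f assume "f : Cp" then show "0 <= \<Lambda> f" using \<Lambda>P L(3) by simp
 next
  fix f s assume f: "f : Cc" and s: "s : CG"
  have tr: "(%x. g (x \<otimes> s)) : Cp" if "g : Cp" for g using that s by (auto simp: Cp_def intro!: Cc_transl)
  have "\<Lambda> (%x. f (x \<otimes> s)) = \<Lambda> (%x. P f (x \<otimes> s) - N f (x \<otimes> s))" by (rule cong) (use s in \<open>simp add: P_def N_def max_def\<close>)
  also have "... = \<Lambda> f" using diff[OF tr[OF PC[OF f]] tr[OF NC[OF f]]] L(4)[OF PC[OF f] s] L(4)[OF NC[OF f] s] by (simp add: \<Lambda>_def)
  finally show "\<Lambda> (%x. f (x \<otimes> s)) = \<Lambda> f" .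
 next
  fix f g :: "'a => real" assume "ALL x:CG. f x = g x" then show "\<Lambda> f = \<Lambda> g" by (intro cong) auto
 next
  fix f x assume "f : Cp" "x : CG" "0 < f x" then show "0 < \<Lambda> f" using \<Lambda>P L(6) by simp
 qed
 then show thesis using that by blast
qed

lemma haar_add: "haar L ==> f : Cc ==> g : Cc ==> L (%x. f x + g x) = L f + L g"
 and haar_scale: "haar L ==> f : Cc ==> L (%x. c * f x) = c * L f"
 and haar_nonneg: "haar L ==> f : Cp ==> 0 <= L f"
 and haar_transl: "haar L ==> f : Cc ==> s : CG ==> L (%x. f (x \<otimes> s)) = L f"
 and haar_cong: "haar L ==> (!!x. x : CG ==> f x = g x) ==> L f = L g"
 and haar_pos: "haar L ==> f : Cp ==> x : CG ==> 0 < f x ==> 0 < L f"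
 unfolding haar_def by blast+

lemma haar_diff: "haar L ==> f : Cc ==> g : Cc ==> L (%x. f x - g x) = L f - L g"
 using haar_add[of L f "%x. (- 1) * g x"] haar_scale[of L g "- 1"] Cc_cmult[of g "- 1"] by simp

lemma haar_mono: "haar L ==> f : Cc ==> g : Cc ==> (!!x. x : CG ==> f x <= g x) ==> L f <= L g"
 using haar_nonneg[of L "%x. g x - f x"] haar_diff[of L g f] by (auto simp: Cp_def Cc_diff)

lemma haar_abs_le:
 assumes "haar L" "f : Cc" "g : Cc" "!!x. x : CG ==> \<bar>f x\<bar> <= g x" shows "\<bar>L f\<bar> <= L g"
proof -
 have "L f <= L g" by (rule haar_mono[OF assms(1-3)]) (use assms(4) in force)
 moreover have "L (%x. - 1 * f x) <= L g" by (rule haar_mono[OF assms(1) Cc_cmult[OF assms(2)] assms(3)]) (use assms(4) in force)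
 ultimately show ?thesis using haar_scale[OF assms(1,2), of "- 1"] by simp
qed

end

subsection \<open>Real homomorphisms\<close>

lemma continuous_map_realI:
 assumes "!!x e. x : topspace X ==> 0 < e ==> EX U. openin X U & x : U & (ALL y:U. \<bar>f y - f x\<bar> < e)"
 shows "continuous_map X euclideanreal f"
 unfolding continuous_map_def
proof (intro conjI allI impI)
 fix S assume "openin euclideanreal S"
 then have S: "open S" by simp
 show "openin X {x : topspace X. f x : S}"
 proof (subst openin_subopen, intro ballI)
  fix x assume x: "x : {x : topspace X. f x : S}"
  then obtain e where e: "0 < e" "!!y. dist y (f x) < e ==> y : S" using S unfolding open_dist by auto
  obtain U where U: "openin X U" "x : U" "ALL y:U. \<bar>f y - f x\<bar> < e" using assms[of x e] x e by auto
  have "U <= {x : topspace X. f x : S}" using U e(2) openin_subset[OF U(1)] by (auto simp: dist_real_def)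
  then show "EX T. openin X T & x : T & T <= {x : topspace X. f x : S}" using U by blast
 qed
qed simp

lemma continuous_map_realD:
 assumes "continuous_map X euclideanreal f" "x : topspace X" "0 < (e::real)"
 shows "EX U. openin X U & x : U & (ALL y:U. \<bar>f y - f x\<bar> < e)"
proof -
 let ?U = "{y : topspace X. f y : {f x - e<..<f x + e}}"
 have "openin X ?U" by (rule openin_continuous_map_preimage[OF assms(1)]) simp
 then show ?thesis using assms by (intro exI[of _ ?U]) (auto simp: abs_less_iff)
qed

definition rhom :: "'a dynamical_group => ('a => real) => bool" where
 "rhom G h \<longleftrightarrow> continuous_map (topol G) euclideanreal h &
   (ALL x:carrier G. ALL y:carrier G. h (x \<otimes>\<^bsub>G\<^esub> y) = h x + h y)"

text \<open>Serves the gauge below, whose value one step further on is compared with its own sum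
  shifted by two levels.\<close>

lemma sum_shift2_le:
 fixes a :: "nat => real"
 assumes "!!m. 0 <= a m"
 shows "(\<Sum>m<n. if m < 2 then 1 else a (m - 2)) <= 2 + (\<Sum>m<n. a m)"
proof -
 have "(\<Sum>m<n. if m < 2 then 1 else a (m - 2)) <= 2 + (\<Sum>m<n - 2. a m)"
 proof (induction n)
  case (Suc n)
  show ?case
  proof (cases "n < 2")
   case True
   then have "n = 0 \<or> n = 1" by auto
   then show ?thesis by auto
  next
   case False
   then have "Suc n - 2 = Suc (n - 2)" by simp
   then show ?thesis using Suc False by simp
  qed
 qed simp
 also have "(\<Sum>m<n - 2. a m) <= (\<Sum>m<n. a m)" using assms by (intro sum_mono2) auto
 finally show ?thesis by simp
qed

context lcgroup begin

lemma additive_one: "(!!x y. x : CG ==> y : CG ==> h (x \<otimes> y) = h x + (h y :: real)) ==> h \<one> = 0"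
 by (metis add_cancel_right_left one_closed r_one)

lemma additive_pow:
 assumes "!!x y. x : CG ==> y : CG ==> h (x \<otimes> y) = h x + (h y :: real)" "x : CG"
 shows "h (x [^] (n::nat)) = n * h x"
 by (induction n) (use assms additive_one[OF assms(1)] in \<open>auto simp: algebra_simps\<close>)

lemma additive_inv:
 assumes "!!x y. x : CG ==> y : CG ==> h (x \<otimes> y) = h x + (h y :: real)" "x : CG"
 shows "h (inv x) = - h x"
 using assms(1)[of x "inv x"] additive_one[OF assms(1)] assms(2) by simp

lemma nbhd_spow:
 assumes "openin T U" "\<one> : U"
 obtains V where "openin T V" "\<one> : V" "!!x. x : V ==> inv x : V" "spow V k <= U"
proof -
 have "EX V. openin T V & \<one> : V & (ALL x:V. inv x : V) & spow V k <= U"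
  using assms
 proof (induction k arbitrary: U)
  case 0
  obtain V where "openin T V" "\<one> : V" "!!x. x : V ==> inv x : V" using nbhd_sym[OF 0] by metis
  then show ?case using 0 by auto
 next
  case (Suc k)
  obtain V where V: "openin T V" "\<one> : V" "!!x y. x : V ==> y : V ==> x \<otimes> y : U" using nbhd_mult[OF Suc.prems] by metis
  obtain V1 where V1: "openin T V1" "\<one> : V1" "ALL x:V1. inv x : V1" "spow V1 k <= V" using Suc.IH[OF V(1,2)] by blast
  have o: "openin T (V \<inter> V1)" "\<one> : V \<inter> V1" using V V1 by auto
  obtain V2 where V2: "openin T V2" "\<one> : V2" "V2 <= V \<inter> V1" "!!x. x : V2 ==> inv x : V2" using nbhd_sym[OF o] by metis
  have "spow V2 k <= V" using spow_mono[of V2 V1 k] V2 V1 by blast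
  then have "spow V2 (Suc k) <= U" using V(3) V2(3) unfolding spow.simps set_mult_def by blast
  then show ?case using V2 by blast
 qed
 then show thesis using that by blast
qed

text \<open>If \<open>u^k\<close> lies in \<open>V\<close>, additivity gives
  \<open>|h u| <= B / k\<close>; so neighbourhoods whose \<open>k\<close>-fold products stay in
  \<open>V\<close> make \<open>h\<close> small.\<close>

lemma bounded_additive_rhom:
 assumes h: "!!x y. x : CG ==> y : CG ==> h (x \<otimes> y) = h x + (h y :: real)"
  and V: "openin T V" "\<one> : V" "!!x. x : V ==> \<bar>h x\<bar> <= B"
 shows "rhom G h"
proof -
 have "rcont h"
 proof (rule continuous_map_realI)
  fix x and e :: real assume x: "x : topspace T" and e: "0 < e"
  obtain k :: nat where k: "\<bar>B\<bar> / e < k" using reals_Archimedean2 by blast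
  then have k0: "0 < k" using e by (cases k) (auto simp: field_simps)
  obtain U where U: "openin T U" "\<one> : U" "spow U k <= V" using nbhd_spow[OF V(1,2)] by metis
  have small: "\<bar>h u\<bar> < e" if "u : U" for u
  proof -
   have uc: "u : CG" using that U openin_carrier by blast
   have "u [^] k : V" using spow_pow[OF openin_subset_carrier[OF U(1)] that, of k] U by blast
   then have "\<bar>real k * h u\<bar> <= B" using V(3) additive_pow[of h, OF h uc, of k] by metis
   then have "real k * \<bar>h u\<bar> <= B" by (simp add: abs_mult)
   also have "B < real k * e" using k e by (simp add: field_simps)
   finally show ?thesis using k0 by simp
  qed
  let ?N = "{y : CG. inv x \<otimes> y : U}"
  have "openin T ?N" using open_ltrans U x by simp
  moreover have "\<bar>h y - h x\<bar> < e" if "y : ?N" for y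
  proof -
   have "h (inv x \<otimes> y) = h y - h x" using that x h[of "inv x" y] additive_inv[of h, OF h] by simp
   then show ?thesis using small that by force
  qed
  ultimately show "EX U. openin T U & x : U & (ALL y:U. \<bar>h y - h x\<bar> < e)"
   using U x by (intro exI[of _ ?N]) auto
 qed
 then show ?thesis using h by (simp add: rhom_def)
qed

lemma spow_path:
 assumes "X <= CG" "y : spow X m"
 obtains p where "p 0 = \<one>" "p m = y" "!!k. k < m ==> EX w:X. p (Suc k) = p k \<otimes> w" "!!k. k <= m ==> p k : spow X k"
proof -
 have "EX p. p 0 = \<one> & p m = y & (ALL k<m. EX w:X. p (Suc k) = p k \<otimes> w) & (ALL k<=m. p k : spow X k)"
  using assms(2)
 proof (induction m arbitrary: y)
  case 0 then show ?case by (intro exI[of _ "%_. \<one>"]) auto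
 next
  case (Suc m)
  obtain a w where aw: "a : spow X m" "w : X" "y = a \<otimes> w" using Suc.prems by (auto simp: mem_set_mult)
  obtain p where p: "p 0 = \<one>" "p m = a" "ALL k<m. EX w:X. p (Suc k) = p k \<otimes> w" "ALL k<=m. p k : spow X k"
   using Suc.IH[OF aw(1)] by blast
  have "EX w:X. (p(Suc m := y)) (Suc k) = (p(Suc m := y)) k \<otimes> w" if "k < Suc m" for k
   using that p aw by (cases "k = m") auto
  moreover have "(p(Suc m := y)) k : spow X k" if "k <= Suc m" for k
   using that p Suc.prems by (cases "k = Suc m") auto
  ultimately show ?case using p by (intro exI[of _ "p(Suc m := y)"]) auto
 qed
 then show thesis using that by metis
qed

end

section \<open>A nonzero real homomorphism as a limit of averaged gauges\<close>

context contraction begin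

text \<open>Uniform continuity bounds the integrand pointwise, and it vanishes off the compact set
  \<open>K W\<close>. So the integral is at most a small multiple of the integral of a bump that
  equals 1 on \<open>K W\<close>.\<close>

lemma haar_L1:
 assumes L: "haar L" and r: "r : Cc" and e: "0 < e"
 obtains V where "openin T V" "\<one> : V" "!!c. c : V ==> L (%g. \<bar>r (g \<otimes> inv c) - r g\<bar>) <= e"
proof -
 obtain K where K: "compactin T K" "ALL x:CG - K. r x = 0" using r by (auto simp: Cc_def)
 obtain V1 W where W: "openin T V1" "compactin T W" "\<one> : V1" "V1 <= W" "!!x. x : W ==> inv x : W"
  using base_nbhd[of "CG"] by (metis one_closed openin_topspace topspace_T)
 have KW: "compactin T (K <#> W)" using K W compact_mult by blast
 obtain b where b: "b : Cp" "!!x. x : K <#> W ==> b x = 1"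
  using bump[OF KW openin_topspace] compactin_subset_topspace[OF KW] by metis
 define B where "B = L b + 1"
 have B: "0 < B" using haar_nonneg[OF L b(1)] by (simp add: B_def)
 obtain V2 where V2: "openin T V2" "\<one> : V2" "!!x. x : V2 ==> inv x : V2" "!!x v. x : CG ==> v : V2 ==> \<bar>r (x \<otimes> v) - r x\<bar> < e / B"
  using uniform_cont[OF r, of "e / B"] B e by (metis divide_pos_pos)
 show thesis
 proof (rule that[of "V1 \<inter> V2"])
  fix c assume c: "c : V1 \<inter> V2"
  have cc: "c : CG" using c V2 openin_carrier by blast
  have Cd: "(%g. \<bar>r (g \<otimes> inv c) - r g\<bar>) : Cc" using Cc_abs[OF Cc_diff[OF Cc_transl[OF r] r]] cc by blast
  have "L (%g. \<bar>r (g \<otimes> inv c) - r g\<bar>) <= L (%g. e / B * b g)"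
  proof (rule haar_mono[OF L Cd Cc_cmult[OF Cp_Cc[OF b(1)]]])
   fix g assume g: "g : CG"
   show "\<bar>r (g \<otimes> inv c) - r g\<bar> <= e / B * b g"
   proof (cases "g : K <#> W")
    case True
    then show ?thesis using V2(4)[OF g V2(3)[of c]] c b(2) by fastforce
   next
    case False
    have 1: "g ~: K"
    proof
     assume "g : K"
     then have "g \<otimes> \<one> : K <#> W" using W by (intro set_multI) auto
     then show False using False g by simp
    qed
    have 2: "g \<otimes> inv c ~: K"
    proof
     assume "g \<otimes> inv c : K"
     then have "(g \<otimes> inv c) \<otimes> c : K <#> W" using W c by (intro set_multI) auto
     then show False using False g cc by (simp add: m_assoc)
    qed
    show ?thesis using 1 2 K g cc e B Cp_nonneg[OF b(1) g] by simp
   qed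
  qed
  also have "... = e / B * L b" by (rule haar_scale[OF L Cp_Cc[OF b(1)]])
  also have "... <= e" using e B haar_nonneg[OF L b(1)] by (simp add: B_def field_simps)
  finally show "L (%g. \<bar>r (g \<otimes> inv c) - r g\<bar>) <= e" .
 qed (use W V2 in auto)
qed

text \<open>Let \<open>M n\<close> be the number of steps from \<open>\<alpha>\<^sup>n(W)\<close> one can make from the neutral element without
 leaving \<open>W\<close>. It grows at most exponentially, so the number of steps needed to leave \<open>\<alpha>\<^sup>j(W)\<close> is a
 fixed proportion of it.\<close>

lemma exit_times:
 assumes conn: "connected_space T" and nt: "CG ~= {\<one>}"
  and V: "openin T V" "\<one> : V" "V <= W" and W: "compactin T W" "!!x. x : W ==> inv x : W" "!!x. x : W ==> contr G x : W"
 obtains M :: "nat => nat" and C where "!!n. spow (act (int n) ` W) (M n) <= W" "!!n. ~ spow (act (int n) ` W) (Suc (M n)) <= W"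
  "!!n. 0 < M n" "0 < C" "!!n j. M (n + j) <= C ^ j * M n"
proof -
 let ?W = "%n::nat. act (int n) ` W"
 have Wc: "W <= CG" "\<one> : W" using W V compactin_subset_carrier by auto
 have WW: "?W n <= CG" "\<one> : ?W n" "?W n <= W" "!!x. x : ?W n ==> inv x : ?W n" "openin T (act (int n) ` V)" "\<one> : act (int n) ` V" "act (int n) ` V <= ?W n" for n
 proof -
  show "?W n <= W" using act_image_antimono[OF W(3) Wc(1), of 0 "int n"] by simp
  show "?W n <= CG" using Wc by auto
  show "\<one> : ?W n" "\<one> : act (int n) ` V" using Wc V by (auto intro!: image_eqI[of _ _ "\<one>"])
  show "inv x : ?W n" if "x : ?W n" for x using that W(2) Wc by (auto simp: act_inv[symmetric] subset_iff)
  show "openin T (act (int n) ` V)" using V open_act by blast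
  show "act (int n) ` V <= ?W n" using V by blast
 qed
 have gen: "(\<Union>m. spow (?W n) m) = CG" for n
  using connected_generated[OF conn WW(1,4,5,6,7)] .
 have "~ CG <= W"
 proof
  assume "CG <= W"
  then have "compactin T (CG)" using W Wc by (metis subset_antisym)
  then have "CG <= {\<one>}" using invariant_compact_trivial by blast
  then show False using nt by auto
 qed
 then obtain x where x: "x : CG" "x ~: W" by blast
 have "EX m. spow (?W n) m <= W & ~ spow (?W n) (Suc m) <= W" for n
 proof (rule ccontr)
  assume "~ ?thesis"
  then have "spow (?W n) m <= W" for m by (induction m) (use Wc in auto)
  then show False using gen[of n] x by blast
 qed
 then obtain M where M: "!!n. spow (?W n) (M n) <= W" "!!n. ~ spow (?W n) (Suc (M n)) <= W" by metis
 have M0: "0 < M n" for n using M(2)[of n] spow_1[OF WW(1)[of n]] WW(3)[of n] by (cases "M n") auto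
 \<comment> \<open>By compactness \<open>W\<close> is reached with a bounded number of steps from
   \<alpha>(W); applying \<alpha>^n gives the same bound \<open>K\<close> at every scale.\<close>
 obtain K where K: "W <= spow (?W 1) K"
 proof -
  let ?U = "%m. spow (?W 1) m <#> act (int 1) ` V"
  have "openin T (?U m)" for m using open_mult_left[OF WW(5)] spow_carrier[OF WW(1)] by blast
  moreover have "?U m <= ?U n" if "m <= n" for m n using spow_le[OF WW(1,2) that, of 1] by (intro set_mult_mono) auto
  moreover have "W <= (\<Union>m. ?U m)"
  proof
   fix w assume w: "w : W"
   then obtain m where "w : spow (?W 1) m" using gen[of 1] Wc by blast
   then have "w \<otimes> \<one> : ?U m" using WW(6) by (intro set_multI)
   moreover have "w \<otimes> \<one> = w" using w Wc by auto
   ultimately show "w : (\<Union>m. ?U m)" by (metis UN_I UNIV_I)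
  qed
  ultimately obtain m where "W <= ?U m" using compact_increasing[OF W(1), of ?U] by blast
  moreover have "?U m <= spow (?W 1) (Suc m)" unfolding spow.simps by (rule set_mult_mono[OF order_refl WW(7)])
  ultimately show thesis using that by blast
 qed
 have K': "?W n <= spow (?W (n + 1)) K" for n
 proof -
  have "?W n <= act (int n) ` spow (?W 1) K" using K by blast
  also have "... = spow (?W (n + 1)) K" using act_spow[OF WW(1)[of 1], of "int n" K] act_image_add[OF Wc(1), of "int n" 1] by (simp add: add.commute)
  finally show ?thesis .
 qed
 have step: "M (n + 1) <= K * Suc (M n)" for n
 proof (rule ccontr)
  assume "~ ?thesis"
  then have "K * Suc (M n) <= M (n + 1)" by simp
  from spow_le[OF WW(1,2)[of "n + 1"] this] have "spow (?W (n + 1)) (K * Suc (M n)) <= W" using M(1)[of "n + 1"] by (rule subset_trans)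
  moreover have "spow (?W n) (Suc (M n)) <= spow (spow (?W (n + 1)) K) (Suc (M n))" using K' by (rule spow_mono)
  ultimately show False using M(2)[of n] unfolding spow_mult[OF WW(1)] by (meson subset_trans)
 qed
 have step2: "M (n + 1) <= (2 * K + 1) * M n" for n
 proof -
  have "Suc (M n) <= 2 * M n" using M0[of n] by simp
  then have "K * Suc (M n) <= K * (2 * M n)" by (rule mult_le_mono2)
  with step[of n] have "M (n + 1) <= K * (2 * M n)" by (rule order_trans)
  also have "... <= (2 * K + 1) * M n" by (simp add: algebra_simps)
  finally show ?thesis .
 qed
 have "M (n + j) <= (2 * K + 1) ^ j * M n" for n j
 proof (induction j)
  case (Suc j)
  have "M (n + Suc j) <= (2 * K + 1) * M (n + j)" using step2[of "n + j"] by simp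
  also have "... <= (2 * K + 1) * ((2 * K + 1) ^ j * M n)" using Suc by (rule mult_le_mono2)
  finally show ?case unfolding power_Suc add_Suc_right mult.assoc .
 qed simp
 then show thesis using that[of M "2 * K + 1"] M M0 by auto
qed

end

context contraction begin

lemma one_in_act: "\<one> : S ==> \<one> : act k ` S"
 by (metis act_one imageI)

text \<open>A continuous version of the word distance from \<open>Q\<close>, cut off at
  \<open>l\<close>: the summand \<open>1 - b m\<close> records whether \<open>x\<close> is outside
  \<open>Q X^m\<close>, up to one level of smoothing. A step from \<open>X\<close> costs one level
  and the smoothing another, whence the constant 2.\<close>

lemma gauge:
 assumes Q: "compactin T Q" and X: "compactin T X" "openin T V" "\<one> : V" "V <= X" "!!x. x : X ==> inv x : X"
 obtains f where "rcont f" "!!x w. x : CG ==> w : X ==> \<bar>f (x \<otimes> w) - f x\<bar> <= 2"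
  "!!x. x : Q ==> f x = 0" "!!x. x : CG ==> x ~: Q <#> spow X l ==> f x = real l"
proof -
 have Xc: "X <= CG" "\<one> : X" and Qc: "Q <= CG" using X Q compactin_subset_carrier by auto
 define S where "S m = Q <#> spow X m" for m
 have Sc: "S m <= CG" for m unfolding S_def using Qc spow_carrier[OF Xc(1)] set_mult_carrier by blast
 have SS: "S (Suc m) = S m <#> X" for m by (simp add: S_def set_mult_assoc Qc spow_carrier Xc)
 define U where "U m = S m <#> V" for m
 have Uo: "openin T (U m)" for m unfolding U_def using open_mult_left[OF X(2) Sc] .
 have US: "U m <= S (Suc m)" for m unfolding U_def SS using X(4) by (intro set_mult_mono) auto
 have SU: "S m <= U m" for m
 proof
  fix x assume "x : S m"
  then have "x \<otimes> \<one> : U m" "x : CG" unfolding U_def using X(3) Sc by (auto intro: set_multI)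
  then show "x : U m" by simp
 qed
 have Smono: "S m <= S k" if "m <= k" for m k unfolding S_def using spow_le[OF Xc that] by (intro set_mult_mono) auto
 have "EX b. b : Cp & (ALL x:S m. b x = 1) & (ALL x:CG. b x <= 1) & (ALL x:CG. x ~: U m --> b x = 0)" for m
  using bump[OF _ Uo SU, of m] compact_mult[OF Q spow_compact[OF X(1)]] S_def by metis
 then obtain b where b: "!!m. b m : Cp" "!!m x. x : S m ==> b m x = 1" "!!m x. x : CG ==> b m x <= 1"
  "!!m x. x : CG ==> x ~: U m ==> b m x = 0" by metis
 define f where "f x = (\<Sum>m<l. 1 - b m x)" for x
 have up: "f (x \<otimes> w) <= f x + 2" if x: "x : CG" and w: "w : X" for x w
 proof -
  have wc: "w : CG" using w Xc by auto
  define a where "a m = max 0 (1 - b m x)" for m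
  have am: "a m = 1 - b m x" for m using b(3)[OF x] by (simp add: a_def)
  have "f (x \<otimes> w) <= (\<Sum>m<l. if m < 2 then 1 else a (m - 2))"
   unfolding f_def
  proof (rule sum_mono)
   fix m
   have xw: "x \<otimes> w : CG" using x wc by simp
   show "1 - b m (x \<otimes> w) <= (if m < 2 then 1 else a (m - 2))"
   proof (cases "m < 2 \<or> x \<otimes> w : S m")
    case True
    then show ?thesis using Cp_nonneg[OF b(1) xw, of m] b(2)[of "x \<otimes> w" m] by (auto simp: a_def)
   next
    case False
    then obtain k where k: "m = Suc (Suc k)" by (metis One_nat_def Suc_1 lessI less_Suc_eq not0_implies_Suc zero_less_Suc)
    have "x ~: S (Suc k)" using False w unfolding k SS[of "Suc k"] by (auto intro: set_multI)
    then have "x ~: U k" using US by blast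
    then have "a k = 1" using b(4)[OF x] am by simp
    then show ?thesis using Cp_nonneg[OF b(1) xw, of m] k by simp
   qed
  qed
  also have "... <= 2 + (\<Sum>m<l. a m)" by (rule sum_shift2_le) (simp add: a_def)
  finally show ?thesis by (simp add: f_def am)
 qed
 show thesis
 proof (rule that[of f])
  show "rcont f" unfolding f_def using Cc_cont[OF Cp_Cc[OF b(1)]] by (intro continuous_intros) auto
  show "\<bar>f (x \<otimes> w) - f x\<bar> <= 2" if "x : CG" "w : X" for x w
  proof -
   have "w : CG" "inv w : X" using that Xc X by auto
   then show ?thesis using up[OF that] up[of "x \<otimes> w" "inv w"] that by (simp add: m_assoc)
  qed
  show "f x = 0" if "x : Q" for x
  proof -
   have "S 0 = Q" using Qc by (simp add: S_def set_mult_one)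
   then have "x : S m" for m using Smono[of 0 m] that by auto
   then show ?thesis by (simp add: f_def b(2))
  qed
  show "f x = real l" if "x : CG" "x ~: Q <#> spow X l" for x
  proof -
   have "b m x = 0" if "m < l" for m
    using b(4) US[of m] Smono[of "Suc m" l] that \<open>x : CG\<close> \<open>x ~: Q <#> spow X l\<close> unfolding S_def[of l, symmetric] by (metis Suc_leI subsetD)
   then show ?thesis by (simp add: f_def)
  qed
 qed
qed

text \<open>For each \<open>n\<close> the gauge vanishes where \<open>r\<close> does not, and equals
  \<open>M n\<close> at the corresponding points \<open>g y\<close>, for a point \<open>y\<close>
  outside \<open>W\<close> reached in \<open>M (n + j) + 1\<close> steps from \<alpha>^(n+j)(W). The
  averaged increments along this path add up to \<open>M n\<close>, and the number of steps is at
  most a fixed multiple of \<open>M n\<close>. Hence some step \<open>w n\<close>, taken at the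
  position \<open>p n\<close>, contributes at least a constant \<open>c\<close>.\<close>

lemma stages:
 assumes conn: "connected_space T" and nt: "CG ~= {\<one>}"
  and V: "openin T V" "\<one> : V" "V <= W" and W0: "compactin T W" "ALL x:W. inv x : W" "ALL x:W. contr G x : W"
 shows "EX L r c j f p w. haar L & r : Cp & L r = 1 & 0 < c &
  (ALL n::nat. rcont (f n) & (ALL x:CG. ALL w:act (int (n + j)) ` W. \<bar>f n (x \<otimes> w) - f n x\<bar> <= 2) &
   p n : W & w n : act (int (n + j)) ` W & c <= L (%g. r g * (f n (g \<otimes> p n \<otimes> w n) - f n (g \<otimes> p n))))"
proof -
 have W: "compactin T W" "!!x. x : W ==> inv x : W" "!!x. x : W ==> contr G x : W" using W0 by auto
 obtain M C where M: "!!n. spow (act (int n) ` W) (M n) <= W" "!!n. ~ spow (act (int n) ` W) (Suc (M n)) <= W"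
  "!!n. 0 < M n" "0 < C" "!!n j. M (n + j) <= C ^ j * M n" using exit_times[OF conn nt V W] by metis
 have Wc: "W <= CG" "\<one> : W" using W V compactin_subset_carrier by auto
 obtain N where N: "!!n x. int N <= n ==> x : spow W 3 ==> act n x : V"
  using act_compact_eventually[OF spow_compact[OF W(1)] V(1,2)] by metis
 \<comment> \<open>Three factors from \<alpha>^j(W) then stay in \<open>W\<close>, which keeps
   translates of an exit point away from the range of the gauge.\<close>
 define j where "j = N"
 define Q where "Q = act (int j) ` W"
 have Qc: "Q <= CG" "compactin T Q" using Wc W compact_act by (auto simp: Q_def)
 have Qi: "inv x : Q" if "x : Q" for x using that W(2) Wc by (auto simp: Q_def act_inv[symmetric] subset_iff)
 have Q3: "spow Q 3 <= W"
 proof -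
  have "spow Q 3 = act (int j) ` spow W 3" unfolding Q_def by (rule act_spow[OF Wc(1), symmetric])
  then show ?thesis using N[of "int j"] V(3) by (auto simp: j_def)
 qed
 obtain L where L: "haar L" by (rule haar_exists)
 have c1: "compactin T {\<one>}" by simp
 have oQ: "openin T (act (int j) ` V)" "{\<one>} <= act (int j) ` V" using V open_act one_in_act by auto
 obtain r0 where r0: "r0 : Cp" "r0 \<one> = 1" "!!x. x : CG ==> x ~: act (int j) ` V ==> r0 x = 0"
  using bump[OF c1 oQ] by (metis singletonI)
 have Lr0: "0 < L r0" using haar_pos[OF L r0(1), of "\<one>"] r0(2) by simp
 define r where "r x = inverse (L r0) * r0 x" for x
 have r: "r : Cp" using r0(1) Lr0 Cc_cmult by (auto simp: Cp_def r_def[abs_def])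
 have Lr: "L r = 1" unfolding r_def[abs_def] using haar_scale[OF L Cp_Cc[OF r0(1)]] Lr0 by simp
 have rQ: "x : Q" if "x : CG" "r x ~= 0" for x using r0(3) that V(3) by (auto simp: r_def Q_def)
 \<comment> \<open>The gain \<open>M n\<close> is shared by at most \<open>2 * C^j * M n\<close>
   steps.\<close>
 define c where "c = 1 / (2 * real (C ^ j))"
 have c: "0 < c" using M(4) by (simp add: c_def)
 define P where "P n f p w \<longleftrightarrow> rcont f & (ALL x:CG. ALL w:act (int (n + j)) ` W. \<bar>f (x \<otimes> w) - f x\<bar> <= 2)
  & p : W & w : act (int (n + j)) ` W & c <= L (%g. r g * (f (g \<otimes> p \<otimes> w) - f (g \<otimes> p)))" for n :: nat and f p w
 have "EX f p w. P n f p w" for n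
 proof -
  define X where "X = act (int (n + j)) ` W"
  have X: "X <= CG" "compactin T X" "openin T (act (int (n + j)) ` V)" "\<one> : act (int (n + j)) ` V" "act (int (n + j)) ` V <= X"
   unfolding X_def using Wc W(1) V one_in_act[OF V(2)] by (auto intro: compact_act open_act)
  have Xi: "inv x : X" if "x : X" for x using that W(2) Wc by (auto simp: X_def act_inv[symmetric] subset_iff)
  obtain f where f: "rcont f" "!!x w. x : CG ==> w : X ==> \<bar>f (x \<otimes> w) - f x\<bar> <= 2"
   "!!x. x : Q ==> f x = 0" "!!x. x : CG ==> x ~: Q <#> spow X (M n) ==> f x = real (M n)"
   using gauge[OF Qc(2) X(2-5) Xi, of "M n"] by metis
  obtain y where y: "y : spow X (Suc (M (n + j)))" "y ~: W" using M(2)[of "n + j"] by (auto simp: X_def)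
  have yc: "y : CG" using y spow_carrier[OF X(1)] by blast
  obtain p where p: "p 0 = \<one>" "p (Suc (M (n + j))) = y" "!!k. k < Suc (M (n + j)) ==> EX w:X. p (Suc k) = p k \<otimes> w"
   "!!k. k <= Suc (M (n + j)) ==> p k : spow X k" using spow_path[OF X(1) y(1)] by metis
  have pc: "p k : CG" if "k <= Suc (M (n + j))" for k using p(4)[OF that] spow_carrier[OF X(1)] by blast
  have "act (int j) ` act (int n) ` W = X" using act_image_add[OF Wc(1), of "int j" "int n"] by (simp add: X_def add.commute)
  then have "spow X (M n) = act (int j) ` spow (act (int n) ` W) (M n)"
   using act_spow[of "act (int n) ` W" "int j" "M n"] Wc(1) by (metis act_closed image_subset_iff subsetD)
  then have XQ: "spow X (M n) <= Q" using M(1)[of n] by (auto simp: Q_def)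
  \<comment> \<open>As \<open>X^(M n)\<close> lies in \<open>Q\<close>, the contrary would put
    \<open>y\<close> into \<open>Q^-1 Q Q\<close>, hence into \<open>W\<close>.\<close>
  have far: "g \<otimes> y ~: Q <#> spow X (M n)" if g: "g : Q" for g
  proof
   assume "g \<otimes> y : Q <#> spow X (M n)"
   then obtain a d where ad: "a : Q" "d : Q" "g \<otimes> y = a \<otimes> d" using XQ by (auto simp: mem_set_mult)
   have gc: "g : CG" "a : CG" "d : CG" using g ad Qc by auto
   have "y = inv g \<otimes> (g \<otimes> y)" using gc yc by (simp add: m_assoc[symmetric])
   then have "y = (\<one> \<otimes> inv g \<otimes> a) \<otimes> d" unfolding ad(3) using gc by (simp add: m_assoc)
   moreover have "(\<one> \<otimes> inv g \<otimes> a) \<otimes> d : spow Q 3" unfolding numeral_3_eq_3 using ad Qi[OF g] by (auto intro!: set_multI)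
   ultimately show False using y Q3 by blast
  qed
  define F where "F k g = r g * f (g \<otimes> p k)" for k g
  have cf: "rcont (%g. f (g \<otimes> s))" if "s : CG" for s
  proof -
   have "continuous_map T T (%x. x \<otimes> s)" using that by (intro continuous_intros)
   from continuous_map_compose[OF this f(1)] show ?thesis by (simp add: o_def)
  qed
  have FC: "F k : Cc" if "k <= Suc (M (n + j))" for k unfolding F_def using Cc_mult[OF Cp_Cc[OF r] cf[OF pc[OF that]]] .
  have "(\<Sum>k<Suc (M (n + j)). L (F (Suc k)) - L (F k)) = L (F (Suc (M (n + j)))) - L (F 0)"
   by (rule sum_lessThan_telescope)
  also have "L (F (Suc (M (n + j)))) = L (%g. real (M n) * r g)"
  proof (rule haar_cong[OF L])
   fix g assume g: "g : CG"
   show "F (Suc (M (n + j))) g = real (M n) * r g"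
    using f(4)[of "g \<otimes> y"] far[of g] rQ[OF g] g yc by (cases "r g = 0") (auto simp: F_def p(2))
  qed
  also have "... = real (M n)" using haar_scale[OF L Cp_Cc[OF r]] Lr by simp
  also have "L (F 0) = L (%g. 0 * r g)"
  proof (rule haar_cong[OF L])
   fix g assume g: "g : CG"
   show "F 0 g = 0 * r g" using f(3)[of g] rQ[OF g] g by (cases "r g = 0") (auto simp: F_def p(1))
  qed
  also have "... = 0" using haar_scale[OF L Cp_Cc[OF r], of 0] by simp
  finally have tel: "(\<Sum>k<Suc (M (n + j)). L (F (Suc k)) - L (F k)) = real (M n)" by simp
  have "EX k<Suc (M (n + j)). c <= L (F (Suc k)) - L (F k)"
  proof (rule ccontr)
   assume "~ ?thesis"
   then have "(\<Sum>k<Suc (M (n + j)). L (F (Suc k)) - L (F k)) < (\<Sum>k<Suc (M (n + j)). c)" by (intro sum_strict_mono) auto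
   then have "real (M n) < real (Suc (M (n + j))) * c" using tel by simp
   also have "... <= (2 * real (M (n + j))) * c" using c M(3)[of "n + j"] by (intro mult_right_mono) auto
   also have "... <= (2 * real (C ^ j * M n)) * c" using c M(5)[of n j] by (intro mult_right_mono) (auto simp flip: of_nat_mult of_nat_power)
   also have "... = real (M n)" using M(4) by (simp add: c_def)
   finally show False by simp
  qed
  then obtain k where k: "k < Suc (M (n + j))" "c <= L (F (Suc k)) - L (F k)" by blast
  obtain w where w: "w : X" "p (Suc k) = p k \<otimes> w" using p(3)[OF k(1)] by blast
  have kle: "k <= Suc (M (n + j))" "Suc k <= Suc (M (n + j))" using k by auto
  have "spow X k <= spow X (M (n + j))" by (rule spow_le[OF X(1)]) (use X k in auto)
  then have "p k : W" using p(4)[OF kle(1)] M(1)[of "n + j"] by (auto simp: X_def)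
  have wc: "w : CG" using w X by auto
  have "L (F (Suc k)) - L (F k) = L (%g. F (Suc k) g - F k g)" using haar_diff[OF L FC[OF kle(2)] FC[OF kle(1)]] by simp
  also have "... = L (%g. r g * (f (g \<otimes> p k \<otimes> w) - f (g \<otimes> p k)))"
   by (rule haar_cong[OF L]) (use pc[OF kle(1)] wc in \<open>simp add: F_def w(2) m_assoc right_diff_distrib\<close>)
  finally have "c <= L (%g. r g * (f (g \<otimes> p k \<otimes> w) - f (g \<otimes> p k)))" using k by simp
  then have "P n f (p k) w" using f(1,2) w(1) \<open>p k : W\<close> unfolding X_def P_def by blast
  then show ?thesis by blast
 qed
 then obtain f p w where "!!n. P n (f n) (p n) (w n)" by metis
 then show ?thesis using L r Lr c unfolding P_def by blast
qed

text \<open>\<open>H n z\<close> is the mean increment of the gauge \<open>f n\<close> under right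
  multiplication by \<alpha>^(n+j)(z), based at \<open>p n\<close>. Its additivity defect comes from
  translating the weight \<open>r\<close> by a conjugate of \<alpha>^(n+j)(z), which tends to the
  identity, so a cluster point of the \<open>H n\<close> is additive. It is nonzero because the
  steps \<open>w n\<close> give \<open>H n\<close> a value of at least \<open>c\<close> somewhere on
  \<open>W\<close>.\<close>

theorem rhom_exists:
 assumes conn: "connected_space T" and nt: "CG ~= {\<one>}"
 obtains h z where "rhom G h" "z : CG" "h z ~= 0"
proof -
 obtain V W where VW: "openin T V" "compactin T W" "\<one> : V" "V <= W" "!!x. x : W ==> inv x : W"
  "!!x. x : W ==> contr G x : W" using base_nbhd[of "CG"] by (metis one_closed openin_topspace topspace_T)
 have Wc: "W <= CG" "\<one> : W" using VW compactin_subset_carrier by auto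
 obtain L r c j f p w where "haar L & r : Cp & L r = 1 & 0 < c &
  (ALL n::nat. rcont (f n) & (ALL x:CG. ALL w:act (int (n + j)) ` W. \<bar>f n (x \<otimes> w) - f n x\<bar> <= 2) &
   p n : W & w n : act (int (n + j)) ` W & c <= L (%g. r g * (f n (g \<otimes> p n \<otimes> w n) - f n (g \<otimes> p n))))"
  using stages[OF conn nt VW(1,3,4,2)] VW(5,6) by blast
 then have st: "haar L" "r : Cp" "L r = 1" "0 < c"
  "!!n. rcont (f n)" "!!n::nat. ALL x:CG. ALL w:act (int (n + j)) ` W. \<bar>f n (x \<otimes> w) - f n x\<bar> <= 2"
  "!!n. p n : W" "!!n. w n : act (int (n + j)) ` W" "!!n. c <= L (%g. r g * (f n (g \<otimes> p n \<otimes> w n) - f n (g \<otimes> p n)))"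
  by simp_all
 note L = st(1) and r = st(2) and fcont = st(5)
 have pc: "p n : CG" for n using st(7) Wc by blast
 define a where "a n z = act (int (n + j)) z" for n and z
 have ac: "a n z : CG" if "z : CG" for n z using that by (simp add: a_def)
 have lip: "\<bar>f n (x \<otimes> a n z) - f n x\<bar> <= 2 * real k" if "x : CG" "z : spow W k" for n x z k
  using that(2)
 proof (induction k arbitrary: z)
  case 0 then show ?case using that by (simp add: a_def)
 next
  case (Suc k)
  then obtain u v where uv: "u : spow W k" "v : W" "z = u \<otimes> v" by (auto simp: mem_set_mult)
  have c: "u : CG" "v : CG" using uv Wc spow_carrier[OF Wc(1)] by auto
  have "\<bar>f n ((x \<otimes> a n u) \<otimes> a n v) - f n (x \<otimes> a n u)\<bar> <= 2" using st(6)[of n] that(1) ac[OF c(1)] uv(2) by (auto simp: a_def)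
  moreover have "x \<otimes> a n z = (x \<otimes> a n u) \<otimes> a n v" using that(1) c uv(3) ac by (simp add: a_def act_mult m_assoc)
  ultimately show ?case using Suc.IH[OF uv(1)] by simp
 qed
 define D where "D n z g = f n (g \<otimes> p n \<otimes> a n z) - f n (g \<otimes> p n)" for n z g
 have Dcont: "rcont (D n z)" if "z : CG" for n z
 proof -
  have "continuous_map T T (%g. g \<otimes> p n \<otimes> a n z)" "continuous_map T T (%g. g \<otimes> p n)" using pc ac[OF that] by (intro continuous_intros; simp)+
  from this[THEN continuous_map_compose[OF _ fcont[of n]]] show ?thesis unfolding D_def by (intro continuous_intros) (auto simp: o_def)
 qed
 have Db: "\<bar>D n z g\<bar> <= 2 * real k" if "z : spow W k" "g : CG" for n z g k
  using lip[of "g \<otimes> p n" z k n] that pc by (simp add: D_def)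
 define H where "H n z = (if z : CG then L (%g. r g * D n z g) else 0)" for n z
 have Cr: "(%g. r g * D n z g) : Cc" if "z : CG" for n z using Cc_mult[OF Cp_Cc[OF r] Dcont[OF that]] .
 have Hb: "\<bar>H n z\<bar> <= 2 * real k" if z: "z : spow W k" for n z k
 proof -
  have zc: "z : CG" using z spow_carrier[OF Wc(1)] by blast
  have "\<bar>L (%g. r g * D n z g)\<bar> <= L (%g. 2 * real k * r g)"
  proof (rule haar_abs_le[OF L Cr[OF zc] Cc_cmult[OF Cp_Cc[OF r]]])
   fix g assume g: "g : CG"
   have "\<bar>r g * D n z g\<bar> = r g * \<bar>D n z g\<bar>" using Cp_nonneg[OF r g] by (simp add: abs_mult)
   also have "... <= r g * (2 * real k)" using Db[OF z g] Cp_nonneg[OF r g] by (intro mult_left_mono)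
   finally show "\<bar>r g * D n z g\<bar> <= 2 * real k * r g" by (simp add: mult.commute)
  qed
  also have "... = 2 * real k" using haar_scale[OF L Cp_Cc[OF r]] st(3) by simp
  finally show ?thesis using zc by (simp add: H_def)
 qed
 have defect: "EX N. ALL n>=N. ALL z:spow W k. ALL z':spow W k. \<bar>H n (z \<otimes> z') - H n z - H n z'\<bar> <= e" if e: "0 < e" for k e
 proof -
  define e' where "e' = e / (2 * real k + 1)"
  have e': "0 < e'" "2 * real k * e' <= e" using e by (auto simp: e'_def field_simps)
  obtain U where U: "openin T U" "\<one> : U" "!!c. c : U ==> L (%g. \<bar>r (g \<otimes> inv c) - r g\<bar>) <= e'"
   using haar_L1[OF L Cp_Cc[OF r] e'(1)] by metis
  have c1: "compactin T {\<one>}" by simp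
  have cm: "continuous_map (prod_topology T T) T (%z. fst z \<otimes> snd z \<otimes> inv (fst z))" by (intro continuous_intros)
  have in_U: "x \<otimes> y \<otimes> inv x : U" if "x : W" "y : {\<one>}" for x y using that Wc U by auto
  obtain A B where AB: "openin T A" "openin T B" "W <= A" "{\<one>} <= B" "!!x y. x : A ==> y : B ==> x \<otimes> y \<otimes> inv x : U"
   by (rule Wallace[OF VW(2) c1 U(1) cm in_U]) auto
  obtain N where N: "!!n x. int N <= n ==> x : spow W k ==> act n x : B"
   using act_compact_eventually[OF spow_compact[OF VW(2)] AB(2)] AB(4) by (metis insert_subset)
  have "\<bar>H n (z \<otimes> z') - H n z - H n z'\<bar> <= e" if n: "N <= n" and z: "z : spow W k" "z' : spow W k" for n z z'
  proof -
   have zc: "z : CG" "z' : CG" using z spow_carrier[OF Wc(1)] by auto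
   define d where "d = p n \<otimes> a n z \<otimes> inv (p n)"
   have dc: "d : CG" using pc ac[OF zc(1)] by (simp add: d_def)
   have "d : U" unfolding d_def using AB(3,5) st(7)[of n] N[of "int (n + j)" z] n z by (auto simp: a_def)
   have tr: "(%g. r (g \<otimes> inv d) * D n z' g) : Cc" using Cc_mult[OF Cc_transl[OF Cp_Cc[OF r]] Dcont[OF zc(2)]] dc by simp
   have "H n (z \<otimes> z') - H n z = L (%g. r g * D n (z \<otimes> z') g - r g * D n z g)"
    using haar_diff[OF L Cr Cr] zc by (simp add: H_def)
   also have "... = L (%g. (%g. r (g \<otimes> inv d) * D n z' g) (g \<otimes> d))"
   proof (rule haar_cong[OF L])
    fix g assume g: "g : CG"
    have 1: "g \<otimes> d \<otimes> p n = g \<otimes> p n \<otimes> a n z" using g pc ac[OF zc(1)] by (simp add: d_def m_assoc)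
    have 2: "g \<otimes> p n \<otimes> a n (z \<otimes> z') = g \<otimes> p n \<otimes> a n z \<otimes> a n z'" using g pc ac zc by (simp add: a_def act_mult m_assoc)
    have 3: "g \<otimes> d \<otimes> inv d = g" using g dc by (simp add: m_assoc)
    show "r g * D n (z \<otimes> z') g - r g * D n z g = r (g \<otimes> d \<otimes> inv d) * D n z' (g \<otimes> d)"
     unfolding D_def 1 2 3 by (simp add: algebra_simps)
   qed
   also have "... = L (%g. r (g \<otimes> inv d) * D n z' g)" using haar_transl[OF L tr dc] by simp
   finally have "H n (z \<otimes> z') - H n z - H n z' = L (%g. r (g \<otimes> inv d) * D n z' g - r g * D n z' g)"
    using haar_diff[OF L tr Cr[OF zc(2)]] zc by (simp add: H_def)
   also have "\<bar>...\<bar> <= L (%g. 2 * real k * \<bar>r (g \<otimes> inv d) - r g\<bar>)"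
   proof (rule haar_abs_le[OF L Cc_diff[OF tr Cr[OF zc(2)]]])
    show "(%g. 2 * real k * \<bar>r (g \<otimes> inv d) - r g\<bar>) : Cc"
     using Cc_cmult[OF Cc_abs[OF Cc_diff[OF Cc_transl[OF Cp_Cc[OF r]] Cp_Cc[OF r]]]] dc by simp
    fix g assume g: "g : CG"
    have "\<bar>r (g \<otimes> inv d) * D n z' g - r g * D n z' g\<bar> = \<bar>D n z' g\<bar> * \<bar>r (g \<otimes> inv d) - r g\<bar>"
     by (simp add: abs_mult[symmetric] algebra_simps)
    then show "\<bar>r (g \<otimes> inv d) * D n z' g - r g * D n z' g\<bar> <= 2 * real k * \<bar>r (g \<otimes> inv d) - r g\<bar>"
     using mult_right_mono[OF Db[OF z(2) g, of n], of "\<bar>r (g \<otimes> inv d) - r g\<bar>"] by simp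
   qed
   also have "... = 2 * real k * L (%g. \<bar>r (g \<otimes> inv d) - r g\<bar>)"
    using haar_scale[OF L Cc_abs[OF Cc_diff[OF Cc_transl[OF Cp_Cc[OF r]] Cp_Cc[OF r]]]] dc by simp
   also have "... <= 2 * real k * e'" using U(3)[OF \<open>d : U\<close>] by (intro mult_left_mono) auto
   finally show ?thesis using e' by simp
  qed
  then show ?thesis by blast
 qed
 have gen: "(\<Union>k. spow W k) = CG" using connected_generated[OF conn Wc(1) VW(5,1,3,4)] .
 \<comment> \<open>Word length with respect to \<open>W\<close> bounds \<open>H n\<close> pointwise
   and uniformly in \<open>n\<close>, as a cluster point requires.\<close>
 define bd where "bd z = (if z : CG then 2 * real (LEAST k. z : spow W k) else 0)" for z
 have Hbd: "\<bar>H n z\<bar> <= bd z" for n z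
 proof (cases "z : CG")
  case True
  then have "z : spow W (LEAST k. z : spow W k)" using gen by (metis LeastI UN_iff)
  then show ?thesis using Hb True by (simp add: bd_def)
 qed (simp add: H_def bd_def)
 have "- bd z <= H n z" "H n z <= bd z" for n z using Hbd[of n z] by (auto simp: abs_le_iff)
 then obtain h where h: "!!z. - bd z <= h z" "!!z. h z <= bd z" "!!J e N. finite J ==> 0 < e ==> EX n>=N. ALL z:J. \<bar>H n z - h z\<bar> < e"
  using cluster_point[of "%z. - bd z" H bd] by metis
 have add: "h (z \<otimes> z') = h z + h z'" if z: "z : CG" "z' : CG" for z z'
 proof -
  obtain k k' where "z : spow W k" "z' : spow W k'" using z gen by blast
  then have zk: "z : spow W (max k k')" "z' : spow W (max k k')"
   using spow_le[OF Wc, of k "max k k'"] spow_le[OF Wc, of k' "max k k'"] by auto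
  have "\<bar>h (z \<otimes> z') - h z - h z'\<bar> <= 4 * e" if e: "0 < e" for e
  proof -
   obtain N where N: "ALL n>=N. ALL z:spow W (max k k'). ALL z':spow W (max k k'). \<bar>H n (z \<otimes> z') - H n z - H n z'\<bar> <= e" using defect[OF e] by blast
   obtain n where n: "N <= n" "ALL x:{z, z', z \<otimes> z'}. \<bar>H n x - h x\<bar> < e" using h(3)[of "{z, z', z \<otimes> z'}" e N] e by auto
   have "\<bar>H n (z \<otimes> z') - H n z - H n z'\<bar> <= e" using N n(1) zk by blast
   then show ?thesis using n(2) by (auto simp: abs_le_iff abs_less_iff)
  qed
  from this[of "\<bar>h (z \<otimes> z') - h z - h z'\<bar> / 8"] show ?thesis by (cases "h (z \<otimes> z') - h z - h z' = 0") auto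
 qed
 have "\<bar>h z\<bar> <= 2" if "z : V" for z
 proof -
  have "z : spow W 1" using that VW(4) spow_1[OF Wc(1)] by auto
  then have "(LEAST k. z : spow W k) <= 1" by (rule Least_le)
  then have "bd z <= 2" unfolding bd_def by simp
  then show ?thesis using h(1)[of z] h(2)[of z] by linarith
 qed
 then have "rhom G h" using bounded_additive_rhom[of h V 2] add VW by blast
 \<comment> \<open>A cluster point sees only finitely many points at a time. So the value at the
   varying point \<alpha>^(-n-j)(w n) is moved to one of the finitely many \<open>z\<close> in
   \<open>F\<close>. The other factor \<open>v\<close> contributes little, because its first
   \<open>k\<close> powers stay in \<open>W\<close>, where \<open>H n\<close> is at most 2 in
   modulus and almost additive.\<close>
 moreover have "EX z:CG. h z ~= 0"
 proof -
  obtain k :: nat where k: "16 / c < k" using reals_Archimedean2 by blast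
  then have k0: "0 < k" using st(4) by (cases k) (auto simp: field_simps)
  obtain O1 where O1: "openin T O1" "\<one> : O1" "spow O1 k <= V" using nbhd_spow[OF VW(1,3)] by metis
  have O1c: "O1 <= CG" using O1 openin_subset_carrier by blast
  have O1i: "spow O1 i <= W" if "i <= k" for i using spow_le[OF O1c O1(2) that] O1(3) VW(4) by blast
  obtain F where F: "finite F" "F <= W" "!!x. x : W ==> EX f:F. EX v:O1. x = f \<otimes> v" using finite_translates[OF VW(2) O1(1,2)] by metis
  have W1: "spow W 1 = W" by (rule spow_1[OF Wc(1)])
  have "0 < c / 16" using st(4) by simp
  from defect[OF this, of 1] obtain N where N: "ALL n>=N. ALL z:W. ALL z':W. \<bar>H n (z \<otimes> z') - H n z - H n z'\<bar> <= c / 16" unfolding W1 by blast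
  have "EX z:F. c / 2 <= H n z" if n: "N <= n" for n
  proof -
   have small: "\<bar>H n v\<bar> <= c / 4" if v: "v : O1" for v
   proof -
    have vc: "v : CG" using v O1c by blast
    have vi: "v [^] i : W" if "i <= k" for i :: nat using spow_pow[OF O1c v, of i] O1i[OF that] by blast
    have "v [^] (1::nat) : W" by (rule vi) (use k0 in simp)
    then have vW: "v : W" using vc by simp
    have "\<bar>H n (v [^] i) - real i * H n v\<bar> <= real i * (c / 16) + c / 16" if "i <= k" for i :: nat
     using that
    proof (induction i)
     case 0
     have "\<bar>H n (\<one> \<otimes> \<one>) - H n \<one> - H n \<one>\<bar> <= c / 16" using N n Wc by blast
     then show ?case by simp
    next
     case (Suc i)
     have "\<bar>H n (v [^] i \<otimes> v) - H n (v [^] i) - H n v\<bar> <= c / 16" using N n vi[of i] vW Suc.prems by auto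
     moreover have "\<bar>H n (v [^] i) - real i * H n v\<bar> <= real i * (c / 16) + c / 16" using Suc by simp
     moreover have eqs: "real (Suc i) * H n v = real i * H n v + H n v" "real (Suc i) * (c / 16) = real i * (c / 16) + c / 16"
      by (simp_all add: algebra_simps)
     moreover have pw: "v [^] Suc i = v [^] i \<otimes> v" by simp
     ultimately show ?case unfolding pw eqs by linarith
    qed
    from this[of k] have 1: "\<bar>H n (v [^] k) - real k * H n v\<bar> <= real k * (c / 16) + c / 16" by simp
    have 2: "\<bar>H n (v [^] k)\<bar> <= 2" using Hb[of "v [^] k" 1 n] vi[of k] W1 by simp
    have "real k * \<bar>H n v\<bar> = \<bar>real k * H n v\<bar>" by (simp add: abs_mult)
    also have "... <= real k * (c / 16) + c / 16 + 2" using 1 2 by linarith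
    also have "... <= real k * (c / 4)"
    proof -
     have "16 < real k * c" using k st(4) by (simp add: field_simps)
     moreover have "1 * c <= real k * c" using k0 st(4) by (intro mult_right_mono) auto
     ultimately show ?thesis by (auto simp: field_simps)
    qed
    finally show ?thesis using k0 by simp
   qed
   obtain z v where zv: "z : F" "v : O1" "act (- int (n + j)) (w n) = z \<otimes> v"
   proof -
    obtain x where x: "x : W" "w n = act (int (n + j)) x" using st(8)[of n] by blast
    have "act (- int (n + j)) (w n) = x" unfolding x(2) by (rule act_minus(1)) (use x Wc in blast)
    then have "act (- int (n + j)) (w n) : W" using x by simp
    then show thesis using F(3) that by blast
   qed
   have vW: "v : W" using O1i[of 1] zv(2) spow_1[OF O1c] k0 by auto
   have wc: "w n : CG" using st(8)[of n] Wc by auto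
   have "a n (act (- int (n + j)) (w n)) = w n" unfolding a_def by (rule act_minus(2)[OF wc])
   then have "c <= H n (z \<otimes> v)" using st(9)[of n] wc unfolding zv(3)[symmetric] by (simp add: H_def D_def)
   moreover have "\<bar>H n (z \<otimes> v) - H n z - H n v\<bar> <= c / 16" using N n zv F vW by blast
   ultimately have "c / 2 <= H n z" using small[OF zv(2)] by linarith
   then show ?thesis using zv by blast
  qed
  moreover obtain n where n: "N <= n" "ALL z:F. \<bar>H n z - h z\<bar> < c / 4" using h(3)[OF F(1), of "c / 4" N] st(4) by auto
  ultimately obtain z where z: "z : F" "c / 2 <= H n z" by blast
  then have "h z ~= 0" using n(2) st(4) by force
  then show ?thesis using z F Wc by blast
 qed
 ultimately show thesis using that by blast
qed

end

subsection \<open>The identity component\<close>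

context contraction begin

definition comp0 :: "'a set" where "comp0 = connected_component_of_set T \<one>"

lemma comp0_connected: "connectedin T comp0"
 unfolding comp0_def by (rule connectedin_connected_component_of)

lemma comp0_maximal: "connectedin T S ==> \<one> : S ==> S <= comp0"
 unfolding comp0_def by (rule connected_component_of_maximal)

lemma comp0_closed: "closedin T comp0"
 unfolding comp0_def by (rule closedin_connected_component_of)

lemma comp0_one: "\<one> : comp0"
 by (simp add: comp0_def connected_component_of_refl)

lemma comp0_carrier: "comp0 <= CG"
 using closedin_subset_carrier comp0_closed by blast

lemma comp0_image:
 assumes "continuous_map T T f" "f \<one> = \<one>" shows "f ` comp0 <= comp0"
 by (rule comp0_maximal) (use connectedin_continuous_map_image[OF assms(1) comp0_connected] assms(2) comp0_one in force)+

lemma comp0_mult: assumes "x : comp0" "y : comp0" shows "inv x \<otimes> y : comp0"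
proof -
 have xc: "x : CG" using assms comp0_carrier by blast
 have "continuous_map T T (%z. inv x \<otimes> z)" using xc by (intro continuous_intros) auto
 from connectedin_continuous_map_image[OF this comp0_connected]
 have "(%z. inv x \<otimes> z) ` comp0 <= comp0" by (rule comp0_maximal) (use assms xc in \<open>auto intro!: image_eqI[of _ _ x]\<close>)
 then show ?thesis using assms by blast
qed

lemma comp0_subgroup: "subgroup comp0 G"
proof (rule subgroupI[OF comp0_carrier])
 show inv: "inv x : comp0" if "x : comp0" for x using comp0_mult[OF that comp0_one] that comp0_carrier by auto
 show "x \<otimes> y : comp0" if "x : comp0" "y : comp0" for x y
  using comp0_mult[OF inv[OF that(1)] that(2)] that comp0_carrier by auto
qed (use comp0_one in auto)

lemma comp0_conj: assumes "g : CG" "x : comp0" shows "g \<otimes> x \<otimes> inv g : comp0"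
proof -
 have "continuous_map T T (%z. g \<otimes> z \<otimes> inv g)" using assms by (intro continuous_intros) auto
 from comp0_image[OF this] show ?thesis using assms by auto
qed

lemma act_comp0: "act k ` comp0 = comp0"
proof -
 have le: "act k ` comp0 <= comp0" for k by (rule comp0_image[OF continuous_act0]) simp
 have "comp0 <= act k ` comp0"
 proof
  fix x assume x: "x : comp0"
  then have "act (- k) x : comp0" using le by blast
  moreover have "act k (act (- k) x) = x" using x comp0_carrier by auto
  ultimately show "x : act k ` comp0" by (metis imageI)
 qed
 then show ?thesis using le by blast
qed

lemma contr_comp0: "contr G ` comp0 = comp0"
 using act_comp0[of 1] by (simp add: act_1 cong: image_cong_simp)

lemma coset_comp0:
 assumes "x : CG" "y : CG" shows "x <# comp0 = y <# comp0 \<longleftrightarrow> inv x \<otimes> y : comp0"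
proof -
 interpret C: subgroup comp0 G by (rule comp0_subgroup)
 have mem: "z : x <# comp0 \<longleftrightarrow> inv x \<otimes> z : comp0" if "x : CG" "z : CG" for x z
 proof
  assume "z : x <# comp0" then show "inv x \<otimes> z : comp0" using that comp0_carrier by (auto simp: l_coset_def m_assoc[symmetric] subset_iff)
 next
  assume "inv x \<otimes> z : comp0"
  moreover have "x \<otimes> (inv x \<otimes> z) = z" using that by (simp add: m_assoc[symmetric])
  ultimately show "z : x <# comp0" unfolding l_coset_def by force
 qed
 show ?thesis
 proof
  assume "x <# comp0 = y <# comp0"
  moreover have "y : y <# comp0" using mem[OF assms(2,2)] assms comp0_one by simp
  ultimately show "inv x \<otimes> y : comp0" using mem assms by blast
 next
  assume *: "inv x \<otimes> y : comp0"
  have "z : x <# comp0 \<longleftrightarrow> z : y <# comp0" if z: "z : CG" for z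
  proof -
   have "inv x \<otimes> z = (inv x \<otimes> y) \<otimes> (inv y \<otimes> z)" using assms z by (simp add: m_assoc[symmetric]) (simp add: m_assoc)
   moreover have "inv y \<otimes> z = inv (inv x \<otimes> y) \<otimes> (inv x \<otimes> z)" using assms z
    by (simp add: inv_mult_group m_assoc) (simp add: m_assoc[symmetric])
   ultimately show ?thesis using mem z assms * by (metis C.m_closed C.m_inv_closed)
  qed
  moreover have "x <# comp0 <= CG" "y <# comp0 <= CG" using assms comp0_carrier by (auto simp: l_coset_def)
  ultimately show "x <# comp0 = y <# comp0" by blast
 qed
qed

text \<open>A van Dantzig theorem relative to the identity component: the space of cosets of the
 component is totally disconnected, so it has a compact open neighbourhood of the base point, and
 the stabilizer of the latter is an open subgroup that is compact modulo the component.\<close>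

lemma open_subgroup_cocompact:
 obtains O1 W where "subgroup O1 G" "openin T O1" "comp0 <= O1" "compactin T W" "O1 <= W <#> comp0"
proof -
 interpret C: subgroup comp0 G by (rule comp0_subgroup)
 define p where "p x = x <# comp0" for x
 define Q where "Q = p ` CG"
 have peq: "p x = p y \<longleftrightarrow> inv x \<otimes> y : comp0" if "x : CG" "y : CG" for x y
  unfolding p_def using coset_comp0[OF that] .
 define Y where "Y = topology (%U. U <= Q & openin T {x : CG. p x : U})"
 have isY: "istopology (%U. U <= Q & openin T {x : CG. p x : U})"
  unfolding istopology_def
 proof (intro conjI allI impI)
  fix S U assume "S <= Q & openin T {x : CG. p x : S}" "U <= Q & openin T {x : CG. p x : U}"
  moreover have "{x : CG. p x : S \<inter> U} = {x : CG. p x : S} \<inter> {x : CG. p x : U}" by auto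
  ultimately show "S \<inter> U <= Q" "openin T {x : CG. p x : S \<inter> U}" by auto
 next
  fix \<K> assume K: "ALL U:\<K>. U <= Q & openin T {x : CG. p x : U}"
  have "{x : CG. p x : \<Union>\<K>} = (\<Union>U\<in>\<K>. {x : CG. p x : U})" by auto
  then show "\<Union>\<K> <= Q" "openin T {x : CG. p x : \<Union>\<K>}" using K by auto
 qed
 have oY: "openin Y U \<longleftrightarrow> U <= Q & openin T {x : CG. p x : U}" for U
  unfolding Y_def topology_inverse'[OF isY] by simp
 have tY: "topspace Y = Q"
 proof -
  have "{x : CG. p x : Q} = topspace T" by (auto simp: Q_def)
  then have "openin Y Q" by (simp only: oY openin_topspace subset_refl simp_thms)
  then have "Q <= topspace Y" by (rule openin_subset)
  moreover have "openin Y (topspace Y)" by simp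
  ultimately show ?thesis unfolding oY by blast
 qed
 have cont: "continuous_map T Y p"
  unfolding continuous_map_def by (auto simp: tY Q_def oY)
 have opn: "open_map T Y p"
  unfolding open_map_def
 proof (intro allI impI)
  fix V assume V: "openin T V"
  have "{x : CG. p x : p ` V} = V <#> comp0"
  proof (intro equalityI subsetI)
   fix x assume "x : {x : CG. p x : p ` V}"
   then obtain v where v: "x : CG" "v : V" "p v = p x" by auto
   then have vc: "v : CG" using V openin_carrier by blast
   have "v \<otimes> (inv v \<otimes> x) : V <#> comp0" using v peq[OF vc v(1)] by (intro set_multI) auto
   then show "x : V <#> comp0" using v vc by (simp add: m_assoc[symmetric])
  next
   fix x assume "x : V <#> comp0"
   then obtain v c where vc: "v : V" "c : comp0" "x = v \<otimes> c" by (auto simp: mem_set_mult)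
   then have c: "v : CG" "c : CG" using V openin_carrier comp0_carrier by auto
   then have "p v = p x" using peq[of v x] vc by (simp add: m_assoc[symmetric])
   then show "x : {x : CG. p x : p ` V}" using vc c by auto
  qed
  then have "openin T {x : CG. p x : p ` V}" using open_mult_right[OF V comp0_carrier] by simp
  moreover have "p ` V <= Q" using V openin_subset_carrier by (auto simp: Q_def)
  ultimately show "openin Y (p ` V)" unfolding oY by blast
 qed
 have surj: "p ` topspace T = topspace Y" by (simp add: tY Q_def)
 have lcY: "locally_compact_space Y" using locally_compact_space_continuous_open_map_image[OF cont opn surj loccomp] .
 have hY: "Hausdorff_space Y"
  unfolding Hausdorff_space_def
 proof (intro allI impI, elim conjE)
  fix a b assume ab: "a : topspace Y" "b : topspace Y" "a ~= b"
  obtain x y where xy: "x : CG" "y : CG" "a = p x" "b = p y" using ab by (auto simp: tY Q_def)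
  have c1: "compactin T {x}" "compactin T {y}" using xy by auto
  have op: "openin T (CG - comp0)" using comp0_closed openin_diff[OF openin_topspace, of T comp0] by simp
  have cm: "continuous_map (prod_topology T T) T (%z. inv (fst z) \<otimes> snd z)" by (intro continuous_intros)
  obtain V1 V2 where V: "openin T V1" "openin T V2" "{x} <= V1" "{y} <= V2" "!!u v. u : V1 ==> v : V2 ==> inv u \<otimes> v : CG - comp0"
   by (rule Wallace[OF c1 op cm]) (use xy ab peq in auto)
  have "disjnt (p ` V1) (p ` V2)"
  proof -
   have "p u ~= p v" if "u : V1" "v : V2" for u v
    using V(5)[OF that] peq openin_carrier[OF V(1) that(1)] openin_carrier[OF V(2) that(2)] by blast
   then show ?thesis by (auto simp: disjnt_def)
  qed
  then show "EX U V. openin Y U & openin Y V & a : U & b : V & disjnt U V"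
   using opn V xy unfolding open_map_def by (intro exI[of _ "p ` V1"] exI[of _ "p ` V2"]) auto
 qed
 have quo: "quotient_map T Y p" using continuous_open_imp_quotient_map[OF cont opn surj] .
 have fib: "{x : CG. p x = p y} = (%c. y \<otimes> c) ` comp0" if y: "y : CG" for y
 proof (intro equalityI subsetI)
  fix x assume "x : {x : CG. p x = p y}"
  then have x: "x : CG" "inv y \<otimes> x : comp0" using peq[of y x] y by auto
  moreover have "x = y \<otimes> (inv y \<otimes> x)" using x y by (simp add: m_assoc[symmetric])
  ultimately show "x : (%c. y \<otimes> c) ` comp0" by blast
 next
  fix x assume "x : (%c. y \<otimes> c) ` comp0"
  then obtain c where c: "c : comp0" "x = y \<otimes> c" by auto
  then have "c : CG" using comp0_carrier by auto
  then show "x : {x : CG. p x = p y}" using c peq[of y x] y by (simp add: m_assoc[symmetric])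
 qed
 \<comment> \<open>Cosets of the component are connected, so connected sets of cosets have connected
   preimages. This is what makes the component of the base point in the quotient a single
   point.\<close>
 have mono: "monotone_map T Y p"
  unfolding monotone_map_def
 proof (intro conjI ballI)
  fix a assume "a : topspace Y"
  then obtain y where y: "y : CG" "a = p y" by (auto simp: tY Q_def)
  have "continuous_map T T (%c. y \<otimes> c)" using y by (intro continuous_intros)
  from connectedin_continuous_map_image[OF this comp0_connected]
  show "connectedin T {x : topspace T. p x = a}" using fib[OF y(1)] y(2) by simp
 qed (use surj in auto)
 define e where "e = p \<one>"
 have eQ: "e : topspace Y" by (auto simp: e_def tY Q_def)
 have compY: "connected_component_of_set Y e = {e}"
 proof -
  let ?D = "connected_component_of_set Y e"
  have "connectedin T {x : topspace T. p x : ?D}"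
   by (rule connectedin_monotone_quotient_map_preimage[OF mono quo connectedin_connected_component_of]) (simp add: closedin_connected_component_of)
  then have "{x : topspace T. p x : ?D} <= comp0"
   by (rule comp0_maximal) (use eQ connected_component_of_refl[of Y e] in \<open>auto simp: e_def\<close>)
  then have "a = e" if "a : ?D" for a
  proof -
   have "a : topspace Y" using that connected_component_of_subset_topspace by fastforce
   then obtain x where x: "x : CG" "a = p x" by (auto simp: tY Q_def)
   then have "x : comp0" using that \<open>_ <= comp0\<close> by auto
   then show "a = e" using x peq[of "\<one>" x] by (simp add: e_def)
  qed
  then show ?thesis using eQ connected_component_of_refl[of Y e] by blast
 qed
 obtain V W where VW: "openin T V" "compactin T W" "\<one> : V" "V <= W" "!!x. x : W ==> inv x : W"
  using base_nbhd[of "CG"] by (metis one_closed openin_topspace topspace_T)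
 have pV: "openin Y (p ` V)" "e : p ` V" using opn VW unfolding open_map_def e_def by auto
 have sep: "separated_between Y {e} (topspace Y - p ` V)"
 proof (rule separated_between_compact_connected_component[OF lcY hY])
  show "{e} : connected_components_of Y" using connected_component_in_connected_components_of[of Y e] compY eQ by simp
  show "closedin Y (topspace Y - p ` V)" using pV by blast
  show "compactin Y {e}" using eQ by simp
  show "disjnt {e} (topspace Y - p ` V)" using pV by (auto simp: disjnt_def)
 qed
 then obtain B D where BD: "openin Y B" "openin Y D" "B \<union> D = topspace Y" "disjnt B D" "e : B" "topspace Y - p ` V <= D"
  unfolding separated_between_def by auto
 define B' where "B' = {x : CG. p x : B}"
 have oB: "openin T B'" using BD oY by (simp add: B'_def)
 have clB: "closedin T B'"
 proof -
  have "CG - B' = {x : CG. p x : D}" using BD(3,4) by (auto simp: B'_def disjnt_def tY Q_def)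
  then show ?thesis using BD(2) oY by (simp add: closedin_def B'_def)
 qed
 have Bc: "x \<otimes> c : B'" if "x : B'" "c : comp0" for x c
 proof -
  have "x : CG" "c : CG" using that comp0_carrier by (auto simp: B'_def)
  then have "p x = p (x \<otimes> c)" using peq[of x "x \<otimes> c"] that by (simp add: m_assoc[symmetric])
  then show ?thesis using that \<open>x : CG\<close> \<open>c : CG\<close> by (auto simp: B'_def)
 qed
 have BW: "EX w:B' \<inter> W. EX c:comp0. b = w \<otimes> c" if b: "b : B'" for b
 proof -
  have bc: "b : CG" "p b : B" using b by (auto simp: B'_def)
  then have "p b : p ` V" using BD(3,4,6) by (auto simp: disjnt_def)
  then obtain v where v: "v : V" "p b = p v" by blast
  have vc: "v : CG" using VW v openin_carrier by blast
  have "inv v \<otimes> b : comp0" using peq[OF vc bc(1)] v by simp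
  moreover have "b = v \<otimes> (inv v \<otimes> b)" using vc bc by (simp add: m_assoc[symmetric])
  moreover have "v : B' \<inter> W" using v vc bc VW by (auto simp: B'_def)
  ultimately show ?thesis by blast
 qed
 have K0: "compactin T (B' \<inter> W)" using closed_Int_compactin[OF clB VW(2)] .
 obtain V0 where V0: "openin T V0" "\<one> : V0" "!!x y. x : B' \<inter> W ==> y : V0 ==> y \<otimes> x : B'"
  using tube_left[OF K0 oB] by blast
 obtain V1 where V1: "openin T V1" "\<one> : V1" "V1 <= V0" "!!x. x : V1 ==> inv x : V1" using nbhd_sym[OF V0(1,2)] by metis
 \<comment> \<open>The stabilizer of the clopen set \<open>B'\<close>, which is a union of cosets of
   the component and compact modulo it.\<close>
 define O1 where "O1 = {x : CG. ALL b:B'. x \<otimes> b : B' & inv x \<otimes> b : B'}"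
 have B'c: "B' <= CG" by (auto simp: B'_def)
 have sO: "subgroup O1 G"
 proof (rule subgroupI)
  show "O1 ~= {}" using B'c by (auto simp: O1_def intro!: exI[of _ "\<one>"])
  show "inv a : O1" if "a : O1" for a using that by (auto simp: O1_def)
  show "a \<otimes> b : O1" if ab: "a : O1" "b : O1" for a b
  proof -
   have "a \<otimes> b \<otimes> x : B' & inv (a \<otimes> b) \<otimes> x : B'" if x: "x : B'" for x
   proof -
    have "a \<otimes> (b \<otimes> x) : B'" "inv b \<otimes> (inv a \<otimes> x) : B'" using ab x by (auto simp: O1_def)
    then show ?thesis using ab x B'c by (auto simp: O1_def m_assoc inv_mult_group subset_iff)
   qed
   then show ?thesis using ab by (auto simp: O1_def)
  qed
 qed (auto simp: O1_def)
 have V1O: "V1 <= O1"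
 proof
  fix v assume v: "v : V1"
  have "u \<otimes> b : B'" if u: "u : V1" and b: "b : B'" for u b
  proof -
   obtain w c where wc: "w : B' \<inter> W" "c : comp0" "b = w \<otimes> c" using BW[OF b] by blast
   have "u \<otimes> w : B'" using V0(3)[OF wc(1)] u V1 by blast
   then have "(u \<otimes> w) \<otimes> c : B'" using Bc wc by blast
   moreover have "u : CG" "w : CG" "c : CG" using u V1 openin_carrier wc B'c comp0_carrier by auto
   ultimately show ?thesis using wc by (simp add: m_assoc)
  qed
  then show "v : O1" using v V1 openin_carrier by (auto simp: O1_def)
 qed
 have oO: "openin T O1" using open_subgroupI[OF sO V1(1,2) V1O] .
 have "\<one> : B'" using BD by (auto simp: B'_def e_def)
 then have OB: "O1 <= B'" by (auto simp: O1_def)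
 have "B' <= W <#> comp0"
 proof
  fix b assume "b : B'"
  then obtain w c where "w : W" "c : comp0" "b = w \<otimes> c" using BW by blast
  then show "b : W <#> comp0" by (auto intro: set_multI)
 qed
 moreover have "comp0 <= O1"
 proof
  fix c assume c: "c : comp0"
  have "d \<otimes> b : B'" if d: "d : comp0" and b: "b : B'" for d b
  proof -
   have bc: "b : CG" "d : CG" using b d B'c comp0_carrier by auto
   have "b \<otimes> (inv b \<otimes> d \<otimes> inv (inv b)) : B'" using Bc[OF b] comp0_conj[OF _ d, of "inv b"] bc by auto
   then show ?thesis using bc by (simp add: m_assoc[symmetric])
  qed
  then show "c : O1" using c comp0_carrier by (auto simp: O1_def)
 qed
 ultimately show thesis using that[OF sO oO _ VW(2)] OB by blast
qed

text \<open>As for compact neighbourhoods, intersecting the images of \<open>U\<close> under the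
  powers 0 to \<open>N\<close> gives invariance. Late iterates map \<open>U\<close> into itself
  because \<open>U\<close> lies in \<open>W\<close> times the component, the component is invariant,
  and \<open>W\<close> is contracted into \<open>U\<close>.\<close>

lemma open_subgroup_invariant:
 obtains O1 W where "subgroup O1 G" "openin T O1" "comp0 <= O1" "!!x. x : O1 ==> contr G x : O1" "compactin T W" "O1 <= W <#> comp0"
proof -
 obtain U W where U: "subgroup U G" "openin T U" "comp0 <= U" "compactin T W" "U <= W <#> comp0" by (rule open_subgroup_cocompact)
 interpret U: subgroup U G by fact
 obtain N where N: "!!n x. int N <= n ==> x : W ==> act n x : U" using act_compact_eventually[OF U(4,2) U.one_closed] by metis
 have Wc: "W <= CG" using U compactin_subset_carrier by blast
 let ?O = "\<Inter>n\<in>{0..int N}. act n ` U"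
 have sub0: "?O <= U" using INF_lower[of 0 "{0..int N}" "%n. act n ` U"] by simp
 have big: "act n u : U" if "int N <= n" "u : U" for n u
 proof -
  have "u : W <#> comp0" using U(5) \<open>u : U\<close> by blast
  then obtain w c where wc: "w : W" "c : comp0" "u = w \<otimes> c" by (auto simp: mem_set_mult)
  have "act n c : U" using act_comp0[of n] wc U by blast
  moreover have "act n u = act n w \<otimes> act n c" using wc Wc comp0_carrier by (simp add: act_mult subset_iff)
  ultimately show ?thesis using N[OF that(1) wc(1)] by simp
 qed
 show thesis
 proof (rule that[of ?O])
  show "subgroup ?O G" by (rule subgroups_Inter) (use U subgroup_act in auto)
  show "openin T ?O" using U open_act by (intro openin_INT2) auto
  show "comp0 <= ?O" using U act_comp0 by (intro INF_greatest) (metis image_mono)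
  show "compactin T W" by fact
  show "?O <= W <#> comp0" using U sub0 by blast
  show "contr G x : ?O" if x: "x : ?O" for x
  proof
   fix n assume n: "n : {0..int N}"
   have xc: "x : CG" using x sub0 U.subset by blast
   show "contr G x : act n ` U"
   proof (cases "n = 0")
    case True
    have "x : act (int N) ` U" using x by auto
    then obtain u where u: "u : U" "x = act (int N) u" by auto
    then have "contr G x = act (int N + 1) u" using act_Suc by auto
    then show ?thesis using big[of "int N + 1" u] u True by simp
   next
    case False
    then have "x : act (n - 1) ` U" using x n by auto
    then obtain u where u: "u : U" "x = act (n - 1) u" by auto
    then have "contr G x = act n u" using act_Suc[of u "n - 1"] by auto
    then show ?thesis using u by blast
   qed
  qed
 qed
qed

lemma comp0_contraction: "contraction (sub G comp0)"
 using sub_contraction[OF comp0_subgroup comp0_closed contr_comp0] .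

lemma comp0_connected_space: "connected_space (topol (sub G comp0))"
 using comp0_connected by (simp add: connectedin_def)

end

subsection \<open>Bounds for chains of real homomorphisms\<close>

text \<open>A descending tower of subgroups, each with a real homomorphism that takes the value 1 at
  a marked point, the next subgroup lying in its kernel. The length of such towers replaces
  dimension.\<close>

fun chain :: "'a dynamical_group => 'a set => (('a => real) \<times> 'a) list => bool" where
 "chain G S [] \<longleftrightarrow> True"
| "chain G S ((h, x) # l) \<longleftrightarrow> subgroup S G & rhom (sub G S) h & x : S & h x = 1 & (EX S'. S' <= {y : S. h y = 0} & chain G S' l)"

text \<open>Ordered words \<open>x1^a1 x2^a2 ...\<close>; of two lists of different length the
  longer one is truncated.\<close>

fun (in monoid) wd :: "'a list => nat list => 'a" where
 "wd (x # xs) (a # as) = x [^] a \<otimes> wd xs as"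
| "wd _ _ = \<one>"

context contraction begin

lemma chain_carrier: "chain G S l ==> set (map snd l) <= CG"
proof (induction l arbitrary: S)
 case (Cons p l)
 obtain h x where p: "p = (h, x)" by force
 obtain S' where S': "subgroup S G" "x : S" "chain G S' l" using Cons.prems unfolding p by auto
 then show ?case using Cons.IH[OF S'(3)] subgroup.subset[OF S'(1)] p by auto
qed simp

lemma wd_closed: "set xs <= CG ==> wd xs as : CG"
 by (induction xs as rule: wd.induct) auto

lemma wd_chain: "chain G S l ==> wd (map snd l) as : S \<union> {\<one>}"
proof (induction l arbitrary: S as)
 case (Cons p l)
 obtain h x where p: "p = (h, x)" by force
 obtain S' where S': "subgroup S G" "x : S" "S' <= S" "chain G S' l" using Cons.prems unfolding p by auto
 interpret S: subgroup S G by fact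
 show ?case
 proof (cases as)
  case (Cons a as')
  have "wd (map snd l) as' : S" using Cons.IH[OF S'(4), of as'] S' by auto
  moreover have "x [^] a : S" using S' by (induction a) auto
  ultimately show ?thesis by (simp add: Cons p)
 qed simp
qed simp

text \<open>The first homomorphism kills all later factors and reads off the difference of the first
  exponents, an integer that vanishes once its modulus is below 1. Equal first factors then cancel
  and the next subgroup takes over.\<close>

lemma wd_separated:
 "chain G S l ==> EX V. openin T V & \<one> : V & (ALL as bs. length as = length l --> length bs = length l -->
   inv (wd (map snd l) as) \<otimes> wd (map snd l) bs : V --> as = bs)"
proof (induction l arbitrary: S)
 case Nil
 show ?case by (intro exI[of _ "topspace T"]) (use openin_topspace[of T] in auto)
next
 case (Cons p l)
 obtain h x where p: "p = (h, x)" by force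
 obtain S' where S': "subgroup S G" "rhom (sub G S) h" "x : S" "h x = 1" "S' <= {y : S. h y = 0}" "chain G S' l"
  using Cons.prems unfolding p by auto
 interpret S: subgroup S G by fact
 obtain V' where V': "openin T V'" "\<one> : V'" "!!as bs. length as = length l ==> length bs = length l ==>
   inv (wd (map snd l) as) \<otimes> wd (map snd l) bs : V' ==> as = bs" using Cons.IH[OF S'(6)] by blast
 have h: "h (a \<otimes> b) = h a + h b" if "a : S" "b : S" for a b using S'(2) that by (simp add: rhom_def)
 have h1: "h \<one> = 0" using h[of "\<one>" "\<one>"] by simp
 have hinv: "h (inv a) = - h a" if "a : S" for a using h[of a "inv a"] h1 that by simp
 have hpow: "x [^] n : S & h (x [^] n) = real n" for n :: nat
  by (induction n) (use S' h h1 in \<open>auto simp: algebra_simps\<close>)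
 have "continuous_map (subtopology T S) euclideanreal h" using S'(2) by (simp add: rhom_def)
 then obtain U where U: "openin (subtopology T S) U" "\<one> : U" "ALL y:U. \<bar>h y - h \<one>\<bar> < 1"
  using continuous_map_realD[of "subtopology T S" h "\<one>" 1] by auto
 obtain V1 where V1: "openin T V1" "U = V1 \<inter> S" using U(1) by (auto simp: openin_subtopology)
 have "as = bs" if len: "length as = length (p # l)" "length bs = length (p # l)" and
  sep: "inv (wd (map snd (p # l)) as) \<otimes> wd (map snd (p # l)) bs : V1 \<inter> V'" for as bs
 proof -
  obtain a as' where as: "as = a # as'" using len by (cases as) auto
  obtain b bs' where bs: "bs = b # bs'" using len by (cases bs) auto
  define r where "r = wd (map snd l) as'" define r' where "r' = wd (map snd l) bs'"
  have r: "r : S" "h r = 0" "r' : S" "h r' = 0"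
   using wd_chain[OF S'(6), of as'] wd_chain[OF S'(6), of bs'] S'(5) h1 by (auto simp: r_def r'_def)
  define t where "t = x [^] a \<otimes> r" define t' where "t' = x [^] b \<otimes> r'"
  have t: "t : S" "h t = real a" "t' : S" "h t' = real b" using r hpow h by (auto simp: t_def t'_def)
  have tt: "inv t \<otimes> t' : V1 \<inter> V'" using sep by (simp add: as bs p t_def t'_def r_def r'_def)
  then have "inv t \<otimes> t' : U" using V1 t by simp
  then have "\<bar>h (inv t \<otimes> t')\<bar> < 1" using U(3) h1 by force
  then have "\<bar>real b - real a\<bar> < 1" using t h hinv by simp
  then have ab: "a = b" by linarith
  have "inv t \<otimes> t' = inv r \<otimes> r'"
   using r hpow[of a] unfolding t_def t'_def ab by (simp add: inv_mult_group m_assoc) (simp add: m_assoc[symmetric])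
  then have "as' = bs'" using V'(3)[of as' bs'] len tt by (simp add: as bs r_def r'_def)
  then show ?thesis using as bs ab by simp
 qed
 then show ?case using V1 V' U by (intro exI[of _ "V1 \<inter> V'"]) auto
qed

text \<open>A volume count with the sets \<open>A k\<close>, which are \<alpha>^(-k)(W). Every
  \<open>c\<close> steps in \<open>k\<close> multiply the covering number by at most
  \<open>N\<close>, and doubling the word length also costs \<open>c\<close> steps. Hence the
  \<open>2^(m n)\<close> words with exponents below \<open>2^m\<close>, uniformly separated by
  \<open>wd_separated\<close>, fit into a constant times \<open>N^m\<close> translates of a small
  set; letting \<open>m\<close> grow gives \<open>2^n <= N\<close>.\<close>

lemma rank_bound: obtains N where "!!S l. chain G S l ==> length l <= N"
proof -
 obtain V W where VW: "openin T V" "compactin T W" "\<one> : V" "V <= W" "!!x. x : W ==> inv x : W"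
  "!!x. x : W ==> contr G x : W" using base_nbhd[of "CG"] by (metis one_closed openin_topspace topspace_T)
 have Wc: "W <= CG" "\<one> : W" using VW compactin_subset_carrier by auto
 define A where "A k = act (- int k) ` W" for k
 have Ac: "A k <= CG" for k using Wc by (auto simp: A_def)
 have A1: "\<one> : A k" for k unfolding A_def using one_in_act Wc by blast
 have Amono: "A k <= A l" if "k <= l" for k l unfolding A_def using act_image_antimono[OF VW(6) Wc(1), of "- int l" "- int k"] that by simp
 have Aact: "act (- int k) ` A l = A (k + l)" for k l unfolding A_def using act_image_add[OF Wc(1), of "- int k" "- int l"] by simp
 obtain c0 where c0: "spow W 2 <= A c0" using absorbing[OF spow_compact[OF VW(2), of 2] VW(1,3)] VW(4) unfolding A_def by (metis image_mono subset_trans)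
 \<comment> \<open>The summand 1 makes \<open>c\<close> positive, so that \<open>s0\<close> and
   \<open>s\<close> may later be replaced by their multiples by \<open>c\<close>.\<close>
 define c where "c = c0 + 1"
 have c: "spow W 2 <= A c" using c0 Amono[of c0 c] by (auto simp: c_def)
 have c1: "c ~= 0" by (simp add: c_def)
 have two: "spow (A k) 2 <= A (k + c)" for k
 proof -
  have "spow (A k) 2 = act (- int k) ` spow W 2" unfolding A_def by (rule act_spow[OF Wc(1), symmetric])
  also have "... <= act (- int k) ` A c" using c by blast
  finally show ?thesis using Aact by simp
 qed
 have pow: "spow (A k) (2 ^ m) <= A (k + c * m)" for k m
 proof (induction m)
  case 0 show ?case using spow_1[OF Ac] by simp
 next
  case (Suc m)
  have "spow (A k) (2 ^ Suc m) = spow (spow (A k) (2 ^ m)) 2" by (simp add: spow_mult[OF Ac] mult.commute)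
  also have "... <= spow (A (k + c * m)) 2" using Suc by (rule spow_mono)
  also have "... <= A (k + c * m + c)" by (rule two)
  finally show ?case by (simp add: algebra_simps)
 qed
 obtain F0 where F0: "finite F0" "F0 <= W" "!!x. x : W ==> EX f:F0. EX v:act (int c) ` V. x = f \<otimes> v"
  using finite_translates[OF VW(2) open_act[OF VW(1)] one_in_act[OF VW(3)]] by metis
 define N where "N = card F0 + 1"
 have cover: "EX F. finite F & F <= CG & card F <= N ^ t & (ALL x:A (c * t). EX f:F. EX v:W. x = f \<otimes> v)" for t
 proof (induction t)
  case 0
  have "EX v:W. x = \<one> \<otimes> v" if "x : A (c * 0)" for x using that Wc by (intro bexI[of _ x]) (auto simp: A_def)
  then show ?case by (intro exI[of _ "{\<one>}"]) auto
 next
  case (Suc t)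
  then obtain F where F: "finite F" "F <= CG" "card F <= N ^ t" "!!x. x : A (c * t) ==> EX f:F. EX v:W. x = f \<otimes> v" by blast
  let ?g = "%(f, f'). act (- int (c * Suc t)) f \<otimes> f'"
  let ?F = "?g ` (F0 \<times> F)"
  have "EX f:?F. EX v:W. x = f \<otimes> v" if x: "x : A (c * Suc t)" for x
  proof -
   obtain w where w: "w : W" "x = act (- int (c * Suc t)) w" using x by (auto simp: A_def)
   obtain f v where f: "f : F0" "v : V" "w = f \<otimes> act (int c) v" using F0(3)[OF w(1)] by blast
   have cc: "f : CG" "v : CG" using f F0 Wc VW by auto
   have "act (- int (c * Suc t)) (act (int c) v) = act (- int (c * t)) v" using cc by (simp add: act_add[symmetric] algebra_simps)
   then have x2: "x = act (- int (c * Suc t)) f \<otimes> act (- int (c * t)) v" using w f cc by (simp add: act_mult)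
   have "act (- int (c * t)) v : A (c * t)" using f VW by (auto simp: A_def)
   then obtain f' v' where f': "f' : F" "v' : W" "act (- int (c * t)) v = f' \<otimes> v'" using F(4) by blast
   have "x = ?g (f, f') \<otimes> v'" using x2 f' cc F Wc by (simp add: m_assoc subset_iff)
   then show ?thesis using f f' by blast
  qed
  moreover have "finite ?F" using F F0 by blast
  moreover have "?F <= CG" using F F0 Wc by (auto simp: subset_iff)
  moreover have "card ?F <= N ^ Suc t"
  proof -
   have "card ?F <= card (F0 \<times> F)" using F F0 by (intro card_image_le) auto
   also have "... <= N * N ^ t" unfolding card_cartesian_product using F(3) by (intro mult_mono) (auto simp: N_def)
   finally show ?thesis by simp
  qed
  ultimately show ?case by blast
 qed
 have "length l <= N" if ch: "chain G S l" for S l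
 proof -
  define n where "n = length l" define xs where "xs = map snd l"
  have xsc: "set xs <= CG" "length xs = n" using chain_carrier[OF ch] by (auto simp: xs_def n_def)
  obtain U where U: "openin T U" "\<one> : U" "!!as bs. length as = n ==> length bs = n ==>
    inv (wd xs as) \<otimes> wd xs bs : U ==> as = bs" using wd_separated[OF ch] unfolding n_def xs_def by blast
  obtain U1 where U1: "openin T U1" "\<one> : U1" "!!x. x : U1 ==> inv x : U1" "!!x y. x : U1 ==> y : U1 ==> x \<otimes> y : U"
   using nbhd_mult[OF U(1,2)] by metis
  \<comment> \<open>From time \<open>s\<close> on the iterates make \<open>W\<close> smaller than
    the separation of the words, so a translate of such an iterate contains at most one of
    them.\<close>
  obtain s where s: "!!k x. int s <= k ==> x : W ==> act k x : U1" using act_compact_eventually[OF VW(2) U1(1,2)] by metis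
  obtain s0 where s0: "set xs <= A s0"
   using absorbing[of "set xs" V] VW xsc unfolding A_def by (metis List.finite_set finite_imp_compactin image_mono subset_trans topspace_T)
  have wdA: "wd xs as : A (s0 + c * m + c * n)" if as: "set as <= {..<2 ^ m}" "length as = n" for as m
  proof -
   have "wd ys as : spow (A (s0 + c * m)) (length ys)" if "set ys <= A s0" "length as = length ys" "set as <= {..<2 ^ m}" for ys as
    using that
   proof (induction ys arbitrary: as)
    case (Cons y ys)
    obtain a as' where as: "as = a # as'" using Cons.prems by (cases as) auto
    have "y [^] a : spow (A s0) a" using spow_pow[OF Ac] Cons.prems by simp
    also have "... <= spow (A s0) (2 ^ m)" using Cons.prems as by (intro spow_le[OF Ac A1]) auto
    also have "... <= A (s0 + c * m)" by (rule pow)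
    finally have "y [^] a : spow (A (s0 + c * m)) 1" using spow_1[OF Ac] by simp
    moreover have "wd ys as' : spow (A (s0 + c * m)) (length ys)" using Cons as by auto
    ultimately have "y [^] a \<otimes> wd ys as' : spow (A (s0 + c * m)) (1 + length ys)"
     unfolding spow_add[OF Ac] by (rule set_multI)
    then show ?case using as by simp
   qed simp
   from this[of xs as] have "wd xs as : spow (A (s0 + c * m)) n" using s0 as xsc by simp
   also have "... <= spow (A (s0 + c * m)) (2 ^ n)" by (intro spow_le[OF Ac A1]) (simp add: less_imp_le)
   also have "... <= A (s0 + c * m + c * n)" by (rule pow)
   finally show ?thesis .
  qed
  have count: "(2 ^ n) ^ m <= N ^ (s0 + m + n + s)" for m
  proof -
   define t where "t = s0 + m + n + s"
   obtain F where F: "finite F" "F <= CG" "card F <= N ^ t" "!!x. x : A (c * t) ==> EX f:F. EX v:W. x = f \<otimes> v" using cover[of t] by blast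
   define P where "P = {as. set as <= {..<(2::nat) ^ m} & length as = n}"
   have "EX f:F. EX v:U1. wd xs as = act (int (c * s)) f \<otimes> v" if "as : P" for as
   proof -
    have "s0 + c * m + c * n <= c * (s0 + m + n)" using c1 by (simp add: algebra_simps)
    then have "wd xs as : A (c * (s0 + m + n))" using wdA[of as m] Amono that by (auto simp: P_def)
    then have "act (- int (c * s)) (wd xs as) : act (- int (c * s)) ` A (c * (s0 + m + n))" by (rule imageI)
    then have "act (- int (c * s)) (wd xs as) : A (c * t)" unfolding Aact by (simp add: t_def algebra_simps)
    then obtain f v where f: "f : F" "v : W" "act (- int (c * s)) (wd xs as) = f \<otimes> v" using F(4) by blast
    have "wd xs as = act (int (c * s)) (act (- int (c * s)) (wd xs as))" by (rule act_minus(2)[OF wd_closed[OF xsc(1)], symmetric])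
    also have "... = act (int (c * s)) f \<otimes> act (int (c * s)) v" unfolding f(3) using f F Wc by (intro act_mult) auto
    finally have "wd xs as = act (int (c * s)) f \<otimes> act (int (c * s)) v" .
    moreover have "int s <= int (c * s)" unfolding of_nat_le_iff using c1 by simp
    then have "act (int (c * s)) v : U1" using s f by blast
    ultimately show ?thesis using f by blast
   qed
   then obtain g where g: "!!as. as : P ==> g as : F" "!!as. as : P ==> EX v:U1. wd xs as = act (int (c * s)) (g as) \<otimes> v" by metis
   have "inj_on g P"
   proof (rule inj_onI)
    fix as bs assume ab: "as : P" "bs : P" "g as = g bs"
    obtain u v where uv: "u : U1" "v : U1" "wd xs as = act (int (c * s)) (g as) \<otimes> u" "wd xs bs = act (int (c * s)) (g as) \<otimes> v"
     using g(2)[OF ab(1)] g(2)[OF ab(2)] ab(3) by auto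
    have cc: "act (int (c * s)) (g as) : CG" "u : CG" "v : CG" using g(1)[OF ab(1)] F uv openin_carrier[OF U1(1)] by auto
    have "inv (wd xs as) \<otimes> wd xs bs = inv u \<otimes> v" unfolding uv using cc by (simp add: inv_mult_group m_assoc) (simp add: m_assoc[symmetric])
    then have "inv (wd xs as) \<otimes> wd xs bs : U" using U1 uv by auto
    then show "as = bs" using U(3) ab by (auto simp: P_def)
   qed
   then have "card P <= card F" using g(1) F(1) by (intro card_inj_on_le[of g]) auto
   moreover have "card P = (2 ^ m) ^ n" unfolding P_def by (simp add: card_lists_length_eq)
   ultimately show ?thesis using F(3) unfolding t_def by (simp add: power_mult[symmetric] mult.commute)
  qed
  have "2 ^ n <= N"
  proof (rule ccontr)
   assume "~ 2 ^ n <= N"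
   then have "real N < real (2 ^ n)" unfolding of_nat_less_iff by simp
   moreover have N0: "0 < real N" by (simp add: N_def)
   ultimately have gt: "1 < real (2 ^ n) / real N" by (simp only: less_divide_eq_1_pos)
   then obtain m where m: "real (N ^ (s0 + n + s)) < (real (2 ^ n) / real N) ^ m" using real_arch_pow by blast
   have "real ((2 ^ n) ^ m) <= real (N ^ (s0 + m + n + s))" using count[of m] by (simp only: of_nat_le_iff)
   also have "N ^ (s0 + m + n + s) = N ^ (s0 + n + s) * N ^ m" by (simp add: power_add algebra_simps)
   finally have le: "real ((2 ^ n) ^ m) <= real (N ^ (s0 + n + s)) * real N ^ m" by simp
   have "(real (2 ^ n) / real N) ^ m = real ((2 ^ n) ^ m) / real N ^ m" by (simp add: power_divide)
   also have "... <= real (N ^ (s0 + n + s))" using le N0 by (simp only: pos_divide_le_eq zero_less_power)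
   finally have "(real (2 ^ n) / real N) ^ m <= real (N ^ (s0 + n + s))" .
   then show False using m by simp
  qed
  moreover have "n < 2 ^ n" by simp
  ultimately show ?thesis unfolding n_def by linarith
 qed
 then show thesis using that by blast
qed

end

subsection \<open>The common kernel of all real homomorphisms\<close>

definition rker :: "'a dynamical_group => 'a set" where
 "rker G = {x : carrier G. ALL h. rhom G h --> h x = 0}"

text \<open>A basis of the vector space of real homomorphisms together with dual points in the
  group; finite dimension is part of the notion.\<close>

definition dual_basis :: "'a dynamical_group => nat => (nat => 'a => real) => (nat => 'a) => bool" where
 "dual_basis G n h x \<longleftrightarrow> (ALL i<n. rhom G (h i) & x i : carrier G) & (ALL i<n. ALL j<n. h i (x j) = (if i = j then 1 else 0)) &
   (ALL g. rhom G g --> (ALL y:carrier G. g y = (\<Sum>i<n. g (x i) * h i y)))"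

context contraction begin

lemma rhom_cont: "rhom G h ==> rcont h"
 and rhom_mult: "rhom G h ==> x : CG ==> y : CG ==> h (x \<otimes> y) = h x + h y"
 by (auto simp: rhom_def)

lemma rhom_one: "rhom G h ==> h \<one> = 0"
 using rhom_mult[of h "\<one>" "\<one>"] by simp

lemma rhom_inv: "rhom G h ==> x : CG ==> h (inv x) = - h x"
 using rhom_mult[of h x "inv x"] rhom_one[of h] by (simp add: eq_neg_iff_add_eq_0 add.commute)

lemma rhom_pow: "rhom G h ==> x : CG ==> h (x [^] (n::nat)) = n * h x"
 using additive_pow[of h x n] rhom_mult by blast

lemma rhom_int_pow:
 assumes "rhom G h" "x : CG" shows "h (x [^] (k::int)) = k * h x"
proof (cases "k < 0")
 case True
 then have "x [^] k = inv (x [^] nat (- k))" using int_pow_def2[of G x k] by simp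
 moreover have "h (inv (x [^] nat (- k))) = - h (x [^] nat (- k))" using assms by (intro rhom_inv) auto
 moreover have "h (x [^] nat (- k)) = real (nat (- k)) * h x" using assms by (rule rhom_pow)
 ultimately show ?thesis using True by simp
next
 case False
 then have "x [^] k = x [^] nat k" using int_pow_def2[of G x k] by simp
 moreover have "h (x [^] nat k) = real (nat k) * h x" using assms by (rule rhom_pow)
 ultimately show ?thesis using False by simp
qed

lemma rhom_act: "rhom G h ==> rhom G (%x. h (act k x))"
 using continuous_map_compose[OF continuous_act0[of k] rhom_cont[of h]]
 by (simp add: rhom_def o_def act_mult)

lemma rhom_scale: "rhom G h ==> rhom G (%x. c * h x)"
 by (simp add: rhom_def continuous_map_real_mult_left distrib_left)

lemma rhom_diff: "rhom G h ==> rhom G g ==> rhom G (%x. h x - g x)"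
 by (simp add: rhom_def continuous_map_diff)

lemma rhom_sum:
 fixes n :: nat
 assumes h: "!!i. i < n ==> rhom G (h i)"
 shows "rhom G (%x. \<Sum>i<n. c i * h i x)"
proof -
 have "rcont (%x. \<Sum>i<n. c i * h i x)"
  using h by (intro continuous_map_sum continuous_map_real_mult_left) (auto simp: rhom_def)
 then show ?thesis using h by (simp add: rhom_def sum.distrib[symmetric] distrib_left[symmetric])
qed

lemma rhom_bounded: "rhom G h ==> compactin T K ==> EX B. ALL x:K. \<bar>h x\<bar> <= B"
proof -
 assume "rhom G h" "compactin T K"
 then have "compact (h ` K)" using image_compactin[OF _ rhom_cont] by fastforce
 then show ?thesis using compact_imp_bounded bounded_iff by (metis imageI real_norm_def)
qed

lemma rhom_compact_subgroup:
 assumes "rhom G h" "subgroup K G" "compactin T K" "x : K" shows "h x = 0"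
proof (rule ccontr)
 assume nz: "h x ~= 0"
 interpret K: subgroup K G by fact
 obtain B where B: "ALL x:K. \<bar>h x\<bar> <= B" using rhom_bounded[OF assms(1,3)] by blast
 obtain n :: nat where n: "B / \<bar>h x\<bar> < n" using reals_Archimedean2 by blast
 have "x [^] n : K" by (induction n) (use assms in auto)
 then have "real n * \<bar>h x\<bar> <= B" using B rhom_pow[OF assms(1), of x n] assms K.subset by (force simp: abs_mult)
 then show False using n nz by (simp add: field_simps)
qed

lemma rker_carrier: "rker G <= CG" by (auto simp: rker_def)

lemma rker_subgroup: "subgroup (rker G) G"
proof (rule subgroupI[OF rker_carrier])
 show "rker G ~= {}" using rhom_one by (auto simp: rker_def intro!: exI[of _ "\<one>"])
qed (auto simp: rker_def rhom_inv rhom_mult)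

lemma rker_closed: "closedin T (rker G)"
proof -
 have "closedin T {x : topspace T. h x : {0}}" if "rhom G h" for h
  by (rule closedin_continuous_map_preimage[OF rhom_cont[OF that]]) simp
 then have "closedin T (topspace T \<inter> (\<Inter>h\<in>{h. rhom G h}. {x : topspace T. h x : {0}}))"
  using closedin_topspace[of T] by (cases "{h. rhom G h} = {}") (auto simp del: topspace_T intro!: closedin_Int closedin_INT)
 moreover have "topspace T \<inter> (\<Inter>h\<in>{h. rhom G h}. {x : topspace T. h x : {0}}) = rker G" by (auto simp: rker_def)
 ultimately show ?thesis by simp
qed

lemma rker_act: "act k ` rker G = rker G"
proof -
 have le: "act k ` rker G <= rker G" for k using rhom_act by (auto simp: rker_def)
 have "rker G <= act k ` rker G"
 proof
  fix x assume x: "x : rker G"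
  then have "act (- k) x : rker G" using le by blast
  moreover have "act k (act (- k) x) = x" using x rker_carrier by auto
  ultimately show "x : act k ` rker G" by (metis imageI)
 qed
 then show ?thesis using le by blast
qed

lemma rker_contr: "contr G ` rker G = rker G"
 using rker_act[of 1] by (simp add: act_1 cong: image_cong_simp)

lemma rker_contraction: "contraction (sub G (rker G))"
 using sub_contraction[OF rker_subgroup rker_closed rker_contr] .

text \<open>A real homomorphism \<open>g\<close> that vanishes on the finite set \<open>F\<close> is
  zero: for \<open>x = f v\<close> with \<open>v^2\<close> in \<open>W\<close> one has
  \<open>g x = g (v^2) / 2\<close>, so every bound for \<open>g\<close> on \<open>W\<close> can be
  halved. Hence dual systems in \<open>F\<close> have length at most \<open>card F\<close>, and one
  of maximal length spans.\<close>

lemma dual_basis_exists: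
 assumes conn: "connected_space T" obtains n h x where "dual_basis G n h x"
proof -
 obtain V W where VW: "openin T V" "compactin T W" "\<one> : V" "V <= W" "!!x. x : W ==> inv x : W"
  using base_nbhd[of "CG"] by (metis one_closed openin_topspace topspace_T)
 have Wc: "W <= CG" "\<one> : W" using VW compactin_subset_carrier by auto
 have gen: "(\<Union>k. spow W k) = CG" using connected_generated[OF conn Wc(1) VW(5,1,3,4)] .
 obtain U where U: "openin T U" "\<one> : U" "spow U 2 <= V" using nbhd_spow[OF VW(1,3)] by metis
 obtain F where F: "finite F" "F <= W" "!!x. x : W ==> EX f:F. EX v:U. x = f \<otimes> v" using finite_translates[OF VW(2) U(1,2)] by metis
 have Uc: "U <= CG" using U openin_subset_carrier by blast
 have zero: "g y = 0" if g: "rhom G g" "!!f. f : F ==> g f = 0" and y: "y : CG" for g y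
 proof -
  obtain B where B: "ALL x:W. \<bar>g x\<bar> <= B" using rhom_bounded[OF g(1) VW(2)] by blast
  have "ALL x:W. \<bar>g x\<bar> <= B / 2 ^ k" for k :: nat
  proof (induction k)
   case (Suc k)
   show ?case
   proof
    fix x assume "x : W"
    then obtain f v where fv: "f : F" "v : U" "x = f \<otimes> v" using F by blast
    have c: "f : CG" "v : CG" using fv F Wc Uc by auto
    have "v [^] (2::nat) : W" using spow_pow[OF Uc fv(2), of 2] U VW by blast
    then have "\<bar>g (v [^] (2::nat))\<bar> <= B / 2 ^ k" using Suc by blast
    then show "\<bar>g x\<bar> <= B / 2 ^ Suc k" using rhom_pow[OF g(1) c(2), of 2] rhom_mult[OF g(1) c] g(2)[OF fv(1)] fv(3) by (simp add: abs_mult)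
   qed
  qed (use B in simp)
  then have W0: "g x = 0" if "x : W" for x
  proof -
   have *: "\<bar>g x\<bar> * 2 ^ k <= B" for k :: nat using \<open>!!k. ALL x:W. \<bar>g x\<bar> <= B / 2 ^ k\<close>[of k] that by (simp add: field_simps)
   show ?thesis
   proof (rule ccontr)
    assume nz: "g x ~= 0"
    obtain k where "B / \<bar>g x\<bar> < 2 ^ k" using real_arch_pow[of 2 "B / \<bar>g x\<bar>"] by auto
    then show False using *[of k] nz by (simp add: field_simps)
   qed
  qed
  have "g z = 0" if "z : spow W k" for k z
   using that
  proof (induction k arbitrary: z)
   case (Suc k)
   then obtain a b where "a : spow W k" "b : W" "z = a \<otimes> b" by (auto simp: mem_set_mult)
   then show ?case using Suc.IH[of a] W0[of b] rhom_mult[OF g(1), of a b] spow_carrier[OF Wc(1), of k] Wc by auto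
  qed (use rhom_one[OF g(1)] in simp)
  then show ?thesis using y gen by blast
 qed
 define D where "D n \<longleftrightarrow> (EX h x. (ALL i<n. rhom G (h i) & x i : F) & (ALL i<n. ALL j<n. h i (x j) = (if i = j then 1 else (0::real))))" for n :: nat
 have "n <= card F" if Dn: "D n" for n
 proof -
  obtain h x where hx: "ALL i<n. rhom G (h i) & x i : F" "ALL i<n. ALL j<n. h i (x j) = (if i = j then 1 else (0::real))"
   using Dn unfolding D_def by blast
  have "inj_on x {..<n}"
  proof (rule inj_onI)
   fix i j assume ij: "i : {..<n}" "j : {..<n}" "x i = x j"
   then have "h i (x j) = 1" using hx(2) by (metis lessThan_iff)
   then show "i = j" using hx(2) ij by (metis lessThan_iff zero_neq_one)
  qed
  moreover have "x ` {..<n} <= F" using hx by auto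
  ultimately have "card {..<n} <= card F" using F(1) by (intro card_inj_on_le)
  then show ?thesis by simp
 qed
 moreover have "D 0" by (auto simp: D_def)
 ultimately obtain n where n: "D n" "!!m. D m ==> m <= n" using GreatestI_nat[of D 0 "card F"] Greatest_le_nat[of D _ "card F"] by metis
 obtain h x where hx: "ALL i<n. rhom G (h i) & x i : F" "ALL i<n. ALL j<n. h i (x j) = (if i = j then 1 else 0)"
  using n(1) unfolding D_def by blast
 have span: "g y = (\<Sum>i<n. g (x i) * h i y)" if g: "rhom G g" and y: "y : CG" for g y
 proof -
  define g' where "g' y = g y - (\<Sum>i<n. g (x i) * h i y)" for y
  have g': "rhom G g'" unfolding g'_def by (intro rhom_diff rhom_sum g) (use hx in auto)
  have g'x: "g' (x j) = 0" if "j < n" for j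
  proof -
   have "(\<Sum>i<n. g (x i) * h i (x j)) = (\<Sum>i<n. if i = j then g (x i) else 0)" by (rule sum.cong) (use hx(2) that in auto)
   then show ?thesis using that by (simp add: g'_def)
  qed
  have "g' f = 0" if f: "f : F" for f
  proof (rule ccontr)
   assume nz: "g' f ~= 0"
   define k where "k y = inverse (g' f) * g' y" for y
   have k: "rhom G k" "k f = 1" "!!j. j < n ==> k (x j) = 0" unfolding k_def using rhom_scale[OF g'] nz g'x by auto
   \<comment> \<open>A homomorphism outside the span, corrected to vanish at all \<open>x j\<close>,
     would enlarge the dual system; the old homomorphisms are adjusted to vanish at the new point
     \<open>f\<close>.\<close>
   let ?h = "%i. if i < n then (%y. h i y - h i f * k y) else k" let ?x = "%i. if i < n then x i else f"
   have "ALL i<Suc n. rhom G (?h i) & ?x i : F" using hx k rhom_diff rhom_scale f by auto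
   moreover have "ALL i<Suc n. ALL j<Suc n. ?h i (?x j) = (if i = j then 1 else 0)" using hx(2) k by (auto simp: less_Suc_eq)
   ultimately have "D (Suc n)" unfolding D_def by (intro exI[of _ ?h] exI[of _ ?x] conjI)
   then show False using n(2) by fastforce
  qed
  then have "g' y = 0" using zero[OF g' _ y] by blast
  then show ?thesis by (simp add: g'_def)
 qed
 have "dual_basis G n h x" unfolding dual_basis_def using hx span F Wc by blast
 then show thesis by (rule that)
qed

lemma dual_basis_rker:
 assumes "dual_basis G n h x" shows "rker G = {y : CG. ALL i<n. h i y = 0}"
proof (intro equalityI subsetI)
 fix y assume "y : {y : CG. ALL i<n. h i y = 0}"
 then show "y : rker G" using assms unfolding dual_basis_def rker_def by auto
qed (use assms in \<open>auto simp: dual_basis_def rker_def\<close>)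

lemma dual_basis_act:
 assumes "dual_basis G n h x" "i < n" "y : CG" shows "h i (act k y) = (\<Sum>j<n. h i (act k (x j)) * h j y)"
proof -
 have "!!g y. rhom G g ==> y : CG ==> g y = (\<Sum>i<n. g (x i) * h i y)" "rhom G (h i)"
  using assms(1,2) unfolding dual_basis_def by blast+
 from this(1)[OF rhom_act[OF this(2)] assms(3)] show ?thesis .
qed

text \<open>A point \<open>y\<close> outside \<open>W R\<close>, where \<open>R\<close> is the
  common kernel, is followed along its orbit to the first entry into \<open>W R\<close>. The point
  just before lies in \<open>Z R\<close>, where \<open>Z\<close> is compact and misses
  \<open>R\<close>, so its coordinates have norm at least \<open>e0\<close>. Nonnegative powers of
  the contraction act on coordinates by uniformly bounded matrices, so the coordinates of
  \<open>y\<close> cannot have been small.\<close>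

lemma rker_nbhd:
 assumes db: "dual_basis G n h x" and U: "openin T U" "\<one> : U"
 obtains e where "0 < e" "!!y. y : CG ==> ALL i<n. \<bar>h i y\<bar> < e ==> y : U <#> rker G"
proof -
 obtain V W where VW: "openin T V" "compactin T W" "\<one> : V" "V <= W" "W <= U" "!!x. x : W ==> inv x : W"
  "!!x. x : W ==> contr G x : W" using base_nbhd[OF U] by metis
 have Wc: "W <= CG" "\<one> : W" using VW compactin_subset_carrier by auto
 interpret R: subgroup "rker G" G by (rule rker_subgroup)
 have hx: "!!i. i < n ==> rhom G (h i)" "!!i. i < n ==> x i : CG" using db by (auto simp: dual_basis_def)
 have hR: "h i (y \<otimes> r) = h i y" if "i < n" "y : CG" "r : rker G" for i y r
 proof -
  have "h i (y \<otimes> r) = h i y + h i r" using that rker_carrier by (intro rhom_mult hx) auto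
  moreover have "h i r = 0" using that hx(1) unfolding rker_def by blast
  ultimately show ?thesis by simp
 qed
 define nm where "nm y = (\<Sum>i<n. \<bar>h i y\<bar>)" for y
 have nmc: "rcont nm" unfolding nm_def using rhom_cont hx by (intro continuous_intros) auto
 define Z where "Z = act (- 1) ` W - (V <#> rker G)"
 have Zc: "compactin T Z"
  unfolding Z_def using compact_act[OF VW(2), of "-1"] open_mult_right[OF VW(1) rker_carrier]
  by (metis closed_compactin compact_closed closedin_diff Diff_subset)
 have oneR: "y : V <#> rker G" if "y : rker G" for y
 proof -
  have "\<one> \<otimes> y : V <#> rker G" using that VW by (intro set_multI)
  then show ?thesis using that rker_carrier by auto
 qed
 have Zpos: "0 < nm z" if "z : Z" for z
 proof -
  have zc: "z : CG" using that Zc compactin_carrier by blast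
  have "z ~: rker G" using that oneR by (auto simp: Z_def)
  then have "~ (ALL i<n. h i z = 0)" using zc unfolding dual_basis_rker[OF db] by blast
  then obtain i where "i < n" "h i z ~= 0" by blast
  then have "0 < \<bar>h i z\<bar>" "\<bar>h i z\<bar> <= nm z" unfolding nm_def by (auto intro!: member_le_sum)
  then show ?thesis by linarith
 qed
 obtain e0 where e0: "0 < e0" "!!z. z : Z ==> e0 <= nm z"
 proof (cases "Z = {}")
  case True then show ?thesis using that[of 1] by simp
 next
  case False
  have "compact (nm ` Z)" using image_compactin[OF Zc nmc] by simp
  then obtain s where "s : nm ` Z" "ALL t:nm ` Z. s <= t" using compact_attains_inf[of "nm ` Z"] False by blast
  then show ?thesis using that[of s] Zpos by auto
 qed
 \<comment> \<open>Forward orbits of the dual points stay in a compact set, so the matrices of all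
   nonnegative powers share one bound.\<close>
 have "EX B. ALL i<n. ALL j<n. ALL m>=0. \<bar>h i (act m (x j))\<bar> <= B"
 proof -
  have "EX B. ALL m>=0. \<bar>h i (act m (x j))\<bar> <= B" if ij: "i < n" "j < n" for i j
  proof -
   obtain N where N: "{x j} <= act (- int N) ` V" using absorbing[of "{x j}" V] VW hx(2)[OF ij(2)] by (metis compactin_sing topspace_T)
   obtain B where B: "ALL y:act (- int N) ` W. \<bar>h i y\<bar> <= B" using rhom_bounded[OF hx(1)[OF ij(1)] compact_act[OF VW(2)]] by blast
   have "act m (x j) : act (- int N) ` W" if "0 <= m" for m
   proof -
    obtain v where v: "v : V" "x j = act (- int N) v" using N by auto
    then have vW: "v : W" "v : CG" using VW Wc by auto
    have "act m (x j) = act (- int N) (act m v)" using v vW by (simp add: act_add[symmetric] add.commute)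
    moreover have "act m v : W" using act_invariant[OF VW(7) Wc(1) that vW(1)] .
    ultimately show ?thesis by blast
   qed
   then show ?thesis using B by blast
  qed
  then obtain b where b: "!!i j m. i < n ==> j < n ==> 0 <= m ==> \<bar>h i (act m (x j))\<bar> <= b i j" by metis
  have "b i j <= (\<Sum>i<n. \<Sum>j<n. \<bar>b i j\<bar>)" if "i < n" "j < n" for i j
  proof -
   have "b i j <= (\<Sum>j<n. \<bar>b i j\<bar>)" using member_le_sum[of j "{..<n}" "%j. \<bar>b i j\<bar>"] that by auto
   also have "... <= (\<Sum>i<n. \<Sum>j<n. \<bar>b i j\<bar>)" using member_le_sum[of i "{..<n}" "%i. \<Sum>j<n. \<bar>b i j\<bar>"] that by (auto intro: sum_nonneg)
   finally show ?thesis .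
  qed
  then show ?thesis using b by (meson order_trans)
 qed
 then obtain B0 where B0: "!!i j m. i < n ==> j < n ==> 0 <= m ==> \<bar>h i (act m (x j))\<bar> <= B0" by blast
 define B where "B = \<bar>B0\<bar> + 1"
 have B: "0 < B" "!!i j m. i < n ==> j < n ==> 0 <= m ==> \<bar>h i (act m (x j))\<bar> <= B" using B0 by (force simp: B_def)+
 have grow: "nm (act m y) <= real n * B * nm y" if y: "y : CG" and m: "0 <= m" for m y
 proof -
  have "nm (act m y) <= (\<Sum>i<n. B * nm y)"
   unfolding nm_def[of "act m y"]
  proof (rule sum_mono)
   fix i assume i: "i : {..<n}"
   have "\<bar>h i (act m y)\<bar> <= (\<Sum>j<n. \<bar>h i (act m (x j)) * h j y\<bar>)" using dual_basis_act[OF db _ y, of i m] i by (simp add: sum_abs)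
   also have "... <= (\<Sum>j<n. B * \<bar>h j y\<bar>)" unfolding abs_mult by (intro sum_mono mult_right_mono) (use B i m in auto)
   finally show "\<bar>h i (act m y)\<bar> <= B * nm y" by (simp add: nm_def sum_distrib_left)
  qed
  then show ?thesis by simp
 qed
 define e where "e = e0 / (real n * B * real n + 1)"
 have den: "0 < real n * B * real n + 1" using B(1) by (intro add_nonneg_pos) auto
 show thesis
 proof (rule that[of e])
  show "0 < e" using e0 den by (simp add: e_def)
  fix y assume y: "y : CG" "ALL i<n. \<bar>h i y\<bar> < e"
  have "nm y <= real n * e" unfolding nm_def using sum_bounded_above[of "{..<n}" "%i. \<bar>h i y\<bar>" e] y by force
  then have "real n * B * nm y <= real n * B * (real n * e)" using B by (intro mult_left_mono) auto
  also have "... < e0" using e0 den by (simp add: e_def field_simps)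
  finally have small: "real n * B * nm y < e0" .
  have "y : W <#> rker G"
  proof (rule ccontr)
   assume no: "y ~: W <#> rker G"
   obtain N where "{y} <= act (- int N) ` V" using absorbing[of "{y}" V] VW y by (metis compactin_sing topspace_T)
   then obtain v where v: "v : V" "y = act (- int N) v" by auto
   then have "act (int N) y = v" using VW Wc by auto
   moreover have "v \<otimes> \<one> : W <#> rker G" using v VW by (intro set_multI) auto
   ultimately have ex: "act (int N) y : W <#> rker G" using v VW Wc by auto
   define k where "k = (LEAST k. act (int k) y : W <#> rker G)"
   have k: "act (int k) y : W <#> rker G" unfolding k_def by (rule LeastI) (rule ex)
   have k0: "k ~= 0" using k no by (intro notI) simp
   then have km: "act (int k - 1) y ~: W <#> rker G" using not_less_Least[of "k - 1" "%k. act (int k) y : W <#> rker G"] by (simp add: k_def[symmetric] of_nat_diff)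
   define z where "z = act (int k - 1) y"
   have zc: "z : CG" using y by (simp add: z_def)
   have "act 1 z : W <#> rker G" using k y act_add[of y 1 "int k - 1"] by (simp add: z_def)
   then obtain w r where wr: "w : W" "r : rker G" "act 1 z = w \<otimes> r" by (auto simp: mem_set_mult)
   have wc: "w : CG" "r : CG" using wr Wc rker_carrier by auto
   have "z = act (- 1) (act 1 z)" using zc by simp
   also have "... = act (- 1) w \<otimes> act (- 1) r" unfolding wr(3) using wc by (rule act_mult)
   finally have z2: "z = act (- 1) w \<otimes> act (- 1) r" .
   have rr: "act (- 1) r : rker G" using wr(2) rker_act[of "- 1"] by blast
   have "act (- 1) w : Z"
   proof -
    have "act (- 1) w ~: V <#> rker G"
    proof
     assume "act (- 1) w : V <#> rker G"
     then obtain v s where vs: "v : V" "s : rker G" "act (- 1) w = v \<otimes> s" by (auto simp: mem_set_mult)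
     have "z = v \<otimes> (s \<otimes> act (- 1) r)" unfolding z2 vs(3) using vs rr VW Wc rker_carrier by (intro m_assoc) auto
     moreover have "v \<otimes> (s \<otimes> act (- 1) r) : W <#> rker G" using vs rr VW by (intro set_multI) auto
     ultimately show False using km by (simp add: z_def)
    qed
    then show ?thesis using wr by (auto simp: Z_def)
   qed
   then have "e0 <= nm (act (- 1) w)" by (rule e0(2))
   also have "nm (act (- 1) w) = nm z" unfolding nm_def z2 using hR rr wc by (intro sum.cong) auto
   also have "... <= real n * B * nm y" unfolding z_def using k0 by (intro grow[OF y(1)]) auto
   finally show False using small by simp
  qed
  then show "y : U <#> rker G" using set_mult_mono[OF VW(5) order_refl] by blast
 qed
qed

text \<open>A high power of the contraction has a small matrix and brings bounded coordinates into
  the range of \<open>rker_nbhd\<close>; the inverse power then turns the small neighbourhood into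
  the compact set \<alpha>^(-m)(W).\<close>

lemma rker_proper:
 assumes db: "dual_basis G n h x"
 obtains K where "compactin T K" "!!y. y : CG ==> ALL i<n. \<bar>h i y\<bar> <= r ==> y : K <#> rker G"
proof -
 have hx: "!!i. i < n ==> rhom G (h i)" "!!i. i < n ==> x i : CG" using db by (auto simp: dual_basis_def)
 obtain V W where VW: "openin T V" "compactin T W" "\<one> : V" "V <= W"
  using base_nbhd[of "CG"] by (metis one_closed openin_topspace topspace_T)
 obtain e where e: "0 < e" "!!y. y : CG ==> ALL i<n. \<bar>h i y\<bar> < e ==> y : V <#> rker G" using rker_nbhd[OF db VW(1,3)] by metis
 define d where "d = e / (real n * \<bar>r\<bar> + 1)"
 have d: "0 < d" using e by (simp add: d_def add_nonneg_pos)
 have "EX N. ALL m>=int N. \<bar>h i (act m (x j))\<bar> < d" if ij: "i < n" "j < n" for i j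
 proof -
  obtain U where U: "openin T U" "\<one> : U" "ALL y:U. \<bar>h i y - h i \<one>\<bar> < d"
   using continuous_map_realD[OF rhom_cont[OF hx(1)[OF ij(1)]], of "\<one>" d] d by auto
  obtain N where "!!m. int N <= m ==> act m (x j) : U" using act_eventually[OF hx(2)[OF ij(2)] U(1,2)] by metis
  then show ?thesis using U rhom_one[OF hx(1)[OF ij(1)]] by (intro exI[of _ N]) auto
 qed
 then obtain N where N: "!!i j m. i < n ==> j < n ==> int (N i j) <= m ==> \<bar>h i (act m (x j))\<bar> < d" by metis
 define m where "m = (\<Sum>i<n. \<Sum>j<n. N i j)"
 have Nm: "N i j <= m" if "i < n" "j < n" for i j
 proof -
  have "N i j <= (\<Sum>j<n. N i j)" using member_le_sum[of j "{..<n}" "N i"] that by auto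
  also have "... <= m" unfolding m_def using member_le_sum[of i "{..<n}" "%i. \<Sum>j<n. N i j"] that by auto
  finally show ?thesis .
 qed
 show thesis
 proof (rule that[OF compact_act[OF VW(2), of "- int m"]])
  fix y assume y: "y : CG" "ALL i<n. \<bar>h i y\<bar> <= r"
  have "\<bar>h i (act (int m) y)\<bar> < e" if i: "i < n" for i
  proof -
   have "\<bar>h i (act (int m) y)\<bar> <= (\<Sum>j<n. \<bar>h i (act (int m) (x j)) * h j y\<bar>)" using dual_basis_act[OF db i y(1)] by (simp add: sum_abs)
   also have "... <= (\<Sum>j<n. d * \<bar>r\<bar>)" unfolding abs_mult 
   proof (intro sum_mono mult_mono)
    fix j assume j: "j : {..<n}"
    then have "int (N i j) <= int m" using Nm[of i j] i by simp
    then show "\<bar>h i (act (int m) (x j))\<bar> <= d" using N[of i j "int m"] i j by simp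
    show "\<bar>h j y\<bar> <= \<bar>r\<bar>" using y(2) j by force
   qed (use d in auto)
   also have "... = real n * \<bar>r\<bar> * d" by simp
   also have "... < e"
   proof -
    have "0 < real n * \<bar>r\<bar> + 1" by (intro add_nonneg_pos) auto
    then have "(real n * \<bar>r\<bar> + 1) * d = e" by (simp add: d_def)
    then show ?thesis using d by (simp only: distrib_right)
   qed
   finally show ?thesis .
  qed
  then have "act (int m) y : V <#> rker G" using e(2) y by simp
  then obtain v s where vs: "v : V" "s : rker G" "act (int m) y = v \<otimes> s" by (auto simp: mem_set_mult)
  have c: "v : CG" "s : CG" using vs VW openin_carrier rker_carrier by auto
  have "y = act (- int m) (act (int m) y)" using y by simp
  also have "... = act (- int m) v \<otimes> act (- int m) s" unfolding vs(3) using c by (rule act_mult)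
  also have "... : act (- int m) ` W <#> rker G" using vs VW rker_act[of "- int m"] by (intro set_multI) auto
  finally show "y : act (- int m) ` W <#> rker G" .
 qed
qed

end

section \<open>Coarse retraction onto the common kernel and connectedness of the kernel\<close>

lemma subgroup_sub_iff:
 assumes "group G" "subgroup R G" "H <= R"
 shows "subgroup H (sub G R) \<longleftrightarrow> subgroup H G"
proof -
 interpret G: group G by fact
 interpret S: group "sub G R" using group_sub assms by blast
 have inv: "inv\<^bsub>sub G R\<^esub> x = inv\<^bsub>G\<^esub> x" if "x : H" for x
  by (rule inv_sub[OF assms(1,2)]) (use assms(3) that in blast)
 have Rc: "R <= carrier G" using assms subgroup.subset by blast
 show ?thesis
 proof
  assume h: "subgroup H (sub G R)"
  show "subgroup H G"
  proof (rule subgroup.intro)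
   show "inv\<^bsub>G\<^esub> x : H" if "x : H" for x using subgroup.m_inv_closed[OF h that] inv[OF that] by simp
  qed (use Rc assms subgroup.m_closed[OF h] subgroup.one_closed[OF h] in auto)
 next
  assume h: "subgroup H G"
  show "subgroup H (sub G R)"
  proof (rule subgroup.intro)
   show "inv\<^bsub>sub G R\<^esub> x : H" if "x : H" for x using subgroup.m_inv_closed[OF h that] inv[OF that] by simp
  qed (use assms subgroup.m_closed[OF h] subgroup.one_closed[OF h] in auto)
 qed
qed

lemma sub_sub: "S <= R ==> sub (sub G R) S = sub G S"
 by (simp add: sub_def subtopology_subtopology Int_absorb1)

lemma (in group) inv_cancel [simp]:
 assumes "x : carrier G" "y : carrier G"
 shows "x \<otimes> (inv x \<otimes> y) = y" "inv x \<otimes> (x \<otimes> y) = y"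
 using assms by (simp_all add: m_assoc[symmetric])

primrec lincomb :: "('a, 'm) monoid_scheme => nat => (nat => 'a) => (nat => int) => 'a" where
 "lincomb G 0 x v = \<one>\<^bsub>G\<^esub>"
| "lincomb G (Suc n) x v = x n [^]\<^bsub>G\<^esub> v n \<otimes>\<^bsub>G\<^esub> lincomb G n x v"

lemma lincomb_cong: "(!!i. i < n ==> v i = w i) ==> lincomb G n x v = lincomb G n x w"
 by (induction n) auto

lemma (in group) lincomb_closed [intro]: "(!!i. i < n ==> x i : carrier G) ==> lincomb G n x v : carrier G"
 by (induction n) auto

lemma (in group) lincomb_zero: "(!!i. i < n ==> x i : carrier G) ==> (!!i. i < n ==> v i = 0) ==> lincomb G n x v = \<one>"
 by (induction n) auto

lemma (in comm_group) lincomb_add: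
 assumes "!!i. i < n ==> x i : carrier G"
 shows "lincomb G n x (%i. v i + w i) = lincomb G n x v \<otimes> lincomb G n x w"
 using assms
proof (induction n)
 case (Suc n)
 note cl = Suc.prems[of n, simplified] lincomb_closed[of n x v] lincomb_closed[of n x w]
 show ?case using Suc cl by (simp add: int_pow_mult[symmetric] m_ac)
qed simp

lemma (in group_hom) lincomb_hom:
 assumes "!!i. i < n ==> x i : carrier G"
 shows "h (lincomb G n x v) = lincomb H n (%i. h (x i)) v"
 using assms
proof (induction n)
 case (Suc n)
 then have "x n : carrier G" "lincomb G n x v : carrier G" by auto
 then show ?case using Suc by (simp add: hom_int_pow)
qed simp

text \<open>Bookkeeping for decompositions \<open>y = k c z\<close>: in a commutative image the
  failure of \<open>c\<close> to be multiplicative is expressed by the factors \<open>k\<close> and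
  the correction \<open>w\<close> of the factors \<open>z\<close>.\<close>

lemma (in group_hom) split_defect:
 assumes H: "comm_group H" and G: "k1 : carrier G" "c1 : carrier G" "z1 : carrier G" "k2 : carrier G" "c2 : carrier G" "z2 : carrier G"
   "k3 : carrier G" "c3 : carrier G" "z3 : carrier G" "w : carrier G"
  and eq: "(k1 \<otimes> c1 \<otimes> z1) \<otimes> (k2 \<otimes> c2 \<otimes> z2) = k3 \<otimes> c3 \<otimes> z3" and zw: "h z1 \<otimes>\<^bsub>H\<^esub> h z2 = h z3 \<otimes>\<^bsub>H\<^esub> h w"
 shows "h c3 = h (inv k3 \<otimes> (k1 \<otimes> k2 \<otimes> w) \<otimes> (c1 \<otimes> c2))"
proof -
 interpret H: comm_group H by (rule H)
 have "h k3 \<otimes>\<^bsub>H\<^esub> h c3 \<otimes>\<^bsub>H\<^esub> h z3 = (h k1 \<otimes>\<^bsub>H\<^esub> h k2 \<otimes>\<^bsub>H\<^esub> (h c1 \<otimes>\<^bsub>H\<^esub> h c2)) \<otimes>\<^bsub>H\<^esub> (h z1 \<otimes>\<^bsub>H\<^esub> h z2)"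
  using arg_cong[OF eq[symmetric], of h] G by (simp add: H.m_ac)
 also have "... = (h k1 \<otimes>\<^bsub>H\<^esub> h k2 \<otimes>\<^bsub>H\<^esub> h w \<otimes>\<^bsub>H\<^esub> (h c1 \<otimes>\<^bsub>H\<^esub> h c2)) \<otimes>\<^bsub>H\<^esub> h z3" unfolding zw using G by (simp add: H.m_ac)
 finally have "h k3 \<otimes>\<^bsub>H\<^esub> h c3 = h k1 \<otimes>\<^bsub>H\<^esub> h k2 \<otimes>\<^bsub>H\<^esub> h w \<otimes>\<^bsub>H\<^esub> (h c1 \<otimes>\<^bsub>H\<^esub> h c2)" using G by simp
 then have "inv\<^bsub>H\<^esub> h k3 \<otimes>\<^bsub>H\<^esub> (h k3 \<otimes>\<^bsub>H\<^esub> h c3) = inv\<^bsub>H\<^esub> h k3 \<otimes>\<^bsub>H\<^esub> (h k1 \<otimes>\<^bsub>H\<^esub> h k2 \<otimes>\<^bsub>H\<^esub> h w \<otimes>\<^bsub>H\<^esub> (h c1 \<otimes>\<^bsub>H\<^esub> h c2))" by simp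
 then show ?thesis using G by (simp add: H.m_assoc)
qed

lemma lincomb_finite: "finite (lincomb G n x ` {v. ALL i<n. v i : {- b..b}})"
proof (rule finite_subset)
 show "lincomb G n x ` {v. ALL i<n. v i : {- b..b}} <= lincomb G n x ` PiE {..<n} (%i. {- b..b})"
 proof
  fix y assume "y : lincomb G n x ` {v. ALL i<n. v i : {- b..b}}"
  then obtain v where v: "y = lincomb G n x v" "ALL i<n. v i : {- b..b}" by auto
  have "restrict v {..<n} : PiE {..<n} (%i. {- b..b})" using v(2) by auto
  moreover have "lincomb G n x (restrict v {..<n}) = y" unfolding v(1) by (rule lincomb_cong) simp
  ultimately show "y : lincomb G n x ` PiE {..<n} (%i. {- b..b})" by blast
 qed
qed (intro finite_imageI finite_PiE, auto)

context contraction begin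

lemma rhoms_bounded:
 fixes n :: nat
 assumes "!!i. i < n ==> rhom G (h i)" "compactin T K"
 shows "EX B. ALL i<n. ALL y:K. \<bar>h i y\<bar> <= B"
 using assms(1)
proof (induction n)
 case (Suc m)
 obtain B1 where B1: "ALL i<m. ALL y:K. \<bar>h i y\<bar> <= B1" using Suc by (metis less_Suc_eq)
 obtain B2 where B2: "ALL y:K. \<bar>h m y\<bar> <= B2" using rhom_bounded[OF Suc.prems[of m] assms(2)] by auto
 have "ALL i<Suc m. ALL y:K. \<bar>h i y\<bar> <= max B1 B2"
 proof (intro allI impI ballI)
  fix i y assume i: "i < Suc m" and y: "y : K"
  show "\<bar>h i y\<bar> <= max B1 B2"
  proof (cases "i = m")
   case True then show ?thesis using B2 y by (simp add: le_max_iff_disj)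
  next
   case False then have "\<bar>h i y\<bar> <= B1" using B1 y i by simp
   then show ?thesis by linarith
  qed
 qed
 then show ?case by blast
qed auto

lemma dual_basis_carrier: "dual_basis G n h x ==> i < n ==> x i : CG"
 by (simp add: dual_basis_def)

lemma dual_basis_rhom: "dual_basis G n h x ==> i < n ==> rhom G (h i)"
 by (simp add: dual_basis_def)

lemma lincomb_rhom:
 assumes "rhom G g" "!!i. i < n ==> x i : CG"
 shows "g (lincomb G n x v) = (\<Sum>i<n. v i * g (x i))"
 using assms(2)
proof (induction n)
 case 0 show ?case using rhom_one[OF assms(1)] by simp
next
 case (Suc n)
 have "g (x n [^] v n \<otimes> lincomb G n x v) = g (x n [^] v n) + g (lincomb G n x v)"
  by (rule rhom_mult[OF assms(1)]) (use Suc.prems lincomb_closed[of n x v] in auto)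
 then show ?case using Suc rhom_int_pow[OF assms(1), of "x n" "v n"] by simp
qed

lemma dual_basis_lincomb:
 assumes "dual_basis G n h x" "i < n" shows "h i (lincomb G n x v) = v i"
proof -
 have "h i (lincomb G n x v) = (\<Sum>j<n. v j * h i (x j))"
  by (rule lincomb_rhom[OF dual_basis_rhom[OF assms] dual_basis_carrier[OF assms(1)]])
 also have "... = (\<Sum>j<n. if j = i then real_of_int (v j) else 0)" by (rule sum.cong) (use assms in \<open>auto simp: dual_basis_def\<close>)
 finally show ?thesis using assms(2) by simp
qed

text \<open>The map \<open>c\<close> is a retraction onto the common kernel, and a homomorphism, up to the compact
 set \<open>P\<close> and modulo every normal subgroup with commutative quotient.\<close>

definition retracts :: "('a => 'a) => 'a set => 'a set => bool" where
 "retracts c P V \<longleftrightarrow> compactin T P & openin T V & \<one> : V & (ALL y:CG. c y : rker G) & (ALL y:V. c y : P) &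
  (ALL y:rker G. EX p:P. y = p \<otimes> c y) &
  (ALL y:CG. ALL z:CG. EX p:P. ALL M. M \<lhd> G & comm_group (G Mod M) --> M #> c (y \<otimes> z) = M #> (p \<otimes> (c y \<otimes> c z)))"

lemma retractsD:
 assumes "retracts c P V"
 shows "compactin T P" "openin T V" "\<one> : V" "y : CG ==> c y : rker G" "y : V ==> c y : P"
  "y : rker G ==> EX p:P. y = p \<otimes> c y"
  "y : CG ==> z : CG ==> EX p:P. ALL M. M \<lhd> G & comm_group (G Mod M) --> M #> c (y \<otimes> z) = M #> (p \<otimes> (c y \<otimes> c z))"
 using assms unfolding retracts_def by simp_all

text \<open>Each \<open>y\<close> is written as \<open>k c z\<close>, where \<open>z\<close> is the
  word in the dual points whose exponents are the integer parts of the coordinates of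
  \<open>y\<close>. The coordinates of \<open>y z^-1\<close> then lie in the unit interval, and
  properness yields \<open>k\<close> in the compact set \<open>K\<close> and \<open>c\<close> in the
  kernel. Integer parts are additive up to -1 or 0, so only finitely many correction words
  occur.\<close>

lemma coarse_retraction:
 assumes db: "dual_basis G n h x"
 shows "EX c P V. retracts c P V"
proof -
 note xc = dual_basis_carrier[OF db] and hr = dual_basis_rhom[OF db]
 let ?S = "rker G"
 obtain K where K: "compactin T K" "!!y. y : CG ==> ALL i<n. \<bar>h i y\<bar> <= 1 ==> y : K <#> ?S"
  using rker_proper[OF db] by blast
 obtain V L where V: "openin T V" "\<one> : V" "V <= L" "compactin T L" using compact_nbhd[of "CG"] openin_topspace[of T] by (metis one_closed topspace_T)
 obtain B where B: "ALL i<n. ALL y:L. \<bar>h i y\<bar> <= B" using rhoms_bounded[of n h L] hr V(4) by blast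
 define b where "b = max 1 \<lceil>B\<rceil> + 1"
 have b1: "1 <= b" by (simp add: b_def)
 define Z where "Z = lincomb G n x ` {v. ALL i<n. v i : {- b..b}}"
 have ZG: "Z <= CG" unfolding Z_def using lincomb_closed[of n x] xc by auto
 have Zc: "compactin T Z" using lincomb_finite[of G n x b] ZG unfolding Z_def by (intro finite_imp_compactin) auto
 define zz where "zz y = lincomb G n x (%i. \<lfloor>h i y\<rfloor>)" for y
 have zzG: "zz y : CG" for y unfolding zz_def using lincomb_closed[of n x] xc by blast
 have "EX k c. k : K & c : ?S & y = k \<otimes> c \<otimes> zz y" if y: "y : CG" for y
 proof -
  have "\<bar>h i (y \<otimes> inv zz y)\<bar> <= 1" if i: "i < n" for i
  proof -
   have "h i (y \<otimes> inv zz y) = h i y - \<lfloor>h i y\<rfloor>"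
    using rhom_mult[OF hr[OF i] y inv_closed[OF zzG[of y]]] rhom_inv[OF hr[OF i] zzG[of y]] dual_basis_lincomb[OF db i] by (simp add: zz_def)
   then show ?thesis by linarith
  qed
  then have "y \<otimes> inv zz y : K <#> ?S" using K(2) y zzG by simp
  then obtain k c where kc: "k : K" "c : ?S" "y \<otimes> inv zz y = k \<otimes> c" by (auto simp: mem_set_mult)
  have "k \<otimes> c \<otimes> zz y = y" unfolding kc(3)[symmetric] using y zzG[of y] by (simp add: m_assoc)
  then show ?thesis using kc by metis
 qed
 then obtain kk cc where kc: "!!y. y : CG ==> kk y : K" "!!y. y : CG ==> cc y : ?S" "!!y. y : CG ==> y = kk y \<otimes> cc y \<otimes> zz y"
  by metis
 have ccG: "cc y : CG" and kkG: "kk y : CG" if "y : CG" for y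
  using kc that rker_carrier compactin_carrier[OF K(1)] by auto
 define I where "I X = (%x. inv x) ` X" for X
 \<comment> \<open>One compact set for three errors: the multiplicative defect, the deviation from
   the identity on the kernel, and the values near the identity.\<close>
 define P where "P = (I K <#> (K <#> K <#> Z)) \<union> K \<union> (I K <#> (L <#> I Z))"
 have Pc: "compactin T P" unfolding P_def I_def
  by (intro compactin_Un compact_mult compact_inverses K(1) V(4) Zc)
 have "cc y : P" if y: "y : V" for y
 proof -
  have yG: "y : CG" using y openin_carrier[OF V(1)] by auto
  have "zz y : Z" unfolding zz_def Z_def
  proof (rule imageI, rule CollectI, intro allI impI)
   fix i assume i: "i < n"
   have "\<bar>h i y\<bar> <= B" using B i y V(3) by blast
   then show "\<lfloor>h i y\<rfloor> : {- b..b}" by (simp add: b_def; linarith)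
  qed
  then have "inv kk y \<otimes> (y \<otimes> inv zz y) : P" unfolding P_def I_def
   by (intro UnI2 set_multI imageI) (use y V(3) kc(1)[OF yG] in auto)
  moreover have "inv kk y \<otimes> (y \<otimes> inv zz y) = inv kk y \<otimes> ((kk y \<otimes> cc y \<otimes> zz y) \<otimes> inv zz y)" using kc(3)[OF yG] by simp
  ultimately show ?thesis using ccG[OF yG] kkG[OF yG] zzG[of y] by (simp add: m_assoc)
 qed
 moreover have "EX p:P. y = p \<otimes> cc y" if y: "y : ?S" for y
 proof -
  have yG: "y : CG" using y rker_carrier by auto
  have "h i y = 0" if "i < n" for i using y hr[OF that] by (auto simp: rker_def)
  then have "zz y = \<one>" unfolding zz_def using xc by (intro lincomb_zero) auto
  then have "y = kk y \<otimes> cc y" using kc(3)[OF yG] ccG[OF yG] kkG[OF yG] by simp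
  then show ?thesis using kc(1)[OF yG] unfolding P_def by blast
 qed
 moreover have "EX p:P. ALL M. M \<lhd> G & comm_group (G Mod M) --> M #> cc (y \<otimes> z) = M #> (p \<otimes> (cc y \<otimes> cc z))"
  if y: "y : CG" and z: "z : CG" for y z
 proof -
  have yz: "y \<otimes> z : CG" using y z by simp
  let ?w = "%i. \<lfloor>h i y\<rfloor> + \<lfloor>h i z\<rfloor> + - \<lfloor>h i (y \<otimes> z)\<rfloor>"
  let ?p = "inv kk (y \<otimes> z) \<otimes> (kk y \<otimes> kk z \<otimes> lincomb G n x ?w)"
  have wZ: "lincomb G n x ?w : Z" unfolding Z_def
  proof (rule imageI, rule CollectI, intro allI impI)
   fix i assume i: "i < n"
   have "?w i : {-1..0}" using rhom_mult[OF hr[OF i] y z] by (simp; linarith)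
   then show "?w i : {- b..b}" using b1 by simp
  qed
  have "?p : P" unfolding P_def I_def using wZ kc(1)[OF y] kc(1)[OF z] kc(1)[OF yz] by (intro UnI1 set_multI imageI)
  moreover have "M #> cc (y \<otimes> z) = M #> (?p \<otimes> (cc y \<otimes> cc z))" if M: "M \<lhd> G" "comm_group (G Mod M)" for M
  proof -
   interpret N: normal M G by (rule M(1))
   interpret Q: comm_group "G Mod M" by (rule M(2))
   let ?Q = "G Mod M"
   interpret ph: group_hom G ?Q "%a. M #> a" using N.r_coset_hom_Mod Q.is_group by (simp add: group_hom_def group_hom_axioms_def)
   let ?f = "%a. M #> a"
   note G = ccG[OF y] ccG[OF z] ccG[OF yz] kkG[OF y] kkG[OF z] kkG[OF yz] zzG[of y] zzG[of z] zzG[of "y \<otimes> z"] subsetD[OF ZG wZ]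
   have zc: "?f (lincomb G n x v) = lincomb ?Q n (%i. ?f (x i)) v" for v by (rule ph.lincomb_hom) (rule xc)
   have "?f (zz y) \<otimes>\<^bsub>?Q\<^esub> ?f (zz z) = lincomb ?Q n (%i. ?f (x i)) (%i. \<lfloor>h i y\<rfloor> + \<lfloor>h i z\<rfloor>)"
    unfolding zz_def zc by (rule Q.lincomb_add[symmetric]) (use xc in auto)
   also have "... = lincomb ?Q n (%i. ?f (x i)) (%i. \<lfloor>h i (y \<otimes> z)\<rfloor> + ?w i)" by simp
   also have "... = ?f (zz (y \<otimes> z)) \<otimes>\<^bsub>?Q\<^esub> ?f (lincomb G n x ?w)" unfolding zz_def zc by (rule Q.lincomb_add) (use xc in auto)
   finally have zw: "?f (zz y) \<otimes>\<^bsub>?Q\<^esub> ?f (zz z) = ?f (zz (y \<otimes> z)) \<otimes>\<^bsub>?Q\<^esub> ?f (lincomb G n x ?w)" .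
   have "(kk y \<otimes> cc y \<otimes> zz y) \<otimes> (kk z \<otimes> cc z \<otimes> zz z) = kk (y \<otimes> z) \<otimes> cc (y \<otimes> z) \<otimes> zz (y \<otimes> z)"
    using kc(3)[OF y] kc(3)[OF z] kc(3)[OF yz] by simp
   then show ?thesis by (rule ph.split_defect[OF M(2) G(4,1,7,5,2,8,6,3,9,10) _ zw])
  qed
  ultimately show ?thesis by blast
 qed
 ultimately have "retracts cc P V" unfolding retracts_def using Pc V(1,2) kc(2) by (intro conjI ballI) auto
 then show ?thesis by blast
qed

text \<open>Let \<open>C\<close> be the identity component of the kernel \<open>R\<close>.
  Commutators of \<open>G\<close> lie in \<open>C\<close>, so every subgroup \<open>M\<close>
  between \<open>C\<close> and \<open>R\<close> is normal with commutative quotient. If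
  \<open>M\<close> is open in \<open>R\<close> and contains the compact errors that lie in
  \<open>R\<close>, the coarse retraction induces a homomorphism from the connected group
  \<open>G\<close> to \<open>G / M\<close> with open kernel, which is trivial. As the retraction
  moves points of \<open>R\<close> only by such errors, \<open>R <= M\<close>. Powers of the
  contraction turn this into compactness of \<open>R\<close> modulo \<open>C\<close>, and
  contracting gives \<open>R = C\<close>.\<close>

lemma rker_connected:
 assumes conn: "connected_space T" shows "connectedin T (rker G)"
proof -
 obtain n h x where db: "dual_basis G n h x" using dual_basis_exists[OF conn] by metis
 have hx: "!!i. i < n ==> rhom G (h i)" "!!i. i < n ==> x i : CG"
  "!!i j. i < n ==> j < n ==> h i (x j) = (if i = j then 1 else 0)" using db by (auto simp: dual_basis_def)
 define R where "R = rker G"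
 have RR: "R = {y : CG. ALL i<n. h i y = 0}" unfolding R_def by (rule dual_basis_rker[OF db])
 have Rs: "subgroup R G" and Rcl: "closedin T R" and Rc: "R <= CG" and Rct: "contr G ` R = R" and Ract: "!!k. act k ` R = R"
  unfolding R_def using rker_subgroup rker_closed rker_carrier rker_contr rker_act by blast+
 interpret R: subgroup R G by (rule Rs)
 interpret S: contraction "sub G R" unfolding R_def by (rule rker_contraction)
 define C where "C = S.comp0"
 have CR: "C <= R" using S.comp0_carrier by (simp add: C_def)
 have Csub: "subgroup C G" using S.comp0_subgroup subgroup_sub_iff[OF is_group Rs] S.comp0_carrier by (simp add: C_def)
 interpret C: subgroup C G by (rule Csub)
 have Cmax: "D <= C" if "connectedin T D" "\<one> : D" "D <= R" for D
  using S.comp0_maximal[of D] that by (simp add: C_def connectedin_subtopology)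
 have Cconn: "connectedin T C" using S.comp0_connected by (simp add: C_def connectedin_subtopology)
 have Ccl: "closedin T C" using S.comp0_closed closedin_trans_full[of T R C] Rcl by (simp add: C_def)
 have comm: "a \<otimes> b \<otimes> inv a \<otimes> inv b : C" if ab: "a : CG" "b : CG" for a b
 proof -
  let ?f = "%u. u \<otimes> b \<otimes> inv u \<otimes> inv b"
  have "continuous_map T T ?f" using ab by (intro continuous_intros) auto
  moreover have "connectedin T (CG)" using conn by (metis connectedin_topspace topspace_T)
  ultimately have "connectedin T (?f ` CG)" by (rule connectedin_continuous_map_image)
  moreover have "\<one> : ?f ` CG" by (rule image_eqI[of _ _ "\<one>"]) (use ab in simp_all)
  moreover have "?f ` CG <= R"
  proof -
   have "k (?f u) = 0" if k: "rhom G k" and u: "u : CG" for k u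
    using u ab by (simp add: rhom_mult[OF k] rhom_inv[OF k])
   then show ?thesis unfolding R_def rker_def using ab by (intro image_subsetI CollectI conjI allI impI) simp_all
  qed
  ultimately show ?thesis using Cmax[of "?f ` CG"] ab by blast
 qed
 obtain O1 W1 where O1: "subgroup O1 (sub G R)" "openin (subtopology T R) O1" "C <= O1" "!!x. x : O1 ==> contr G x : O1"
  "compactin (subtopology T R) W1" "O1 <= W1 <#> C" using S.open_subgroup_invariant unfolding C_def by (metis set_mult_sub sub_simps(2,5))
 have O1R: "O1 <= R" using O1(1) subgroup.subset by fastforce
 have O1s: "subgroup O1 G" using O1(1) subgroup_sub_iff[OF is_group Rs O1R] by blast
 interpret O1: subgroup O1 G by (rule O1s)
 obtain U1 where U1: "openin T U1" "O1 = U1 \<inter> R" using O1(2) by (auto simp: openin_subtopology)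
 have O1c: "O1 <= CG" using O1R Rc by blast
 define M where "M m = act (- int m) ` O1" for m
 have Ms: "subgroup (M m) G" for m unfolding M_def by (rule subgroup_act[OF O1s])
 have Mmono: "M m <= M l" if "m <= l" for m l unfolding M_def using act_image_antimono[OF O1(4) O1c, of "- int l" "- int m"] that by simp
 have CM: "C <= M m" for m using Mmono[of 0 m] O1(3) by (simp add: M_def)
 have MR: "M m <= R" for m unfolding M_def using O1R Ract by blast
 have Mo: "openin (subtopology T R) (M m)" for m
 proof -
  have "M m = act (- int m) ` U1 \<inter> act (- int m) ` R"
   unfolding M_def U1(2) by (rule inj_on_image_Int[of _ "CG"]) (use act_inj openin_subset_carrier[OF U1(1)] Rc in \<open>auto intro: inj_onI\<close>)
  then have "M m = act (- int m) ` U1 \<inter> R" unfolding Ract .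
  then show ?thesis using open_act[OF U1(1)] by (auto simp: openin_subtopology)
 qed
 have MU: "R <= (\<Union>m. M m)"
 proof
  fix r assume r: "r : R"
  then obtain m where m: "!!k. int m <= k ==> act k r : U1" using act_eventually[of r U1] Rc U1 O1.one_closed by blast
  have "act (int m) r : O1" using m[of "int m"] r Ract U1(2) by blast
  then show "r : (\<Union>m. M m)" using act_image_iff[OF O1c, of r "- int m" for m] r Rc by (auto simp: M_def)
 qed
 obtain c P V where "retracts c P V" using coarse_retraction[OF db] by blast
 note P = retractsD(1)[OF this] and V = retractsD(2,3)[OF this] and cR = retractsD(4)[OF this, folded R_def] and cV = retractsD(5)[OF this]
  and cr = retractsD(6)[OF this, folded R_def] and cm = retractsD(7)[OF this]
 have "compactin (topol (sub G R)) (R \<inter> P)" using closed_Int_compactin[OF Rcl P] by (simp add: compactin_subtopology)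
 then obtain m where m: "R \<inter> P <= M m"
  using S.compact_increasing[of "R \<inter> P" M] Mo Mmono MU by (metis inf.coboundedI1 sub_simps(2))
 let ?M = "M m"
 have nM: "?M \<lhd> G"
 proof (rule normal_invI[OF Ms])
  fix g y assume gy: "g : CG" "y : ?M"
  then have yG: "y : CG" using MR Rc by blast
  have "g \<otimes> y \<otimes> inv g = (g \<otimes> y \<otimes> inv g \<otimes> inv y) \<otimes> y" using gy yG by (simp add: m_assoc)
  also have "... : ?M" by (rule subgroup.m_closed[OF Ms _ gy(2)]) (use comm[OF gy(1) yG] CM in blast)
  finally show "g \<otimes> y \<otimes> inv g : ?M" .
 qed
 interpret N: normal ?M G by (rule nM)
 define Q where "Q = G Mod ?M"
 define \<phi> where "\<phi> = (%a. ?M #> a)"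
 have gQ: "group Q" unfolding Q_def by (rule N.factorgroup_is_group)
 interpret ph: group_hom G Q \<phi> using N.r_coset_hom_Mod gQ is_group by (simp add: group_hom_def group_hom_axioms_def Q_def \<phi>_def)
 have surj: "carrier Q = \<phi> ` CG" by (auto simp: Q_def \<phi>_def FactGroup_def RCOSETS_def)
 have f1: "\<phi> a = \<one>\<^bsub>Q\<^esub> \<longleftrightarrow> a : ?M" if "a : CG" for a
  using that coset_join1[OF _ that Ms] coset_join2[OF that Ms] subgroup.subset[OF Ms] by (auto simp: Q_def \<phi>_def FactGroup_def)
 have "\<phi> (a \<otimes> b) = \<phi> (b \<otimes> a)" if "a : CG" "b : CG" for a b
 proof -
  have "a \<otimes> b = (a \<otimes> b \<otimes> inv a \<otimes> inv b) \<otimes> (b \<otimes> a)" using that by (simp add: m_assoc)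
  moreover have "\<phi> (a \<otimes> b \<otimes> inv a \<otimes> inv b) = \<one>\<^bsub>Q\<^esub>" using f1[of "a \<otimes> b \<otimes> inv a \<otimes> inv b"] comm[OF that] CM that by auto
  ultimately show ?thesis using that ph.hom_mult[of "a \<otimes> b \<otimes> inv a \<otimes> inv b" "b \<otimes> a"] by simp
 qed
 then have Qc: "comm_group Q"
  by (intro group.group_comm_groupI[OF gQ]) (auto simp: surj ph.hom_mult[symmetric] simp del: ph.hom_mult)
 have cG: "c y : CG" if "y : CG" for y using cR[OF that] Rc by blast
 have "(%y. \<phi> (c y)) : hom G Q"
 proof (rule homI)
  fix y z assume y: "y : CG" and z: "z : CG"
  obtain p where p: "p : P" "\<phi> (c (y \<otimes> z)) = \<phi> (p \<otimes> (c y \<otimes> c z))" using cm[OF y z] nM Qc unfolding Q_def \<phi>_def by blast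
  have G: "p : CG" "c y : CG" "c z : CG" "c (y \<otimes> z) : CG" using p(1) compactin_carrier[OF P] cG y z by auto
  \<comment> \<open>A priori the error \<open>p\<close> is only in \<open>P\<close>; it is a product
    of elements of \<open>R\<close>, so it belongs to \<open>R\<close> as well and therefore to the
    chosen \<open>M m\<close>.\<close>
  have "\<phi> (c (y \<otimes> z) \<otimes> inv (p \<otimes> (c y \<otimes> c z))) = \<one>\<^bsub>Q\<^esub>" using p(2) G by simp
  then have "c (y \<otimes> z) \<otimes> inv (p \<otimes> (c y \<otimes> c z)) : R" using f1[of "c (y \<otimes> z) \<otimes> inv (p \<otimes> (c y \<otimes> c z))"] G MR by auto
  then have "inv (c (y \<otimes> z) \<otimes> inv (p \<otimes> (c y \<otimes> c z))) \<otimes> c (y \<otimes> z) \<otimes> inv (c y \<otimes> c z) : R"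
   by (intro R.m_closed[OF R.m_closed[OF R.m_inv_closed] R.m_inv_closed[OF R.m_closed]] cR m_closed y z)
  also have "inv (c (y \<otimes> z) \<otimes> inv (p \<otimes> (c y \<otimes> c z))) \<otimes> c (y \<otimes> z) \<otimes> inv (c y \<otimes> c z) = p" using G by (simp add: inv_mult_group m_assoc)
  finally have "\<phi> p = \<one>\<^bsub>Q\<^esub>" using f1[OF G(1)] m p(1) by blast
  then show "\<phi> (c (y \<otimes> z)) = \<phi> (c y) \<otimes>\<^bsub>Q\<^esub> \<phi> (c z)" using p(2) G by simp
 qed (use cG in auto)
 then interpret k: group_hom G Q "%y. \<phi> (c y)" using gQ is_group by (simp add: group_hom_def group_hom_axioms_def)
 have "kernel G Q (%y. \<phi> (c y)) = CG"
 proof (rule connected_open_subgroup[OF conn k.subgroup_kernel open_subgroupI[OF k.subgroup_kernel V]])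
  show "V <= kernel G Q (%y. \<phi> (c y))"
  proof
   fix v assume v: "v : V"
   then have vG: "v : CG" using openin_carrier[OF V(1)] by auto
   have "c v : ?M" using cV[OF v] cR[OF vG] m by blast
   then show "v : kernel G Q (%y. \<phi> (c y))" using f1[OF cG[OF vG]] vG by (simp add: kernel_def)
  qed
 qed
 then have cM: "c y : ?M" if "y : CG" for y using that f1[OF cG[OF that]] by (auto simp: kernel_def)
 have "R <= M m"
 proof
  fix r assume r: "r : R"
  then have rc: "r : CG" using Rc by blast
  obtain p where p: "p : P" "r = p \<otimes> c r" using cr[OF r] by blast
  have pG: "p : CG" using p(1) compactin_carrier[OF P] by blast
  have "r \<otimes> inv (c r) = p" by (subst p(2)) (use pG cG[OF rc] in \<open>simp add: m_assoc\<close>)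
  then have "p : R" using R.m_closed[OF r R.m_inv_closed[OF cR[OF rc]]] by simp
  then have "p \<otimes> c r : M m" using m p(1) cM[OF rc] subgroup.m_closed[OF Ms] by blast
  then show "r : M m" using p(2) by simp
 qed
 then have "act (int m) ` R <= act (int m) ` act (- int m) ` O1" unfolding M_def by blast
 then have RO: "R <= O1" unfolding Ract act_image_minus(2)[OF O1c] .
 have W1c: "compactin T W1" using O1(5) by (simp add: compactin_subtopology)
 have actC: "act m c : C" if "c : C" for m c
 proof -
  have "connectedin T (act m ` C)" using connectedin_continuous_map_image[OF continuous_act0 Cconn] .
  moreover have "act m ` C <= R" using CR Ract by blast
  ultimately have "act m ` C <= C" by (intro Cmax one_in_act C.one_closed)
  then show ?thesis using that by blast
 qed
 have "R <= C"
 proof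
  fix r assume r: "r : R"
  then have rc: "r : CG" using Rc by blast
  show "r : C"
  proof (rule ccontr)
   assume no: "r ~: C"
   \<comment> \<open>If \<open>r\<close> is outside \<open>C\<close>, then so is
     \<open>w^-1 r\<close> for all \<open>w\<close> near the identity. But \<alpha>^(-m)(r) lies in
     \<open>W1 C\<close>, which puts \<open>r\<close> into \<alpha>^m(W1) C.\<close>
   let ?U = "{w : topspace T. inv w \<otimes> r : CG - C}"
   have oC: "openin T (CG - C)" using openin_diff[OF openin_topspace Ccl] by simp
   have cm: "continuous_map T T (%w. inv w \<otimes> r)" using rc by (intro continuous_intros)
   have "openin T ?U" using open_preimage[OF cm oC] .
   moreover have "\<one> : ?U" using rc no by simp
   ultimately obtain m where m: "!!k w. int m <= k ==> w : W1 ==> act k w : ?U" using act_compact_eventually[OF W1c] by metis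
   have "act (- int m) r : R" using r Ract by blast
   then have "act (- int m) r : W1 <#> C" using RO O1(6) by blast
   then obtain w c where wc: "w : W1" "c : C" "act (- int m) r = w \<otimes> c" by (auto simp: mem_set_mult)
   have wcc: "w : CG" "c : CG" using wc W1c compactin_carrier by auto
   have "r = act (int m) (act (- int m) r)" using rc by simp
   also have "... = act (int m) w \<otimes> act (int m) c" unfolding wc(3) using wcc by (rule act_mult)
   finally have "inv (act (int m) w) \<otimes> r = act (int m) c" using wcc by (simp add: m_assoc[symmetric])
   then show False using m[of "int m" w] wc actC by auto
  qed
 qed
 then show ?thesis using Cconn CR R_def by (metis subset_antisym)
qed

end

lemma chain_mono_sub: "subgroup R G ==> group G ==> chain (sub G R) S l ==> l = [] \<or> S <= R & chain G S l"
proof (induction l arbitrary: S)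
 case (Cons p l)
 obtain h x where p: "p = (h, x)" by force
 obtain S' where S': "subgroup S (sub G R)" "rhom (sub (sub G R) S) h" "x : S" "h x = 1" "S' <= {y : S. h y = 0}" "chain (sub G R) S' l"
  using Cons.prems unfolding p by auto
 have SR: "S <= R" using S'(1) subgroup.subset by fastforce
 have "subgroup S G" using subgroup_sub_iff[OF Cons.prems(2,1) SR] S'(1) by blast
 moreover have "rhom (sub G S) h" using S'(2) sub_sub[OF SR] by metis
 moreover have "EX S'. S' <= {y : S. h y = 0} & chain G S' l" using Cons.IH[OF Cons.prems(1,2) S'(6)] S'(5) by (cases l) auto
 ultimately show ?case using SR S' p by auto
qed simp

text \<open>Compact subgroups lie in the common kernel of all real homomorphisms, which is again
 connected; the descent terminates because chains of real homomorphisms have bounded length.\<close>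

lemma no_compact_subgroups_aux:
 assumes "contraction G" "connected_space (topol G)" "!!S l. chain G S l ==> length l <= n"
  "subgroup K G" "compactin (topol G) K"
 shows "K = {\<one>\<^bsub>G\<^esub>}"
 using assms
proof (induction n arbitrary: G)
 case (0 G)
 interpret contraction G by fact
 have "carrier G = {\<one>\<^bsub>G\<^esub>}"
 proof (rule ccontr)
  assume "carrier G ~= {\<one>\<^bsub>G\<^esub>}"
  then obtain h z where hz: "rhom G h" "z : carrier G" "h z ~= 0" using rhom_exists[OF 0(2)] by metis
  have "rhom (sub G (carrier G)) (%y. inverse (h z) * h y)" using rhom_scale[OF hz(1)] by (simp add: rhom_def subtopology_superset)
  then have "chain G (carrier G) [(%y. inverse (h z) * h y, z)]" using hz subgroup_self by auto
  then show False using 0(3) by fastforce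
 qed
 then show ?case using subgroup.subset[OF 0(4)] subgroup.one_closed[OF 0(4)] by auto
next
 case (Suc n G)
 interpret contraction G by fact
 show ?case
 proof (cases "carrier G = {\<one>\<^bsub>G\<^esub>}")
  case True
  then show ?thesis using subgroup.subset[OF Suc.prems(4)] subgroup.one_closed[OF Suc.prems(4)] by auto
 next
  case False
  then obtain h z where hz: "rhom G h" "z : carrier G" "h z ~= 0" using rhom_exists[OF Suc.prems(2)] by metis
  have rh: "rhom (sub G (carrier G)) (%y. inverse (h z) * h y)" using rhom_scale[OF hz(1)] by (simp add: rhom_def subtopology_superset)
  have KR: "K <= rker G"
   using rhom_compact_subgroup[OF _ Suc.prems(4,5)] subgroup.subset[OF Suc.prems(4)] by (auto simp: rker_def)
  have "K = {\<one>\<^bsub>sub G (rker G)\<^esub>}"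
  proof (rule Suc.IH[OF rker_contraction])
   show "connected_space (topol (sub G (rker G)))" using rker_connected[OF Suc.prems(2)] by (simp add: connectedin_def)
   show "length l <= n" if l: "chain (sub G (rker G)) S l" for S l
   proof -
    \<comment> \<open>A chain in the kernel becomes longer by one in \<open>G\<close> when the
      homomorphism \<open>h\<close>, normalized to 1 at \<open>z\<close>, is put in front; so the
      bound drops from \<open>Suc n\<close> to \<open>n\<close>.\<close>
    have "EX S'. S' <= {y : carrier G. inverse (h z) * h y = 0} & chain G S' l"
     using chain_mono_sub[OF rker_subgroup is_group l] hz by (cases l) (auto simp: rker_def)
    then have "chain G (carrier G) ((%y. inverse (h z) * h y, z) # l)" using hz rh subgroup_self by auto
    then show ?thesis using Suc.prems(3) by fastforce
   qed
   show "subgroup K (sub G (rker G))" using subgroup_sub_iff[OF is_group rker_subgroup KR] Suc.prems by blast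
   show "compactin (topol (sub G (rker G))) K" using Suc.prems KR by (simp add: compactin_subtopology)
  qed
  then show ?thesis by simp
 qed
qed

theorem (in contraction) no_compact_subgroups:
 assumes "connected_space T" "subgroup K G" "compactin T K" shows "K = {\<one>}"
proof -
 have "EX N. ALL S l. chain G S l --> length l <= N" by (rule rank_bound) blast
 then obtain N where "!!S l. chain G S l ==> length l <= N" by blast
 then show ?thesis using no_compact_subgroups_aux[OF contraction_axioms assms(1) _ assms(2,3)] by blast
qed

subsection \<open>Abelian contraction groups\<close>

text \<open>Homogenization of a quasimorphism along powers of two: the values
  \<open>f (x^(2^k)) / 2^k\<close> change by at most \<open>B / 2^(k+1)\<close> from
  \<open>k\<close> to \<open>k + 1\<close>, and the additivity defect is divided by
  \<open>2^k\<close>. Commutativity enters through \<open>(x y)^m = x^m y^m\<close>.\<close>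

lemma (in comm_group) quasi_hom:
 fixes f :: "'a => real"
 assumes H: "subgroup H G" and f: "!!x y. x : H ==> y : H ==> \<bar>f (x \<otimes> y) - f x - f y\<bar> <= B"
 shows "EX h. (ALL x:H. ALL y:H. h (x \<otimes> y) = h x + h y) & (ALL x:H. \<bar>h x - f x\<bar> <= B)"
proof -
 define u where "u x k = f (x [^] ((2::nat) ^ k)) / 2 ^ k" for x k
 have HG: "x : carrier G" if "x : H" for x using that subgroup.subset[OF H] by auto
 have powH: "x [^] (m::nat) : H" if "x : H" for x m
  using that by (induction m) (auto intro: subgroup.one_closed[OF H] subgroup.m_closed[OF H])
 have step: "\<bar>u x (Suc k) - u x k\<bar> <= B / 2 ^ Suc k" if x: "x : H" for x k
 proof -
  let ?y = "x [^] ((2::nat) ^ k)"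
  have "x [^] ((2::nat) ^ Suc k) = ?y \<otimes> ?y" using nat_pow_mult[OF HG[OF x], of "2^k" "2^k"] by (simp add: mult_2)
  then have "u x (Suc k) - u x k = (f (?y \<otimes> ?y) - f ?y - f ?y) / 2 ^ Suc k" unfolding u_def by (simp add: field_simps)
  moreover have "\<bar>(f (?y \<otimes> ?y) - f ?y - f ?y) / 2 ^ Suc k\<bar> <= B / 2 ^ Suc k"
   using f[OF powH[OF x] powH[OF x], of "2^k" "2^k"] by (simp add: abs_divide divide_right_mono)
  ultimately show ?thesis by simp
 qed
 have close: "\<bar>u x k - u x 0\<bar> <= B * (1 - 1 / 2 ^ k)" if x: "x : H" for x k
 proof (induction k)
  case (Suc k)
  have "B * (1 - 1 / 2 ^ k) + B / 2 ^ Suc k = B * (1 - 1 / 2 ^ Suc k)" by (simp add: field_simps)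
  then show ?case using Suc step[OF x, of k] by linarith
 qed simp
 have u0: "u x 0 = f x" if "x : H" for x using HG[OF that] by (simp add: u_def)
 have B0: "0 <= B" using f[OF subgroup.one_closed[OF H] subgroup.one_closed[OF H]] by linarith
 have "EX l. u x \<longlonglongrightarrow> l" if x: "x : H" for x
 proof -
  \<comment> \<open>Subtracting \<open>B / 2^k\<close> compensates the possible decrease at each
    step, so the sequence is increasing and bounded.\<close>
  let ?v = "%k. u x k - B / 2 ^ k"
  have "incseq ?v"
  proof (rule incseq_SucI)
   fix k
   have "B / 2 ^ k = B / 2 ^ Suc k + B / 2 ^ Suc k" by simp
   then show "?v k <= ?v (Suc k)" using step[OF x, of k] by linarith
  qed
  moreover have "?v k <= f x + B" for k
  proof -
   have "B * (1 - 1 / 2 ^ k) <= B * 1" by (rule mult_left_mono[OF _ B0]) simp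
   moreover have "0 <= B / 2 ^ k" using B0 by simp
   ultimately show ?thesis using close[OF x, of k] u0[OF x] by linarith
  qed
  ultimately obtain l where "?v \<longlonglongrightarrow> l" using incseq_convergent[of ?v "f x + B"] by blast
  moreover have "(%k. B / 2 ^ k) \<longlonglongrightarrow> 0" by real_asymp
  ultimately have "(%k. ?v k + B / 2 ^ k) \<longlonglongrightarrow> l + 0" by (rule tendsto_add)
  then show ?thesis by auto
 qed
 then obtain h where h: "!!x. x : H ==> u x \<longlonglongrightarrow> h x" by metis
 have add: "h (x \<otimes> y) = h x + h y" if x: "x : H" and y: "y : H" for x y
 proof -
  have xy: "x \<otimes> y : H" using subgroup.m_closed[OF H x y] .
  have lim: "(%k. u (x \<otimes> y) k - u x k - u y k) \<longlonglongrightarrow> h (x \<otimes> y) - h x - h y" by (intro tendsto_diff h xy x y)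
  have "\<bar>u (x \<otimes> y) k - u x k - u y k\<bar> <= B / 2 ^ k" for k
  proof -
   let ?k = "(2::nat) ^ k"
   have "(x \<otimes> y) [^] ?k = x [^] ?k \<otimes> y [^] ?k" using nat_pow_distrib HG[OF x] HG[OF y] by simp
   then have "u (x \<otimes> y) k - u x k - u y k = (f (x [^] ?k \<otimes> y [^] ?k) - f (x [^] ?k) - f (y [^] ?k)) / 2 ^ k"
    unfolding u_def by (simp add: diff_divide_distrib)
   then show ?thesis using f[OF powH[OF x] powH[OF y], of ?k ?k] by (simp add: abs_divide divide_right_mono)
  qed
  then have ev: "\<forall>\<^sub>F k in sequentially. norm (u (x \<otimes> y) k - u x k - u y k) <= B / 2 ^ k" by simp
  have "(%k. B / 2 ^ k) \<longlonglongrightarrow> 0" by real_asymp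
  from Lim_null_comparison[OF ev this] have "(%k. u (x \<otimes> y) k - u x k - u y k) \<longlonglongrightarrow> 0" .
  then have "h (x \<otimes> y) - h x - h y = 0" by (rule LIMSEQ_unique[OF lim])
  then show ?thesis by simp
 qed
 have bd: "\<bar>h x - f x\<bar> <= B" if x: "x : H" for x
 proof -
  have "(%k. \<bar>u x k - f x\<bar>) \<longlonglongrightarrow> \<bar>h x - f x\<bar>" by (intro tendsto_intros h x)
  moreover have "\<bar>u x k - f x\<bar> <= B" for k
  proof -
   have "B * (1 - 1 / 2 ^ k) <= B * 1" by (rule mult_left_mono[OF _ B0]) simp
   then show ?thesis using close[OF x, of k] u0[OF x] by linarith
  qed
  ultimately show ?thesis by (intro LIMSEQ_le_const2[of "%k. \<bar>u x k - f x\<bar>"]) auto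
 qed
 show ?thesis using add bd by blast
qed

lemma (in comm_group) subgroup_additive_bounded_zero:
 fixes u :: "'a => real"
 assumes S: "subgroup S G" and u: "!!x y. x : S ==> y : S ==> u (x \<otimes> y) = u x + u y"
  and b: "!!x. x : S ==> \<bar>u x\<bar> <= B" and x: "x : S"
 shows "u x = 0"
proof -
 have p: "x [^] (m::nat) : S & u (x [^] m) = m * u x" for m
 proof (induction m)
  case 0 show ?case using u[of \<one> \<one>] subgroup.one_closed[OF S] by simp
 next
  case (Suc m) then show ?case using u[of "x [^] m" x] x subgroup.m_closed[OF S, of "x [^] m" x] by (simp add: algebra_simps)
 qed
 show ?thesis
 proof (rule ccontr)
  assume "u x ~= 0"
  then obtain m :: nat where "B < m * \<bar>u x\<bar>" using reals_Archimedean3[of "\<bar>u x\<bar>"] by auto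
  moreover have "\<bar>real m * u x\<bar> <= B" using b[of "x [^] m"] p[of m] by simp
  ultimately show False by (simp add: abs_mult)
 qed
qed

text \<open>Homogenizing the composition of \<open>g\<close> with the coarse retraction
  \<open>c\<close> gives a homomorphism on \<open>H\<close>. On \<open>S\<close> it differs from
  \<open>g\<close> by a bounded homomorphism, which is zero.\<close>

lemma (in comm_group) hom_extend:
 fixes g :: "'a => real"
 assumes H: "subgroup H G" and S: "subgroup S G" "S <= H"
  and g: "!!x y. x : S ==> y : S ==> g (x \<otimes> y) = g x + g y"
  and c: "!!x. x : H ==> c x : S"
  and b: "!!x y. x : H ==> y : H ==> \<bar>g (c (x \<otimes> y) \<otimes> inv (c x \<otimes> c y))\<bar> <= B" "!!x. x : S ==> \<bar>g (c x \<otimes> inv x)\<bar> <= B"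
 shows "EX h. (ALL x:H. ALL y:H. h (x \<otimes> y) = h x + h y) & (ALL x:S. h x = g x) & (ALL x:H. \<bar>h x - g (c x)\<bar> <= B)"
proof -
 have SG: "x : carrier G" if "x : S" for x using that subgroup.subset[OF S(1)] by auto
 have g1: "g \<one> = 0" using g[of \<one> \<one>] subgroup.one_closed[OF S(1)] by simp
 have ginv: "g (inv x) = - g x" if "x : S" for x
  using g[OF that subgroup.m_inv_closed[OF S(1) that]] g1 SG[OF that] by simp
 have "\<bar>g (c (x \<otimes> y)) - g (c x) - g (c y)\<bar> <= B" if x: "x : H" and y: "y : H" for x y
 proof -
  have xy: "x \<otimes> y : H" using subgroup.m_closed[OF H x y] .
  have cc: "c x \<otimes> c y : S" using subgroup.m_closed[OF S(1) c[OF x] c[OF y]] .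
  show ?thesis using b(1)[OF x y] g[OF c[OF xy] subgroup.m_inv_closed[OF S(1) cc]] ginv[OF cc] g[OF c[OF x] c[OF y]] by linarith
 qed
 then obtain h where h: "!!x y. x : H ==> y : H ==> h (x \<otimes> y) = h x + h y" "!!x. x : H ==> \<bar>h x - g (c x)\<bar> <= B"
  using quasi_hom[OF H, of "%x. g (c x)" B] by blast
 have "h x - g x = 0" if x: "x : S" for x
 proof (rule subgroup_additive_bounded_zero[OF S(1), of "%x. h x - g x" "2 * B"])
  fix y z assume y: "y : S" and z: "z : S"
  show "h (y \<otimes> z) - g (y \<otimes> z) = h y - g y + (h z - g z)" using h(1)[of y z] g[OF y z] S(2) y z by auto
 next
  fix y assume y: "y : S"
  then have yH: "y : H" using S(2) by auto
  show "\<bar>h y - g y\<bar> <= 2 * B"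
   using b(2)[OF y] h(2)[OF yH] g[OF c[OF yH] subgroup.m_inv_closed[OF S(1) y]] ginv[OF y] by linarith
 qed (rule x)
 then have "ALL x:S. h x = g x" by auto
 then show ?thesis using h by blast
qed

context contraction begin

context
 assumes comm: "comm_group G"
begin

interpretation comm_group G by (rule comm)

text \<open>Otherwise the kernel, itself a connected contraction group, has a nonzero real
  homomorphism. For a commutative group the coarse retraction extends it to the whole group, and the
  extension vanishes on the kernel by the definition of the latter.\<close>

lemma rker_trivial:
 assumes conn: "connected_space T" shows "rker G = {\<one>}"
proof (rule ccontr)
 assume nt: "rker G ~= {\<one>}"
 let ?S = "rker G"
 interpret R: contraction "sub G ?S" by (rule rker_contraction)
 have "connected_space (topol (sub G ?S))" using rker_connected[OF conn] by (simp add: connectedin_def)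
 then obtain g z where g: "rhom (sub G ?S) g" "z : ?S" "g z ~= 0"
  using R.rhom_exists nt by auto
 obtain n h x where db: "dual_basis G n h x" using dual_basis_exists[OF conn] .
 obtain c P V where "retracts c P V" using coarse_retraction[OF db] by blast
 note P = retractsD(1)[OF this] and V = retractsD(2,3)[OF this] and cS = retractsD(4)[OF this] and cV = retractsD(5)[OF this]
  and cr = retractsD(6)[OF this] and cm = retractsD(7)[OF this]
 have sS: "subgroup ?S G" by (rule rker_subgroup)
 have cG: "c y : CG" if "y : CG" for y using cS[OF that] rker_carrier by auto
 have "compactin (topol (sub G ?S)) (?S \<inter> (P \<union> (%x. inv x) ` P))"
  using closed_Int_compactin[OF rker_closed compactin_Un[OF P compact_inverses[OF P]]] by (simp add: compactin_subtopology)
 then obtain B where B: "!!y. y : ?S ==> y : P \<or> y : (%x. inv x) ` P ==> \<bar>g y\<bar> <= B" using R.rhom_bounded[OF g(1)] by blast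
 have gadd: "g (y \<otimes> z) = g y + g z" if "y : ?S" "z : ?S" for y z using R.rhom_mult[OF g(1), of y z] that by simp
 \<comment> \<open>In a commutative group the trivial subgroup may serve as \<open>M\<close> in
   \<open>retracts\<close>, so the multiplicative defect is controlled in the group itself.\<close>
 have triv: "{\<one>} \<lhd> G & comm_group (G Mod {\<one>})"
  using abelian_FactGroup[of "{\<one>}"] subgroup_imp_normal[of "{\<one>}"] triv_subgroup by simp
 have key1: "\<bar>g (c (y \<otimes> z) \<otimes> inv (c y \<otimes> c z))\<bar> <= B" if y: "y : CG" and z: "z : CG" for y z
 proof (rule B)
  have yz: "y \<otimes> z : CG" using y z by simp
  show "c (y \<otimes> z) \<otimes> inv (c y \<otimes> c z) : ?S" by (intro subgroup.m_closed[OF sS] subgroup.m_inv_closed[OF sS] cS y z yz)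
  obtain p where p: "p : P" "{\<one>} #> c (y \<otimes> z) = {\<one>} #> (p \<otimes> (c y \<otimes> c z))" using cm[OF y z] triv by blast
  note G = compactin_carrier[OF P p(1)] cG[OF y] cG[OF z] cG[OF yz]
  have "c (y \<otimes> z) = p \<otimes> (c y \<otimes> c z)" using p(2) G by (simp add: r_coset_def)
  then show "c (y \<otimes> z) \<otimes> inv (c y \<otimes> c z) : P \<or> c (y \<otimes> z) \<otimes> inv (c y \<otimes> c z) : (%x. inv x) ` P" using p(1) G by (simp add: m_assoc)
 qed
 have key2: "\<bar>g (c y \<otimes> inv y)\<bar> <= B" if y: "y : ?S" for y
 proof (rule B)
  have yG: "y : CG" using y rker_carrier by auto
  show "c y \<otimes> inv y : ?S" by (intro subgroup.m_closed[OF sS] subgroup.m_inv_closed[OF sS] cS y yG)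
  obtain p where p: "p : P" "y = p \<otimes> c y" using cr[OF y] by blast
  have "c y \<otimes> inv (p \<otimes> c y) = inv p" using compactin_carrier[OF P p(1)] cG[OF yG] by (simp add: inv_mult_group m_assoc[symmetric])
  then have "c y \<otimes> inv y = inv p" using p(2) by simp
  then show "c y \<otimes> inv y : P \<or> c y \<otimes> inv y : (%x. inv x) ` P" using p(1) by blast
 qed
 obtain f where f: "!!y z. y : CG ==> z : CG ==> f (y \<otimes> z) = f y + f z" "!!y. y : ?S ==> f y = g y"
  "!!y. y : CG ==> \<bar>f y - g (c y)\<bar> <= B"
  using hom_extend[OF subgroup_self sS rker_carrier gadd cS key1 key2] by blast
 have "\<bar>f y\<bar> <= 2 * B" if y: "y : V" for y
 proof -
  have yG: "y : CG" using y openin_carrier[OF V(1)] by auto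
  show ?thesis using f(3)[OF yG] B[OF cS[OF yG]] cV[OF y] by force
 qed
 then have "rhom G f" using f(1) V(1,2) by (intro bounded_additive_rhom[of f V "2 * B"])
 then have "f z = 0" using g(2) by (auto simp: rker_def)
 then show False using f(2)[OF g(2)] g(3) by simp
qed

text \<open>Words in the dual points realize all integer coordinate vectors, and a high power of the
  contraction makes this lattice arbitrarily fine. The kernel being trivial, properness makes the
  sets of approximate solutions nested and compact, so that an exact solution exists.\<close>

lemma dual_basis_surj:
 assumes conn: "connected_space T" and db: "dual_basis G n h x"
 shows "EX y:CG. ALL i<n. h i y = t i"
proof -
 note xc = dual_basis_carrier[OF db] and hr = dual_basis_rhom[OF db]
 have approx: "EX y:CG. ALL i<n. \<bar>h i y - t i\<bar> <= e" if e: "0 < e" for e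
 proof -
  have "EX N. ALL m>=N. ALL i<n. ALL j<n. \<bar>h i (act (int m) (x j))\<bar> <= e / (n + 1)"
  proof -
   have "EX N. ALL m>=N. \<bar>h i (act (int m) (x j))\<bar> <= e / (n + 1)" if i: "i < n" and j: "j < n" for i j
   proof -
    obtain U where U: "openin T U" "\<one> : U" "ALL y:U. \<bar>h i y - h i \<one>\<bar> < e / (n + 1)"
     using continuous_map_realD[OF rhom_cont[OF hr[OF i]], of \<one> "e / (n + 1)"] e by auto
    obtain N where N: "!!n. int N <= n ==> act n (x j) : U" using act_eventually[OF xc[OF j] U(1,2)] by blast
    show ?thesis using U(3) N rhom_one[OF hr[OF i]] by (intro exI[of _ N]) (auto intro!: less_imp_le)
   qed
   then obtain N where N: "!!i j m. i < n ==> j < n ==> N i j <= m ==> \<bar>h i (act (int m) (x j))\<bar> <= e / (n + 1)" by metis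
   have "N i j <= (\<Sum>i<n. \<Sum>j<n. N i j)" if "i < n" "j < n" for i j
   proof -
    have "N i j <= (\<Sum>j<n. N i j)" using that by (intro member_le_sum) auto
    also have "... <= (\<Sum>i<n. \<Sum>j<n. N i j)" using that by (intro member_le_sum[of i "{..<n}" "%i. \<Sum>j<n. N i j"]) auto
    finally show ?thesis .
   qed
   then show ?thesis using N by (meson order_trans)
  qed
  then obtain m where m: "!!i j. i < n ==> j < n ==> \<bar>h i (act (int m) (x j))\<bar> <= e / (n + 1)" by blast
  \<comment> \<open>\<open>s\<close> is the vector \<open>t\<close> transformed by \<alpha>^(-m).
    Rounding it costs at most 1 in each coordinate, and the small matrix of \<alpha>^m reduces this
    error to at most \<open>e\<close>.\<close>
  define s where "s j = (\<Sum>l<n. h j (act (- int m) (x l)) * t l)" for j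
  let ?y = "act (int m) (lincomb G n x (%j. \<lfloor>s j\<rfloor>))"
  have lc: "lincomb G n x v : CG" for v by (rule lincomb_closed) (rule xc)
  have "\<bar>h i ?y - t i\<bar> <= e" if i: "i < n" for i
  proof -
   have 1: "h i ?y = (\<Sum>j<n. of_int \<lfloor>s j\<rfloor> * h i (act (int m) (x j)))"
    using lincomb_rhom[OF rhom_act[OF hr[OF i], of "int m"], of n x "%j. \<lfloor>s j\<rfloor>"] xc by simp
   have "t i = (\<Sum>l<n. (if l = i then 1 else 0) * t l)" using i by (simp add: if_distrib[of "%u. u * _"] cong: if_cong)
   also have "... = (\<Sum>l<n. h i (act (int m) (act (- int m) (x l))) * t l)"
    by (rule sum.cong) (use db i xc in \<open>simp_all add: dual_basis_def\<close>)
   also have "... = (\<Sum>l<n. (\<Sum>j<n. h i (act (int m) (x j)) * h j (act (- int m) (x l))) * t l)"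
   proof (rule sum.cong[OF refl])
    fix l assume "l : {..<n}"
    then have "act (- int m) (x l) : CG" using xc by simp
    then show "h i (act (int m) (act (- int m) (x l))) * t l = (\<Sum>j<n. h i (act (int m) (x j)) * h j (act (- int m) (x l))) * t l"
     using dual_basis_act[OF db i, of _ "int m"] by simp
   qed
   also have "... = (\<Sum>l<n. \<Sum>j<n. h i (act (int m) (x j)) * (h j (act (- int m) (x l)) * t l))" by (simp add: sum_distrib_right mult.assoc)
   also have "... = (\<Sum>j<n. h i (act (int m) (x j)) * s j)" unfolding s_def by (subst sum.swap) (simp add: sum_distrib_left)
   finally have "h i ?y - t i = (\<Sum>j<n. (of_int \<lfloor>s j\<rfloor> - s j) * h i (act (int m) (x j)))"
    unfolding 1 by (simp add: sum_subtractf[symmetric] algebra_simps)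
   also have "\<bar>...\<bar> <= (\<Sum>j<n. e / (n + 1))"
   proof (rule order_trans[OF sum_abs], rule sum_mono)
    fix j assume "j : {..<n}"
    then have "\<bar>h i (act (int m) (x j))\<bar> <= e / (n + 1)" using m i by simp
    moreover have "\<bar>of_int \<lfloor>s j\<rfloor> - s j\<bar> <= 1" by linarith
    ultimately have "\<bar>of_int \<lfloor>s j\<rfloor> - s j\<bar> * \<bar>h i (act (int m) (x j))\<bar> <= 1 * (e / (n + 1))" by (intro mult_mono) auto
    then show "\<bar>(of_int \<lfloor>s j\<rfloor> - s j) * h i (act (int m) (x j))\<bar> <= e / (n + 1)" by (simp add: abs_mult)
   qed
   also have "... <= e" using e by (simp add: field_simps)
   finally show ?thesis .
  qed
  then show ?thesis using lc by blast
 qed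
 define C where "C k = {y : CG. ALL i<n. \<bar>h i y - t i\<bar> <= 1 / real (Suc k)}" for k
 have Ccl: "closedin T (C k)" for k
 proof -
  have "closedin T {y : topspace T. h i y : {t i - 1 / real (Suc k)..t i + 1 / real (Suc k)}}" if "i < n" for i
   by (rule closedin_continuous_map_preimage[OF rhom_cont[OF hr[OF that]]]) simp
  then have "closedin T (\<Inter>(insert (CG) ((%i. {y : topspace T. h i y : {t i - 1 / real (Suc k)..t i + 1 / real (Suc k)}}) ` {..<n})))"
   using closedin_topspace[of T] by (intro closedin_Inter) auto
  also have "\<Inter>(insert (CG) ((%i. {y : topspace T. h i y : {t i - 1 / real (Suc k)..t i + 1 / real (Suc k)}}) ` {..<n})) = C k"
   unfolding C_def by (auto simp: abs_le_iff algebra_simps)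
  finally show ?thesis .
 qed
 obtain K where K: "compactin T K" "!!y. y : CG ==> ALL i<n. \<bar>h i y\<bar> <= (\<Sum>i<n. \<bar>t i\<bar>) + 1 ==> y : K <#> rker G"
  using rker_proper[OF db] by blast
 have CK: "C k <= K" for k
 proof
  fix y assume y: "y : C k"
  have "\<bar>h i y\<bar> <= (\<Sum>i<n. \<bar>t i\<bar>) + 1" if i: "i < n" for i
  proof -
   have "\<bar>h i y - t i\<bar> <= 1 / real (Suc k)" using y i by (simp add: C_def)
   moreover have "1 / real (Suc k) <= 1" by simp
   moreover have "\<bar>t i\<bar> <= (\<Sum>i<n. \<bar>t i\<bar>)" using i by (intro member_le_sum) auto
   ultimately show ?thesis by linarith
  qed
  then have "y : K <#> {\<one>}" using K(2)[of y] y rker_trivial[OF conn] by (simp add: C_def)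
  then show "y : K" using set_mult_one(1)[OF compactin_subset_carrier[OF K(1)]] by simp
 qed
 have mono: "C k <= C l" if "l <= k" for k l
 proof -
  have "1 / real (Suc k) <= 1 / real (Suc l)" using that by (simp add: frac_le)
  then show ?thesis unfolding C_def by (auto intro: order_trans)
 qed
 show ?thesis
 proof (rule ccontr)
  assume no: "~ ?thesis"
  have "K <= (\<Union>k. CG - C k)"
  proof
   fix y assume "y : K"
   then have yG: "y : CG" using compactin_carrier[OF K(1)] by auto
   then obtain i where i: "i < n" "h i y ~= t i" using no by blast
   obtain k where "1 / real (Suc k) < \<bar>h i y - t i\<bar>" using nat_approx_posE[of "\<bar>h i y - t i\<bar>"] i(2) by auto
   then have "y ~: C k" using i(1) by (auto simp: C_def)
   then show "y : (\<Union>k. CG - C k)" using yG by blast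
  qed
  moreover have "openin T (CG - C k)" for k using openin_diff[OF openin_topspace Ccl[of k]] by simp
  moreover have "CG - C m <= CG - C k" if "m <= k" for m k using mono[OF that] by auto
  ultimately obtain k where "K <= CG - C k" using compact_increasing[OF K(1), of "%k. CG - C k"] by blast
  moreover obtain y where "y : C k" using approx[of "1 / real (Suc k)"] by (auto simp: C_def)
  ultimately show False using CK by blast
 qed
qed

end

end

section \<open>Structure of abelian contraction groups\<close>

context contraction begin

lemma rhom_zero_closed:
 fixes n :: nat
 assumes "!!i. i < n ==> rhom G (h i)" "closedin T S"
 shows "closedin T {y : S. ALL i<n. h i y = 0}"
proof -
 have "closedin T {y : topspace T. h i y : {0}}" if "i < n" for i
  by (rule closedin_continuous_map_preimage[OF rhom_cont[OF assms(1)[OF that]]]) simp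
 then have "closedin T (\<Inter>(insert S ((%i. {y : topspace T. h i y : {0}}) ` {..<n})))"
  using assms(2) by (intro closedin_Inter) auto
 also have "\<Inter>(insert S ((%i. {y : topspace T. h i y : {0}}) ` {..<n})) = {y : S. ALL i<n. h i y = 0}"
  using closedin_subset_carrier[OF assms(2)] by auto
 finally show ?thesis .
qed

text \<open>The conclusion encodes a product decomposition: \<open>E\<close> is a vector group with
  coordinates \<open>h i\<close>, on which the contraction has the matrix \<open>M\<close>, and the
  complement is the common kernel of the \<open>h i\<close>, in which \<open>S\<close> cuts out a
  compact open invariant subgroup. The coordinates are those of the identity component. They extend
  to \<open>S\<close>, which is compact modulo the component, by homogenization, and from
  \<open>S\<close> to the whole group by applying \<alpha>^m first and the inverse matrix power
  afterwards.\<close>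

theorem abelian_structure:
 assumes comm: "comm_group G"
 shows "EX (n::nat) h M E S. (ALL i<n. rhom G (h i)) & (ALL i<n. ALL y:CG. h i (contr G y) = (\<Sum>j<n. M i j * h j y)) &
  subgroup E G & contr G ` E = E & (ALL t. EX y:E. ALL i<n. h i y = t i) &
  (ALL U. openin T U & \<one> : U --> (EX e>0. ALL y:E. (ALL i<n. \<bar>h i y\<bar> < e) --> y : U)) &
  subgroup S G & openin T S & (ALL y:S. contr G y : S) & compactin T {y : S. ALL i<n. h i y = 0}"
proof -
 interpret comm_group G by (rule comm)
 let ?E = comp0
 interpret E: contraction "sub G ?E" by (rule comp0_contraction)
 have Ecomm: "comm_group (sub G ?E)"
  by (rule E.group_comm_groupI) (use comp0_carrier m_comm in auto)
 have EG: "y : CG" if "y : ?E" for y using that comp0_carrier by auto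
 have sE: "subgroup ?E G" by (rule comp0_subgroup)
 obtain n g e where db: "dual_basis (sub G ?E) n g e" using E.dual_basis_exists[OF comp0_connected_space] .
 have gr: "rhom (sub G ?E) (g i)" and eE: "e i : ?E" if "i < n" for i using db that by (auto simp: dual_basis_def)
 have gadd: "g i (y \<otimes> z) = g i y + g i z" if "i < n" "y : ?E" "z : ?E" for i y z using E.rhom_mult[OF gr[OF that(1)], of y z] that by simp
 have actE: "act k y : ?E" if "y : ?E" for k y using act_comp0[of k] that by blast
 define M where "M k i j = g i (act k (e j))" for k i j
 have gact: "g i (act k y) = (\<Sum>j<n. M k i j * g j y)" if "i < n" "y : ?E" for i k y
  using E.dual_basis_act[OF db that(1), of y k] that(2) eE by (simp add: M_def act_sub[OF sE contr_comp0])
 have Mcomp: "(\<Sum>j<n. M a i j * M b j l) = M (a + b) i l" if "i < n" "l < n" for a b i l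
  using gact[OF that(1) actE[OF eE[OF that(2)]], of a b] act_add[OF EG[OF eE[OF that(2)]], of a b] by (simp add: M_def)
 have M0: "M 0 i j = (if i = j then 1 else 0)" if "i < n" "j < n" for i j using db that by (simp add: M_def dual_basis_def)
 obtain S W where S: "subgroup S G" "openin T S" "?E <= S" "!!x. x : S ==> contr G x : S" and W: "compactin T W" "S <= W <#> ?E"
  using open_subgroup_invariant by blast
 have SG: "x : CG" if "x : S" for x using that openin_carrier[OF S(2)] by auto
 have Sact: "act (int k) x : S" if "x : S" for k x using act_invariant[of S "int k" x] S(4) openin_subset_carrier[OF S(2)] that by simp
 \<comment> \<open>\<open>cc\<close> is a coarse retraction of \<open>S\<close> onto the component:
   its error \<open>kk\<close> stays in the compact set \<open>W\<close>.\<close>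
 have "ALL x:S. EX k c. k : W & c : ?E & x = k \<otimes> c" using W(2) unfolding subset_iff mem_set_mult by blast
 then obtain kk cc where kc: "!!x. x : S ==> kk x : W" "!!x. x : S ==> cc x : ?E" "!!x. x : S ==> x = kk x \<otimes> cc x" by metis
 have kkG: "kk x : CG" and ccG: "cc x : CG" if "x : S" for x using kc(1,2)[OF that] compactin_carrier[OF W(1)] EG by auto
 have cck: "cc x = inv kk x \<otimes> x" if "x : S" for x using kc(3)[OF that] kkG[OF that] ccG[OF that] by (metis inv_closed l_inv l_one m_assoc)
 let ?I = "(%x. inv x) ` W"
 define P where "P = (?I <#> (W <#> W)) \<union> ?I"
 have gbd: "EX B. ALL i<n. ALL y:?E \<inter> L. \<bar>g i y\<bar> <= B" if "compactin T L" for L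
  by (rule E.rhoms_bounded) (use gr closed_Int_compactin[OF comp0_closed that] in \<open>auto simp: compactin_subtopology\<close>)
 have Pc: "compactin T P" unfolding P_def by (intro compactin_Un compact_mult compact_inverses W(1))
 obtain B where B: "ALL i<n. ALL y:?E \<inter> P. \<bar>g i y\<bar> <= B" using gbd[OF Pc] by blast
 have key1: "cc (x \<otimes> y) \<otimes> inv (cc x \<otimes> cc y) : ?E \<inter> P" if x: "x : S" and y: "y : S" for x y
 proof -
  have xy: "x \<otimes> y : S" using subgroup.m_closed[OF S(1) x y] .
  note G = ccG[OF x] ccG[OF y] ccG[OF xy] kkG[OF x] kkG[OF y] kkG[OF xy]
  have "x \<otimes> y = (kk x \<otimes> cc x) \<otimes> (kk y \<otimes> cc y)" using kc(3)[OF x] kc(3)[OF y] by simp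
  also have "... = (kk x \<otimes> kk y) \<otimes> (cc x \<otimes> cc y)" using G by (simp add: m_ac)
  finally have "cc (x \<otimes> y) = inv kk (x \<otimes> y) \<otimes> ((kk x \<otimes> kk y) \<otimes> (cc x \<otimes> cc y))"
   by (rule trans[OF cck[OF xy] arg_cong[of _ _ "%z. inv kk (x \<otimes> y) \<otimes> z"]])
  then have "cc (x \<otimes> y) \<otimes> inv (cc x \<otimes> cc y) = inv kk (x \<otimes> y) \<otimes> (kk x \<otimes> kk y)" using G by (simp add: m_assoc)
  also have "... : P" unfolding P_def using kc(1)[OF x] kc(1)[OF y] kc(1)[OF xy] by (intro UnI1 set_multI imageI)
  moreover have "cc (x \<otimes> y) \<otimes> inv (cc x \<otimes> cc y) : ?E" by (intro subgroup.m_closed[OF sE] subgroup.m_inv_closed[OF sE] kc(2) x y xy)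
  ultimately show ?thesis by simp
 qed
 have key2: "cc x \<otimes> inv x : ?E \<inter> P" if x: "x : ?E" for x
 proof -
  have xS: "x : S" using x S(3) by auto
  have "cc x \<otimes> inv x = inv kk x" using cck[OF xS] kkG[OF xS] SG[OF xS] by (simp add: m_assoc)
  then have "cc x \<otimes> inv x : P" unfolding P_def using kc(1)[OF xS] by auto
  moreover have "cc x \<otimes> inv x : ?E" by (intro subgroup.m_closed[OF sE] subgroup.m_inv_closed[OF sE] kc(2) x xS)
  ultimately show ?thesis by simp
 qed
 have "EX h. (ALL x:S. ALL y:S. h (x \<otimes> y) = h x + h y) & (ALL x:?E. h x = g i x) & (ALL x:S. \<bar>h x - g i (cc x)\<bar> <= B)" if i: "i < n" for i
  by (rule hom_extend[OF S(1) sE S(3)]) (use gadd[OF i] kc(2) key1 key2 B i in auto)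
 then have "ALL i. EX h. i < n --> (ALL x:S. ALL y:S. h (x \<otimes> y) = h x + h y) & (ALL x:?E. h x = g i x) & (ALL x:S. \<bar>h x - g i (cc x)\<bar> <= B)" by blast
 then obtain f where f': "ALL i. i < n --> (ALL x:S. ALL y:S. f i (x \<otimes> y) = f i x + f i y) & (ALL x:?E. f i x = g i x) & (ALL x:S. \<bar>f i x - g i (cc x)\<bar> <= B)"
  by (rule choice[THEN exE])
 have fadd: "f i (x \<otimes> y) = f i x + f i y" if "i < n" "x : S" "y : S" for i x y using f' that by blast
 have fE: "f i x = g i x" if "i < n" "x : ?E" for i x using f' that by blast
 have fc: "\<bar>f i x - g i (cc x)\<bar> <= B" if "i < n" "x : S" for i x using f' that by blast
 have fbd: "EX b. ALL i<n. ALL x:S \<inter> L. \<bar>f i x\<bar> <= b" if L: "compactin T L" for L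
 proof -
  obtain b where b: "ALL i<n. ALL y:?E \<inter> (?I <#> L). \<bar>g i y\<bar> <= b" using gbd[OF compact_mult[OF compact_inverses[OF W(1)] L]] by blast
  have "\<bar>f i x\<bar> <= B + b" if i: "i < n" and x: "x : S \<inter> L" for i x
  proof -
   have xS: "x : S" and xL: "x : L" using x by auto
   have "cc x : ?I <#> L" unfolding cck[OF xS] by (intro set_multI imageI kc(1)[OF xS] xL)
   then have "\<bar>g i (cc x)\<bar> <= b" using b i kc(2)[OF xS] by blast
   then show ?thesis using fc[OF i xS] by linarith
  qed
  then show ?thesis by blast
 qed
 have fact: "f i (act (int k) x) = (\<Sum>j<n. M (int k) i j * f j x)" if i: "i < n" and x: "x : S" for i k x
 proof -
  \<comment> \<open>The difference of the two sides is additive and vanishes on the component, so it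
    depends only on the factor \<open>kk\<close> in \<open>W\<close>. It is then a bounded
    homomorphism, hence zero.\<close>
  let ?u = "%x. f i (act (int k) x) - (\<Sum>j<n. M (int k) i j * f j x)"
  have uadd: "?u (y \<otimes> z) = ?u y + ?u z" if y: "y : S" and z: "z : S" for y z
  proof -
   have "f i (act (int k) (y \<otimes> z)) = f i (act (int k) y) + f i (act (int k) z)"
    using fadd[OF i Sact[OF y] Sact[OF z]] act_mult[OF SG[OF y] SG[OF z]] by simp
   moreover have "(\<Sum>j<n. M (int k) i j * f j (y \<otimes> z)) = (\<Sum>j<n. M (int k) i j * f j y + M (int k) i j * f j z)"
    by (rule sum.cong) (use fadd y z in \<open>auto simp: algebra_simps\<close>)
   ultimately show ?thesis by (simp add: sum.distrib)
  qed
  have uE: "?u c = 0" if c: "c : ?E" for c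
  proof -
   have "f i (act (int k) c) = (\<Sum>j<n. M (int k) i j * g j c)" using fE[OF i actE[OF c]] gact[OF i c] by simp
   also have "... = (\<Sum>j<n. M (int k) i j * f j c)" by (rule sum.cong) (use fE c in auto)
   finally show ?thesis by simp
  qed
  obtain b1 where b1: "ALL i<n. ALL x:S \<inter> W. \<bar>f i x\<bar> <= b1" using fbd[OF W(1)] by blast
  obtain b2 where b2: "ALL i<n. ALL x:S \<inter> act (int k) ` W. \<bar>f i x\<bar> <= b2" using fbd[OF compact_act[OF W(1)]] by blast
  have bnd: "\<bar>?u y\<bar> <= b2 + (\<Sum>j<n. \<bar>M (int k) i j\<bar> * b1)" if y: "y : S" for y
  proof -
   have cS: "cc y : S" using kc(2)[OF y] S(3) by auto
   have "kk y = y \<otimes> inv cc y" using kc(3)[OF y] kkG[OF y] ccG[OF y] by (metis inv_solve_right m_closed)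
   then have kS: "kk y : S" using subgroup.m_closed[OF S(1) y subgroup.m_inv_closed[OF S(1) cS]] by simp
   have "?u y = ?u (kk y \<otimes> cc y)" using kc(3)[OF y] by simp
   also have "... = ?u (kk y)" using uadd[OF kS cS] uE[OF kc(2)[OF y]] by simp
   finally have "?u y = ?u (kk y)" .
   moreover have "\<bar>f i (act (int k) (kk y))\<bar> <= b2" using b2 i Sact[OF kS] kc(1)[OF y] by blast
   moreover have "\<bar>\<Sum>j<n. M (int k) i j * f j (kk y)\<bar> <= (\<Sum>j<n. \<bar>M (int k) i j\<bar> * b1)"
    by (rule order_trans[OF sum_abs], rule sum_mono) (use b1 kS kc(1)[OF y] in \<open>auto simp: abs_mult intro!: mult_left_mono\<close>)
   ultimately show ?thesis by linarith
  qed
  have "?u x = 0"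
   by (rule subgroup_additive_bounded_zero[OF S(1), of ?u "b2 + (\<Sum>j<n. \<bar>M (int k) i j\<bar> * b1)" x]; fact)
  then show ?thesis by simp
 qed
 have hit: "EX N. ALL m>=N. act (int m) x : S" if "x : CG" for x
  using act_eventually[OF that S(2) subgroup.one_closed[OF S(1)]] by (metis of_nat_le_iff)
 \<comment> \<open>The value is independent of \<open>m\<close> once the iterate of \<open>x\<close>
   lies in \<open>S\<close>; the least such \<open>m\<close> is used for the definition of
   \<open>H\<close>.\<close>
 define V where "V m i x = (\<Sum>j<n. M (- int m) i j * f j (act (int m) x))" for m i x
 define H where "H i x = V (LEAST m. act (int m) x : S) i x" for i x
 have Vadd: "V (m + k) i x = V m i x" if x: "x : CG" "act (int m) x : S" and i: "i < n" for m k i x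
 proof -
  have "f j (act (int (m + k)) x) = (\<Sum>l<n. M (int k) j l * f l (act (int m) x))" if "j < n" for j
   using fact[OF that x(2), of k] act_add[OF x(1), of "int k" "int m"] by (simp add: add.commute)
  then have "V (m + k) i x = (\<Sum>j<n. M (- int (m + k)) i j * (\<Sum>l<n. M (int k) j l * f l (act (int m) x)))"
   unfolding V_def by (intro sum.cong) auto
  also have "... = (\<Sum>l<n. (\<Sum>j<n. M (- int (m + k)) i j * M (int k) j l) * f l (act (int m) x))"
   by (simp add: sum_distrib_left sum_distrib_right mult.assoc) (rule sum.swap)
  also have "... = V m i x" unfolding V_def by (rule sum.cong) (use Mcomp[OF i] in auto)
  finally show ?thesis .
 qed
 have HV: "H i x = V m i x" if x: "x : CG" "act (int m) x : S" and i: "i < n" for i x m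
 proof -
  let ?m = "LEAST m. act (int m) x : S"
  have "act (int ?m) x : S" by (rule LeastI[of "%m. act (int m) x : S", OF x(2)])
  moreover have "?m <= m" by (rule Least_le) (rule x(2))
  ultimately show ?thesis using Vadd[OF x(1) _ i, of ?m "m - ?m"] by (simp add: H_def)
 qed
 have HS: "H i x = f i x" if x: "x : S" and i: "i < n" for i x
 proof -
  have "H i x = (\<Sum>j<n. M 0 i j * f j x)" using HV[OF SG[OF x] _ i, of 0] x by (simp add: V_def)
  also have "... = (\<Sum>j<n. if i = j then f j x else 0)" by (rule sum.cong) (use M0 i in auto)
  finally show ?thesis using i by simp
 qed
 have Hadd: "H i (x \<otimes> y) = H i x + H i y" if i: "i < n" and x: "x : CG" and y: "y : CG" for i x y
 proof -
  obtain N1 N2 where "ALL m>=N1. act (int m) x : S" "ALL m>=N2. act (int m) y : S" using hit[OF x] hit[OF y] by blast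
  then have m: "act (int (max N1 N2)) x : S" "act (int (max N1 N2)) y : S" by (meson max.cobounded1, meson max.cobounded2)
  let ?m = "max N1 N2"
  have am: "act (int ?m) (x \<otimes> y) = act (int ?m) x \<otimes> act (int ?m) y" by (rule act_mult[OF x y])
  then have xyS: "act (int ?m) (x \<otimes> y) : S" using subgroup.m_closed[OF S(1) m] by simp
  have "V ?m i (x \<otimes> y) = (\<Sum>j<n. M (- int ?m) i j * f j (act (int ?m) x) + M (- int ?m) i j * f j (act (int ?m) y))"
   unfolding V_def am by (rule sum.cong) (use fadd m in \<open>auto simp: algebra_simps\<close>)
  then show ?thesis using HV[OF x m(1) i] HV[OF y m(2) i] HV[OF _ xyS i] x y by (simp add: V_def sum.distrib)
 qed
 obtain V0 K0 where V0: "openin T V0" "\<one> : V0" "V0 <= K0" "compactin T K0" "K0 <= S"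
  using compact_nbhd[OF S(2) subgroup.one_closed[OF S(1)]] by metis
 obtain b0 where b0: "ALL i<n. ALL x:S \<inter> K0. \<bar>f i x\<bar> <= b0" using fbd[OF V0(4)] by blast
 have Hr: "rhom G (H i)" if i: "i < n" for i
 proof (rule bounded_additive_rhom[of _ V0 b0])
  fix x assume "x : V0"
  then have "x : S \<inter> K0" using V0 by auto
  then show "\<bar>H i x\<bar> <= b0" using b0 i HS[OF _ i, of x] by auto
 qed (use Hadd[OF i] V0 in auto)
 have Hcontr: "H i (contr G y) = (\<Sum>j<n. M 1 i j * H j y)" if i: "i < n" and y: "y : CG" for i y
 proof -
  obtain m where m: "act (int m) y : S" using hit[OF y] by blast
  have c: "act (int m) (contr G y) = act (int 1) (act (int m) y)" using act_contr[OF y] by (simp add: act_1)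
  have mc: "act (int m) (contr G y) : S" unfolding c by (rule Sact[OF m])
  have yc: "contr G y : CG" using y by simp
  have "H i (contr G y) = (\<Sum>j<n. M (- int m) i j * (\<Sum>l<n. M 1 j l * f l (act (int m) y)))"
   unfolding HV[OF yc mc i] V_def c by (rule sum.cong) (use fact[OF _ m, of _ 1] in auto)
  also have "... = (\<Sum>l<n. (\<Sum>j<n. M (- int m) i j * M 1 j l) * f l (act (int m) y))"
   by (simp add: sum_distrib_left sum_distrib_right mult.assoc) (rule sum.swap)
  also have "... = (\<Sum>l<n. (\<Sum>j<n. M 1 i j * M (- int m) j l) * f l (act (int m) y))"
   by (rule sum.cong) (use Mcomp[OF i] in \<open>auto simp: add.commute\<close>)
  also have "... = (\<Sum>j<n. M 1 i j * (\<Sum>l<n. M (- int m) j l * f l (act (int m) y)))"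
   by (simp add: sum_distrib_left sum_distrib_right mult.assoc) (rule sum.swap)
  also have "... = (\<Sum>j<n. M 1 i j * H j y)" by (rule sum.cong) (use HV[OF y m] in \<open>auto simp: V_def\<close>)
  finally show ?thesis .
 qed
 have HE: "H i y = g i y" if "i < n" "y : ?E" for i y using HS[OF _ that(1), of y] fE[OF that] that(2) S(3) by auto
 have triv: "rker (sub G ?E) = {\<one>}" using E.rker_trivial[OF Ecomm comp0_connected_space] by simp
 have surj: "EX y:?E. ALL i<n. H i y = t i" for t
 proof -
  obtain y where "y : ?E" "ALL i<n. g i y = t i" using E.dual_basis_surj[OF Ecomm comp0_connected_space db, of t] by auto
  then show ?thesis using HE by (intro bexI[of _ y]) auto
 qed
 have near: "EX d>0. ALL y:?E. (ALL i<n. \<bar>H i y\<bar> < d) --> y : U" if U: "openin T U" "\<one> : U" for U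
 proof -
  have "openin (topol (sub G ?E)) (U \<inter> ?E)" using U(1) by (auto simp: openin_subtopology)
  moreover have "\<one>\<^bsub>sub G ?E\<^esub> : U \<inter> ?E" using U(2) comp0_one by simp
  ultimately obtain d where d: "0 < d" "!!y. y : carrier (sub G ?E) ==> ALL i<n. \<bar>g i y\<bar> < d ==> y : (U \<inter> ?E) <#>\<^bsub>sub G ?E\<^esub> rker (sub G ?E)"
   using E.rker_nbhd[OF db] by blast
  have "(U \<inter> ?E) <#>\<^bsub>sub G ?E\<^esub> rker (sub G ?E) = U \<inter> ?E"
   unfolding triv set_mult_sub using set_mult_one(1)[of "U \<inter> ?E"] comp0_carrier by auto
  then show ?thesis using d HE by (intro exI[of _ d]) auto
 qed
 have comp: "compactin T {y : S. ALL i<n. H i y = 0}"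
 proof -
  \<comment> \<open>Where all coordinates of \<open>y\<close> vanish, those of \<open>cc y\<close>
    are at most \<open>B\<close>, so properness in the component confines \<open>cc y\<close> to a
    compact set.\<close>
  obtain K where K: "compactin (topol (sub G ?E)) K" "!!y. y : carrier (sub G ?E) ==> ALL i<n. \<bar>g i y\<bar> <= B ==> y : K <#>\<^bsub>sub G ?E\<^esub> rker (sub G ?E)"
   using E.rker_proper[OF db] by blast
  have KT: "compactin T K" "K <= CG" using K(1) comp0_carrier by (auto simp: compactin_subtopology)
  have "{y : S. ALL i<n. H i y = 0} <= W <#> K"
  proof
   fix y assume y: "y : {y : S. ALL i<n. H i y = 0}"
   then have yS: "y : S" by simp
   have "\<bar>g i (cc y)\<bar> <= B" if i: "i < n" for i
   proof -
    have "f i y = 0" using y HS[OF yS i] i by simp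
    then show ?thesis using fc[OF i yS] by simp
   qed
   then have "cc y : K <#> {\<one>}" using K(2)[of "cc y"] kc(2)[OF yS] triv by simp
   then have "cc y : K" using set_mult_one(1)[OF KT(2)] by simp
   then have "kk y \<otimes> cc y : W <#> K" by (intro set_multI kc(1)[OF yS])
   then show "y : W <#> K" using kc(3)[OF yS] by simp
  qed
  moreover have "closedin T {y : S. ALL i<n. H i y = 0}" by (rule rhom_zero_closed[OF Hr open_subgroup_closed[OF S(1,2)]])
  ultimately show ?thesis using closed_compactin[OF compact_mult[OF W(1) KT(1)]] by blast
 qed
 show ?thesis
  by (rule exI[of _ n], rule exI[of _ H], rule exI[of _ "M 1"], rule exI[of _ ?E], rule exI[of _ S])
   (intro conjI allI impI ballI sE contr_comp0 S(1,2,4) comp Hr Hcontr surj near; simp)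
qed

end

subsection \<open>Equivariant sections\<close>

lemma continuous_mapI_local:
 assumes "!!x. x : topspace X ==> f x : topspace Y"
  "!!x U. x : topspace X ==> openin Y U ==> f x : U ==> EX V. openin X V & x : V & (ALL y:V. f y : U)"
 shows "continuous_map X Y f"
 unfolding continuous_map_def
proof (intro conjI allI impI)
 fix U assume U: "openin Y U"
 show "openin X {x : topspace X. f x : U}"
 proof (subst openin_subopen, intro ballI)
  fix x assume x: "x : {x : topspace X. f x : U}"
  then obtain V where V: "openin X V" "x : V" "ALL y:V. f y : U" using assms(2)[of x U] U by blast
  then have "V <= {x : topspace X. f x : U}" using openin_subset[OF V(1)] by blast
  then show "EX T. openin X T & x : T & T <= {x : topspace X. f x : U}" using V by blast
 qed
qed (use assms(1) in auto)

lemma (in group) transversal_exists: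
 assumes M: "subgroup M G" and H: "subgroup H G" "M <= H"
 obtains R where "R <= H" "\<one> : R" "!!x. x : H ==> EX t:R. inv t \<otimes> x : M" "!!s t. s : R ==> t : R ==> inv s \<otimes> t : M ==> s = t"
proof -
 have HG: "x : carrier G" if "x : H" for x using that subgroup.subset[OF H(1)] by auto
 define cl where "cl x = {y : H. inv x \<otimes> y : M}" for x
 define r where "r x = (if \<one> : cl x then \<one> else SOME y. y : cl x)" for x
 have self: "x : cl x" if "x : H" for x using that HG[OF that] subgroup.one_closed[OF M] by (simp add: cl_def)
 have rcl: "r x : cl x" if "x : H" for x using someI[of "%y. y : cl x" x] self[OF that] by (simp add: r_def)
 have trans: "inv x \<otimes> z : M" if "x : H" "y : H" "z : H" "inv x \<otimes> y : M" "inv y \<otimes> z : M" for x y z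
 proof -
  have "(inv x \<otimes> y) \<otimes> (inv y \<otimes> z) = inv x \<otimes> z" using HG that by (simp add: m_assoc)
  then show ?thesis using subgroup.m_closed[OF M that(4,5)] by simp
 qed
 have sym: "inv y \<otimes> x : M" if "x : H" "y : H" "inv x \<otimes> y : M" for x y
  using subgroup.m_inv_closed[OF M that(3)] HG[OF that(1)] HG[OF that(2)] by (simp add: inv_mult_group)
 show ?thesis
 proof (rule that[of "r ` H"])
  show "r ` H <= H" using rcl by (auto simp: cl_def)
  have "r \<one> = \<one>" using self[OF subgroup.one_closed[OF H(1)]] by (simp add: r_def)
  then show "\<one> : r ` H" using subgroup.one_closed[OF H(1)] by (metis imageI)
  show "EX t:r ` H. inv t \<otimes> x : M" if x: "x : H" for x
   using rcl[OF x] sym[OF x] x by (intro bexI[of _ "r x"]) (auto simp: cl_def)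
  show "s = t" if s: "s : r ` H" and t: "t : r ` H" and st: "inv s \<otimes> t : M" for s t
  proof -
   obtain x y where xy: "x : H" "s = r x" "y : H" "t = r y" using s t by blast
   have sH: "s : H" "inv x \<otimes> s : M" and tH: "t : H" "inv y \<otimes> t : M" using rcl[OF xy(1)] rcl[OF xy(3)] xy by (auto simp: cl_def)
   have xy': "inv x \<otimes> y : M" by (rule trans[OF xy(1) tH(1) xy(3) trans[OF xy(1) sH(1) tH(1) sH(2) st] sym[OF xy(3) tH]])
   have "cl x = cl y" unfolding cl_def using trans xy(1,3) xy' sym[OF xy(1,3) xy'] by blast
   then show ?thesis using xy by (simp add: r_def)
  qed
 qed
qed

section \<open>Totally disconnected kernels and digit expansions\<close>

context contraction begin

text \<open>\<open>D\<close> meets the identity component trivially: late iterates of a common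
  element lie in the intersection of \<open>P\<close> with the component, a compact subgroup of a
  connected contraction group. An element of \<open>D\<close> outside \<open>P\<close> enters
  \<open>P\<close> from the compact set \<open>Q\<close>, which misses the component. Elements of
  \<open>H\<close> lie in \<open>W\<close> times the component and after \<open>N\<close> steps are
  too close to the component to be in \<open>Q\<close>. So all elements of \<open>D\<close> in
  \<open>H\<close> have entered \<open>P\<close> by time \<open>N\<close>.\<close>

lemma compact_part:
 assumes D: "subgroup D G" "closedin T D" "contr G ` D = D"
  and P: "subgroup P G" "compactin T P" "openin T U" "P = D \<inter> U" "!!x. x : P ==> contr G x : P"
 obtains H where "subgroup H G" "openin T H" "!!x. x : H ==> contr G x : H" "compactin T (D \<inter> H)"
proof -
 have DG: "x : CG" if "x : D" for x using that subgroup.subset[OF D(1)] by auto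
 have PD: "P <= D" and oneU: "\<one> : U" and oneP: "\<one> : P" using P(4) subgroup.one_closed[OF P(1)] by auto
 have actD: "act k d : D" if "d : D" for k d using act_stable[OF D(3) subgroup.subset[OF D(1)], of k] that by blast
 interpret C: contraction "sub G comp0" by (rule comp0_contraction)
 have PC: "P \<inter> comp0 = {\<one>}"
 proof -
  have "subgroup (P \<inter> comp0) G" by (rule subgroups_Inter_pair[OF P(1) comp0_subgroup])
  then have "subgroup (P \<inter> comp0) (sub G comp0)" using subgroup_sub_iff[OF is_group comp0_subgroup, of "P \<inter> comp0"] by simp
  moreover have "compactin (topol (sub G comp0)) (P \<inter> comp0)"
   using compact_Int_closedin[OF P(2) comp0_closed] by (simp add: compactin_subtopology)
  ultimately show ?thesis using C.no_compact_subgroups[OF comp0_connected_space] by simp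
 qed
 have DC: "d = \<one>" if d: "d : D" "d : comp0" for d
 proof -
  obtain N where "!!n. int N <= n ==> act n d : U" using act_eventually[OF DG[OF d(1)] P(3) oneU] by blast
  then have "act (int N) d : P \<inter> comp0" using actD[OF d(1)] act_comp0[of "int N"] d(2) P(4) by blast
  then show ?thesis using PC act_eq_one[OF DG[OF d(1)], of "int N"] by blast
 qed
 obtain H W where H: "subgroup H G" "openin T H" "comp0 <= H" "!!x. x : H ==> contr G x : H" and W: "compactin T W" "H <= W <#> comp0"
  using open_subgroup_invariant by blast
 define Q where "Q = act (- 1) ` P \<inter> (CG - U)"
 have Qc: "compactin T Q" unfolding Q_def
  by (rule compact_Int_closedin[OF compact_act[OF P(2)]]) (use closedin_diff[OF closedin_topspace P(3)] in simp)
 have "Q <= CG - comp0"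
 proof
  fix x assume x: "x : Q"
  then have "x : D" "x ~: U" using actD PD by (auto simp: Q_def)
  then show "x : CG - comp0" using DC[of x] oneU DG by auto
 qed
 moreover have "openin T (CG - comp0)" using openin_diff[OF openin_topspace comp0_closed] by simp
 ultimately obtain V where V: "openin T V" "\<one> : V" "!!x y. x : Q ==> y : V ==> y \<otimes> x : CG - comp0"
  using tube_left[OF Qc] by metis
 obtain N where N: "!!n x. int N <= n ==> x : W ==> act n x : {y : CG. inv y : V}"
  using act_compact_eventually[OF W(1) open_inverses[OF V(1)]] V(2) by auto
 have sub: "act (int N) d : P" if d: "d : D \<inter> H" for d
 proof -
  have dG: "d : CG" using d DG by auto
  obtain N' where "!!n. int N' <= n ==> act n d : U" using act_eventually[OF dG P(3) oneU] by blast
  then have ex: "act (int N') d : P" using actD d P(4) by auto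
  define m where "m = (LEAST m. act (int m) d : P)"
  have mP: "act (int m) d : P" unfolding m_def by (rule LeastI) (rule ex)
  have "m <= N"
  proof (rule ccontr)
   assume "~ m <= N"
   then obtain l where l: "m = Suc l" "N <= l" by (cases m) auto
   have "act (int l) d ~: P" using not_less_Least[of l "%m. act (int m) d : P"] l by (simp add: m_def)
   moreover have "act (int l) d = act (- 1) (act (int m) d)" using act_add[OF dG, of "- 1" "int m"] l by simp
   ultimately have Ql: "act (int l) d : Q" using mP actD[of d "int l"] d P(4) DG by (auto simp: Q_def)
   have "d : W <#> comp0" using W(2) d by blast
   then obtain w c where wc: "w : W" "c : comp0" "d = w \<otimes> c" unfolding mem_set_mult by blast
   have wG: "w : CG" and cG: "c : CG" using wc compactin_carrier[OF W(1)] comp0_carrier by auto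
   have "inv (act (int l) w) : V" using N[of "int l" w] wc(1) l by simp
   then have "inv (act (int l) w) \<otimes> act (int l) d ~: comp0" using V(3)[OF Ql] by blast
   moreover have "inv (act (int l) w) \<otimes> act (int l) d = act (int l) c"
    using wG cG unfolding wc(3) by (simp add: act_mult m_assoc[symmetric])
   ultimately show False using act_comp0[of "int l"] wc(2) by blast
  qed
  then have "act (int N) d = act (int (N - m)) (act (int m) d)" using act_add[OF dG, of "int (N - m)" "int m"] by simp
  then show ?thesis using act_invariant[of P "int (N - m)"] P(5) subgroup.subset[OF P(1)] mP by simp
 qed
 have "D \<inter> H <= act (- int N) ` P"
 proof
  fix d assume d: "d : D \<inter> H"
  have "act (- int N) (act (int N) d) = d" using d DG by simp
  then show "d : act (- int N) ` P" using sub[OF d] by (metis imageI)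
 qed
 then have "compactin T (D \<inter> H)"
  using closed_compactin[OF compact_act[OF P(2)]] closedin_Int[OF D(2) open_subgroup_closed[OF H(1,2)]] by blast
 then show ?thesis using that H by blast
qed

text \<open>For a transversal \<open>R\<close> of \<open>\<alpha>(H D)\<close> in \<open>H D\<close>, the union \<open>S\<close> of the sets
 \<open>\<alpha>\<^sup>-\<^sup>n(R) \<dots> \<alpha>\<^sup>-\<^sup>1(R) H\<close> meets every coset of \<open>D\<close> in a coset of the compact group \<open>D \<inter> H\<close>
 and satisfies \<open>\<alpha>(S) \<subseteq> S\<close>, so the intersection of all \<open>\<alpha>\<^sup>k(S)\<close> is an invariant section.\<close>

primrec reps :: "'a set => 'a set => nat => 'a set" where
 "reps R H 0 = H"
| "reps R H (Suc n) = act (- int (Suc n)) ` R <#> reps R H n"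

text \<open>\<open>F x\<close> is the unique \<open>d\<close> in \<open>D\<close> for which
  \<open>x d^-1\<close> lies in every \<alpha>^k(S). A solution for one \<open>k\<close> is
  determined up to \<alpha>^k of the compact group \<open>D \<inter> H\<close>. These groups shrink
  to the identity, which gives uniqueness and continuity; existence is a compactness
  argument.\<close>

lemma digit_section:
 assumes D: "subgroup D G" "closedin T D" "contr G ` D = D" "!!x d. x : CG ==> d : D ==> x \<otimes> d \<otimes> inv x : D"
  and H: "subgroup H G" "openin T H" "!!x. x : H ==> contr G x : H" "compactin T (D \<inter> H)"
 obtains F where "continuous_map T T F" "!!x. x : CG ==> F x : D" "!!x d. x : CG ==> d : D ==> F (x \<otimes> d) = F x \<otimes> d"
  "!!x. x : CG ==> F (contr G x) = contr G (F x)"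
proof -
 interpret D: subgroup D G by (rule D(1))
 interpret H: subgroup H G by (rule H(1))
 have actD: "act k d : D" if "d : D" for k d using act_stable[OF D(3) D.subset, of k] that by blast
 define L where "L = H <#> D"
 have LI: "h \<otimes> d : L" if "h : H" "d : D" for h d unfolding L_def using that by (rule set_multI)
 have LE: "EX h:H. EX d:D. x = h \<otimes> d" if "x : L" for x using that unfolding L_def mem_set_mult .
 have HL: "h : L" if "h : H" for h using LI[OF that D.one_closed] that by simp
 have DL: "d : L" if "d : D" for d using LI[OF H.one_closed that] that by simp
 have sL: "subgroup L G"
 proof (rule subgroupI)
  show "L <= CG" unfolding L_def by (rule set_mult_carrier[OF H.subset D.subset])
  show "L ~= {}" using HL[OF H.one_closed] by blast
  show "inv a : L" if aL: "a : L" for a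
  proof -
   obtain h d where a: "h : H" "d : D" "a = h \<otimes> d" using LE[OF aL] by blast
   have "inv a = inv h \<otimes> (h \<otimes> inv d \<otimes> inv h)" unfolding a(3) using a by (simp add: inv_mult_group m_assoc)
   then show ?thesis using LI[OF H.m_inv_closed[OF a(1)] D(4)[of h "inv d"]] a by simp
  qed
  show "a \<otimes> b : L" if ab: "a : L" "b : L" for a b
  proof -
   obtain h d where a: "h : H" "d : D" "a = h \<otimes> d" using LE[OF ab(1)] by blast
   obtain k e where b: "k : H" "e : D" "b = k \<otimes> e" using LE[OF ab(2)] by blast
   have "inv k \<otimes> d \<otimes> k : D" using D(4)[of "inv k" d] a b by simp
   then have "(h \<otimes> k) \<otimes> (inv k \<otimes> d \<otimes> k \<otimes> e) : L" using LI a b by simp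
   then show ?thesis unfolding a(3) b(3) using a b by (simp add: m_assoc)
  qed
 qed
 have Lc: "L <= CG" using subgroup.subset[OF sL] .
 have contrL: "contr G x : L" if xL: "x : L" for x
 proof -
  obtain h d where "h : H" "d : D" "x = h \<otimes> d" using LE[OF xL] by blast
  then show ?thesis using LI[OF H(3)] D(3) by (auto simp: contr_mult)
 qed
 have sM: "subgroup (act k ` L) G" for k by (rule subgroup_act[OF sL])
 have DM: "d : act k ` L" if "d : D" for d k using act_image_iff[OF Lc, of d k] DL[OF actD[OF that]] that by simp
 \<comment> \<open>Choosing the identity as a representative makes the sets
   \<open>reps R H n\<close> increase with \<open>n\<close>.\<close>
 obtain R where R: "R <= H" "\<one> : R" "!!x. x : H ==> EX t:R. inv t \<otimes> x : act 1 ` L \<inter> H"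
  "!!s t. s : R ==> t : R ==> inv s \<otimes> t : act 1 ` L \<inter> H ==> s = t"
  using transversal_exists[OF subgroups_Inter_pair[OF sM[of 1] H(1)] H(1)] by (metis Int_lower2)
 have RH: "t : H" if "t : R" for t using that R(1) by blast
 let ?A = "reps R H"
 have AE: "EX t:R. EX b:?A n. a = act (- int (Suc n)) t \<otimes> b" if "a : ?A (Suc n)" for a n using that by (auto simp: mem_set_mult)
 have AI: "act (- int (Suc n)) t \<otimes> b : ?A (Suc n)" if "t : R" "b : ?A n" for t b n unfolding reps.simps by (intro set_multI imageI that)
 have sN: "subgroup (act (- int n) ` L) G" for n by (rule sM)
 have LN: "act (- int n) ` L <= act (- int (Suc n)) ` L" for n by (rule act_image_antimono) (use contrL Lc in auto)
 have AL: "?A n <= act (- int n) ` L" for n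
 proof (induction n)
  case (Suc n)
  show ?case
  proof
   fix a assume "a : ?A (Suc n)"
   then obtain t b where tb: "t : R" "b : ?A n" "a = act (- int (Suc n)) t \<otimes> b" using AE by blast
   have "act (- int (Suc n)) t : act (- int (Suc n)) ` L" "b : act (- int (Suc n)) ` L" using tb(1) RH HL subsetD[OF LN subsetD[OF Suc tb(2)]] by blast+
   then show "a : act (- int (Suc n)) ` L" unfolding tb(3) by (rule subgroup.m_closed[OF sN])
  qed
 qed (use HL in auto)
 have Ac: "?A n <= CG" for n using AL subgroup.subset[OF sN] by blast
 have Amono: "?A m <= ?A n" if "m <= n" for m n
 proof (rule lift_Suc_mono_le[OF _ that])
  fix n
  show "?A n <= ?A (Suc n)" using AI[OF R(2)] Ac[of n] by fastforce
 qed
 have AH: "a \<otimes> h : ?A n" if "a : ?A n" "h : H" for a h n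
  using that
 proof (induction n arbitrary: a)
  case (Suc n)
  then obtain t b where "t : R" "b : ?A n" "a = act (- int (Suc n)) t \<otimes> b" using AE by blast
  then show ?case using AI[of t "b \<otimes> h" n] Suc.IH[of b] Suc.prems Ac RH by (simp add: m_assoc subset_iff)
 qed simp
 have Acontr: "contr G a : ?A n" if "a : ?A (Suc n)" for a n
  using that
 proof (induction n arbitrary: a)
  case 0
  then obtain t b where "t : R" "b : H" "a = act (- 1) t \<otimes> b" using AE[of a 0] by auto
  then show ?case using RH H(3) act_Suc[of t "- 1"] by (simp add: contr_mult)
 next
  case (Suc n)
  obtain t b where tb: "t : R" "b : ?A (Suc n)" "a = act (- int (Suc (Suc n))) t \<otimes> b" using AE[OF Suc.prems] by blast
  have "contr G a = act (- int (Suc n)) t \<otimes> contr G b"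
   unfolding tb(3) using RH[OF tb(1)] subsetD[OF Ac tb(2)] act_Suc[of t "- int (Suc (Suc n))"] by (simp add: contr_mult del: reps.simps)
  then show ?case using AI[OF tb(1) Suc.IH[OF tb(2)]] by simp
 qed
 \<comment> \<open>Existence of expansions: after splitting off the leading digit \<open>t\<close>,
   the rest lies one level lower.\<close>
 have Aex: "EX d:D. x \<otimes> inv d : ?A n" if "x : act (- int n) ` L" for x n
  using that
 proof (induction n arbitrary: x)
  case 0
  then have "x : L" by simp
  then obtain h d where "h : H" "d : D" "x = h \<otimes> d" using LE by blast
  then show ?case by (intro bexI[of _ d]) (simp_all add: m_assoc)
 next
  case (Suc n)
  obtain l where l: "l : L" "x = act (- int (Suc n)) l" using Suc.prems by blast
  obtain h d where hd: "h : H" "d : D" "l = h \<otimes> d" using LE[OF l(1)] by blast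
  obtain t where t: "t : R" "inv t \<otimes> h : act 1 ` L" using R(3)[OF hd(1)] by blast
  have "inv t \<otimes> l = (inv t \<otimes> h) \<otimes> d" unfolding hd(3) using hd RH[OF t(1)] by (simp add: m_assoc)
  then have "inv t \<otimes> l : act 1 ` L" using subgroup.m_closed[OF sM t(2) DM[OF hd(2)]] by simp
  then obtain m where m: "m : L" "inv t \<otimes> l = act 1 m" by blast
  have G: "l : CG" "t : CG" "m : CG" using l(1) m(1) Lc RH[OF t(1)] by auto
  have "x = act (- int (Suc n)) (t \<otimes> act 1 m)" unfolding l(2) m(2)[symmetric] using G by simp
  also have "... = act (- int (Suc n)) t \<otimes> act (- int n) m" using G act_add[of m "- int (Suc n)" 1] by (simp add: act_mult)
  finally have x: "x = act (- int (Suc n)) t \<otimes> act (- int n) m" .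
  obtain e where e: "e : D" "act (- int n) m \<otimes> inv e : ?A n" using Suc.IH[of "act (- int n) m"] m(1) by blast
  have "x \<otimes> inv e = act (- int (Suc n)) t \<otimes> (act (- int n) m \<otimes> inv e)" unfolding x using G e(1) by (simp add: m_assoc)
  then have "x \<otimes> inv e : ?A (Suc n)" using AI[OF t(1) e(2)] by (simp only:)
  then show ?case using e(1) by blast
 qed
 \<comment> \<open>Uniqueness of the digits: comparing the leading digits \<open>s\<close> and
   \<open>t\<close> puts \<open>s^-1 t\<close> into \<alpha>(L), so they agree and cancel.\<close>
 have Auniq: "d : H" if "a : ?A n" "d : D" "a \<otimes> d : ?A n" for a d n
  using that
 proof (induction n arbitrary: a)
  case 0
  then have "inv a \<otimes> (a \<otimes> d) = d" by simp
  moreover have "inv a \<otimes> (a \<otimes> d) : H" by (rule H.m_closed[OF H.m_inv_closed]) (use 0 in simp_all)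
  ultimately show ?case by metis
 next
  case (Suc n)
  let ?a = "act (- int (Suc n))"
  obtain s b where s: "s : R" "b : ?A n" "a = ?a s \<otimes> b" using AE[OF Suc.prems(1)] by blast
  obtain t c where t: "t : R" "c : ?A n" "a \<otimes> d = ?a t \<otimes> c" using AE[OF Suc.prems(3)] by blast
  have G: "s : CG" "t : CG" "b : CG" "c : CG" "d : CG" using s t RH Ac Suc.prems(2) by auto
  have "?a s \<otimes> (b \<otimes> d) = ?a t \<otimes> c" using s(3) t(3) G by (simp add: m_assoc)
  then have bd: "b \<otimes> d = ?a (inv s \<otimes> t) \<otimes> c" using G by (metis act_closed act_inv act_mult inv_cancel(2) inv_closed m_assoc m_closed)
  then have "?a (inv s \<otimes> t) = b \<otimes> d \<otimes> inv c" using G by (simp add: m_assoc)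
  also have "... : act (- int n) ` L" using subgroup.m_closed[OF sN subgroup.m_closed[OF sN] subgroup.m_inv_closed[OF sN]] subsetD[OF AL s(2)] subsetD[OF AL t(2)] DM[OF Suc.prems(2)] by blast
  finally have "act (int n) (?a (inv s \<otimes> t)) : L" using act_image_iff[OF Lc, of "?a (inv s \<otimes> t)" "- int n"] G by simp
  then have "act (- 1) (inv s \<otimes> t) : L" using act_add[of "inv s \<otimes> t" "int n" "- int (Suc n)"] G by simp
  then have "inv s \<otimes> t : act 1 ` L \<inter> H" using act_image_iff[OF Lc, of "inv s \<otimes> t" 1] RH[OF s(1)] RH[OF t(1)] G by simp
  then have "s = t" by (rule R(4)[OF s(1) t(1)])
  then have "b \<otimes> d = c" using bd G by simp
  then show ?case using Suc.IH[OF s(2) Suc.prems(2)] t(2) by simp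
 qed
 define S where "S = (\<Union>n. ?A n)"
 have Sc: "S <= CG" using Ac by (auto simp: S_def)
 have clopen: "openin T (Y \<inter> CG)" if "!!y h. y : Y ==> h : H ==> y \<otimes> h : Y" for Y
 proof -
  have "(Y \<inter> CG) <#> H = Y \<inter> CG"
  proof (intro equalityI subsetI)
   fix y assume "y : Y \<inter> CG"
   then have "y \<otimes> \<one> : (Y \<inter> CG) <#> H" by (intro set_multI) auto
   then show "y : (Y \<inter> CG) <#> H" using \<open>y : Y \<inter> CG\<close> by simp
  qed (use that in \<open>auto simp: mem_set_mult\<close>)
  then show ?thesis using open_mult_left[OF H(2), of "Y \<inter> CG"] by simp
 qed
 have SH: "s \<otimes> h : S" if "s : S" "h : H" for s h using that AH unfolding S_def by blast
 have So: "openin T S" using clopen[of S, OF SH] Sc by (simp add: Int_absorb2)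
 have "openin T ((CG - S) \<inter> CG)"
 proof (rule clopen)
  fix y h assume y: "y : CG - S" and h: "h : H"
  have "y \<otimes> h ~: S"
  proof
   assume "y \<otimes> h : S"
   then have "y \<otimes> h \<otimes> inv h : S" by (rule SH) (use h in simp)
   then show False using y h by (simp add: m_assoc)
  qed
  then show "y \<otimes> h : CG - S" using y h by simp
 qed
 then have Scl: "closedin T S" using Sc by (simp add: closedin_def Int_absorb2)
 have Scontr: "contr G s : S" if "s : S" for s using that Acontr Amono[OF le_SucI[OF order_refl]] unfolding S_def by blast
 have Sdec: "act (int n) ` S <= act (int m) ` S" if "m <= n" for m n using act_image_antimono[OF Scontr Sc, of "int m" "int n"] that by simp
 have hit: "EX n. x : act (- int n) ` L" if xG: "x : CG" for x
 proof -
  obtain n where "!!k. int n <= k ==> act k x : H" using act_eventually[OF xG H(2)] by auto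
  then show ?thesis using HL act_image_iff[OF Lc xG, of "- int n" for n] by fastforce
 qed
 have ex: "EX d:D. x \<otimes> inv d : act k ` S" if x: "x : CG" for x k
 proof -
  obtain n where "act (- k) x : act (- int n) ` L" using hit[of "act (- k) x"] x by blast
  then obtain d where d: "d : D" "act (- k) x \<otimes> inv d : S" using Aex unfolding S_def by blast
  have "act k (act (- k) x \<otimes> inv d) = x \<otimes> inv (act k d)" using x d by (simp add: act_mult act_inv)
  then show ?thesis using d actD by (metis imageI)
 qed
 have uniq: "d : act k ` H" if a: "a : act k ` S" "d : D" "a \<otimes> d : act k ` S" for a d k
 proof -
  have G: "a : CG" "d : CG" using a Sc by auto
  have 1: "act (- k) a : S" "act (- k) a \<otimes> act (- k) d : S" using a act_image_iff[OF Sc] G by (auto simp: act_mult)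
  then obtain m n where "act (- k) a : ?A m" "act (- k) a \<otimes> act (- k) d : ?A n" unfolding S_def by blast
  then have "act (- k) d : H" using Auniq[of "act (- k) a" "max m n" "act (- k) d"] Amono[of m "max m n"] Amono[of n "max m n"] actD[OF a(2)] by auto
  then show ?thesis using act_image_iff[OF H.subset G(2)] by simp
 qed
 have small: "EX N. ALL e:D. e : act (int N) ` H --> e : U" if U: "openin T U" "\<one> : U" for U
 proof -
  obtain N where N: "!!n x. int N <= n ==> x : D \<inter> H ==> act n x : U" using act_compact_eventually[OF H(4) U] by blast
  have "e : U" if e: "e : D" "e : act (int N) ` H" for e
   using N[of "int N" "act (- int N) e"] actD[OF e(1), of "- int N"] act_image_iff[OF H.subset, of e "int N"] e by simp
  then show ?thesis by blast
 qed
 define Z where "Z = {x. ALL k. x : act (int k) ` S}"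
 have Zex: "EX d:D. x \<otimes> inv d : Z" if x: "x : CG" for x
 proof (rule ccontr)
  assume no: "~ ?thesis"
  obtain d0 where d0: "d0 : D" "x \<otimes> inv d0 : act (int 0) ` S" using ex[OF x] by blast
  \<comment> \<open>\<open>V k\<close> consists of the corrections to \<open>d0\<close> that fail at
    level \<open>k\<close>. If no \<open>d\<close> worked at all levels, these increasing open sets
    would cover \<open>D \<inter> H\<close>, so one of them would, against solvability at that
    level.\<close>
  define V where "V k = {e : topspace T. x \<otimes> inv (e \<otimes> d0) : CG - act (int k) ` S}" for k
  have "openin T (V k)" for k unfolding V_def
  proof (rule open_preimage)
   show "continuous_map T T (%e. x \<otimes> inv (e \<otimes> d0))" by (intro continuous_intros x) (use d0 in simp)
   show "openin T (CG - act (int k) ` S)" using openin_diff[OF openin_topspace closed_act[OF Scl]] by simp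
  qed
  moreover have "V k <= V l" if "k <= l" for k l using Sdec[OF that] by (auto simp: V_def)
  moreover have "D \<inter> H <= (\<Union>k. V k)"
  proof
   fix e assume e: "e : D \<inter> H"
   then have "x \<otimes> inv (e \<otimes> d0) ~: Z" using no d0 by blast
   then show "e : (\<Union>k. V k)" using e d0 x by (auto simp: V_def Z_def)
  qed
  ultimately obtain k where k: "D \<inter> H <= V k" using compact_increasing[OF H(4), of V] by metis
  obtain d where d: "d : D" "x \<otimes> inv d : act (int k) ` S" using ex[OF x] by blast
  have "(x \<otimes> inv d) \<otimes> (d \<otimes> inv d0) = x \<otimes> inv d0" using x d d0 by (simp add: m_assoc)
  then have "d \<otimes> inv d0 : D \<inter> H" using uniq[of "x \<otimes> inv d" 0 "d \<otimes> inv d0"] d d0 Sdec[of 0 k] by auto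
  moreover have "(d \<otimes> inv d0) \<otimes> d0 = d" using d d0 by (simp add: m_assoc)
  ultimately show False using k d(2) by (auto simp: V_def)
 qed
 have Zuniq: "c = d" if x: "x : CG" and c: "c : D" "x \<otimes> inv c : Z" and d: "d : D" "x \<otimes> inv d : Z" for x c d
 proof (rule ccontr)
  assume "c ~= d"
  then have "c \<otimes> inv d ~= \<one>" using c d by (metis D.mem_carrier inv_equality inv_inv inv_closed)
  then obtain U where U: "openin T U" "\<one> : U" "c \<otimes> inv d ~: U" using separate_one[of "c \<otimes> inv d"] c d by auto
  obtain N where N: "ALL e:D. e : act (int N) ` H --> e : U" using small[OF U(1,2)] by blast
  have "(x \<otimes> inv c) \<otimes> (c \<otimes> inv d) = x \<otimes> inv d" using x c d by (simp add: m_assoc)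
  then have "c \<otimes> inv d : act (int N) ` H" using uniq[of "x \<otimes> inv c" "int N" "c \<otimes> inv d"] c d by (simp add: Z_def)
  then show False using N U(3) c d by simp
 qed
 define F where "F x = (SOME d. d : D & x \<otimes> inv d : Z)" for x
 have F: "F x : D" "x \<otimes> inv (F x) : Z" if "x : CG" for x
  using someI_ex[of "%d. d : D & x \<otimes> inv d : Z"] Zex[OF that] unfolding F_def by blast+
 have FI: "F x = d" if "x : CG" "d : D" "x \<otimes> inv d : Z" for x d using Zuniq[OF that(1) F[OF that(1)] that(2,3)] .
 have FG: "F x : CG" if "x : CG" for x using F(1)[OF that] by simp
 have Fmult: "F (x \<otimes> d) = F x \<otimes> d" if x: "x : CG" and d: "d : D" for x d
 proof (rule FI)
  have "x \<otimes> d \<otimes> inv (F x \<otimes> d) = x \<otimes> inv (F x)" using x d FG[OF x] by (simp add: inv_mult_group m_assoc)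
  then show "x \<otimes> d \<otimes> inv (F x \<otimes> d) : Z" using F(2)[OF x] by simp
 qed (use x d F(1)[OF x] in auto)
 have Fcontr: "F (contr G x) = contr G (F x)" if x: "x : CG" for x
 proof (rule FI)
  let ?z = "x \<otimes> inv (F x)"
  have "contr G ?z : act (int k) ` S" for k
  proof (cases k)
   case 0
   have "?z : act (int 0) ` S" using F(2)[OF x] unfolding Z_def by blast
   then show ?thesis using 0 Scontr by auto
  next
   case (Suc l)
   have "?z : act (int l) ` S" using F(2)[OF x] unfolding Z_def by blast
   then obtain s where s: "s : S" "?z = act (int l) s" by blast
   then have "contr G ?z = act (int k) s" using act_Suc[of s "int l"] Sc Suc by (auto simp: add.commute)
   then show ?thesis using s(1) by blast
  qed
  then show "contr G x \<otimes> inv (contr G (F x)) : Z" using x FG[OF x] by (simp add: Z_def contr_mult act_inv[of "F x" 1, unfolded act_1])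
 qed (use x D(3) F(1) in auto)
 have cont: "continuous_map T T F"
 proof (rule continuous_mapI_local)
  fix x U assume x: "x : topspace T" and U: "openin T U" "F x : U"
  then have xG: "x : CG" and dG: "F x : CG" using FG by auto
  have U': "openin T {e : CG. e \<otimes> F x : U}" "\<one> : {e : CG. e \<otimes> F x : U}" using open_rtrans[OF U(1) dG] U(2) dG by auto
  obtain N where N: "ALL e:D. e : act (int N) ` H --> e : {e : CG. e \<otimes> F x : U}" using small[OF U'] by blast
  let ?V = "{y : topspace T. y \<otimes> inv (F x) : act (int N) ` S}"
  have "openin T ?V" by (rule open_preimage[OF _ open_act[OF So]]) (intro continuous_intros inv_closed dG)
  moreover have "x : ?V" using x F(2)[OF xG] by (simp add: Z_def)
  moreover have "F y : U" if y: "y : ?V" for y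
  proof -
   have yG: "y : CG" and fyG: "F y : CG" using y FG by auto
   have "(y \<otimes> inv (F y)) \<otimes> (F y \<otimes> inv (F x)) = y \<otimes> inv (F x)" using yG dG fyG by (simp add: m_assoc)
   then have "F y \<otimes> inv (F x) : act (int N) ` H"
    using uniq[of "y \<otimes> inv (F y)" "int N" "F y \<otimes> inv (F x)"] F[OF yG] F(1)[OF xG] y by (simp add: Z_def)
   then have "F y \<otimes> inv (F x) \<otimes> F x : U" using N F(1)[OF yG] F(1)[OF xG] by blast
   then show ?thesis using dG fyG by (simp add: m_assoc)
  qed
  ultimately show "EX V. openin T V & x : V & (ALL y:V. F y : U)" by blast
 qed (use FG in simp)
 show ?thesis by (rule that[OF cont F(1) Fmult Fcontr])
qed

end

section \<open>Vector kernels and averages over orbits\<close>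

lemma rhom_cong:
 assumes "rhom H h" "!!x. x : topspace (topol H) ==> g x = h x" "topspace (topol H) = carrier H" "group H"
 shows "rhom H g"
proof -
 have "continuous_map (topol H) euclideanreal g" using assms(1,2) continuous_map_eq[of "topol H" euclideanreal h g] by (simp add: rhom_def)
 then show ?thesis using assms by (auto simp: rhom_def monoid.m_closed group.is_monoid)
qed

locale abelian_normal = contraction G for G :: "'a dynamical_group" (structure) +
 fixes N :: "'a set"
 assumes N_subgroup: "subgroup N G" and N_closed: "closedin T N" and N_contr: "contr G ` N = N"
  and N_comm: "!!a b. a : N ==> b : N ==> a \<otimes> b = b \<otimes> a"
begin

interpretation S: contraction "sub G N" by (rule sub_contraction[OF N_subgroup N_closed N_contr])

lemma N_carrier: "a : N ==> a : CG" using closedin_carrier[OF N_closed] .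

lemma N_act: "a : N ==> act k a : N" using act_stable[OF N_contr subgroup.subset[OF N_subgroup], of k] by blast

lemma N_act_iff: "x : CG ==> act k x : N \<longleftrightarrow> x : N" using N_act[of x k] N_act[of "act k x" "- k"] by auto

lemma N_mult_iff: "x : CG ==> a : N ==> x \<otimes> a : N \<longleftrightarrow> x : N"
 using subgroup.m_closed[OF N_subgroup] subgroup.m_inv_closed[OF N_subgroup, of a] N_carrier[of a] by (metis inv_solve_right m_closed)

lemma N_one: "\<one> : N" by (rule subgroup.one_closed[OF N_subgroup])

lemma slice_Cc:
 assumes f: "f : Cc" and x: "x : CG" and h: "continuous_map (topol (sub G N)) euclideanreal h"
 shows "(%b. f (x \<otimes> b) * h b) : S.Cc"
proof -
 obtain K where K: "compactin T K" "!!y. y : CG ==> y ~: K ==> f y = 0" using f by (auto simp: Cc_def)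
 have fc: "rcont f" by (rule Cc_cont[OF f])
 have "continuous_map T T (%b. x \<otimes> b)" by (intro continuous_intros x)
 then have "rcont (%b. f (x \<otimes> b))" using continuous_map_compose[OF _ fc] by (force simp: o_def)
 then have c: "continuous_map (topol (sub G N)) euclideanreal (%b. f (x \<otimes> b))" by (simp add: continuous_map_from_subtopology)
 show ?thesis
 proof (rule S.CcI)
  show "continuous_map (topol (sub G N)) euclideanreal (%b. f (x \<otimes> b) * h b)" by (rule continuous_map_real_mult[OF c h])
  show "compactin (topol (sub G N)) (N \<inter> ({inv x} <#> K))"
   using closed_Int_compactin[OF N_closed compact_mult[OF _ K(1), of "{inv x}"]] x by (simp add: compactin_subtopology)
  show "f (x \<otimes> b) * h b = 0" if b: "b : carrier (sub G N)" "b ~: N \<inter> ({inv x} <#> K)" for b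
  proof -
   have bG: "b : CG" using b N_carrier by simp
   have "x \<otimes> b ~: K"
   proof
    assume "x \<otimes> b : K"
    then have "inv x \<otimes> (x \<otimes> b) : {inv x} <#> K" by (intro set_multI) auto
    then show False using b bG x by simp
   qed
   then show ?thesis using K(2) x bG by simp
  qed
 qed
qed

text \<open>For \<open>y\<close> near \<open>x\<close> both integrands vanish off the compact set
  \<open>B\<close>, and uniform continuity of \<open>f\<close> bounds their difference by
  \<open>d\<close> times a fixed function in \<open>Cc\<close> of the subgroup.\<close>

lemma slice_cont:
 assumes L: "S.haar L" and f: "f : Cc" and h: "continuous_map (topol (sub G N)) euclideanreal h"
 shows "rcont (%x. L (%b. f (x \<otimes> b) * h b))"
proof (rule continuous_map_realI)
 fix x and e :: real assume x': "x : topspace T" and e: "0 < e"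
 then have x: "x : CG" by simp
 obtain K where K: "compactin T K" "!!y. y : CG ==> y ~: K ==> f y = 0" using f by (auto simp: Cc_def)
 obtain V C where V: "openin T V" "compactin T C" "\<one> : V" "V <= C" "!!x. x : C ==> inv x : C"
  using compact_nbhd[of "CG"] openin_topspace[of T] by (metis one_closed topspace_T)
 define B where "B = N \<inter> ({inv x} <#> (C <#> K))"
 have Bc: "compactin (topol (sub G N)) B"
  unfolding B_def using closed_Int_compactin[OF N_closed compact_mult[OF _ compact_mult[OF V(2) K(1)], of "{inv x}"]] x by (simp add: compactin_subtopology)
 obtain p where p: "p : S.Cp" "!!b. b : B ==> p b = 1"
  using S.bump[OF Bc openin_topspace] compactin_subset_topspace[OF Bc] by metis
 have pc: "(%b. p b * \<bar>h b\<bar>) : S.Cc" by (rule S.Cc_mult[OF S.Cp_Cc[OF p(1)] continuous_map_real_abs[OF h]])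
 have ppos: "0 <= p b" if "b : N" for b using S.Cp_nonneg[OF p(1)] that by simp
 let ?c = "L (%b. p b * \<bar>h b\<bar>)"
 define d where "d = e / (\<bar>?c\<bar> + 1)"
 have d: "0 < d" "d * ?c < e"
 proof -
  show "0 < d" unfolding d_def using e by simp
  have "d * ?c <= d * \<bar>?c\<bar>" using \<open>0 < d\<close> by (intro mult_left_mono) auto
  also have "... < d * (\<bar>?c\<bar> + 1)" using \<open>0 < d\<close> by (intro mult_strict_left_mono) auto
  also have "... = e" by (simp add: d_def)
  finally show "d * ?c < e" .
 qed
 obtain U where U: "openin T U" "\<one> : U" "!!y v. y : CG ==> v : U ==> \<bar>f (v \<otimes> y) - f y\<bar> < d"
  using uniform_cont[OF f d(1)] by metis
 let ?W = "{y : CG. y \<otimes> inv x : U \<inter> V}"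
 have "openin T ?W" by (rule open_rtrans) (use U V x in auto)
 moreover have "x : ?W" using x U V by simp
 moreover have "\<bar>L (%b. f (y \<otimes> b) * h b) - L (%b. f (x \<otimes> b) * h b)\<bar> < e" if y: "y : ?W" for y
 proof -
  have yG: "y : CG" using y by simp
  let ?v = "y \<otimes> inv x"
  have "L (%b. f (y \<otimes> b) * h b) - L (%b. f (x \<otimes> b) * h b) = L (%b. f (y \<otimes> b) * h b - f (x \<otimes> b) * h b)"
   by (rule S.haar_diff[OF L slice_Cc[OF f yG h] slice_Cc[OF f x h], symmetric])
  moreover have "\<bar>L (%b. f (y \<otimes> b) * h b - f (x \<otimes> b) * h b)\<bar> <= L (%b. d * (p b * \<bar>h b\<bar>))"
  proof (rule S.haar_abs_le[OF L S.Cc_diff[OF slice_Cc[OF f yG h] slice_Cc[OF f x h]] S.Cc_cmult[OF pc]])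
   fix b assume "b : carrier (sub G N)"
   then have bN: "b : N" and bG: "b : CG" using N_carrier by auto
   have yb: "y \<otimes> b = ?v \<otimes> (x \<otimes> b)" using x yG bG by (simp add: m_assoc)
   show "\<bar>f (y \<otimes> b) * h b - f (x \<otimes> b) * h b\<bar> <= d * (p b * \<bar>h b\<bar>)"
   proof (cases "b : B")
    case True
    have "\<bar>f (y \<otimes> b) - f (x \<otimes> b)\<bar> <= d" unfolding yb using U(3)[of "x \<otimes> b" ?v] x bG y by (simp add: less_imp_le)
    then have "\<bar>f (y \<otimes> b) - f (x \<otimes> b)\<bar> * \<bar>h b\<bar> <= d * \<bar>h b\<bar>" by (rule mult_right_mono) simp
    then show ?thesis using p(2)[OF True] by (simp add: abs_mult[symmetric] left_diff_distrib)
   next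
    case False
    have nK: "z ~: K" if z: "z = v \<otimes> (x \<otimes> b)" and v: "v : C" for z v
    proof
     assume "z : K"
     have vG: "v : CG" using compactin_carrier[OF V(2) v] .
     have "inv x \<otimes> (inv v \<otimes> z) : {inv x} <#> (C <#> K)" using \<open>z : K\<close> V(5)[OF v] by (intro set_multI) auto
     moreover have "inv x \<otimes> (inv v \<otimes> z) = b" unfolding z using x vG bG by simp
     ultimately show False using False bN by (simp add: B_def)
    qed
    have "f (y \<otimes> b) = 0" using K(2)[OF _ nK[OF yb]] y V(4) yG bG by auto
    moreover have "f (x \<otimes> b) = 0" using K(2)[OF _ nK[of "x \<otimes> b" \<one>]] V(3,4) x bG by auto
    ultimately show ?thesis using d(1) ppos[OF bN] by simp
   qed
  qed
  moreover have "L (%b. d * (p b * \<bar>h b\<bar>)) = d * ?c" by (rule S.haar_scale[OF L pc])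
  ultimately show ?thesis using d(2) by linarith
 qed
 ultimately show "EX U. openin T U & x : U & (ALL y:U. \<bar>L (%b. f (y \<otimes> b) * h b) - L (%b. f (x \<otimes> b) * h b)\<bar> < e)" by blast
qed

text \<open>Inversion turns \<open>K N\<close> into \<open>N K^-1\<close>, a closed set times a
  compact one.\<close>

lemma mult_N_closed:
 assumes K: "compactin T K" shows "closedin T (K <#> N)"
proof -
 let ?I = "(%x. inv x) ` K"
 have "closedin T {y : topspace T. inv y : N <#> ?I}"
  by (rule closed_preimage[OF _ closed_compact_mult[OF N_closed compact_inverses[OF K]]]) (intro continuous_intros)
 moreover have "{y : topspace T. inv y : N <#> ?I} = K <#> N"
 proof (intro equalityI subsetI)
  fix y assume y: "y : {y : topspace T. inv y : N <#> ?I}"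
  then obtain a k where ak: "a : N" "k : K" "inv y = a \<otimes> inv k" unfolding mem_set_mult by blast
  have G: "y : CG" "a : CG" "k : CG" using y N_carrier[OF ak(1)] compactin_carrier[OF K ak(2)] by auto
  have "y = inv (a \<otimes> inv k)" using ak(3) G by (metis inv_inv)
  then have "y = k \<otimes> inv a" using G by (simp add: inv_mult_group)
  then show "y : K <#> N" using ak subgroup.m_inv_closed[OF N_subgroup] by (auto intro: set_multI)
 next
  fix y assume "y : K <#> N"
  then obtain k a where ak: "k : K" "a : N" "y = k \<otimes> a" unfolding mem_set_mult by blast
  have G: "k : CG" "a : CG" using N_carrier[OF ak(2)] compactin_carrier[OF K ak(1)] by auto
  have "inv a \<otimes> inv k : N <#> ?I" by (intro set_multI imageI ak subgroup.m_inv_closed[OF N_subgroup])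
  then show "y : {y : topspace T. inv y : N <#> ?I}" using ak(3) G by (simp add: inv_mult_group)
 qed
 ultimately show ?thesis by simp
qed

text \<open>If \<alpha>^(-n)(y) is \<open>k a\<close> with \<open>a\<close> in \<open>N\<close>,
  then \<alpha>^n(k)^-1 y lies in \<open>N\<close>. For large \<open>n\<close> the factor
  \<alpha>^n(k) is close to the identity, and such translates of \<open>L\<close> still avoid
  \<open>N\<close>.\<close>

lemma escape:
 assumes L: "compactin T L" "L \<inter> N = {}" and K: "compactin T K"
 shows "EX m. ALL n y. y : L --> int m <= n --> act (- n) y ~: K <#> N"
proof -
 have "L <= CG - N" using L compactin_subset_carrier by auto
 moreover have "openin T (CG - N)" using openin_diff[OF openin_topspace N_closed] by simp
 ultimately obtain V where V: "openin T V" "\<one> : V" "!!x y. x : L ==> y : V ==> y \<otimes> x : CG - N"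
  using tube_left[OF L(1)] by metis
 obtain m where m: "!!n x. int m <= n ==> x : K ==> act n x : {y : CG. inv y : V}"
  using act_compact_eventually[OF K open_inverses[OF V(1)]] V(2) by auto
 have "act (- n) y ~: K <#> N" if y: "y : L" and n: "int m <= n" for n y
 proof
  assume "act (- n) y : K <#> N"
  then obtain k a where ka: "k : K" "a : N" "act (- n) y = k \<otimes> a" unfolding mem_set_mult by blast
  have G: "k : CG" "a : CG" "y : CG" using ka compactin_carrier[OF K] N_carrier y compactin_carrier[OF L(1)] by auto
  have "y = act n (k \<otimes> a)" using ka(3) G by (metis act_minus(2))
  then have "inv (act n k) \<otimes> y = act n a" using G by (simp add: act_mult)
  moreover have "inv (act n k) \<otimes> y ~: N" using V(3)[OF y] m[OF n ka(1)] by blast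
  ultimately show False using N_act[OF ka(2)] by simp
 qed
 then show ?thesis by blast
qed

end

context abelian_normal begin

interpretation S: contraction "sub G N" by (rule sub_contraction[OF N_subgroup N_closed N_contr])

text \<open>Up to sign the numerator of the local extension; with \<open>h\<close> replaced by the
  constant 1 it is the denominator, the total weight of the coset of \<open>x\<close>.\<close>

definition avg :: "(('a => real) => real) => ('a => real) => ('a => real) => 'a => real" where
 "avg L f h x = L (%b. f (x \<otimes> b) * h b)"

definition levels :: "('a => real) => 'a => int set" where
 "levels f x = {n. EX b:N. f (act n x \<otimes> b) ~= 0}"

text \<open>Collects the local averages at all points \<alpha>^n(x) of the orbit, the coordinates
  being transported back by \<alpha>^(-n). Restricting to \<open>levels\<close> drops only zero
  terms, and for the weights used below it makes the sum finite when \<open>x\<close> is off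
  \<open>N\<close>.\<close>

definition orbit_sum :: "(('a => real) => real) => ('a => real) => ('a => real) => 'a => real" where
 "orbit_sum L f h x = (\<Sum>n\<in>levels f x. avg L f (%b. h (act (- n) b)) (act n x))"

lemma one_cont: "continuous_map (topol (sub G N)) euclideanreal (%b. c)" by simp

lemma rhom_sub_act: assumes "rhom (sub G N) h" shows "rhom (sub G N) (%b. h (act k b))"
 by (rule rhom_cong[OF S.rhom_act[OF assms, of k]]) (use act_sub[OF N_subgroup N_contr] N_carrier in auto)

text \<open>Replacing \<open>b\<close> by \<open>b a\<close>, with \<open>a\<close> and
  \<open>b\<close> commuting, moves \<open>a\<close> from the argument of \<open>f\<close> to that
  of \<open>h\<close>, where additivity turns it into the summand \<open>- h a\<close>.\<close>

lemma avg_mult: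
 assumes L: "S.haar L" and f: "f : Cc" and x: "x : CG" and a: "a : N" and h: "rhom (sub G N) h"
 shows "avg L f h (x \<otimes> a) = avg L f h x - h a * avg L f (%b. 1) x" "avg L f (%b. 1) (x \<otimes> a) = avg L f (%b. 1) x"
proof -
 have aG: "a : CG" using N_carrier[OF a] .
 note hc = S.rhom_cont[OF h]
 have tr: "L (%b. f (x \<otimes> a \<otimes> b) * g (b \<otimes> a)) = L (%b. f (x \<otimes> b) * g b)" if g: "continuous_map (topol (sub G N)) euclideanreal g" for g
 proof -
  have "L (%b. f (x \<otimes> b) * g b) = L (%b. f (x \<otimes> (b \<otimes> a)) * g (b \<otimes> a))"
   using S.haar_transl[OF L slice_Cc[OF f x g], of a] a by simp
  also have "... = L (%b. f (x \<otimes> a \<otimes> b) * g (b \<otimes> a))"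
   by (rule S.haar_cong[OF L]) (use x aG N_carrier N_comm[OF _ a] in \<open>simp add: m_assoc\<close>)
  finally show ?thesis by simp
 qed
 show "avg L f (%b. 1) (x \<otimes> a) = avg L f (%b. 1) x" using tr[of "%b. 1"] by (simp add: avg_def)
 have "avg L f h (x \<otimes> a) = L (%b. f (x \<otimes> a \<otimes> b) * (h (b \<otimes> a) - h a))"
  unfolding avg_def by (rule S.haar_cong[OF L]) (use S.rhom_mult[OF h, of _ a] a in simp)
 also have "... = L (%b. f (x \<otimes> b) * (h b - h a))" by (rule tr) (intro continuous_map_diff hc one_cont)
 also have "... = L (%b. f (x \<otimes> b) * h b - h a * (f (x \<otimes> b) * 1))" by (rule S.haar_cong[OF L]) (simp add: algebra_simps)
 also have "... = L (%b. f (x \<otimes> b) * h b) - h a * L (%b. f (x \<otimes> b) * 1)"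
  unfolding S.haar_diff[OF L slice_Cc[OF f x hc] S.Cc_cmult[OF slice_Cc[OF f x one_cont]]] S.haar_scale[OF L slice_Cc[OF f x one_cont]] by simp
 finally show "avg L f h (x \<otimes> a) = avg L f h x - h a * avg L f (%b. 1) x" by (simp add: avg_def)
qed

lemma avg_zero:
 assumes L: "S.haar L" and f: "f : Cc" and x: "x : CG" and z: "!!b. b : N ==> f (x \<otimes> b) = 0"
 shows "avg L f h x = 0"
proof -
 have "avg L f h x = L (%b. 0 * (f (x \<otimes> b) * 1))" unfolding avg_def by (rule S.haar_cong[OF L]) (use z in simp)
 also have "... = 0" unfolding S.haar_scale[OF L slice_Cc[OF f x one_cont]] by simp
 finally show ?thesis .
qed

lemma avg_linear:
 fixes n :: nat
 assumes L: "S.haar L" and f: "f : Cc" and x: "x : CG" and h: "!!i. i < n ==> rhom (sub G N) (h i)"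
 shows "avg L f (%b. \<Sum>i<n. c i * h i b) x = (\<Sum>i<n. c i * avg L f (h i) x)"
 using h
proof (induction n)
 case 0 then show ?case using S.haar_scale[OF L slice_Cc[OF f x one_cont], of 0 1] by (simp add: avg_def)
next
 case (Suc n)
 note hr = Suc.prems
 have s: "rhom (sub G N) (%b. \<Sum>i<n. c i * h i b)" by (rule S.rhom_sum) (use hr in auto)
 have "avg L f (%b. \<Sum>i<Suc n. c i * h i b) x = L (%b. f (x \<otimes> b) * (\<Sum>i<n. c i * h i b) + c n * (f (x \<otimes> b) * h n b))"
  unfolding avg_def by (rule S.haar_cong[OF L]) (simp add: algebra_simps)
 also have "... = avg L f (%b. \<Sum>i<n. c i * h i b) x + c n * avg L f (h n) x"
  unfolding avg_def S.haar_add[OF L slice_Cc[OF f x S.rhom_cont[OF s]] S.Cc_cmult[OF slice_Cc[OF f x S.rhom_cont[OF hr[of n, simplified]]]]]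
   S.haar_scale[OF L slice_Cc[OF f x S.rhom_cont[OF hr[of n, simplified]]]] ..
 finally show ?case using Suc.IH hr by simp
qed

lemma slice_Cp: "f : Cp ==> x : CG ==> (%b. f (x \<otimes> b) * 1) : S.Cp"
 using slice_Cc[OF Cp_Cc _ one_cont[of 1]] Cp_nonneg N_carrier by (simp add: S.Cp_def)

lemma avg_pos:
 assumes L: "S.haar L" and f: "f : Cp" and x: "x : CG" and b: "b : N" "f (x \<otimes> b) ~= 0"
 shows "0 < avg L f (%b. 1) x"
 unfolding avg_def
 by (rule S.haar_pos[OF L slice_Cp[OF f x], of b]) (use b Cp_nonneg[OF f, of "x \<otimes> b"] x N_carrier[OF b(1)] in auto)

lemma avg_small:
 assumes L: "S.haar L" and f: "f : Cp" and x: "x : CG" and h: "rhom (sub G N) h"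
  and e: "!!b. b : N ==> f (x \<otimes> b) ~= 0 ==> \<bar>h b\<bar> <= e"
 shows "\<bar>avg L f h x\<bar> <= e * avg L f (%b. 1) x"
proof -
 have "\<bar>avg L f h x\<bar> <= L (%b. e * (f (x \<otimes> b) * 1))" unfolding avg_def
 proof (rule S.haar_abs_le[OF L slice_Cc[OF Cp_Cc[OF f] x S.rhom_cont[OF h]] S.Cc_cmult[OF slice_Cc[OF Cp_Cc[OF f] x one_cont]]])
  fix b assume "b : carrier (sub G N)"
  then have b: "b : N" by simp
  have p: "0 <= f (x \<otimes> b)" using Cp_nonneg[OF f] x N_carrier[OF b] by simp
  show "\<bar>f (x \<otimes> b) * h b\<bar> <= e * (f (x \<otimes> b) * 1)"
  proof (cases "f (x \<otimes> b) = 0")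
   case False
   have "f (x \<otimes> b) * \<bar>h b\<bar> <= f (x \<otimes> b) * e" by (rule mult_left_mono[OF e[OF b False] p])
   then show ?thesis using p by (simp add: abs_mult mult.commute)
  qed simp
 qed
 then show ?thesis unfolding S.haar_scale[OF L slice_Cc[OF Cp_Cc[OF f] x one_cont]] avg_def .
qed

lemma levels_mult:
 assumes x: "x : CG" and a: "a : N" shows "levels f (x \<otimes> a) = levels f x"
proof -
 have sub: "levels f (y \<otimes> a) <= levels f y" if y: "y : CG" and a: "a : N" for y a
 proof
  fix n assume "n : levels f (y \<otimes> a)"
  then obtain b where b: "b : N" "f (act n (y \<otimes> a) \<otimes> b) ~= 0" by (auto simp: levels_def)
  have "act n (y \<otimes> a) \<otimes> b = act n y \<otimes> (act n a \<otimes> b)" using y a b N_carrier by (simp add: act_mult m_assoc)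
  then have "f (act n y \<otimes> (act n a \<otimes> b)) ~= 0" using b(2) by simp
  then show "n : levels f y" using subgroup.m_closed[OF N_subgroup N_act[OF a] b(1)] unfolding levels_def by blast
 qed
 have "levels f (x \<otimes> a \<otimes> inv a) <= levels f (x \<otimes> a)"
  by (rule sub) (use x a N_carrier subgroup.m_inv_closed[OF N_subgroup a] in auto)
 moreover have "x \<otimes> a \<otimes> inv a = x" using x N_carrier[OF a] by (simp add: m_assoc)
 ultimately show ?thesis using sub[OF x a] by simp
qed

text \<open>The orbit of \<open>contr G x\<close> is that of \<open>x\<close> with the index shifted
  by one.\<close>

lemma orbit_sum_contr:
 assumes x: "x : CG" and L: "S.haar L"
 shows "orbit_sum L f h (contr G x) = orbit_sum L f (%b. h (contr G b)) x"
proof -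
 have p: "act n (contr G x) = act (n + 1) x" for n using act_add[OF x, of n 1] by (simp add: act_1)
 have lv: "n : levels f (contr G x) \<longleftrightarrow> n + 1 : levels f x" for n unfolding levels_def p by simp
 have "(\<Sum>n\<in>levels f (contr G x). avg L f (%b. h (act (- n) b)) (act n (contr G x))) =
   (\<Sum>n\<in>levels f x. avg L f (%b. h (contr G (act (- n) b))) (act n x))"
 proof (rule sum.reindex_bij_witness[of _ "%n. n - 1" "%n. n + 1"])
  fix n
  show "avg L f (%b. h (contr G (act (- (n + 1)) b))) (act (n + 1) x) = avg L f (%b. h (act (- n) b)) (act n (contr G x))"
   unfolding p avg_def by (rule S.haar_cong[OF L]) (use act_Suc[of _ "- n - 1"] N_carrier in simp)
 qed (use lv in auto)
 then show ?thesis by (simp add: orbit_sum_def)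
qed

text \<open>Weights suited to orbit sums: an orbit no longer contributes once it has come near the
  identity modulo \<open>N\<close>, but every orbit off \<open>N\<close> contributes somewhere,
  which makes the denominators positive.\<close>

definition shape :: "('a => real) => bool" where
 "shape f \<longleftrightarrow> f : Cp & (EX V. openin T V & \<one> : V & (ALL x:V. ALL b:N. f (x \<otimes> b) = 0)) &
  (ALL x:CG - N. levels f x ~= {})"

text \<open>The compact set \<open>Z\<close>, which is \<open>W\<close> without \<alpha>(V) N, meets
  every orbit off \<open>N\<close> modulo \<open>N\<close>: take the first entry of the orbit into
  \<open>V N\<close>. There is a first one because the orbit escapes \<open>W N\<close> backwards in
  time. The weight is a bump that is 1 on \<open>Z\<close>.\<close>

lemma shape_exists: obtains f where "shape f"
proof -
 obtain V W where VW: "openin T V" "compactin T W" "\<one> : V" "V <= W" "W <= CG" "!!x. x : W ==> inv x : W"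
  "!!x. x : W ==> contr G x : W" using base_nbhd[of "CG"] by (metis one_closed openin_topspace topspace_T)
 have NG: "N <= CG" using N_carrier by auto
 let ?V1 = "act 1 ` V"
 have V1: "openin T ?V1" "\<one> : ?V1" using open_act[OF VW(1)] VW(3) act_one[of 1] by (auto simp: image_iff intro!: bexI[of _ \<one>])
 obtain U K where U: "openin T U" "compactin T K" "\<one> : U" "U <= K" "K <= ?V1" using compact_nbhd[OF V1] by metis
 define Z where "Z = W \<inter> (CG - (?V1 <#> N))"
 have Zc: "compactin T Z" unfolding Z_def
  by (rule compact_Int_closedin[OF VW(2)]) (use closedin_diff[OF closedin_topspace open_mult_right[OF V1(1) NG]] in simp)
 have O: "openin T (CG - (K <#> N))" using openin_diff[OF openin_topspace mult_N_closed[OF U(2)]] by simp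
 have "K <#> N <= ?V1 <#> N" by (rule set_mult_mono[OF U(5) subset_refl])
 then have "Z <= CG - (K <#> N)" unfolding Z_def by blast
 then obtain f where f: "f : Cp" "!!x. x : Z ==> f x = 1" "!!x. x : CG ==> x ~: CG - (K <#> N) ==> f x = 0"
  using bump[OF Zc O] by metis
 have van: "f (x \<otimes> b) = 0" if "x : U" "b : N" for x b
 proof -
  have "x \<otimes> b : K <#> N" by (rule set_multI) (use that U(4) in auto)
  then show ?thesis using f(3)[of "x \<otimes> b"] openin_carrier[OF U(1) that(1)] N_carrier[OF that(2)] by simp
 qed
 have "levels f x ~= {}" if x: "x : CG" "x ~: N" for x
 proof -
  have "{x} \<inter> N = {}" "compactin T {x}" using x by auto
  then obtain m where m: "act (- int m) x ~: W <#> N" using escape[OF _ _ VW(2), of "{x}"] by blast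
  obtain M where M: "!!n. int M <= n ==> act n x : V" using act_eventually[OF x(1) VW(1,3)] by blast
  let ?P = "%k::nat. act (int k - int m) x : V <#> N"
  have VN: "y : V <#> N" if "y : V" for y using set_multI[OF that N_one, of G] openin_carrier[OF VW(1) that] by simp
  have "?P (M + m)" by (rule VN) (use M in simp)
  then have P: "?P (LEAST k. ?P k)" by (rule LeastI[of ?P])
  have "(LEAST k. ?P k) ~= 0"
  proof
   assume "(LEAST k. ?P k) = 0"
   then have "act (- int m) x : V <#> N" using P by simp
   then show False using m set_mult_mono[OF VW(4) subset_refl[of N], of G] by blast
  qed
  then obtain l where l: "(LEAST k. ?P k) = Suc l" by (cases "LEAST k. ?P k") auto
  then have nP: "~ ?P l" using not_less_Least[of l ?P] by simp
  let ?n = "int (Suc l) - int m"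
  have P1: "act ?n x : V <#> N" using P unfolding l .
  obtain w b where wb: "w : V" "b : N" "act ?n x = w \<otimes> b" using P1 unfolding mem_set_mult by blast
  have G: "w : CG" "b : CG" using openin_carrier[OF VW(1) wb(1)] N_carrier[OF wb(2)] by auto
  have "w ~: ?V1 <#> N"
  proof
   assume "w : ?V1 <#> N"
   then obtain v c where vc: "v : V" "c : N" "w = act 1 v \<otimes> c" unfolding mem_set_mult by blast
   have vG: "v : CG" "c : CG" using openin_carrier[OF VW(1) vc(1)] N_carrier[OF vc(2)] by auto
   have "act (int l - int m) x = act (- 1) (act ?n x)" using act_add[OF x(1), of "- 1" ?n] by simp
   also have "... = v \<otimes> (act (- 1) c \<otimes> act (- 1) b)" unfolding wb(3) vc(3) using vG G by (simp add: act_mult m_assoc)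
   also have "... : V <#> N" by (intro set_multI vc(1) subgroup.m_closed[OF N_subgroup] N_act vc(2) wb(2))
   finally show False using nP by simp
  qed
  then have "w : Z" unfolding Z_def using wb(1) VW(4) G by blast
  moreover have "act ?n x \<otimes> inv b = w" unfolding wb(3) using G by (simp add: m_assoc)
  ultimately have "f (act ?n x \<otimes> inv b) ~= 0" using f(2) by simp
  then have "?n : levels f x" using subgroup.m_inv_closed[OF N_subgroup wb(2)] unfolding levels_def by blast
  then show ?thesis by blast
 qed
 then have "shape f" unfolding shape_def using f(1) U(1,3) van by blast
 then show ?thesis by (rule that)
qed

lemma shape_Cp: "shape f ==> f : Cp" by (simp add: shape_def)

lemma levels_above:
 assumes f: "shape f"
 obtains V where "openin T V" "\<one> : V" "!!n y. y : CG ==> act n y : V ==> n ~: levels f y"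
proof -
 obtain V where V: "openin T V" "\<one> : V" "ALL x:V. ALL b:N. f (x \<otimes> b) = 0" using f unfolding shape_def by blast
 have "n ~: levels f y" if "y : CG" "act n y : V" for n y using V(3) that(2) unfolding levels_def by blast
 then show ?thesis using that V by blast
qed

lemma levels_support:
 assumes f: "shape f"
 obtains K where "compactin T K" "!!n y b. y : CG ==> b : N ==> f (act n y \<otimes> b) ~= 0 ==> act n y \<otimes> b : K"
  "!!n y. y : CG ==> n : levels f y ==> act n y : K <#> N"
proof -
 obtain K where K: "compactin T K" "!!y. y : CG ==> y ~: K ==> f y = 0" using Cp_Cc[OF shape_Cp[OF f]] by (auto simp: Cc_def)
 have 1: "act n y \<otimes> b : K" if "y : CG" "b : N" "f (act n y \<otimes> b) ~= 0" for n y b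
  using K(2)[of "act n y \<otimes> b"] that N_carrier by auto
 have "act n y : K <#> N" if y: "y : CG" and n: "n : levels f y" for n y
 proof -
  obtain b where b: "b : N" "f (act n y \<otimes> b) ~= 0" using n by (auto simp: levels_def)
  have "(act n y \<otimes> b) \<otimes> inv b : K <#> N" by (intro set_multI 1 y b subgroup.m_inv_closed[OF N_subgroup])
  then show ?thesis using y N_carrier[OF b(1)] by (simp add: m_assoc)
 qed
 then show ?thesis using that K(1) 1 by blast
qed

text \<open>Forward iterates of a compact neighbourhood of \<open>x\<close> enter \<open>V\<close>,
  and backward iterates escape \<open>K N\<close>, both uniformly. So the orbit sum is locally a
  finite sum of continuous functions.\<close>

lemma levels_local:
 assumes f: "shape f" and x: "x : CG" "x ~: N"
 obtains Y M where "openin T Y" "x : Y" "Y <= CG - N" "!!y. y : Y ==> levels f y <= {- int M..int M}"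
proof -
 have "openin T (CG - N)" using openin_diff[OF openin_topspace N_closed] by simp
 then obtain Y C where Y: "openin T Y" "compactin T C" "{x} <= Y" "Y <= C" "C <= CG - N"
  using compact_nbhd_of[of "{x}" "CG - N"] x by auto
 obtain V where V: "openin T V" "\<one> : V" "!!n y. y : CG ==> act n y : V ==> n ~: levels f y" using levels_above[OF f] by metis
 obtain K where K: "compactin T K" "!!n y. y : CG ==> n : levels f y ==> act n y : K <#> N" using levels_support[OF f] by metis
 obtain M1 where M1: "!!n y. int M1 <= n ==> y : C ==> act n y : V" using act_compact_eventually[OF Y(2) V(1,2)] by metis
 obtain M2 where M2: "ALL n y. y : C --> int M2 <= n --> act (- n) y ~: K <#> N" using escape[OF Y(2) _ K(1)] Y(5) by blast
 have "levels f y <= {- int (M1 + M2)..int (M1 + M2)}" if y: "y : Y" for y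
 proof
  fix n assume n: "n : levels f y"
  have yC: "y : C" and yG: "y : CG" using y Y by auto
  have "~ int M1 <= n" using M1[OF _ yC] V(3)[OF yG] n by blast
  moreover have "~ int M2 <= - n" using M2 yC K(2)[OF yG n] by (metis minus_minus)
  ultimately show "n : {- int (M1 + M2)..int (M1 + M2)}" by simp
 qed
 then show ?thesis using that[of Y "M1 + M2"] Y by auto
qed

lemma levels_finite: "shape f ==> x : CG ==> x ~: N ==> finite (levels f x)"
 by (rule levels_local[of f x]) (auto intro: finite_subset)

lemma orbit_sum_one_pos:
 assumes L: "S.haar L" and f: "shape f" and x: "x : CG" "x ~: N"
 shows "0 < orbit_sum L f (%b. 1) x"
 unfolding orbit_sum_def
proof (rule sum_pos)
 show "levels f x ~= {}" using f x by (simp add: shape_def)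
 fix n assume "n : levels f x"
 then obtain b where "b : N" "f (act n x \<otimes> b) ~= 0" by (auto simp: levels_def)
 then show "0 < avg L f (%b. 1) (act n x)" using avg_pos[OF L shape_Cp[OF f]] x by blast
qed (rule levels_finite[OF f x])

lemma orbit_sum_local:
 assumes L: "S.haar L" and f: "shape f" and x: "x : CG" and M: "levels f x <= {- int M..int M}"
 shows "orbit_sum L f h x = (\<Sum>n\<in>{- int M..int M}. avg L f (%b. h (act (- n) b)) (act n x))"
 unfolding orbit_sum_def
proof (rule sum.mono_neutral_left)
 show "ALL n:{- int M..int M} - levels f x. avg L f (%b. h (act (- n) b)) (act n x) = 0"
  using avg_zero[OF L Cp_Cc[OF shape_Cp[OF f]]] x by (auto simp: levels_def)
qed (use M in auto)

lemma orbit_sum_cont_local: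
 assumes L: "S.haar L" and f: "shape f" and Y: "openin T Y" "!!y. y : Y ==> levels f y <= {- int M..int M}"
  and h: "!!n. continuous_map (topol (sub G N)) euclideanreal (%b. h (act n b))"
 shows "continuous_map (subtopology T Y) euclideanreal (orbit_sum L f h)"
proof -
 have "rcont (%y. avg L f (%b. h (act (- n) b)) (act n y))" for n
  using continuous_map_compose[OF continuous_act0 slice_cont[OF L Cp_Cc[OF shape_Cp[OF f]] h[of "- n"]], of n]
  by (simp add: o_def avg_def)
 then have "rcont (%y. \<Sum>n\<in>{- int M..int M}. avg L f (%b. h (act (- n) b)) (act n y))"
  by (intro continuous_map_sum) auto
 then have "continuous_map (subtopology T Y) euclideanreal (%y. \<Sum>n\<in>{- int M..int M}. avg L f (%b. h (act (- n) b)) (act n y))"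
  by (rule continuous_map_from_subtopology)
 then show ?thesis
  by (rule continuous_map_eq) (use orbit_sum_local[OF L f _ Y(2)] openin_carrier[OF Y(1)] in auto)
qed

text \<open>Right multiplication by \<open>a\<close> changes the numerator by \<open>- h a\<close>
  times the denominator; the minus sign turns this into the increment \<open>h a\<close>.\<close>

definition hom_ext :: "(('a => real) => real) => ('a => real) => ('a => real) => 'a => real" where
 "hom_ext L f h x = (if x : N then h x else - orbit_sum L f h x / orbit_sum L f (%b. 1) x)"

lemma hom_ext_mult:
 assumes L: "S.haar L" and f: "shape f" and h: "rhom (sub G N) h" and x: "x : CG" and a: "a : N"
 shows "hom_ext L f h (x \<otimes> a) = hom_ext L f h x + h a"
proof (cases "x : N")
 case True
 then show ?thesis using S.rhom_mult[OF h, of x a] a subgroup.m_closed[OF N_subgroup True a] by (simp add: hom_ext_def)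
next
 case False
 then have xa: "x \<otimes> a ~: N" using N_mult_iff[OF x a] by simp
 have aG: "a : CG" using N_carrier[OF a] .
 have e: "act n (x \<otimes> a) = act n x \<otimes> act n a" for n by (rule act_mult[OF x aG])
 note m = avg_mult[OF L Cp_Cc[OF shape_Cp[OF f]] act_closed[OF x] N_act[OF a]]
 have 1: "orbit_sum L f (%b. 1) (x \<otimes> a) = orbit_sum L f (%b. 1) x"
  unfolding orbit_sum_def levels_mult[OF x a] e using m(2)[OF h] by simp
 have "orbit_sum L f h (x \<otimes> a) = (\<Sum>n\<in>levels f x. avg L f (%b. h (act (- n) b)) (act n x) - h a * avg L f (%b. 1) (act n x))"
  unfolding orbit_sum_def levels_mult[OF x a] e using m(1)[OF rhom_sub_act[OF h]] aG by simp
 also have "... = orbit_sum L f h x - h a * orbit_sum L f (%b. 1) x" by (simp add: orbit_sum_def sum_subtractf sum_distrib_left)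
 finally have 2: "orbit_sum L f h (x \<otimes> a) = orbit_sum L f h x - h a * orbit_sum L f (%b. 1) x" .
 show ?thesis using False xa orbit_sum_one_pos[OF L f x False] unfolding hom_ext_def 1 2 by (simp add: field_simps)
qed

text \<open>Off \<open>N\<close> the orbit sums are locally finite. For \<open>y\<close> close to
  the identity but outside \<open>N\<close>, only levels \<open>n <= - M\<close> contribute, and
  there \<open>y\<close> times \<alpha>^(-n)(b) lies in a strongly contracted copy of the compact
  support. So \<alpha>^(-n)(b) is near the identity and only small values of \<open>h\<close> are
  averaged. The other points of \<open>N\<close> follow by translation with
  \<open>hom_ext_mult\<close>.\<close>

lemma hom_ext_cont:
 assumes L: "S.haar L" and f: "shape f" and h: "rhom (sub G N) h"
 shows "rcont (hom_ext L f h)"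
proof (rule continuous_map_realI)
 fix x and e :: real assume x': "x : topspace T" and e: "0 < e"
 then have x: "x : CG" by simp
 show "EX U. openin T U & x : U & (ALL y:U. \<bar>hom_ext L f h y - hom_ext L f h x\<bar> < e)"
 proof (cases "x : N")
  case False
  obtain Y M where Y: "openin T Y" "x : Y" "Y <= CG - N" "!!y. y : Y ==> levels f y <= {- int M..int M}"
   using levels_local[OF f x False] by metis
  have c1: "continuous_map (subtopology T Y) euclideanreal (orbit_sum L f (%b. 1))" by (rule orbit_sum_cont_local[OF L f Y(1,4) one_cont])
  have c2: "continuous_map (subtopology T Y) euclideanreal (orbit_sum L f h)"
   by (rule orbit_sum_cont_local[OF L f Y(1,4) S.rhom_cont[OF rhom_sub_act[OF h]]])
  have c3: "continuous_map (subtopology T Y) euclideanreal (%y. - orbit_sum L f h y / orbit_sum L f (%b. 1) y)"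
  proof (intro continuous_map_real_divide continuous_map_minus c1 c2)
   fix y assume "y : topspace (subtopology T Y)"
   then show "orbit_sum L f (%b. 1) y ~= 0" using orbit_sum_one_pos[OF L f, of y] Y(3) by auto
  qed
  have "x : topspace (subtopology T Y)" using x' Y(2) by simp
  from continuous_map_realD[OF c3 this e] obtain U where U: "openin (subtopology T Y) U" "x : U"
   "ALL y:U. \<bar>- orbit_sum L f h y / orbit_sum L f (%b. 1) y - - orbit_sum L f h x / orbit_sum L f (%b. 1) x\<bar> < e" by blast
  have "openin T U" using U(1) Y(1) openin_open_subtopology by blast
  moreover have "U <= CG - N" using openin_subset[OF U(1)] Y(3) by auto
  ultimately show ?thesis using U(2,3) by (intro exI[of _ U]) (auto simp: hom_ext_def subset_iff)
 next
  case True
  obtain O1 where O1: "openin (topol (sub G N)) O1" "\<one> : O1" "ALL b:O1. \<bar>h b - h \<one>\<bar> < e / 2"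
   using continuous_map_realD[OF S.rhom_cont[OF h], of \<one> "e / 2"] e N_one by auto
  obtain U1 where U1: "openin T U1" "O1 = U1 \<inter> N" using O1(1) by (auto simp: openin_subtopology)
  have hsm: "\<bar>h b\<bar> < e / 2" if "b : U1" "b : N" for b using O1(3) U1(2) that S.rhom_one[OF h] by auto
  obtain U2 where U2: "openin T U2" "\<one> : U2" "U2 <= U1" "!!y. y : U2 ==> inv y : U2" "!!y z. y : U2 ==> z : U2 ==> y \<otimes> z : U1"
   using nbhd_mult[OF U1(1)] O1(2) U1(2) by (metis IntD1)
  obtain V where V: "openin T V" "\<one> : V" "!!n y. y : CG ==> act n y : V ==> n ~: levels f y" using levels_above[OF f] by metis
  obtain K where K: "compactin T K" "!!n y b. y : CG ==> b : N ==> f (act n y \<otimes> b) ~= 0 ==> act n y \<otimes> b : K" using levels_support[OF f] by metis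
  obtain M where M: "!!n x. int M <= n ==> x : K ==> act n x : U2" using act_compact_eventually[OF K(1) U2(1,2)] by metis
  obtain V2 M2 where V2: "openin T V2" "\<one> : V2" "!!n x. int M2 <= n ==> x : V2 ==> act n x : V" using act_equicontinuous[OF V(1,2)] by metis
  \<comment> \<open>For \<open>y\<close> in \<open>R\<close> the point \<alpha>^n(y) lies in
    \<open>V\<close> for all \<open>n >= - M\<close>, so \<open>y\<close> has no levels
    there.\<close>
  define R where "R = U2 \<inter> {y : topspace T. act (- int (M + M2)) y : V2}"
  have R: "openin T R" "\<one> : R" unfolding R_def using U2(1,2) V2(2) open_preimage[OF continuous_act0 V2(1)] by auto
  have small: "\<bar>hom_ext L f h y\<bar> < e" if y: "y : R" for y
  proof (cases "y : N")
   case True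
   then show ?thesis using hsm[of y] y U2(3) e by (auto simp: hom_ext_def R_def)
  next
   case False
   have yG: "y : CG" using openin_carrier[OF R(1) y] .
   have hl: "\<bar>h (act (- n) b)\<bar> <= e / 2" if n: "n : levels f y" and b: "b : N" "f (act n y \<otimes> b) ~= 0" for n b
   proof -
    have bG: "b : CG" using N_carrier[OF b(1)] .
    have "int M <= - n"
    proof (rule ccontr)
     assume "~ int M <= - n"
     then have "act (n + int (M + M2)) (act (- int (M + M2)) y) : V" using y by (intro V2(3)) (auto simp: R_def)
     then have "act n y : V" using act_add[OF yG, of "n + int (M + M2)" "- int (M + M2)"] by simp
     then show False using V(3)[OF yG] n by blast
    qed
    then have "act (- n) (act n y \<otimes> b) : U2" by (rule M) (rule K(2)[OF yG b])
    then have "y \<otimes> act (- n) b : U2" using yG bG by (simp add: act_mult)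
    then have "inv y \<otimes> (y \<otimes> act (- n) b) : U1" by (intro U2(5) U2(4)) (use y in \<open>auto simp: R_def\<close>)
    then show ?thesis using hsm[of "act (- n) b"] N_act[OF b(1)] yG bG by (simp add: less_imp_le)
   qed
   have "\<bar>orbit_sum L f h y\<bar> <= (\<Sum>n\<in>levels f y. \<bar>avg L f (%b. h (act (- n) b)) (act n y)\<bar>)" unfolding orbit_sum_def by (rule sum_abs)
   also have "... <= (\<Sum>n\<in>levels f y. e / 2 * avg L f (%b. 1) (act n y))"
    by (intro sum_mono avg_small[OF L shape_Cp[OF f] act_closed[OF yG] rhom_sub_act[OF h]] hl)
   also have "... = e / 2 * orbit_sum L f (%b. 1) y" by (simp add: orbit_sum_def sum_distrib_left)
   finally have "\<bar>orbit_sum L f h y\<bar> / orbit_sum L f (%b. 1) y <= e / 2"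
    using orbit_sum_one_pos[OF L f yG False] by (simp add: divide_le_eq)
   moreover have "\<bar>hom_ext L f h y\<bar> = \<bar>orbit_sum L f h y\<bar> / orbit_sum L f (%b. 1) y"
    using False orbit_sum_one_pos[OF L f yG False] by (simp add: hom_ext_def abs_divide)
   ultimately show ?thesis using e by linarith
  qed
  let ?U = "{y : CG. y \<otimes> inv x : R}"
  have "openin T ?U" by (rule open_rtrans[OF R(1)]) (use x in simp)
  moreover have "x : ?U" using x R(2) by simp
  moreover have "\<bar>hom_ext L f h y - hom_ext L f h x\<bar> < e" if y: "y : ?U" for y
  proof -
   have "hom_ext L f h ((y \<otimes> inv x) \<otimes> x) = hom_ext L f h (y \<otimes> inv x) + h x"
    by (rule hom_ext_mult[OF L f h _ True]) (use y x in auto)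
   moreover have "(y \<otimes> inv x) \<otimes> x = y" using y x by (simp add: m_assoc)
   ultimately show ?thesis using small[of "y \<otimes> inv x"] y True by (simp add: hom_ext_def)
  qed
  ultimately show ?thesis by blast
 qed
qed

lemma hom_ext_contr:
 fixes n :: nat
 assumes L: "S.haar L" and f: "shape f" and h: "!!i. i < n ==> rhom (sub G N) (h i)"
  and e: "!!b. b : N ==> g (contr G b) = (\<Sum>j<n. c j * h j b)" and x: "x : CG"
 shows "hom_ext L f g (contr G x) = (\<Sum>j<n. c j * hom_ext L f (h j) x)"
proof (cases "x : N")
 case True
 then have "contr G x : N" using N_contr by blast
 then show ?thesis using True e by (simp add: hom_ext_def)
next
 case False
 then have nc: "contr G x ~: N" using N_act_iff[OF x, of 1] by (simp add: act_1)
 have "orbit_sum L f g (contr G x) = (\<Sum>m\<in>levels f x. \<Sum>j<n. c j * avg L f (%b. h j (act (- m) b)) (act m x))"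
  unfolding orbit_sum_contr[OF x L] unfolding orbit_sum_def
 proof (rule sum.cong[OF refl])
  fix m
  have "avg L f (%b. g (contr G (act (- m) b))) (act m x) = avg L f (%b. \<Sum>j<n. c j * h j (act (- m) b)) (act m x)"
   unfolding avg_def by (rule S.haar_cong[OF L]) (use e N_act in simp)
  also have "... = (\<Sum>j<n. c j * avg L f (%b. h j (act (- m) b)) (act m x))"
   by (rule avg_linear[OF L Cp_Cc[OF shape_Cp[OF f]] act_closed[OF x] rhom_sub_act[OF h]])
  finally show "avg L f (%b. g (contr G (act (- m) b))) (act m x) = (\<Sum>j<n. c j * avg L f (%b. h j (act (- m) b)) (act m x))" .
 qed
 also have "... = (\<Sum>j<n. c j * orbit_sum L f (h j) x)" unfolding orbit_sum_def sum_distrib_left by (rule sum.swap)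
 finally have 1: "orbit_sum L f g (contr G x) = (\<Sum>j<n. c j * orbit_sum L f (h j) x)" .
 have 2: "orbit_sum L f (%b. 1) (contr G x) = orbit_sum L f (%b. 1) x" using orbit_sum_contr[OF x L, of f "%b. 1"] by simp
 show ?thesis using False nc unfolding hom_ext_def 1 2 by (simp add: sum_negf sum_divide_distrib)
qed

lemma rhoms_extend:
 fixes n :: nat
 assumes h: "!!i. i < n ==> rhom (sub G N) (h i)"
  and e: "!!i b. i < n ==> b : N ==> h i (contr G b) = (\<Sum>j<n. M i j * h j b)"
 obtains F where "!!i. i < n ==> rcont (F i)"
  "!!i x a. i < n ==> x : CG ==> a : N ==> F i (x \<otimes> a) = F i x + h i a"
  "!!i x. i < n ==> x : CG ==> F i (contr G x) = (\<Sum>j<n. M i j * F j x)"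
proof -
 obtain L where L: "S.haar L" using S.haar_exists by blast
 obtain f where f: "shape f" using shape_exists by blast
 show ?thesis
  by (rule that[of "%i. hom_ext L f (h i)"])
   (use hom_ext_cont[OF L f h] hom_ext_mult[OF L f h] hom_ext_contr[OF L f h e] in auto)
qed

end

section \<open>Equivariant retraction and equivariant section\<close>

context abelian_normal begin

interpretation S: contraction "sub G N" by (rule sub_contraction[OF N_subgroup N_closed N_contr])

text \<open>The two constructions are composed: \<open>\<nu> x\<close> is the element of the vector
  group \<open>E\<close> with the extended coordinates of \<open>x\<close>, and \<open>F2\<close>,
  the retraction for the common kernel \<open>D\<close> of the coordinates, is applied to
  \<open>x\<close> times the inverse of \<open>\<nu> x\<close>. For the digit expansion
  \<open>D\<close> has to be normal in the whole group, not only in \<open>N\<close>.\<close>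

theorem equivariant_retraction:
 assumes normal: "!!x a. x : CG ==> a : N ==> x \<otimes> a \<otimes> inv x : N"
 obtains F where "continuous_map T T F" "!!x. x : CG ==> F x : N" "!!x a. x : CG ==> a : N ==> F (x \<otimes> a) = F x \<otimes> a"
  "!!x. x : CG ==> F (contr G x) = contr G (F x)"
proof -
 have comm: "comm_group (sub G N)" by (rule S.group_comm_groupI) (use N_comm in simp)
 have sub: "subgroup X G & X <= N" if "subgroup X (sub G N)" for X
  using that subgroup.subset[OF that] subgroup_sub_iff[OF is_group N_subgroup, of X] by simp
 obtain n :: nat and h M E X where
  h: "ALL i<n. rhom (sub G N) (h i)" and hM: "ALL i<n. ALL y:N. h i (contr G y) = (\<Sum>j<n. M i j * h j y)" and
  E': "subgroup E (sub G N)" and Ec: "contr G ` E = E" and surj: "ALL t. EX y:E. ALL i<n. h i y = t i" and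
  near: "ALL U. openin (subtopology T N) U & \<one> : U --> (EX e>0. ALL y:E. (ALL i<n. \<bar>h i y\<bar> < e) --> y : U)" and
  X: "subgroup X (sub G N)" "openin (subtopology T N) X" "ALL y:X. contr G y : X" "compactin (subtopology T N) {y : X. ALL i<n. h i y = 0}"
  using S.abelian_structure[OF comm] unfolding sub_simps by (elim exE conjE) (rule that, assumption+)
 have hr: "rhom (sub G N) (h i)" if "i < n" for i using h that by blast
 have hadd: "h i (a \<otimes> b) = h i a + h i b" if "i < n" "a : N" "b : N" for i a b using S.rhom_mult[OF hr[OF that(1)], of a b] that by simp
 have hinv: "h i (inv a) = - h i a" if "i < n" "a : N" for i a
  using S.rhom_inv[OF hr[OF that(1)], of a] that inv_sub[OF is_group N_subgroup that(2)] by simp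
 have h1: "h i \<one> = 0" if "i < n" for i using S.rhom_one[OF hr[OF that]] by simp
 have sE: "subgroup E G" and EN: "E <= N" using sub[OF E'] by auto
 have sX: "subgroup X G" and XN: "X <= N" using sub[OF X(1)] by auto
 have near': "EX e>0. ALL y:E. (ALL i<n. \<bar>h i y\<bar> < e) --> y : U" if U: "openin T U" "\<one> : U" for U
 proof -
  have "openin (subtopology T N) (U \<inter> N)" "\<one> : U \<inter> N" using U N_one by (auto simp: openin_subtopology)
  then obtain e where "e > 0" "ALL y:E. (ALL i<n. \<bar>h i y\<bar> < e) --> y : U \<inter> N" using near by blast
  then show ?thesis by blast
 qed
 have E0: "y = \<one>" if y: "y : E" "!!i. i < n ==> h i y = 0" for y
 proof (rule ccontr)
  assume "y ~= \<one>"
  moreover have "y : CG" using y(1) EN N_carrier by auto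
  ultimately obtain U where U: "openin T U" "\<one> : U" "y ~: U" using separate_one by metis
  obtain e where "e > 0" "ALL y:E. (ALL i<n. \<bar>h i y\<bar> < e) --> y : U" using near'[OF U(1,2)] by blast
  then show False using y U(3) by auto
 qed
 have Euniq: "y = z" if y: "y : E" and z: "z : E" and e: "!!i. i < n ==> h i y = h i z" for y z
 proof -
  have yz: "y \<otimes> inv z : E" by (intro subgroup.m_closed[OF sE] subgroup.m_inv_closed[OF sE] y z)
  have zN: "z : N" "y : N" "inv z : N" using y z EN subgroup.m_inv_closed[OF sE z] by auto
  have "y \<otimes> inv z = \<one>" by (rule E0[OF yz]) (use e hadd hinv zN in simp)
  then show ?thesis using N_carrier zN by (metis inv_equality inv_inv)
 qed
 define D where "D = {y : N. ALL i<n. h i y = 0}"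
 have DN: "D <= N" by (auto simp: D_def)
 have sD: "subgroup D G"
  by (rule subgroupI) (use N_carrier N_one h1 hadd hinv subgroup.m_closed[OF N_subgroup] subgroup.m_inv_closed[OF N_subgroup] in \<open>auto simp: D_def\<close>)
 have cD: "closedin T D"
 proof (rule closedin_trans_full)
  show "closedin (subtopology T N) D"
   using S.rhom_zero_closed[OF hr closedin_topspace] N_carrier unfolding D_def by (simp add: Int_absorb1 subset_iff)
 qed (rule N_closed)
 have kD: "contr G ` D = D"
 proof (intro equalityI subsetI)
  fix y assume "y : contr G ` D"
  then show "y : D" using N_contr hM by (auto simp: D_def)
 next
  fix y assume y: "y : D"
  then obtain z where z: "z : N" "y = contr G z" using N_contr DN by blast
  \<comment> \<open>\<open>e\<close> carries the coordinates of \<open>z\<close> inside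
    \<open>E\<close>. The contraction sends them to zero, so \<open>contr G e\<close> and then
    \<open>e\<close> are trivial; this stands in for the invertibility of the matrix.\<close>
  obtain e where e: "e : E" "ALL i<n. h i e = h i z" using surj[rule_format, of "%i. h i z"] by blast
  have "contr G e = \<one>"
  proof (rule E0)
   show "contr G e : E" using Ec e(1) by blast
   fix i assume i: "i < n"
   have "h i (contr G e) = (\<Sum>j<n. M i j * h j e)" using hM i e(1) EN by blast
   also have "... = (\<Sum>j<n. M i j * h j z)" using e(2) by simp
   also have "... = h i y" using hM i z by simp
   finally show "h i (contr G e) = 0" using y i by (simp add: D_def)
  qed
  then have "e = \<one>" using act_eq_one[of e 1] e(1) EN N_carrier by (simp add: act_1 subset_iff)
  then have "z : D" using e(2) h1 z(1) by (simp add: D_def)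
  then show "y : contr G ` D" using z(2) by blast
 qed
 define P where "P = {y : X. ALL i<n. h i y = 0}"
 have PX: "P = D \<inter> X" unfolding P_def D_def using XN by auto
 have sP: "subgroup P G" unfolding PX by (rule subgroups_Inter_pair[OF sD sX])
 have Pc: "compactin T P" using X(4) unfolding P_def by (simp add: compactin_subtopology)
 obtain U where U: "openin T U" "X = U \<inter> N" using X(2) by (auto simp: openin_subtopology)
 have PU: "P = D \<inter> U" using PX U(2) DN by auto
 have Pcontr: "contr G x : P" if "x : P" for x using that X(3) kD unfolding PX by blast
 \<comment> \<open>\<open>d\<close> lies in the compact subgroup \<alpha>^(-m)(P) of
   \<open>N\<close>, and \<open>h i\<close> after conjugation by \<open>x\<close> is again a real
   homomorphism of \<open>N\<close>, so it vanishes at \<open>d\<close>.\<close>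
 have Dnormal: "x \<otimes> d \<otimes> inv x : D" if x: "x : CG" and d: "d : D" for x d
 proof -
  have dG: "d : CG" using d DN N_carrier by auto
  obtain m where "!!n. int m <= n ==> act n d : U" using act_eventually[OF dG U(1)] subgroup.one_closed[OF sX] U(2) by blast
  then have "act (int m) d : U" by simp
  moreover have "act (int m) d : D" using act_stable[OF kD subgroup.subset[OF sD], of "int m"] d by blast
  ultimately have "act (- int m) (act (int m) d) : act (- int m) ` P" unfolding PU by blast
  then have dP: "d : act (- int m) ` P" using dG by simp
  have PN: "act (- int m) ` P <= N" using N_act DN unfolding PX by auto
  have sP': "subgroup (act (- int m) ` P) (sub G N)"
   using subgroup_act[OF sP, of "- int m"] subgroup_sub_iff[OF is_group N_subgroup PN] by simp
  have cP': "compactin (topol (sub G N)) (act (- int m) ` P)"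
   using compact_act[OF Pc, of "- int m"] PN by (simp add: compactin_subtopology)
  have "h i (x \<otimes> d \<otimes> inv x) = 0" if i: "i < n" for i
  proof (rule S.rhom_compact_subgroup[OF _ sP' cP' dP])
   have "continuous_map T T (%d. x \<otimes> d \<otimes> inv x)" by (intro continuous_intros x inv_closed)
   then have "continuous_map (subtopology T N) (subtopology T N) (%d. x \<otimes> d \<otimes> inv x)"
    using normal[OF x] by (simp add: continuous_map_in_subtopology continuous_map_from_subtopology image_subset_iff Pi_iff)
   from continuous_map_compose[OF this, of euclideanreal "h i"]
   have "continuous_map (topol (sub G N)) euclideanreal (%d. h i (x \<otimes> d \<otimes> inv x))"
    using S.rhom_cont[OF hr[OF i]] by (simp add: o_def)
   moreover have "h i (x \<otimes> (a \<otimes> b) \<otimes> inv x) = h i (x \<otimes> a \<otimes> inv x) + h i (x \<otimes> b \<otimes> inv x)" if "a : N" "b : N" for a b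
   proof -
    have "x \<otimes> (a \<otimes> b) \<otimes> inv x = (x \<otimes> a \<otimes> inv x) \<otimes> (x \<otimes> b \<otimes> inv x)" using x N_carrier that by (simp add: m_assoc)
    then show ?thesis using hadd[OF i normal[OF x that(1)] normal[OF x that(2)]] by simp
   qed
   ultimately show "rhom (sub G N) (%d. h i (x \<otimes> d \<otimes> inv x))" by (simp add: rhom_def)
  qed
  then show ?thesis using normal[OF x] d DN by (auto simp: D_def)
 qed
 obtain H where H: "subgroup H G" "openin T H" "!!x. x : H ==> contr G x : H" "compactin T (D \<inter> H)"
  by (rule compact_part[OF sD cD kD sP Pc U(1) PU Pcontr]) auto
 obtain F2 where F2: "continuous_map T T F2" "!!x. x : CG ==> F2 x : D" "!!x d. x : CG ==> d : D ==> F2 (x \<otimes> d) = F2 x \<otimes> d"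
  "!!x. x : CG ==> F2 (contr G x) = contr G (F2 x)"
  by (rule digit_section[OF sD cD kD Dnormal H]) auto
 have hM': "h i (contr G b) = (\<Sum>j<n. M i j * h j b)" if "i < n" "b : N" for i b using hM that by blast
 have "EX F1. (ALL i<n. rcont (F1 i)) & (ALL i<n. ALL x:CG. ALL a:N. F1 i (x \<otimes> a) = F1 i x + h i a) &
  (ALL i<n. ALL x:CG. F1 i (contr G x) = (\<Sum>j<n. M i j * F1 j x))"
 proof (rule rhoms_extend[of n h M])
  show "rhom (sub G N) (h i)" if "i < n" for i using hr[OF that] .
  show "h i (contr G b) = (\<Sum>j<n. M i j * h j b)" if "i < n" "b : N" for i b using hM'[OF that] .
 qed blast
 then obtain F1 where "ALL i<n. rcont (F1 i)" "ALL i<n. ALL x:CG. ALL a:N. F1 i (x \<otimes> a) = F1 i x + h i a"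
  "ALL i<n. ALL x:CG. F1 i (contr G x) = (\<Sum>j<n. M i j * F1 j x)" by blast
 then have F1: "!!i. i < n ==> rcont (F1 i)"
  "!!i x a. i < n ==> x : CG ==> a : N ==> F1 i (x \<otimes> a) = F1 i x + h i a"
  "!!i x. i < n ==> x : CG ==> F1 i (contr G x) = (\<Sum>j<n. M i j * F1 j x)" by blast+
 have "EX y. y : E & (ALL i<n. h i y = F1 i x)" for x using surj[rule_format, of "%i. F1 i x"] by blast
 then obtain \<nu> where nu: "!!x. \<nu> x : E" "!!x i. i < n ==> h i (\<nu> x) = F1 i x" by metis
 have nuN: "\<nu> x : N" and nuG: "\<nu> x : CG" for x using nu(1)[of x] EN N_carrier by auto
 have nucont: "continuous_map T T \<nu>"
 proof (rule continuous_mapI_local)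
  fix x U assume x: "x : topspace T" and U: "openin T U" "\<nu> x : U"
  have "openin T {e : CG. e \<otimes> \<nu> x : U}" "\<one> : {e : CG. e \<otimes> \<nu> x : U}" using open_rtrans[OF U(1) nuG] U(2) nuG by auto
  from near'[OF this] obtain e where e: "e > 0" "ALL y:E. (ALL i<n. \<bar>h i y\<bar> < e) --> y : {e : CG. e \<otimes> \<nu> x : U}" by blast
  have "rcont (%y. \<Sum>i<n. \<bar>F1 i y - F1 i x\<bar>)"
   by (intro continuous_map_sum continuous_map_real_abs continuous_map_diff F1(1)) auto
  from continuous_map_realD[OF this x e(1)] obtain V where V: "openin T V" "x : V" "ALL y:V. \<bar>(\<Sum>i<n. \<bar>F1 i y - F1 i x\<bar>) - (\<Sum>i<n. \<bar>F1 i x - F1 i x\<bar>)\<bar> < e" by blast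
  have "\<nu> y : U" if y: "y : V" for y
  proof -
   have "\<nu> y \<otimes> inv \<nu> x : E" by (intro subgroup.m_closed[OF sE] subgroup.m_inv_closed[OF sE] nu)
   moreover have "\<bar>h i (\<nu> y \<otimes> inv \<nu> x)\<bar> < e" if i: "i < n" for i
   proof -
    have "h i (\<nu> y \<otimes> inv \<nu> x) = F1 i y - F1 i x"
     using hadd[OF i nuN[of y] subgroup.m_inv_closed[OF N_subgroup nuN[of x]]] hinv[OF i nuN[of x]] nu(2)[OF i] by simp
    moreover have "\<bar>F1 i y - F1 i x\<bar> <= (\<Sum>i<n. \<bar>F1 i y - F1 i x\<bar>)" using i by (intro member_le_sum) auto
    moreover have "(\<Sum>i<n. \<bar>F1 i y - F1 i x\<bar>) < e" using V(3) y by auto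
    ultimately show ?thesis by linarith
   qed
   ultimately have "\<nu> y \<otimes> inv \<nu> x \<otimes> \<nu> x : U" using e(2) by blast
   then show ?thesis using nuG by (simp add: m_assoc)
  qed
  then show "EX V. openin T V & x : V & (ALL y:V. \<nu> y : U)" using V by blast
 qed (use nuG in simp)
 define F where "F x = F2 (x \<otimes> inv \<nu> x) \<otimes> \<nu> x" for x
 have F2G: "F2 x : CG" and F2N: "F2 x : N" if "x : CG" for x using F2(2)[OF that] DN N_carrier by auto
 show ?thesis
 proof (rule that[of F])
  have "continuous_map T T (%x. x \<otimes> inv \<nu> x)" by (intro continuous_intros nucont)
  from continuous_map_compose[OF this F2(1)] have "continuous_map T T (%x. F2 (x \<otimes> inv \<nu> x))" by (simp add: o_def)
  then show "continuous_map T T F" unfolding F_def by (intro continuous_intros nucont)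
  show "F x : N" if "x : CG" for x
   unfolding F_def by (intro subgroup.m_closed[OF N_subgroup] F2N nuN m_closed that inv_closed nuG)
  show "F (x \<otimes> a) = F x \<otimes> a" if x: "x : CG" and a: "a : N" for x a
  proof -
   obtain e where e: "e : E" "ALL i<n. h i e = h i a" using surj[rule_format, of "%i. h i a"] by blast
   have eN: "e : N" using e(1) EN by auto
   let ?d = "a \<otimes> inv e"
   have iN: "inv e : N" by (rule subgroup.m_inv_closed[OF N_subgroup eN])
   have dD: "?d : D" unfolding D_def using subgroup.m_closed[OF N_subgroup a iN] hadd[OF _ a iN] hinv[OF _ eN] e(2) by simp
   have G: "a : CG" "e : CG" "inv e : CG" using N_carrier a eN by auto
   have nua: "\<nu> (x \<otimes> a) = \<nu> x \<otimes> e"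
   proof (rule Euniq[OF nu(1) subgroup.m_closed[OF sE nu(1) e(1)]])
    fix i assume "i < n"
    then show "h i (\<nu> (x \<otimes> a)) = h i (\<nu> x \<otimes> e)" using nu(2) F1(2) x a hadd nuN eN e(2) by simp
   qed
   have "(x \<otimes> a) \<otimes> inv (\<nu> x \<otimes> e) = x \<otimes> (?d \<otimes> inv \<nu> x)" using x G nuG by (simp add: inv_mult_group m_assoc)
   also have "?d \<otimes> inv \<nu> x = inv \<nu> x \<otimes> ?d" by (rule N_comm) (use dD DN subgroup.m_inv_closed[OF N_subgroup nuN] in auto)
   also have "x \<otimes> (inv \<nu> x \<otimes> ?d) = (x \<otimes> inv \<nu> x) \<otimes> ?d" using x G nuG by (simp add: m_assoc)
   finally have "F2 ((x \<otimes> a) \<otimes> inv (\<nu> x \<otimes> e)) = F2 (x \<otimes> inv \<nu> x) \<otimes> ?d" using F2(3)[OF _ dD, of "x \<otimes> inv \<nu> x"] x nuG by simp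
   then have "F (x \<otimes> a) = F2 (x \<otimes> inv \<nu> x) \<otimes> (?d \<otimes> \<nu> x) \<otimes> e"
    unfolding F_def nua using F2G[of "x \<otimes> inv \<nu> x"] x G nuG by (simp add: m_assoc)
   also have "?d \<otimes> \<nu> x = \<nu> x \<otimes> ?d" by (rule N_comm) (use dD DN nuN in auto)
   also have "F2 (x \<otimes> inv \<nu> x) \<otimes> (\<nu> x \<otimes> ?d) \<otimes> e = F x \<otimes> a"
    unfolding F_def using F2G[of "x \<otimes> inv \<nu> x"] x G nuG by (simp add: m_assoc)
   finally show ?thesis .
  qed
  show "F (contr G x) = contr G (F x)" if x: "x : CG" for x
  proof -
   have "\<nu> (contr G x) = contr G (\<nu> x)"
   proof (rule Euniq[OF nu(1)])
    show "contr G (\<nu> x) : E" using Ec nu(1) by blast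
    fix i assume "i < n"
    then show "h i (\<nu> (contr G x)) = h i (contr G (\<nu> x))" using nu(2) F1(3)[OF _ x] hM nuN by simp
   qed
   moreover have "contr G x \<otimes> inv (contr G (\<nu> x)) = contr G (x \<otimes> inv \<nu> x)"
    using x nuG by (simp add: contr_mult act_inv[of "\<nu> x" 1, unfolded act_1])
   ultimately show ?thesis unfolding F_def using F2(4)[of "x \<otimes> inv \<nu> x"] F2G[of "x \<otimes> inv \<nu> x"] x nuG by (simp add: contr_mult)
  qed
 qed
qed

end

text \<open>The element \<open>x F(x)^-1\<close> depends only on the coset of \<open>x\<close>
  modulo the kernel, so it descends to \<open>Q\<close>; the descended map is continuous because
  \<open>q\<close> is open and hence a quotient map.\<close>

theorem equivariant_section:
 fixes P :: "'a dynamical_group" and Q :: "'b dynamical_group"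
 assumes P: "lc_contraction_group P" and Q: "lc_contraction_group Q" and q: "contraction_morphism P Q q"
  and surj: "q ` carrier P = carrier Q"
  and comm: "!!a b. a : kernel P Q q ==> b : kernel P Q q ==> a \<otimes>\<^bsub>P\<^esub> b = b \<otimes>\<^bsub>P\<^esub> a"
 obtains s where "continuous_map (topol Q) (topol P) s" "!!g. g : carrier Q ==> s g : carrier P" "!!g. g : carrier Q ==> q (s g) = g"
  "!!g. g : carrier Q ==> s (contr Q g) = contr P (s g)"
proof -
 interpret P: contraction P using P by (simp add: contraction_iff)
 interpret Q: contraction Q using Q by (simp add: contraction_iff)
 have qh: "q : hom P Q" and qc: "continuous_map (topol P) (topol Q) q" and qk: "!!x. x : carrier P ==> contr Q (q x) = q (contr P x)"
  using q by (auto simp: contraction_morphism_def)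
 interpret q: group_hom P Q q by unfold_locales (rule qh)
 let ?N = "kernel P Q q"
 have ker: "x : ?N \<longleftrightarrow> x : carrier P & q x = \<one>\<^bsub>Q\<^esub>" for x by (auto simp: kernel_def)
 have cN: "closedin (topol P) ?N"
 proof -
  have "closedin (topol Q) {\<one>\<^bsub>Q\<^esub>}" by (rule Q.compact_closed) simp
  from closedin_continuous_map_preimage[OF qc this] show ?thesis by (simp add: kernel_def)
 qed
 have kN: "contr P ` ?N = ?N"
 proof (intro equalityI subsetI)
  fix y assume "y : contr P ` ?N"
  then show "y : ?N" using qk[symmetric] by (auto simp: ker)
 next
  fix y assume y: "y : ?N"
  let ?z = "inv_into (carrier P) (contr P) y"
  have z: "?z : carrier P" "contr P ?z = y" using y by (auto simp: ker)
  have "contr Q (q ?z) = \<one>\<^bsub>Q\<^esub>" using qk[OF z(1)] z(2) y by (simp add: ker)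
  then have "q ?z = \<one>\<^bsub>Q\<^esub>" using Q.act_eq_one[of "q ?z" 1] z(1) by (simp add: Q.act_1)
  then show "y : contr P ` ?N" using z by (intro image_eqI[of _ _ ?z]) (auto simp: ker)
 qed
 interpret abelian_normal P ?N
  by (intro abelian_normal.intro abelian_normal_axioms.intro P.contraction_axioms q.subgroup_kernel cN kN comm)
 obtain F where F: "continuous_map (topol P) (topol P) F" "!!x. x : carrier P ==> F x : ?N"
  "!!x a. x : carrier P ==> a : ?N ==> F (x \<otimes>\<^bsub>P\<^esub> a) = F x \<otimes>\<^bsub>P\<^esub> a" "!!x. x : carrier P ==> F (contr P x) = contr P (F x)"
  by (rule equivariant_retraction) (auto simp: ker)
 define s' where "s' x = x \<otimes>\<^bsub>P\<^esub> inv\<^bsub>P\<^esub> F x" for x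
 have FG: "F x : carrier P" "q (F x) = \<one>\<^bsub>Q\<^esub>" if "x : carrier P" for x using F(2)[OF that] by (auto simp: ker)
 have s'eq: "s' x = s' y" if x: "x : carrier P" and y: "y : carrier P" and e: "q x = q y" for x y
 proof -
  let ?a = "inv\<^bsub>P\<^esub> x \<otimes>\<^bsub>P\<^esub> y"
  have a: "?a : ?N" using x y e by (simp add: ker)
  have xa: "x \<otimes>\<^bsub>P\<^esub> ?a = y" using x y by simp
  have "s' y = (x \<otimes>\<^bsub>P\<^esub> ?a) \<otimes>\<^bsub>P\<^esub> inv\<^bsub>P\<^esub> F (x \<otimes>\<^bsub>P\<^esub> ?a)" unfolding s'_def xa ..
  also have "F (x \<otimes>\<^bsub>P\<^esub> ?a) = F x \<otimes>\<^bsub>P\<^esub> ?a" by (rule F(3)[OF x a])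
  also have "(x \<otimes>\<^bsub>P\<^esub> ?a) \<otimes>\<^bsub>P\<^esub> inv\<^bsub>P\<^esub> (F x \<otimes>\<^bsub>P\<^esub> ?a) = s' x" unfolding s'_def using x y FG(1)[OF x] by (simp add: P.inv_mult_group P.m_assoc)
  finally show ?thesis by simp
 qed
 define s where "s g = s' (SOME x. x : carrier P & q x = g)" for g
 have sq: "s (q x) = s' x" if x: "x : carrier P" for x
  unfolding s_def using someI[of "%y. y : carrier P & q y = q x" x] x by (intro s'eq) auto
 have s'G: "s' x : carrier P" if "x : carrier P" for x using that FG by (simp add: s'_def)
 show ?thesis
 proof (rule that[of s])
  have "continuous_map (topol P) (topol P) s'" unfolding s'_def by (intro P.continuous_mult P.continuous_inv P.continuous_id F(1))
  then have "continuous_map (topol P) (topol P) (s \<circ> q)" by (rule continuous_map_eq) (use sq in simp)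
  moreover have "quotient_map (topol P) (topol Q) q"
   by (rule continuous_open_quotient_map[OF qc contraction_morphism_open[OF P Q q surj], THEN iffD2]) (use surj in simp)
  ultimately show "continuous_map (topol Q) (topol P) s" by (rule continuous_compose_quotient_map[rotated])
 next
  fix g assume "g : carrier Q"
  then obtain x where x: "x : carrier P" "g = q x" using surj by blast
  show "s g : carrier P" unfolding x(2) sq[OF x(1)] by (rule s'G[OF x(1)])
  show "q (s g) = g" unfolding x(2) sq[OF x(1)] s'_def using x(1) FG by simp
  have "s (contr Q g) = s' (contr P x)" unfolding x(2) using qk[OF x(1)] sq[of "contr P x"] x(1) by simp
  also have "... = contr P (s' x)" unfolding s'_def using F(4)[OF x(1)] x(1) FG(1)[OF x(1)]
   by (simp add: P.contr_mult P.act_inv[of "F x" 1, unfolded P.act_1])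
  finally show "s (contr Q g) = contr P (s g)" using sq[OF x(1)] x(2) by simp
 qed
qed

subsection \<open>Cocycles and extensions\<close>

lemma (in contraction) contr_fixed: "x : carrier G ==> contr G x = x ==> x = \<one>"
proof -
 assume x: "x : carrier G" "contr G x = x"
 have "(contr G ^^ n) x = x" for n by (induction n) (use x(2) in auto)
 then have "limitin T (%n. x) \<one> sequentially" using contr_lim[OF x(1)] by simp
 moreover have "limitin T (%n. x) x sequentially" using x(1) by simp
 ultimately show "x = \<one>" using limitin_Hausdorff_unique[OF _ _ trivial_limit_sequentially haus] by blast
qed

text \<open>Surjective morphisms of contraction groups are open, so the inverse is
  continuous.\<close>

lemma bij_morphism_isomorphism:
 fixes P :: "'a dynamical_group" and Q :: "'b dynamical_group"
 assumes P: "lc_contraction_group P" and Q: "lc_contraction_group Q" and f: "contraction_morphism P Q f"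
  and bij: "bij_betw f (carrier P) (carrier Q)"
 shows "contraction_isomorphism P Q f"
proof -
 interpret P: contraction P using P by (simp add: contraction_iff)
 interpret Q: contraction Q using Q by (simp add: contraction_iff)
 have fh: "f : hom P Q" and fc: "continuous_map (topol P) (topol Q) f" and fk: "!!x. x : carrier P ==> contr Q (f x) = f (contr P x)"
  using f by (auto simp: contraction_morphism_def)
 have im: "f ` carrier P = carrier Q" and inj: "inj_on f (carrier P)" using bij by (auto simp: bij_betw_def)
 have "homeomorphic_map (topol P) (topol Q) f"
  by (rule bijective_open_imp_homeomorphic_map[OF fc contraction_morphism_open[OF P Q f im]]) (use im inj in auto)
 then obtain g where g: "homeomorphic_maps (topol P) (topol Q) f g" using homeomorphic_map_maps by blast
 have gc: "continuous_map (topol Q) (topol P) g" and gf: "!!x. x : carrier P ==> g (f x) = x" and fg: "!!y. y : carrier Q ==> f (g y) = y"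
  using g by (auto simp: homeomorphic_maps_def)
 have gG: "g y : carrier P" if "y : carrier Q" for y using im gf that by (metis imageE)
 have gh: "g : hom Q P"
 proof (rule homI)
  fix x y assume x: "x : carrier Q" and y: "y : carrier Q"
  have "f (g x \<otimes>\<^bsub>P\<^esub> g y) = x \<otimes>\<^bsub>Q\<^esub> y" using hom_mult[OF fh gG[OF x] gG[OF y]] fg x y by simp
  then show "g (x \<otimes>\<^bsub>Q\<^esub> y) = g x \<otimes>\<^bsub>P\<^esub> g y" using gf[of "g x \<otimes>\<^bsub>P\<^esub> g y"] gG x y by simp
 qed (rule gG)
 have "contr P (g y) = g (contr Q y)" if y: "y : carrier Q" for y
  using fk[OF gG[OF y]] fg[OF y] gf[of "contr P (g y)"] gG[OF y] by simp
 then have "contraction_morphism Q P g" using gh gc by (simp add: contraction_morphism_def)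
 moreover have "group_isomorphisms P Q f g" using fh gh gf fg by (simp add: group_isomorphisms_def)
 ultimately show ?thesis using f unfolding contraction_isomorphism_def by blast
qed

lemma contraction_morphism_comp:
 assumes "contraction_morphism P Q f" "contraction_morphism Q R g"
 shows "contraction_morphism P R (g \<circ> f)"
proof -
 have fh: "f : hom P Q" using assms(1) by (simp add: contraction_morphism_def)
 then have "!!x. x : carrier P ==> f x : carrier Q" by (auto simp: hom_def)
 then show ?thesis using assms Group.hom_compose[of f P Q g R] continuous_map_compose[of "topol P" "topol Q" f "topol R" g]
  by (simp add: contraction_morphism_def)
qed

lemma extension_equivalent_sym:
 assumes "extension_equivalent A E1 E2" "contraction_extension A G E1"
 shows "extension_equivalent A E2 E1"
proof -
 obtain f g where f: "contraction_morphism (total_group E1) (total_group E2) f" "ALL a:carrier A. f (incl E1 a) = incl E2 a"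
  "ALL x:carrier (total_group E1). proj E2 (f x) = proj E1 x" and g: "contraction_morphism (total_group E2) (total_group E1) g"
  "group_isomorphisms (total_group E1) (total_group E2) f g"
  using assms(1) by (auto simp: extension_equivalent_def contraction_isomorphism_def)
 have gi: "group_isomorphisms (total_group E2) (total_group E1) g f" using g(2) by (auto simp: group_isomorphisms_def)
 have "incl E1 a : carrier (total_group E1)" if "a : carrier A" for a
  using assms(2) that by (auto simp: contraction_extension_def contraction_morphism_def hom_def)
 then have "ALL a:carrier A. g (incl E2 a) = incl E1 a" using f(2) g(2) by (metis group_isomorphisms_def)
 moreover have "ALL x:carrier (total_group E2). proj E1 (g x) = proj E2 x"
 proof
  fix x assume x: "x : carrier (total_group E2)"
  then have "g x : carrier (total_group E1)" "f (g x) = x" using g(2) by (auto simp: group_isomorphisms_def hom_def)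
  then show "proj E1 (g x) = proj E2 x" using f(3) by metis
 qed
 ultimately show ?thesis using f(1) g(1) gi unfolding extension_equivalent_def contraction_isomorphism_def by blast
qed

lemma extension_equivalent_trans:
 assumes "extension_equivalent A E1 E2" "extension_equivalent A E2 E3"
 shows "extension_equivalent A E1 E3"
proof -
 obtain f f' where f: "contraction_morphism (total_group E1) (total_group E2) f" "contraction_morphism (total_group E2) (total_group E1) f'"
  "group_isomorphisms (total_group E1) (total_group E2) f f'" "ALL a:carrier A. f (incl E1 a) = incl E2 a"
  "ALL x:carrier (total_group E1). proj E2 (f x) = proj E1 x"
  using assms(1) by (auto simp: extension_equivalent_def contraction_isomorphism_def)
 obtain g g' where g: "contraction_morphism (total_group E2) (total_group E3) g" "contraction_morphism (total_group E3) (total_group E2) g'"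
  "group_isomorphisms (total_group E2) (total_group E3) g g'" "ALL a:carrier A. g (incl E2 a) = incl E3 a"
  "ALL x:carrier (total_group E2). proj E3 (g x) = proj E2 x"
  using assms(2) by (auto simp: extension_equivalent_def contraction_isomorphism_def)
 have c: "f x : carrier (total_group E2)" if "x : carrier (total_group E1)" for x using f(3) that by (auto simp: group_isomorphisms_def hom_def)
 have c': "g' x : carrier (total_group E2)" if "x : carrier (total_group E3)" for x using g(3) that by (auto simp: group_isomorphisms_def hom_def)
 have "group_isomorphisms (total_group E1) (total_group E3) (g \<circ> f) (f' \<circ> g')"
  using f(3) g(3) c c' Group.hom_compose[of f _ _ g] Group.hom_compose[of g' _ _ f'] unfolding group_isomorphisms_def by auto
 then have "contraction_isomorphism (total_group E1) (total_group E3) (g \<circ> f)"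
  using contraction_morphism_comp[OF f(1) g(1)] contraction_morphism_comp[OF g(2) f(2)] unfolding contraction_isomorphism_def by blast
 moreover have "ALL a:carrier A. (g \<circ> f) (incl E1 a) = incl E3 a" using f(4) g(4) by simp
 moreover have "ALL x:carrier (total_group E1). proj E3 ((g \<circ> f) x) = proj E1 x" using f(5) g(5) c by simp
 ultimately show ?thesis unfolding extension_equivalent_def by blast
qed

text \<open>The short five lemma with continuity of the inverse included. The equivalences between
  twisted products and extensions below only require a morphism compatible with inclusions and
  projections.\<close>

lemma short_five:
 fixes E1 :: "('a, 'e, 'g) extension" and E2 :: "('a, 'f, 'g) extension"
 assumes E1: "contraction_extension A G E1" and E2: "contraction_extension A G E2" and G: "group G"
  and f: "contraction_morphism (total_group E1) (total_group E2) f"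
  and fi: "!!a. a : carrier A ==> f (incl E1 a) = incl E2 a" and fp: "!!x. x : carrier (total_group E1) ==> proj E2 (f x) = proj E1 x"
  and A: "group A"
 shows "extension_equivalent A E1 E2"
proof -
 let ?P = "total_group E1" and ?Q = "total_group E2"
 have P: "lc_contraction_group ?P" and Q: "lc_contraction_group ?Q" using E1 E2 by (auto simp: contraction_extension_def)
 interpret P: contraction ?P using P by (simp add: contraction_iff)
 interpret Q: contraction ?Q using Q by (simp add: contraction_iff)
 interpret f: group_hom ?P ?Q f by unfold_locales (use f in \<open>simp add: contraction_morphism_def\<close>)
 interpret q: group_hom ?Q G "proj E2"
  using E2 G by (intro group_hom.intro group_hom_axioms.intro Q.is_group) (auto simp: contraction_extension_def contraction_morphism_def)
 interpret i1: group_hom A ?P "incl E1"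
  using E1 A by (intro group_hom.intro group_hom_axioms.intro P.is_group) (auto simp: contraction_extension_def contraction_morphism_def)
 interpret i2: group_hom A ?Q "incl E2"
  using E2 A by (intro group_hom.intro group_hom_axioms.intro Q.is_group) (auto simp: contraction_extension_def contraction_morphism_def)
 have k1: "incl E1 ` carrier A = kernel ?P G (proj E1)" and k2: "incl E2 ` carrier A = kernel ?Q G (proj E2)"
  and inj2: "inj_on (incl E2) (carrier A)" and s1: "proj E1 ` carrier ?P = carrier G"
  using E1 E2 by (auto simp: contraction_extension_def)
 have "inj_on f (carrier ?P)"
 proof (rule f.inj_on_one_iff[THEN iffD2], intro allI impI)
  fix x assume x: "x : carrier ?P" "f x = \<one>\<^bsub>?Q\<^esub>"
  then have "x : kernel ?P G (proj E1)" using fp[OF x(1)] by (simp add: kernel_def)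
  then obtain a where a: "a : carrier A" "x = incl E1 a" using k1 by blast
  then have "incl E2 a = incl E2 \<one>\<^bsub>A\<^esub>" using fi[OF a(1)] x(2) by simp
  then have "a = \<one>\<^bsub>A\<^esub>" using inj_onD[OF inj2, of a "\<one>\<^bsub>A\<^esub>"] a(1) monoid.one_closed[OF group.is_monoid[OF A]] by simp
  then show "x = \<one>\<^bsub>?P\<^esub>" using a(2) by simp
 qed
 moreover have "f ` carrier ?P = carrier ?Q"
 proof (intro equalityI subsetI)
  fix y assume y: "y : carrier ?Q"
  then have "proj E2 y : proj E1 ` carrier ?P" unfolding s1 by simp
  then obtain x where x: "x : carrier ?P" "proj E2 y = proj E1 x" by blast
  have "y \<otimes>\<^bsub>?Q\<^esub> inv\<^bsub>?Q\<^esub> f x : kernel ?Q G (proj E2)" using y x fp q.hom_closed[OF y] group.r_inv[OF G] by (simp add: kernel_def)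
  then obtain a where a: "a : carrier A" "y \<otimes>\<^bsub>?Q\<^esub> inv\<^bsub>?Q\<^esub> f x = incl E2 a" using k2 by blast
  have "f (incl E1 a \<otimes>\<^bsub>?P\<^esub> x) = y \<otimes>\<^bsub>?Q\<^esub> inv\<^bsub>?Q\<^esub> f x \<otimes>\<^bsub>?Q\<^esub> f x" using a x fi by simp
  also have "... = y" using y x by (simp add: Q.m_assoc)
  finally show "y : f ` carrier ?P" using a(1) x(1) by (metis P.m_closed i1.hom_closed imageI)
 qed auto
 ultimately have "contraction_isomorphism ?P ?Q f" by (intro bij_morphism_isomorphism P Q f) (simp add: bij_betw_def)
 then show ?thesis using fi fp unfolding extension_equivalent_def by blast
qed

section \<open>Twisted products as extensions\<close>

locale abelian_action =
 A: contraction A + A: comm_group A + G: contraction G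
 for A :: "'a dynamical_group" (structure) and G :: "'g dynamical_group" +
 fixes \<gamma> :: "'g => 'a => 'a"
 assumes \<gamma>_hom: "\<gamma> : hom G (TopAutoGroup A)"
  and \<gamma>_cont: "continuous_map (topol G) (braconnier_topology A) \<gamma>"
  and \<gamma>_contr: "ALL g:carrier G. ALL a:carrier A. \<gamma> (contr G g) a = contr A (\<gamma> g (inv_into (carrier A) (contr A) a))"
begin

lemma \<gamma>_auto: "g : carrier G ==> \<gamma> g : top_auto A"
 using \<gamma>_hom by (auto simp: hom_def TopAutoGroup_def)

lemma \<gamma>_props:
 assumes "g : carrier G"
 shows "\<gamma> g : hom A A" "bij_betw (\<gamma> g) (carrier A) (carrier A)" "continuous_map (topol A) (topol A) (\<gamma> g)" "\<gamma> g : Bij (carrier A)"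
 using \<gamma>_auto[OF assms] homeomorphic_imp_continuous_map by (auto simp: top_auto_def auto_def Bij_def)

lemma \<gamma>_closed [simp, intro]: "g : carrier G ==> a : carrier A ==> \<gamma> g a : carrier A"
 using hom_in_carrier[OF \<gamma>_props(1)] .

lemma \<gamma>_mult: "g : carrier G ==> a : carrier A ==> b : carrier A ==> \<gamma> g (a \<otimes> b) = \<gamma> g a \<otimes> \<gamma> g b"
 using hom_mult[OF \<gamma>_props(1)] .

lemma \<gamma>_inv: assumes "g : carrier G" "a : carrier A" shows "\<gamma> g (inv a) = inv \<gamma> g a"
proof -
 interpret group_hom A A "\<gamma> g" by unfold_locales (rule \<gamma>_props(1)[OF assms(1)])
 show ?thesis using hom_inv[OF assms(2)] .
qed

lemma \<gamma>_one_right [simp]: assumes "g : carrier G" shows "\<gamma> g \<one> = \<one>"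
proof -
 interpret group_hom A A "\<gamma> g" by unfold_locales (rule \<gamma>_props(1)[OF assms(1)])
 show ?thesis using hom_one .
qed

lemma \<gamma>_comp: assumes "g : carrier G" "h : carrier G" "a : carrier A" shows "\<gamma> (g \<otimes>\<^bsub>G\<^esub> h) a = \<gamma> g (\<gamma> h a)"
proof -
 have "\<gamma> (g \<otimes>\<^bsub>G\<^esub> h) = compose (carrier A) (\<gamma> g) (\<gamma> h)"
  using hom_mult[OF \<gamma>_hom assms(1,2)] \<gamma>_props(4)[OF assms(1)] \<gamma>_props(4)[OF assms(2)] by (simp add: TopAutoGroup_def BijGroup_def)
 then show ?thesis using assms(3) by (simp add: compose_def)
qed

lemma \<gamma>_one [simp]: assumes "a : carrier A" shows "\<gamma> \<one>\<^bsub>G\<^esub> a = a"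
proof -
 have "\<gamma> \<one>\<^bsub>G\<^esub> (\<gamma> \<one>\<^bsub>G\<^esub> a) = \<gamma> \<one>\<^bsub>G\<^esub> a" using \<gamma>_comp[of "\<one>\<^bsub>G\<^esub>" "\<one>\<^bsub>G\<^esub>" a] assms by simp
 then show ?thesis using inj_onD[OF bij_betw_imp_inj_on[OF \<gamma>_props(2)[OF G.one_closed]]] assms by blast
qed

lemma \<gamma>_equivariant: "g : carrier G ==> a : carrier A ==> \<gamma> (contr G g) (contr A a) = contr A (\<gamma> g a)"
 using \<gamma>_contr by simp

lemma action_continuous:
 "continuous_map (prod_topology (topol G) (topol A)) (topol A) (%z. \<gamma> (fst z) (snd z))"
proof (rule continuous_mapI_local)
 fix z U assume z': "z : topspace (prod_topology (topol G) (topol A))" and U: "openin (topol A) U" "\<gamma> (fst z) (snd z) : U"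
 have z: "fst z : carrier G" "snd z : carrier A" using z' by (auto simp: mem_Times_iff)
 have "openin (topol A) {a : topspace (topol A). \<gamma> (fst z) a : U}" by (rule A.open_preimage[OF \<gamma>_props(3)[OF z(1)] U(1)])
 then obtain V K where V: "openin (topol A) V" "compactin (topol A) K" "{snd z} <= V" "V <= K" "K <= {a : topspace (topol A). \<gamma> (fst z) a : U}"
  using A.compact_nbhd_of[of "{snd z}" "{a : topspace (topol A). \<gamma> (fst z) a : U}"] z(2) U(2) by auto
 \<comment> \<open>With empty \<open>K2\<close> and \<open>U2\<close> the condition on inverses is
   void, so this subbasic set constrains only the images of \<open>K\<close>.\<close>
 let ?B = "{\<beta> : top_auto A. \<beta> ` K <= U & inv_into (carrier A) \<beta> ` {} <= {}}"
 have "openin (braconnier_topology A) ?B" unfolding braconnier_topology_def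
  by (rule topology_generated_by_Basis) (use V(2) U(1) in \<open>blast intro: compactin_empty openin_empty\<close>)
 then have "openin (topol G) {g : topspace (topol G). \<gamma> g : ?B}" by (rule openin_continuous_map_preimage[OF \<gamma>_cont])
 then have "openin (prod_topology (topol G) (topol A)) ({g : topspace (topol G). \<gamma> g : ?B} \<times> V)" using V(1) by (simp add: openin_prod_Times_iff)
 moreover have "z : {g : topspace (topol G). \<gamma> g : ?B} \<times> V" using z V(3,5) \<gamma>_auto by (auto simp: mem_Times_iff)
 moreover have "\<gamma> (fst y) (snd y) : U" if y: "y : {g : topspace (topol G). \<gamma> g : ?B} \<times> V" for y
 proof -
  have "snd y : K" "\<gamma> (fst y) ` K <= U" using y V(4) by auto
  then show ?thesis by blast
 qed
 ultimately show "EX V. openin (prod_topology (topol G) (topol A)) V & z : V & (ALL y:V. \<gamma> (fst y) (snd y) : U)"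
  by (intro exI[of _ "{g : topspace (topol G). \<gamma> g : ?B} \<times> V"] conjI ballI)
qed auto

lemma continuous_action:
 assumes "continuous_map Z (topol G) f" "continuous_map Z (topol A) k"
 shows "continuous_map Z (topol A) (%z. \<gamma> (f z) (k z))"
proof -
 have "continuous_map Z (prod_topology (topol G) (topol A)) (%z. (f z, k z))" using assms by (simp add: continuous_map_pairwise o_def)
 from continuous_map_compose[OF this action_continuous] show ?thesis by (simp add: o_def)
qed

abbreviation "Z2 \<equiv> Z2_eq G A \<gamma>"
abbreviation "cls \<equiv> H2_class G A \<gamma>"
abbreviation "tp \<equiv> twisted_product A G \<gamma>"
abbreviation "Ext \<equiv> extensions_inducing A G \<gamma>"
abbreviation "Rel \<equiv> extension_rel A G \<gamma>"

text \<open>The cocycle identity is rearranged without inverses, the form in which associativity of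
  the twisted product uses it.\<close>

lemma Z2_carrier:
 "\<omega> : carrier Z2 \<longleftrightarrow> \<omega> : extensional (carrier G \<times> carrier G) & continuous_map (prod_topology (topol G) (topol G)) (topol A) \<omega> &
  (ALL g1:carrier G. ALL g2:carrier G. ALL g3:carrier G. \<gamma> g1 (\<omega> (g2, g3)) \<otimes> \<omega> (g1, g2 \<otimes>\<^bsub>G\<^esub> g3) = \<omega> (g1, g2) \<otimes> \<omega> (g1 \<otimes>\<^bsub>G\<^esub> g2, g3)) &
  (ALL g1:carrier G. ALL g2:carrier G. \<omega> (contr G g1, contr G g2) = contr A (\<omega> (g1, g2)))"
proof -
 have key: "x \<otimes> inv y \<otimes> z \<otimes> inv w = \<one> \<longleftrightarrow> x \<otimes> z = w \<otimes> y"
  if G: "x : carrier A" "y : carrier A" "z : carrier A" "w : carrier A" for x y z w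
 proof -
  have "x \<otimes> inv y \<otimes> z \<otimes> inv w = (x \<otimes> z) \<otimes> inv (w \<otimes> y)"
   using G by (simp add: A.inv_mult A.m_ac)
  moreover have "(x \<otimes> z) \<otimes> inv (w \<otimes> y) = \<one> \<longleftrightarrow> x \<otimes> z = w \<otimes> y"
   using G by (metis A.inv_equality A.inv_inv A.inv_closed A.m_closed A.r_inv)
  ultimately show ?thesis by simp
 qed
 have cl: "\<omega> (g1, g2) : carrier A" if "continuous_map (prod_topology (topol G) (topol G)) (topol A) \<omega>" "g1 : carrier G" "g2 : carrier G" for g1 g2
  using continuous_map_image_subset_topspace[OF that(1)] that(2,3) by auto
 show ?thesis unfolding Z2_eq_def
  by (simp, intro conj_cong refl ball_cong) (rule key; simp add: cl)
qed

lemma Z2_closed: "\<omega> : carrier Z2 ==> g : carrier G ==> h : carrier G ==> \<omega> (g, h) : carrier A"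
 using continuous_map_image_subset_topspace[of "prod_topology (topol G) (topol G)" "topol A" \<omega>] by (auto simp: Z2_carrier)

lemma Z2_cocycle: "\<omega> : carrier Z2 ==> g1 : carrier G ==> g2 : carrier G ==> g3 : carrier G ==>
  \<gamma> g1 (\<omega> (g2, g3)) \<otimes> \<omega> (g1, g2 \<otimes>\<^bsub>G\<^esub> g3) = \<omega> (g1, g2) \<otimes> \<omega> (g1 \<otimes>\<^bsub>G\<^esub> g2, g3)"
 by (simp add: Z2_carrier)

lemma Z2_contr: "\<omega> : carrier Z2 ==> g1 : carrier G ==> g2 : carrier G ==> \<omega> (contr G g1, contr G g2) = contr A (\<omega> (g1, g2))"
 by (simp add: Z2_carrier)

lemma Z2_cont:
 assumes "\<omega> : carrier Z2" "continuous_map Z (topol G) f" "continuous_map Z (topol G) k"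
 shows "continuous_map Z (topol A) (%z. \<omega> (f z, k z))"
proof -
 have "continuous_map Z (prod_topology (topol G) (topol G)) (%z. (f z, k z))" using assms by (simp add: continuous_map_pairwise o_def)
 from continuous_map_compose[OF this, of "topol A" \<omega>] show ?thesis using assms(1) by (simp add: Z2_carrier o_def)
qed

text \<open>Equivariance normalizes cocycles: the value at the pair of identities is a fixed point
  of the contraction, hence trivial, and the cocycle identity spreads this to both axes.\<close>

lemma Z2_one:
 assumes w: "\<omega> : carrier Z2" and g: "g : carrier G"
 shows "\<omega> (\<one>\<^bsub>G\<^esub>, g) = \<one>" "\<omega> (g, \<one>\<^bsub>G\<^esub>) = \<one>"
proof -
 have 1: "\<omega> (\<one>\<^bsub>G\<^esub>, \<one>\<^bsub>G\<^esub>) = \<one>"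
  by (rule A.contr_fixed) (use Z2_closed[OF w] Z2_contr[OF w, of "\<one>\<^bsub>G\<^esub>" "\<one>\<^bsub>G\<^esub>"] in auto)
 have "\<omega> (\<one>\<^bsub>G\<^esub>, g) \<otimes> \<omega> (\<one>\<^bsub>G\<^esub>, g) = \<one> \<otimes> \<omega> (\<one>\<^bsub>G\<^esub>, g)" using Z2_cocycle[OF w, of "\<one>\<^bsub>G\<^esub>" "\<one>\<^bsub>G\<^esub>" g] g 1 Z2_closed[OF w] by simp
 then show "\<omega> (\<one>\<^bsub>G\<^esub>, g) = \<one>" using Z2_closed[OF w G.one_closed g] by (metis A.one_closed A.right_cancel)
 have "\<one> \<otimes> \<omega> (g, \<one>\<^bsub>G\<^esub>) = \<omega> (g, \<one>\<^bsub>G\<^esub>) \<otimes> \<omega> (g, \<one>\<^bsub>G\<^esub>)" using Z2_cocycle[OF w, of g "\<one>\<^bsub>G\<^esub>" "\<one>\<^bsub>G\<^esub>"] g 1 by simp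
 then show "\<omega> (g, \<one>\<^bsub>G\<^esub>) = \<one>" using Z2_closed[OF w g G.one_closed] by (metis A.one_closed A.right_cancel)
qed

lemma twisted_simps [simp]:
 "carrier (tp \<omega>) = carrier A \<times> carrier G"
 "(a, g) \<otimes>\<^bsub>tp \<omega>\<^esub> (b, h) = (a \<otimes> \<gamma> g b \<otimes> \<omega> (g, h), g \<otimes>\<^bsub>G\<^esub> h)"
 "\<one>\<^bsub>tp \<omega>\<^esub> = (\<one>, \<one>\<^bsub>G\<^esub>)"
 "topol (tp \<omega>) = prod_topology (topol A) (topol G)"
 "contr (tp \<omega>) = map_prod (contr A) (contr G)"
 by (auto simp: twisted_product_def)

lemma twisted_group:
 assumes w: "\<omega> : carrier Z2" shows "group (tp \<omega>)"
proof (rule groupI)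
 let ?E = "tp \<omega>"
 note cl = Z2_closed[OF w]
 show "x \<otimes>\<^bsub>?E\<^esub> y : carrier ?E" if "x : carrier ?E" "y : carrier ?E" for x y using that cl by (cases x; cases y) auto
 show "\<one>\<^bsub>?E\<^esub> : carrier ?E" by simp
 show "\<one>\<^bsub>?E\<^esub> \<otimes>\<^bsub>?E\<^esub> x = x" if "x : carrier ?E" for x using that Z2_one[OF w] by (cases x) auto
 show "x \<otimes>\<^bsub>?E\<^esub> y \<otimes>\<^bsub>?E\<^esub> z = x \<otimes>\<^bsub>?E\<^esub> (y \<otimes>\<^bsub>?E\<^esub> z)" if xyz: "x : carrier ?E" "y : carrier ?E" "z : carrier ?E" for x y z
 proof -
  obtain a g b h c k where e: "x = (a, g)" "y = (b, h)" "z = (c, k)" by (cases x; cases y; cases z) blast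
  have m: "a : carrier A" "b : carrier A" "c : carrier A" "g : carrier G" "h : carrier G" "k : carrier G" using xyz e by auto
  have "a \<otimes> \<gamma> g b \<otimes> \<omega> (g, h) \<otimes> \<gamma> (g \<otimes>\<^bsub>G\<^esub> h) c \<otimes> \<omega> (g \<otimes>\<^bsub>G\<^esub> h, k)
    = a \<otimes> \<gamma> g b \<otimes> \<gamma> g (\<gamma> h c) \<otimes> (\<omega> (g, h) \<otimes> \<omega> (g \<otimes>\<^bsub>G\<^esub> h, k))"
   using m cl by (simp add: \<gamma>_comp A.m_ac)
  also have "... = a \<otimes> \<gamma> g b \<otimes> \<gamma> g (\<gamma> h c) \<otimes> (\<gamma> g (\<omega> (h, k)) \<otimes> \<omega> (g, h \<otimes>\<^bsub>G\<^esub> k))"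
   using Z2_cocycle[OF w m(4,5,6)] by simp
  also have "... = a \<otimes> \<gamma> g (b \<otimes> \<gamma> h c \<otimes> \<omega> (h, k)) \<otimes> \<omega> (g, h \<otimes>\<^bsub>G\<^esub> k)"
   using m cl by (simp add: \<gamma>_mult A.m_assoc)
  finally show ?thesis using m e by (simp add: G.m_assoc)
 qed
 show "EX y:carrier ?E. y \<otimes>\<^bsub>?E\<^esub> x = \<one>\<^bsub>?E\<^esub>" if "x : carrier ?E" for x
 proof -
  obtain a g where e: "x = (a, g)" "a : carrier A" "g : carrier G" using \<open>x : carrier ?E\<close> by (cases x) auto
  let ?c = "\<gamma> (inv\<^bsub>G\<^esub> g) a \<otimes> \<omega> (inv\<^bsub>G\<^esub> g, g)"
  have c: "?c : carrier A" using e cl by auto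
  have "inv ?c \<otimes> \<gamma> (inv\<^bsub>G\<^esub> g) a \<otimes> \<omega> (inv\<^bsub>G\<^esub> g, g) = inv ?c \<otimes> ?c" using e cl by (intro A.m_assoc) auto
  then have "(inv ?c, inv\<^bsub>G\<^esub> g) \<otimes>\<^bsub>?E\<^esub> x = \<one>\<^bsub>?E\<^esub>" using c e by (simp add: A.l_inv)
  then show ?thesis using c e by (intro bexI[of _ "(inv ?c, inv\<^bsub>G\<^esub> g)"]) auto
 qed
qed

lemma twisted_inv:
 assumes w: "\<omega> : carrier Z2" and a: "a : carrier A" and g: "g : carrier G"
 shows "inv\<^bsub>tp \<omega>\<^esub> (a, g) = (inv (\<gamma> (inv\<^bsub>G\<^esub> g) a \<otimes> \<omega> (inv\<^bsub>G\<^esub> g, g)), inv\<^bsub>G\<^esub> g)"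
proof -
 let ?E = "tp \<omega>" and ?c = "\<gamma> (inv\<^bsub>G\<^esub> g) a \<otimes> \<omega> (inv\<^bsub>G\<^esub> g, g)"
 note cl = Z2_closed[OF w]
 have c: "?c : carrier A" using a g cl by auto
 have "inv ?c \<otimes> \<gamma> (inv\<^bsub>G\<^esub> g) a \<otimes> \<omega> (inv\<^bsub>G\<^esub> g, g) = inv ?c \<otimes> ?c" using a g cl by (intro A.m_assoc) auto
 then have "(inv ?c, inv\<^bsub>G\<^esub> g) \<otimes>\<^bsub>?E\<^esub> (a, g) = \<one>\<^bsub>?E\<^esub>" using c g by (simp add: A.l_inv)
 then show ?thesis by (rule group.inv_equality[OF twisted_group[OF w]]) (use a g c in auto)
qed

lemma twisted_contraction:
 assumes w: "\<omega> : carrier Z2" shows "lc_contraction_group (tp \<omega>)"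
proof -
 let ?E = "tp \<omega>" and ?X = "prod_topology (topol A) (topol G)"
 note cl = Z2_closed[OF w]
 have fs: "continuous_map ?X (topol A) fst" "continuous_map ?X (topol G) snd" by (rule continuous_map_fst continuous_map_snd)+
 have top: "topological_group ?E" unfolding topological_group_def
 proof (intro conjI)
  let ?Y = "prod_topology ?X ?X"
  have p: "continuous_map ?Y (topol A) (%z. fst (fst z))" "continuous_map ?Y (topol G) (%z. snd (fst z))"
   "continuous_map ?Y (topol A) (%z. fst (snd z))" "continuous_map ?Y (topol G) (%z. snd (snd z))"
   using continuous_map_compose[OF continuous_map_fst fs(1), of ?X] continuous_map_compose[OF continuous_map_fst fs(2), of ?X]
    continuous_map_compose[OF continuous_map_snd fs(1), of ?X] continuous_map_compose[OF continuous_map_snd fs(2), of ?X] by (simp_all add: o_def)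
  have "continuous_map ?Y ?X (%z. (fst (fst z) \<otimes> \<gamma> (snd (fst z)) (fst (snd z)) \<otimes> \<omega> (snd (fst z), snd (snd z)), snd (fst z) \<otimes>\<^bsub>G\<^esub> snd (snd z)))"
   by (simp add: continuous_map_pairwise o_def A.continuous_mult G.continuous_mult continuous_action Z2_cont[OF w] p)
  then show "continuous_map (prod_topology (topol ?E) (topol ?E)) (topol ?E) (%(x, y). x \<otimes>\<^bsub>?E\<^esub> y)"
   unfolding twisted_simps by (rule continuous_map_eq) auto
  have "continuous_map ?X ?X (%z. (inv (\<gamma> (inv\<^bsub>G\<^esub> snd z) (fst z) \<otimes> \<omega> (inv\<^bsub>G\<^esub> snd z, snd z)), inv\<^bsub>G\<^esub> snd z))"
   using fs by (simp add: continuous_map_pairwise o_def A.continuous_mult A.continuous_inv G.continuous_inv continuous_action Z2_cont[OF w])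
  then show "continuous_map (topol ?E) (topol ?E) (%x. inv\<^bsub>?E\<^esub> x)"
   unfolding twisted_simps by (rule continuous_map_eq) (use twisted_inv[OF w] in auto)
 qed (use twisted_group[OF w] in auto)
 have haus: "Hausdorff_space (topol ?E)" using A.haus G.haus by (simp add: Hausdorff_space_prod_topology)
 have lc: "locally_compact_space (topol ?E)" using A.loccomp G.loccomp by (simp add: locally_compact_space_prod_topology)
 have "map_prod (contr A) (contr G) : hom ?E ?E"
 proof (rule homI)
  fix x y assume "x : carrier ?E" "y : carrier ?E"
  then show "map_prod (contr A) (contr G) (x \<otimes>\<^bsub>?E\<^esub> y) = map_prod (contr A) (contr G) x \<otimes>\<^bsub>?E\<^esub> map_prod (contr A) (contr G) y"
   using cl by (cases x; cases y) (simp add: A.contr_mult G.contr_mult \<gamma>_equivariant Z2_contr[OF w])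
 qed auto
 moreover have "bij_betw (map_prod (contr A) (contr G)) (carrier ?E) (carrier ?E)"
  unfolding twisted_simps by (rule bij_betw_map_prod[OF A.contr_bij G.contr_bij])
 ultimately have iso: "contr ?E : iso ?E ?E" by (simp add: iso_def)
 have homeo: "homeomorphic_map (topol ?E) (topol ?E) (contr ?E)"
 proof -
  obtain g where g: "homeomorphic_maps (topol A) (topol A) (contr A) g" using A.contr_homeo homeomorphic_map_maps by blast
  obtain k where k: "homeomorphic_maps (topol G) (topol G) (contr G) k" using G.contr_homeo homeomorphic_map_maps by blast
  have "homeomorphic_maps ?X ?X (%(x, y). (contr A x, contr G y)) (%(x, y). (g x, k y))"
   using g k by (simp add: homeomorphic_maps_prod)
  moreover have "(%(x, y). (contr A x, contr G y)) = map_prod (contr A) (contr G)" by auto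
  ultimately show ?thesis using homeomorphic_map_maps by fastforce
 qed
 have "limitin (topol ?E) (%n. (contr ?E ^^ n) x) \<one>\<^bsub>?E\<^esub> sequentially" if x: "x : carrier ?E" for x
 proof -
  obtain a g where e: "x = (a, g)" "a : carrier A" "g : carrier G" using x by (cases x) auto
  have "(map_prod (contr A) (contr G) ^^ n) (a, g) = ((contr A ^^ n) a, (contr G ^^ n) g)" for n by (induction n) auto
  then show ?thesis using A.contr_lim[OF e(2)] G.contr_lim[OF e(3)] e(1) by (simp add: limitin_pairwise o_def)
 qed
 then show ?thesis using top haus lc iso homeo unfolding lc_contraction_group_def by blast
qed

abbreviation "tw \<equiv> twisted_extension A G \<gamma>"

lemma tw_simps [simp]: "total_group (tw \<omega>) = tp \<omega>" "incl (tw \<omega>) = (%a. (a, \<one>\<^bsub>G\<^esub>))" "proj (tw \<omega>) = snd"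
 by (simp_all add: twisted_extension_def)

lemma tw_extension:
 assumes w: "\<omega> : carrier Z2" shows "tw \<omega> : Ext"
proof -
 let ?E = "tp \<omega>"
 interpret E: group ?E by (rule twisted_group[OF w])
 note cl = Z2_closed[OF w]
 have i: "contraction_morphism A ?E (%a. (a, \<one>\<^bsub>G\<^esub>))"
  using Z2_one[OF w] by (auto simp: contraction_morphism_def hom_def continuous_map_pairwise o_def)
 have q: "contraction_morphism ?E G snd" by (auto simp: contraction_morphism_def hom_def continuous_map_snd)
 have ker: "(%a. (a, \<one>\<^bsub>G\<^esub>)) ` carrier A = kernel ?E G snd" by (auto simp: kernel_def)
 have "snd ` carrier ?E = carrier G" using A.one_closed by force
 then have ext: "contraction_extension A G (tw \<omega>)"
  unfolding contraction_extension_def tw_simps using twisted_contraction[OF w] i q ker by (auto intro: inj_onI)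
 have "(\<gamma> (snd x) a, \<one>\<^bsub>G\<^esub>) = x \<otimes>\<^bsub>?E\<^esub> (a, \<one>\<^bsub>G\<^esub>) \<otimes>\<^bsub>?E\<^esub> inv\<^bsub>?E\<^esub> x" if a: "a : carrier A" and x: "x : carrier ?E" for a x
 proof -
  obtain b g where e: "x = (b, g)" "b : carrier A" "g : carrier G" using x by (cases x) auto
  have "(\<gamma> (snd x) a, \<one>\<^bsub>G\<^esub>) \<otimes>\<^bsub>?E\<^esub> x = x \<otimes>\<^bsub>?E\<^esub> (a, \<one>\<^bsub>G\<^esub>)" using e a Z2_one[OF w] by (simp add: A.m_comm)
  moreover have "(\<gamma> (snd x) a, \<one>\<^bsub>G\<^esub>) : carrier ?E" "(a, \<one>\<^bsub>G\<^esub>) : carrier ?E" using e a by auto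
  ultimately show ?thesis using x by (metis E.inv_solve_right E.m_closed)
 qed
 then show ?thesis using ext by (simp add: extensions_inducing_def induces_def)
qed

end

section \<open>Sections, cocycles and the classification\<close>

context abelian_action begin

definition is_section :: "('a, 'e, 'g) extension => ('g => 'e) => bool" where
 "is_section E s \<longleftrightarrow> continuous_map (topol G) (topol (total_group E)) s &
  (ALL g:carrier G. s g : carrier (total_group E) & proj E (s g) = g & s (contr G g) = contr (total_group E) (s g))"

lemma section_exists:
 fixes E :: "('a, 'e, 'g) extension"
 assumes E: "contraction_extension A G E" shows "EX s. is_section E s"
proof -
 have P: "lc_contraction_group (total_group E)" and G: "lc_contraction_group G" and q: "contraction_morphism (total_group E) G (proj E)"
  and ker: "incl E ` carrier A = kernel (total_group E) G (proj E)" and surj: "proj E ` carrier (total_group E) = carrier G"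
  and i: "incl E : hom A (total_group E)"
  using E G.contraction_axioms by (auto simp: contraction_extension_def contraction_morphism_def contraction_iff)
 show ?thesis
 proof (rule equivariant_section[OF P G q surj])
  fix a b assume "a : kernel (total_group E) G (proj E)" "b : kernel (total_group E) G (proj E)"
  then obtain c d where cd: "c : carrier A" "d : carrier A" "a = incl E c" "b = incl E d" unfolding ker[symmetric] by blast
  then show "a \<otimes>\<^bsub>total_group E\<^esub> b = b \<otimes>\<^bsub>total_group E\<^esub> a"
   using hom_mult[OF i cd(1,2)] hom_mult[OF i cd(2,1)] A.m_comm[OF cd(1,2)] by simp
 qed (auto simp: is_section_def)
qed

text \<open>\<open>incl E\<close> is a bijective morphism onto the kernel of \<open>proj E\<close>,
  a closed invariant subgroup and so itself a contraction group. It is therefore a homeomorphism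
  onto its image, and continuity may be tested after applying it.\<close>

lemma incl_inverse_continuous:
 fixes E :: "('a, 'e, 'g) extension"
 assumes E: "contraction_extension A G E"
  and f: "continuous_map X (topol (total_group E)) (%z. incl E (w z))" "!!z. z : topspace X ==> w z : carrier A"
 shows "continuous_map X (topol A) w"
proof -
 let ?P = "total_group E" and ?N = "incl E ` carrier A"
 have P: "lc_contraction_group ?P" and i: "contraction_morphism A ?P (incl E)" and q: "contraction_morphism ?P G (proj E)"
  and inj: "inj_on (incl E) (carrier A)" and ker: "?N = kernel ?P G (proj E)"
  using E by (auto simp: contraction_extension_def)
 interpret P: contraction ?P using P by (simp add: contraction_iff)
 interpret q: group_hom ?P G "proj E" by unfold_locales (use q in \<open>simp add: contraction_morphism_def\<close>)
 have ik: "contr ?P (incl E a) = incl E (contr A a)" if "a : carrier A" for a using i that by (simp add: contraction_morphism_def)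
 have sN: "subgroup ?N ?P" unfolding ker by (rule q.subgroup_kernel)
 have cN: "closedin (topol ?P) ?N"
 proof -
  have "closedin (topol G) {\<one>\<^bsub>G\<^esub>}" by (rule G.compact_closed) simp
  moreover have "continuous_map (topol ?P) (topol G) (proj E)" using q by (simp add: contraction_morphism_def)
  ultimately have "closedin (topol ?P) {x : topspace (topol ?P). proj E x : {\<one>\<^bsub>G\<^esub>}}" using closedin_continuous_map_preimage by blast
  then show ?thesis unfolding ker by (simp add: kernel_def)
 qed
 have "contr ?P ` ?N = incl E ` contr A ` carrier A" using ik by (force simp: image_image)
 then have kN: "contr ?P ` ?N = ?N" using A.contr_bij by (simp add: bij_betw_def)
 have Nlc: "lc_contraction_group (sub ?P ?N)" using P.sub_contraction[OF sN cN kN] by (simp add: contraction_iff)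
 have iN: "contraction_morphism A (sub ?P ?N) (incl E)"
  using i by (auto simp: contraction_morphism_def hom_def continuous_map_in_subtopology)
 have "contraction_isomorphism A (sub ?P ?N) (incl E)"
  by (rule bij_morphism_isomorphism[OF _ Nlc iN]) (use inj A.contraction_axioms in \<open>simp_all add: bij_betw_def contraction_iff\<close>)
 then obtain j where j: "contraction_morphism (sub ?P ?N) A j" "group_isomorphisms A (sub ?P ?N) (incl E) j"
  unfolding contraction_isomorphism_def by blast
 have "continuous_map X (subtopology (topol ?P) ?N) (%z. incl E (w z))" using f by (auto simp: continuous_map_in_subtopology)
 moreover have "continuous_map (subtopology (topol ?P) ?N) (topol A) j" using j(1) by (simp add: contraction_morphism_def)
 ultimately have "continuous_map X (topol A) (j \<circ> (%z. incl E (w z)))" by (rule continuous_map_compose)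
 then show ?thesis by (rule continuous_map_eq) (use f(2) j(2) in \<open>simp add: group_isomorphisms_def\<close>)
qed

text \<open>The failure of an equivariant section to be multiplicative is a cocycle, by
  associativity in the total group, and \<open>(a, g)\<close> corresponds to \<open>incl E a\<close>
  times \<open>s g\<close>. The cocycle is characterized by its equation and not constructed, so the
  lemma serves both for an arbitrary extension and for comparing two given cocycles.\<close>

lemma section_cocycle:
 fixes E :: "('a, 'e, 'g) extension"
 assumes E: "E : Ext" and s: "is_section E s"
  and w: "\<omega> : extensional (carrier G \<times> carrier G)" "!!g h. g : carrier G ==> h : carrier G ==> \<omega> (g, h) : carrier A"
   "!!g h. g : carrier G ==> h : carrier G ==> incl E (\<omega> (g, h)) \<otimes>\<^bsub>total_group E\<^esub> s (g \<otimes>\<^bsub>G\<^esub> h) = s g \<otimes>\<^bsub>total_group E\<^esub> s h"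
 shows "\<omega> : carrier Z2 & extension_equivalent A (tw \<omega>) E"
proof -
 let ?P = "total_group E" and ?i = "incl E"
 have ext: "contraction_extension A G E" and ind: "induces A E \<gamma>" using E by (auto simp: extensions_inducing_def)
 have P: "lc_contraction_group ?P" and i: "contraction_morphism A ?P ?i" and q: "contraction_morphism ?P G (proj E)"
  and inj: "inj_on ?i (carrier A)" and ker: "?i ` carrier A = kernel ?P G (proj E)"
  using ext by (auto simp: contraction_extension_def)
 interpret P: contraction ?P using P by (simp add: contraction_iff)
 interpret i: group_hom A ?P ?i by unfold_locales (use i in \<open>simp add: contraction_morphism_def\<close>)
 interpret q: group_hom ?P G "proj E" by unfold_locales (use q in \<open>simp add: contraction_morphism_def\<close>)
 have ic: "continuous_map (topol A) (topol ?P) ?i" and ik: "!!a. a : carrier A ==> contr ?P (?i a) = ?i (contr A a)"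
  using i by (auto simp: contraction_morphism_def)
 have sc: "continuous_map (topol G) (topol ?P) s" and sG: "!!g. g : carrier G ==> s g : carrier ?P" and qs: "!!g. g : carrier G ==> proj E (s g) = g"
  and sk: "!!g. g : carrier G ==> s (contr G g) = contr ?P (s g)" using s by (auto simp: is_section_def)
 have s1: "s \<one>\<^bsub>G\<^esub> = \<one>\<^bsub>?P\<^esub>" by (rule P.contr_fixed) (use sG sk[of "\<one>\<^bsub>G\<^esub>"] in auto)
 have iw: "?i (\<omega> (g, h)) = s g \<otimes>\<^bsub>?P\<^esub> s h \<otimes>\<^bsub>?P\<^esub> inv\<^bsub>?P\<^esub> s (g \<otimes>\<^bsub>G\<^esub> h)" if "g : carrier G" "h : carrier G" for g h
  using w(3)[OF that] w(2)[OF that] sG that by (simp add: P.inv_solve_right)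
 have ieq: "a = b" if "?i a = ?i b" "a : carrier A" "b : carrier A" for a b using inj_onD[OF inj that] .
 have conj: "?i (\<gamma> g a) = s g \<otimes>\<^bsub>?P\<^esub> ?i a \<otimes>\<^bsub>?P\<^esub> inv\<^bsub>?P\<^esub> s g" if "g : carrier G" "a : carrier A" for g a
  using ind that sG qs unfolding induces_def by metis
 have Z: "\<omega> : carrier Z2" unfolding Z2_carrier
 proof (intro conjI ballI w(1))
  let ?X = "prod_topology (topol G) (topol G)"
  have fs: "continuous_map ?X (topol G) fst" "continuous_map ?X (topol G) snd" by (rule continuous_map_fst continuous_map_snd)+
  have c: "continuous_map ?X (topol ?P) (%z. s (fst z))" "continuous_map ?X (topol ?P) (%z. s (snd z))" "continuous_map ?X (topol ?P) (%z. s (fst z \<otimes>\<^bsub>G\<^esub> snd z))"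
   using continuous_map_compose[OF fs(1) sc] continuous_map_compose[OF fs(2) sc] continuous_map_compose[OF G.continuous_mult[OF fs] sc] by (simp_all add: o_def)
  have "continuous_map ?X (topol ?P) (%z. s (fst z) \<otimes>\<^bsub>?P\<^esub> s (snd z) \<otimes>\<^bsub>?P\<^esub> inv\<^bsub>?P\<^esub> s (fst z \<otimes>\<^bsub>G\<^esub> snd z))"
   by (intro P.continuous_mult P.continuous_inv c)
  then have "continuous_map ?X (topol ?P) (%z. ?i (\<omega> z))" by (rule continuous_map_eq) (use iw in auto)
  then show "continuous_map ?X (topol A) \<omega>" by (rule incl_inverse_continuous[OF ext]) (use w(2) in auto)
 next
  fix g1 g2 g3 assume g: "g1 : carrier G" "g2 : carrier G" "g3 : carrier G"
  then have gg: "g1 \<otimes>\<^bsub>G\<^esub> g2 : carrier G" "g2 \<otimes>\<^bsub>G\<^esub> g3 : carrier G" by auto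
  show "\<gamma> g1 (\<omega> (g2, g3)) \<otimes> \<omega> (g1, g2 \<otimes>\<^bsub>G\<^esub> g3) = \<omega> (g1, g2) \<otimes> \<omega> (g1 \<otimes>\<^bsub>G\<^esub> g2, g3)"
   by (rule ieq) (use g gg w(2) sG in \<open>simp_all add: conj iw P.m_assoc G.m_assoc\<close>)
 next
  fix g h assume g: "g : carrier G" "h : carrier G"
  show "\<omega> (contr G g, contr G h) = contr A (\<omega> (g, h))"
   by (rule ieq) (use g w(2) sG in \<open>simp_all add: iw ik[symmetric] sk[symmetric] P.contr_mult P.act_inv[of _ 1, unfolded P.act_1] G.contr_mult\<close>)
 qed
 let ?f = "%z. ?i (fst z) \<otimes>\<^bsub>?P\<^esub> s (snd z)"
 have "contraction_morphism (tp \<omega>) ?P ?f" unfolding contraction_morphism_def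
 proof (intro conjI ballI)
  show "?f : hom (tp \<omega>) ?P"
  proof (rule homI)
   fix x y assume x: "x : carrier (tp \<omega>)" and y: "y : carrier (tp \<omega>)"
   then show "?f (x \<otimes>\<^bsub>tp \<omega>\<^esub> y) = ?f x \<otimes>\<^bsub>?P\<^esub> ?f y"
    using w(2) sG by (cases x; cases y) (simp add: conj iw P.m_assoc)
  qed (use sG in auto)
  have "continuous_map (prod_topology (topol A) (topol G)) (topol ?P) (%z. ?i (fst z))" "continuous_map (prod_topology (topol A) (topol G)) (topol ?P) (%z. s (snd z))"
   using continuous_map_compose[OF continuous_map_fst ic] continuous_map_compose[OF continuous_map_snd sc] by (simp_all add: o_def)
  then show "continuous_map (topol (tp \<omega>)) (topol ?P) ?f" by (simp add: P.continuous_mult)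
  fix x assume "x : carrier (tp \<omega>)"
  then show "contr ?P (?f x) = ?f (contr (tp \<omega>) x)" using sG sk ik by (cases x) (simp add: P.contr_mult)
 qed
 then have "extension_equivalent A (tw \<omega>) E"
 proof (intro short_five[where f = ?f and G = G])
  show "contraction_extension A G (tw \<omega>)" using tw_extension[OF Z] by (simp add: extensions_inducing_def)
  show "?f (incl (tw \<omega>) a) = incl E a" if "a : carrier A" for a using that s1 by simp
  have "proj E (?i a) = \<one>\<^bsub>G\<^esub>" if "a : carrier A" for a using that ker by (auto simp: kernel_def)
  then show "proj E (?f x) = proj (tw \<omega>) x" if "x : carrier (total_group (tw \<omega>))" for x using that sG qs by (cases x) simp
 qed (use ext in simp_all)
 then show ?thesis using Z by blast
qed

lemma extension_cocycle:
 fixes E :: "('a, 'e, 'g) extension"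
 assumes E: "E : Ext"
 shows "EX \<omega>:carrier Z2. extension_equivalent A (tw \<omega>) E"
proof -
 let ?P = "total_group E"
 have ext: "contraction_extension A G E" using E by (simp add: extensions_inducing_def)
 obtain s where s: "is_section E s" using section_exists[OF ext] by blast
 interpret P: contraction ?P using ext by (simp add: contraction_iff contraction_extension_def)
 interpret q: group_hom ?P G "proj E" by unfold_locales (use ext in \<open>simp add: contraction_morphism_def contraction_extension_def\<close>)
 have sG: "s g : carrier ?P" "proj E (s g) = g" if "g : carrier G" for g using s that by (auto simp: is_section_def)
 have "EX a. a : carrier A & incl E a = s g \<otimes>\<^bsub>?P\<^esub> s h \<otimes>\<^bsub>?P\<^esub> inv\<^bsub>?P\<^esub> s (g \<otimes>\<^bsub>G\<^esub> h)" if g: "g : carrier G" "h : carrier G" for g h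
 proof -
  have "s g \<otimes>\<^bsub>?P\<^esub> s h \<otimes>\<^bsub>?P\<^esub> inv\<^bsub>?P\<^esub> s (g \<otimes>\<^bsub>G\<^esub> h) : kernel ?P G (proj E)" using g sG by (simp add: kernel_def)
  then have "s g \<otimes>\<^bsub>?P\<^esub> s h \<otimes>\<^bsub>?P\<^esub> inv\<^bsub>?P\<^esub> s (g \<otimes>\<^bsub>G\<^esub> h) : incl E ` carrier A" using ext by (simp add: contraction_extension_def)
  then show ?thesis by (metis imageE)
 qed
 then obtain w where w: "!!g h. g : carrier G ==> h : carrier G ==> w g h : carrier A"
  "!!g h. g : carrier G ==> h : carrier G ==> incl E (w g h) = s g \<otimes>\<^bsub>?P\<^esub> s h \<otimes>\<^bsub>?P\<^esub> inv\<^bsub>?P\<^esub> s (g \<otimes>\<^bsub>G\<^esub> h)" by metis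
 let ?w = "\<lambda>(g, h)\<in>carrier G \<times> carrier G. w g h"
 have "?w : carrier Z2 & extension_equivalent A (tw ?w) E"
  by (rule section_cocycle[OF E s]) (use w sG in \<open>auto simp: P.m_assoc\<close>)
 then show ?thesis by blast
qed

text \<open>Converse of \<open>section_cocycle\<close>: in the twisted product the section sending
  \<open>g\<close> to the pair of the identity and \<open>g\<close> has exactly the defect
  \<open>\<omega>\<close>, and the equivalence carries it over to \<open>E\<close>.\<close>

lemma equivalent_section:
 fixes E :: "('a, 'e, 'g) extension"
 assumes w: "\<omega> : carrier Z2" and eq: "extension_equivalent A (tw \<omega>) E"
 shows "EX s. is_section E s & (ALL g:carrier G. ALL h:carrier G. incl E (\<omega> (g, h)) \<otimes>\<^bsub>total_group E\<^esub> s (g \<otimes>\<^bsub>G\<^esub> h) = s g \<otimes>\<^bsub>total_group E\<^esub> s h)"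
proof -
 let ?T = "tp \<omega>" and ?P = "total_group E"
 obtain p where p: "contraction_morphism ?T ?P p" "ALL a:carrier A. p (a, \<one>\<^bsub>G\<^esub>) = incl E a" "ALL x:carrier ?T. proj E (p x) = snd x"
  using eq unfolding extension_equivalent_def contraction_isomorphism_def tw_simps by blast
 have ph: "p : hom ?T ?P" and pc: "continuous_map (prod_topology (topol A) (topol G)) (topol ?P) p"
  and pk: "!!x. x : carrier ?T ==> contr ?P (p x) = p (contr ?T x)" using p(1) by (auto simp: contraction_morphism_def)
 show ?thesis
 proof (intro exI[of _ "%g. p (\<one>, g)"] conjI ballI)
  have "continuous_map (topol G) (prod_topology (topol A) (topol G)) (%g. (\<one>, g))" by (simp add: continuous_map_pairwise o_def)
  from continuous_map_compose[OF this pc] have "continuous_map (topol G) (topol ?P) (%g. p (\<one>, g))" by (simp add: o_def)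
  then show "is_section E (%g. p (\<one>, g))" using p(3) pk hom_in_carrier[OF ph] by (simp add: is_section_def)
  fix g h assume g: "g : carrier G" "h : carrier G"
  have "(\<omega> (g, h), \<one>\<^bsub>G\<^esub>) \<otimes>\<^bsub>?T\<^esub> (\<one>, g \<otimes>\<^bsub>G\<^esub> h) = (\<one>, g) \<otimes>\<^bsub>?T\<^esub> (\<one>, h)" using g Z2_closed[OF w] Z2_one[OF w] by simp
  then show "incl E (\<omega> (g, h)) \<otimes>\<^bsub>?P\<^esub> p (\<one>, g \<otimes>\<^bsub>G\<^esub> h) = p (\<one>, g) \<otimes>\<^bsub>?P\<^esub> p (\<one>, h)"
   using hom_mult[OF ph, of "(\<omega> (g, h), \<one>\<^bsub>G\<^esub>)" "(\<one>, g \<otimes>\<^bsub>G\<^esub> h)"] hom_mult[OF ph, of "(\<one>, g)" "(\<one>, h)"] p(2) g Z2_closed[OF w] by simp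
 qed
qed

text \<open>Equivariant sections of the twisted product are the maps sending \<open>g\<close> to
  \<open>(f g, g)\<close> with \<open>f\<close> continuous and equivariant, and their cocycles are
  \<open>\<omega>\<close> times the coboundary of \<open>f\<close>. Describing the whole class as a
  set yields well-definedness and injectivity of the classification together.\<close>

lemma H2_class_eq:
 assumes w: "\<omega> : carrier Z2"
 shows "cls \<omega> = {\<omega>' : carrier Z2. extension_equivalent A (tw \<omega>') (tw \<omega>)}"
proof -
 let ?c = "%f. \<lambda>p\<in>carrier G \<times> carrier G. coboundary G A \<gamma> f p \<otimes> \<omega> p"
 have cls: "cls \<omega> = {?c f | f. continuous_map (topol G) (topol A) f & (ALL g:carrier G. f (contr G g) = contr A (f g))}"
  unfolding H2_class_def r_coset_def B2_eq_def by (auto simp: Z2_eq_def)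
 have cob: "v = \<gamma> g (f h) \<otimes> inv f (g \<otimes>\<^bsub>G\<^esub> h) \<otimes> f g \<otimes> \<omega> (g, h) \<longleftrightarrow> v \<otimes> f (g \<otimes>\<^bsub>G\<^esub> h) = f g \<otimes> \<gamma> g (f h) \<otimes> \<omega> (g, h)"
  if "g : carrier G" "h : carrier G" "v : carrier A" "f g : carrier A" "f h : carrier A" "f (g \<otimes>\<^bsub>G\<^esub> h) : carrier A" for f v g h
 proof -
  have "\<gamma> g (f h) \<otimes> inv f (g \<otimes>\<^bsub>G\<^esub> h) \<otimes> f g \<otimes> \<omega> (g, h) = (f g \<otimes> \<gamma> g (f h) \<otimes> \<omega> (g, h)) \<otimes> inv f (g \<otimes>\<^bsub>G\<^esub> h)"
   using that Z2_closed[OF w] by (simp add: A.m_ac)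
  then show ?thesis using that Z2_closed[OF w] A.inv_solve_right[of v "f g \<otimes> \<gamma> g (f h) \<otimes> \<omega> (g, h)" "f (g \<otimes>\<^bsub>G\<^esub> h)"] by auto
 qed
 show ?thesis
 proof (intro equalityI subsetI)
  fix \<omega>' assume "\<omega>' : cls \<omega>"
  then obtain f where f: "\<omega>' = ?c f" "continuous_map (topol G) (topol A) f" "!!g. g : carrier G ==> f (contr G g) = contr A (f g)"
   unfolding cls by blast
  have fA: "f g : carrier A" if "g : carrier G" for g using continuous_map_image_subset_topspace[OF f(2)] that by auto
  have v: "\<omega>' (g, h) = \<gamma> g (f h) \<otimes> inv f (g \<otimes>\<^bsub>G\<^esub> h) \<otimes> f g \<otimes> \<omega> (g, h)" if "g : carrier G" "h : carrier G" for g h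
   using that by (simp add: f(1) coboundary_def)
  have "is_section (tw \<omega>) (%g. (f g, g))" using f(2,3) fA by (simp add: is_section_def continuous_map_pairwise o_def)
  then have "\<omega>' : carrier Z2 & extension_equivalent A (tw \<omega>') (tw \<omega>)"
  proof (rule section_cocycle[OF tw_extension[OF w]])
   fix g h assume g: "g : carrier G" "h : carrier G"
   show c: "\<omega>' (g, h) : carrier A" using v g fA Z2_closed[OF w] by simp
   show "incl (tw \<omega>) (\<omega>' (g, h)) \<otimes>\<^bsub>total_group (tw \<omega>)\<^esub> (f (g \<otimes>\<^bsub>G\<^esub> h), g \<otimes>\<^bsub>G\<^esub> h) = (f g, g) \<otimes>\<^bsub>total_group (tw \<omega>)\<^esub> (f h, h)"
    using cob[of g h "\<omega>' (g, h)" f] v[OF g] g fA c Z2_one[OF w] Z2_closed[OF w] by simp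
  qed (simp add: f(1))
  then show "\<omega>' : {\<omega>' : carrier Z2. extension_equivalent A (tw \<omega>') (tw \<omega>)}" by simp
 next
  fix \<omega>' assume "\<omega>' : {\<omega>' : carrier Z2. extension_equivalent A (tw \<omega>') (tw \<omega>)}"
  then have w': "\<omega>' : carrier Z2" and eq: "extension_equivalent A (tw \<omega>') (tw \<omega>)" by auto
  obtain s where s: "is_section (tw \<omega>) s"
   "!!g h. g : carrier G ==> h : carrier G ==> incl (tw \<omega>) (\<omega>' (g, h)) \<otimes>\<^bsub>total_group (tw \<omega>)\<^esub> s (g \<otimes>\<^bsub>G\<^esub> h) = s g \<otimes>\<^bsub>total_group (tw \<omega>)\<^esub> s h"
   using equivalent_section[OF w' eq] by blast
  define f where "f g = fst (s g)" for g
  have sf: "s g = (f g, g)" "f g : carrier A" if "g : carrier G" for g using s(1) that by (auto simp: is_section_def f_def prod_eq_iff mem_Times_iff)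
  have sc: "continuous_map (topol G) (prod_topology (topol A) (topol G)) s" using s(1) by (simp add: is_section_def)
  have fc: "continuous_map (topol G) (topol A) f" using continuous_map_compose[OF sc continuous_map_fst] by (simp add: o_def f_def[abs_def])
  have fk: "f (contr G g) = contr A (f g)" if "g : carrier G" for g using s(1) that by (simp add: is_section_def f_def map_prod_def case_prod_beta)
  have "\<omega>' = ?c f"
  proof (rule extensionalityI[of _ "carrier G \<times> carrier G"])
   fix z assume "z : carrier G \<times> carrier G"
   then obtain g h where z: "z = (g, h)" "g : carrier G" "h : carrier G" by blast
   have "\<omega>' (g, h) \<otimes> f (g \<otimes>\<^bsub>G\<^esub> h) = f g \<otimes> \<gamma> g (f h) \<otimes> \<omega> (g, h)"
    using s(2)[OF z(2,3)] sf z Z2_one[OF w] Z2_closed[OF w' z(2,3)] by simp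
   then show "\<omega>' z = ?c f z" using cob[of g h "\<omega>' (g, h)" f] sf z Z2_closed[OF w' z(2,3)] by (simp add: coboundary_def)
  qed (use w' in \<open>auto simp: Z2_carrier\<close>)
  then show "\<omega>' : cls \<omega>" unfolding cls using fc fk by blast
 qed
qed

lemma extension_rel_equiv: "equiv (Ext) (Rel :: (('a, 'e, 'g) extension \<times> _) set)"
proof (rule equivI)
 show "refl_on (Ext) (Rel :: (('a, 'e, 'g) extension \<times> _) set)"
 proof (rule refl_onI)
  fix E :: "('a, 'e, 'g) extension" assume E: "E : Ext"
  have "contraction_morphism (total_group E) (total_group E) (%x. x)" by (auto simp: contraction_morphism_def hom_def)
  then have "extension_equivalent A E E"
   using E by (intro short_five[where f = "%x. x" and G = G]) (simp_all add: extensions_inducing_def)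
  then show "(E, E) : Rel" using E by (simp add: extension_rel_def)
 qed
 show "sym (Rel :: (('a, 'e, 'g) extension \<times> _) set)"
  by (rule symI) (auto simp: extension_rel_def extensions_inducing_def intro: extension_equivalent_sym)
 show "trans (Rel :: (('a, 'e, 'g) extension \<times> _) set)"
  by (rule transI) (auto simp: extension_rel_def intro: extension_equivalent_trans)
qed (auto simp: extension_rel_def)

lemma tw_rel_iff:
 assumes w: "\<omega> : carrier Z2" "\<omega>' : carrier Z2"
 shows "(tw \<omega>, tw \<omega>') : Rel \<longleftrightarrow> cls \<omega> = cls \<omega>'"
proof -
 have mem: "v : cls u \<longleftrightarrow> v : carrier Z2 & (tw v, tw u) : Rel" if "u : carrier Z2" for u v
  using H2_class_eq[OF that] tw_extension[OF that] tw_extension[of v] by (auto simp: extension_rel_def)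
 note e = extension_rel_equiv[where 'e = "'a \<times> 'g"]
 have refl: "(tw \<omega>, tw \<omega>) : Rel" using e tw_extension[OF w(1)] by (auto simp: equiv_def refl_on_def)
 show ?thesis
 proof
  assume r: "(tw \<omega>, tw \<omega>') : Rel"
  have "(x, tw \<omega>) : Rel \<longleftrightarrow> (x, tw \<omega>') : Rel" for x
   using e r unfolding equiv_def by (meson symE transE)
  then show "cls \<omega> = cls \<omega>'" using mem[OF w(1)] mem[OF w(2)] by blast
 qed (use mem[OF w(1)] mem[OF w(2)] w(1) refl in blast)
qed

theorem H2_bijection:
 "EX \<Phi>. (ALL \<omega>:carrier Z2. \<Phi> (cls \<omega>) = Rel `` {tw \<omega>}) &
  bij_betw \<Phi> (carrier (H2_eq G A \<gamma>)) (Ext // Rel)"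
proof -
 define \<Phi> where "\<Phi> c = Rel `` {tw (SOME \<omega>. \<omega> : carrier Z2 & cls \<omega> = c)}" for c
 have \<Phi>: "\<Phi> (cls \<omega>) = Rel `` {tw \<omega>}" if w: "\<omega> : carrier Z2" for \<omega>
 proof -
  let ?w = "SOME \<omega>'. \<omega>' : carrier Z2 & cls \<omega>' = cls \<omega>"
  have "?w : carrier Z2 & cls ?w = cls \<omega>" by (rule someI[of _ \<omega>]) (use w in simp)
  then have "(tw ?w, tw \<omega>) : Rel" using tw_rel_iff w by blast
  then show ?thesis unfolding \<Phi>_def by (rule equiv_class_eq[OF extension_rel_equiv])
 qed
 have car: "carrier (H2_eq G A \<gamma>) = cls ` carrier Z2"
  by (auto simp: H2_eq_def FactGroup_def RCOSETS_def H2_class_def)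
 have "inj_on \<Phi> (carrier (H2_eq G A \<gamma>))" unfolding car
 proof (rule inj_onI)
  fix c d assume "c : cls ` carrier Z2" "d : cls ` carrier Z2" and eq: "\<Phi> c = \<Phi> d"
  then obtain \<omega> \<omega>' where w: "\<omega> : carrier Z2" "c = cls \<omega>" "\<omega>' : carrier Z2" "d = cls \<omega>'" by blast
  have "Rel `` {tw \<omega>} = Rel `` {tw \<omega>'}" using eq \<Phi> w by simp
  then have "(tw \<omega>, tw \<omega>') : Rel"
   by (rule eq_equiv_class[OF _ extension_rel_equiv tw_extension[OF w(3)]])
  then show "c = d" using tw_rel_iff w by blast
 qed
 moreover have "\<Phi> ` carrier (H2_eq G A \<gamma>) = Ext // Rel"
 proof (intro equalityI subsetI)
  fix X assume "X : \<Phi> ` carrier (H2_eq G A \<gamma>)"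
  then obtain \<omega> where "\<omega> : carrier Z2" "X = Rel `` {tw \<omega>}" unfolding car using \<Phi> by auto
  then show "X : Ext // Rel" using tw_extension by (auto intro: quotientI)
 next
  fix X assume "X : Ext // (Rel :: (('a, 'a \<times> 'g, 'g) extension \<times> _) set)"
  then obtain E where E: "E : Ext" "X = Rel `` {E}" by (rule quotientE)
  obtain \<omega> where w: "\<omega> : carrier Z2" "extension_equivalent A (tw \<omega>) E" using extension_cocycle[OF E(1)] by blast
  then have "(tw \<omega>, E) : Rel" using E(1) tw_extension by (simp add: extension_rel_def)
  then have "X = \<Phi> (cls \<omega>)" unfolding E(2) \<Phi>[OF w(1)] by (rule equiv_class_eq[OF extension_rel_equiv, symmetric])
  then show "X : \<Phi> ` carrier (H2_eq G A \<gamma>)" unfolding car using w(1) by blast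
 qed
 ultimately have "bij_betw \<Phi> (carrier (H2_eq G A \<gamma>)) (Ext // Rel)" by (simp add: bij_betw_def)
 then show ?thesis using \<Phi> by blast
qed

end

text \<open>The bijection speaks of total groups whose elements are pairs from \<open>'a\<close> and
  \<open>'g\<close>. The second conjunct, for an arbitrary type \<open>'e\<close>, shows that every
  extension is represented there, so no equivalence class is lost.\<close>

theorem propositionA11:
  fixes A :: "'a dynamical_group" and G :: "'g dynamical_group" and \<gamma> :: "'g \<Rightarrow> 'a \<Rightarrow> 'a"
  assumes "lc_contraction_group A" and "comm_group A" and "lc_contraction_group G"
    and "\<gamma> \<in> hom G (TopAutoGroup A)"
    and "continuous_map (topol G) (braconnier_topology A) \<gamma>"
    and "\<forall>g\<in>carrier G. \<forall>a\<in>carrier A.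
           \<gamma> (contr G g) a = contr A (\<gamma> g (inv_into (carrier A) (contr A) a))"
  shows "(\<exists>\<Phi> :: ('g \<times> 'g \<Rightarrow> 'a) set \<Rightarrow> ('a, 'a \<times> 'g, 'g) extension set.
            (\<forall>\<omega>\<in>carrier (Z2_eq G A \<gamma>).
               \<Phi> (H2_class G A \<gamma> \<omega>) = extension_rel A G \<gamma> `` {twisted_extension A G \<gamma> \<omega>}) \<and>
            bij_betw \<Phi> (carrier (H2_eq G A \<gamma>)) (extensions_inducing A G \<gamma> // extension_rel A G \<gamma>))
       \<and> (\<forall>E :: ('a, 'e, 'g) extension. E \<in> extensions_inducing A G \<gamma> \<longrightarrow>
            (\<exists>E' :: ('a, 'a \<times> 'g, 'g) extension.
               E' \<in> extensions_inducing A G \<gamma> \<and> extension_equivalent A E E'))"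
proof -
 interpret abelian_action A G \<gamma>
  by (intro abelian_action.intro abelian_action_axioms.intro) (use assms in \<open>simp_all add: contraction_iff\<close>)
 have "\<exists>E' :: ('a, 'a \<times> 'g, 'g) extension. E' \<in> extensions_inducing A G \<gamma> \<and> extension_equivalent A E E'"
  if E: "E \<in> extensions_inducing A G \<gamma>" for E :: "('a, 'e, 'g) extension"
 proof -
  obtain \<omega> where w: "\<omega> \<in> carrier Z2" "extension_equivalent A (tw \<omega>) E" using extension_cocycle[OF E] by blast
  have "contraction_extension A G (tw \<omega>)" using tw_extension[OF w(1)] by (simp add: extensions_inducing_def)
  then show ?thesis using extension_equivalent_sym[OF w(2)] tw_extension[OF w(1)] by blast
 qed
 then show ?thesis using H2_bijection by blast
qed

end
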